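(* Let $\mathcal A$ be a premodular category over $\mathbf k$. The assignment $$U:(\mathcal Z(\mathcal A),\overline\otimes)\to(\mathcal Z(\mathcal A),\overline\otimes^{\mathrm{op}}),\qquad (X,\gamma)\mapsto(X,({}^*\gamma)^\vee)$$ (identity on morphisms) is a tensor equivalence. Furthermore, the inverse twist gives a natural isomorphism $\theta^{-1}:U^2\cong\mathrm{id}$, so $U$ generates a $\mathbb Z/2$-action on $\mathcal Z(\mathcal A)$ (which is not an action by tensor functors).
   Context: $\mathbf k$ is an algebraically closed field of characteristic zero. A premodular category $\mathcal A$ is a $\mathbf k$-linear ribbon fusion category, with unit $\mathbf 1$, tensor product $\otimes$ (also concatenation), braiding $c_{X,Y}:XY\to YX$, twist $\theta$ with $\theta_{XY}=c_{Y,X}c_{X,Y}(\theta_X\otimes\theta_Y)$; associativity and pivotal isomorphisms are suppressed. $X^*$, ${}^*X$ are left and right duals, $\mathrm{ev}_X:X^*X\to\mathbf 1$, $\mathrm{coev}_X:\mathbf 1\to XX^*$, and $\widetilde{\mathrm{ev}}_X:XX^*\to\mathbf 1$ is obtained from the pivotal structure. $X_i$ ($i\in\mathrm{Irr}(\mathcal A)$) are representatives of simples, $d_i=\dim X_i$, $\mathcal D=\sum d_i^2\ne0$. $\mathcal Z(\mathcal A)$ has objects $(X,\gamma)$, $\gamma_A:AX\to XA$ a half-braiding (natural isomorphism, $\gamma_{AB}=(\gamma_A\otimes\mathrm{id}_B)(\mathrm{id}_A\otimes\gamma_B)$), and morphisms those of $\mathcal A$ commuting with half-braidings. On any $X$ there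 are half-braidings $c:A\mapsto c_{A,X}$ and $c^{-1}:A\mapsto c_{X,A}^{-1}$; $(\gamma\otimes\mu)_A=(\mathrm{id}_X\otimes\mu_A)(\gamma_A\otimes\mathrm{id}_Y)$. Reduced tensor product: let $$Q_{\gamma,\mu}=\tfrac1{\mathcal D}\sum_i d_i(\mathrm{id}_X\otimes\widetilde{\mathrm{ev}}_{X_i}\otimes\mathrm{id}_Y)\big(\gamma_{X_i}c_{X_i,X}^{-1}\otimes c_{Y,X_i^*}\mu_{X_i^*}\big)(\mathrm{id}_X\otimes\mathrm{coev}_{X_i}\otimes\mathrm{id}_Y),$$ an idempotent on $XY$. Then $(X,\gamma)\overline\otimes(Y,\mu):=(\mathrm{im}\,Q_{\gamma,\mu},\gamma\overline\otimes\mu)$, where $\gamma\overline\otimes\mu$ is the restriction to the image of $\gamma\otimes c^{-1}$, equivalently of $c\otimes\mu$ (they agree there). On morphisms $f\overline\otimes g$ is the restriction of $f\otimes g$; associativity is that of $\mathcal A$; the unit is $I(\mathbf 1)$ with $I$ the two-sided adjoint of the forgetful functor $\mathcal Z(\mathcal A)\to\mathcal A$. $V\,\overline\otimes^{\mathrm{op}}W=W\overline\otimes V$. Duals of half-braidings: ${}^*\gamma$ is the half-braiding on ${}^*X$ making $({}^*X,{}^*\gamma)$ the right dual of $(X,\gamma)$ for the standard tensor product $(X,\gamma)\otimes(Y,\mu)=(XY,\gamma\otimes\mu)$: $({}^*\gamma)_A={}^*(\gamma_{A^*})$. For a half-braiding $\nu$ on $Z$, $\nu^\vee$ is the half-braiding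 on $Z^*$ given by $\nu^\vee_A=c_{Z^*,A}^{-1}(\mathrm{ev}_Z\otimes\mathrm{id}_{AZ^*})(\mathrm{id}_{Z^*}\otimes\nu_A\otimes\mathrm{id}_{Z^*})(\mathrm{id}_{Z^*A}\otimes\mathrm{coev}_Z)c_{A,Z^*}$. Thus, explicitly, $(({}^*\gamma)^\vee)_A=c_{X,A}^{-1}\circ\gamma_A^{-1}\circ c_{A,X}:AX\to XA$. A $\mathbb Z/2$-action generated by a functor $U$ means $U$ together with a natural isomorphism $\eta:U^2\cong\mathrm{id}$ with $U\eta=\eta U$. *)

theory Defs
  imports "HOL-Algebra.Algebraic_Closure_Type" "HOL-Algebra.Module"
begin

no_notation var (\<open>X\<index>\<close>)

section \<open>Linear categories\<close>

text \<open>
  A \<open>'k\<close>-linear category is given by its objects and, for each pair of objects, a Hom space, which is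
  a module in the sense of \<^theory>\<open>HOL-Algebra.Module\<close> over the field \<open>'k\<close> (turned into a
  ring structure by \<^const>\<open>ring_of_type_algebra\<close>).  The ring multiplication and unit of the
  Hom-space record play no role.
\<close>

record ('k, 'o, 'm) lin_cat =
  Obj :: "'o set"
  Hom :: "'o \<Rightarrow> 'o \<Rightarrow> ('k, 'm) module"
  Id :: "'o \<Rightarrow> 'm"
  Comp :: "'m \<Rightarrow> 'm \<Rightarrow> 'm"  (infixr \<open>\<cdot>\<index>\<close> 68)

abbreviation Mor :: "('k, 'o, 'm, 'z) lin_cat_scheme \<Rightarrow> 'o \<Rightarrow> 'o \<Rightarrow> 'm set" where
  "Mor C X Y \<equiv> carrier (Hom C X Y)"

context
  fixes C :: "('k, 'o, 'm, 'z) lin_cat_scheme" (structure)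
begin

definition inverse_pair :: "'o \<Rightarrow> 'o \<Rightarrow> 'm \<Rightarrow> 'm \<Rightarrow> bool" where
  "inverse_pair X Y f g \<longleftrightarrow>
     X \<in> Obj C \<and> Y \<in> Obj C \<and> f \<in> Mor C X Y \<and> g \<in> Mor C Y X \<and> g \<cdot> f = Id C X \<and> f \<cdot> g = Id C Y"

definition is_iso :: "'o \<Rightarrow> 'o \<Rightarrow> 'm \<Rightarrow> bool" where
  "is_iso X Y f \<longleftrightarrow> (\<exists>g. inverse_pair X Y f g)"

definition inv_mor :: "'o \<Rightarrow> 'o \<Rightarrow> 'm \<Rightarrow> 'm" where
  "inv_mor X Y f = (THE g. inverse_pair X Y f g)"

definition isomorphic :: "'o \<Rightarrow> 'o \<Rightarrow> bool" where
  "isomorphic X Y \<longleftrightarrow> (\<exists>f. is_iso X Y f)"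

definition is_zero_object :: "'o \<Rightarrow> bool" where
  "is_zero_object Z \<longleftrightarrow> Z \<in> Obj C \<and>
     (\<forall>X \<in> Obj C. (\<exists>!f. f \<in> Mor C X Z) \<and> (\<exists>!f. f \<in> Mor C Z X))"

definition is_mono :: "'o \<Rightarrow> 'o \<Rightarrow> 'm \<Rightarrow> bool" where
  "is_mono X Y f \<longleftrightarrow> X \<in> Obj C \<and> Y \<in> Obj C \<and> f \<in> Mor C X Y \<and>
     (\<forall>W \<in> Obj C. \<forall>g \<in> Mor C W X. \<forall>h \<in> Mor C W X. f \<cdot> g = f \<cdot> h \<longrightarrow> g = h)"

definition is_epi :: "'o \<Rightarrow> 'o \<Rightarrow> 'm \<Rightarrow> bool" where
  "is_epi X Y f \<longleftrightarrow> X \<in> Obj C \<and> Y \<in> Obj C \<and> f \<in> Mor C X Y \<and>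
     (\<forall>W \<in> Obj C. \<forall>g \<in> Mor C Y W. \<forall>h \<in> Mor C Y W. g \<cdot> f = h \<cdot> f \<longrightarrow> g = h)"

definition is_kernel :: "'o \<Rightarrow> 'o \<Rightarrow> 'm \<Rightarrow> 'o \<Rightarrow> 'm \<Rightarrow> bool" where
  "is_kernel X Y f K k \<longleftrightarrow> K \<in> Obj C \<and> k \<in> Mor C K X \<and> f \<cdot> k = \<zero>\<^bsub>Hom C K Y\<^esub> \<and>
     (\<forall>W \<in> Obj C. \<forall>h \<in> Mor C W X. f \<cdot> h = \<zero>\<^bsub>Hom C W Y\<^esub> \<longrightarrow>
        (\<exists>!u. u \<in> Mor C W K \<and> k \<cdot> u = h))"

definition is_cokernel :: "'o \<Rightarrow> 'o \<Rightarrow> 'm \<Rightarrow> 'o \<Rightarrow> 'm \<Rightarrow> bool" where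
  "is_cokernel X Y f K k \<longleftrightarrow> K \<in> Obj C \<and> k \<in> Mor C Y K \<and> k \<cdot> f = \<zero>\<^bsub>Hom C X K\<^esub> \<and>
     (\<forall>W \<in> Obj C. \<forall>h \<in> Mor C Y W. h \<cdot> f = \<zero>\<^bsub>Hom C X W\<^esub> \<longrightarrow>
        (\<exists>!u. u \<in> Mor C K W \<and> u \<cdot> k = h))"

definition is_direct_sum :: "'o \<Rightarrow> (nat \<Rightarrow> 'o) \<Rightarrow> nat \<Rightarrow> bool" where
  "is_direct_sum X S n \<longleftrightarrow> X \<in> Obj C \<and> (\<forall>j < n. S j \<in> Obj C) \<and>
     (\<exists>i p. (\<forall>j < n. i j \<in> Mor C (S j) X \<and> p j \<in> Mor C X (S j)) \<and>
        (\<forall>j < n. \<forall>l < n. p j \<cdot> i l = (if j = l then Id C (S j) else \<zero>\<^bsub>Hom C (S l) (S j)\<^esub>)) \<and>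
        (\<Oplus>\<^bsub>Hom C X X\<^esub>j \<in> {..<n}. i j \<cdot> p j) = Id C X)"

definition is_simple :: "'o \<Rightarrow> bool" where
  "is_simple X \<longleftrightarrow> X \<in> Obj C \<and> \<not> is_zero_object X \<and>
     (\<forall>Y f. is_mono Y X f \<longrightarrow> is_zero_object Y \<or> is_iso Y X f)"

definition simple_representatives :: "'o set \<Rightarrow> bool" where
  "simple_representatives I \<longleftrightarrow>
     (\<forall>i \<in> I. is_simple i) \<and> (\<forall>X. is_simple X \<longrightarrow> (\<exists>!i. i \<in> I \<and> isomorphic X i))"

end

locale linear_category =
  fixes C :: "('k::field, 'o, 'm, 'z) lin_cat_scheme" (structure)
  assumes hom_disjoint:
      "\<lbrakk>X \<in> Obj C; Y \<in> Obj C; X' \<in> Obj C; Y' \<in> Obj C; f \<in> Mor C X Y; f \<in> Mor C X' Y'\<rbrakk>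
         \<Longrightarrow> X = X' \<and> Y = Y'"
    and hom_module:
      "\<lbrakk>X \<in> Obj C; Y \<in> Obj C\<rbrakk> \<Longrightarrow> module (ring_of_type_algebra :: 'k ring) (Hom C X Y)"
    and id_closed: "X \<in> Obj C \<Longrightarrow> Id C X \<in> Mor C X X"
    and comp_closed:
      "\<lbrakk>X \<in> Obj C; Y \<in> Obj C; Z \<in> Obj C; f \<in> Mor C X Y; g \<in> Mor C Y Z\<rbrakk> \<Longrightarrow> g \<cdot> f \<in> Mor C X Z"
    and comp_id_left: "\<lbrakk>X \<in> Obj C; Y \<in> Obj C; f \<in> Mor C X Y\<rbrakk> \<Longrightarrow> Id C Y \<cdot> f = f"
    and comp_id_right: "\<lbrakk>X \<in> Obj C; Y \<in> Obj C; f \<in> Mor C X Y\<rbrakk> \<Longrightarrow> f \<cdot> Id C X = f"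
    and comp_assoc:
      "\<lbrakk>W \<in> Obj C; X \<in> Obj C; Y \<in> Obj C; Z \<in> Obj C;
        f \<in> Mor C W X; g \<in> Mor C X Y; h \<in> Mor C Y Z\<rbrakk> \<Longrightarrow> (h \<cdot> g) \<cdot> f = h \<cdot> (g \<cdot> f)"
    and comp_add_left:
      "\<lbrakk>X \<in> Obj C; Y \<in> Obj C; Z \<in> Obj C; f \<in> Mor C X Y; g \<in> Mor C Y Z; h \<in> Mor C Y Z\<rbrakk>
         \<Longrightarrow> (g \<oplus>\<^bsub>Hom C Y Z\<^esub> h) \<cdot> f = g \<cdot> f \<oplus>\<^bsub>Hom C X Z\<^esub> h \<cdot> f"
    and comp_add_right:
      "\<lbrakk>X \<in> Obj C; Y \<in> Obj C; Z \<in> Obj C; f \<in> Mor C X Y; g \<in> Mor C X Y; h \<in> Mor C Y Z\<rbrakk>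
         \<Longrightarrow> h \<cdot> (f \<oplus>\<^bsub>Hom C X Y\<^esub> g) = h \<cdot> f \<oplus>\<^bsub>Hom C X Z\<^esub> h \<cdot> g"
    and comp_smult_left:
      "\<lbrakk>X \<in> Obj C; Y \<in> Obj C; Z \<in> Obj C; f \<in> Mor C X Y; g \<in> Mor C Y Z\<rbrakk>
         \<Longrightarrow> (a \<odot>\<^bsub>Hom C Y Z\<^esub> g) \<cdot> f = a \<odot>\<^bsub>Hom C X Z\<^esub> (g \<cdot> f)"
    and comp_smult_right:
      "\<lbrakk>X \<in> Obj C; Y \<in> Obj C; Z \<in> Obj C; f \<in> Mor C X Y; g \<in> Mor C Y Z\<rbrakk>
         \<Longrightarrow> g \<cdot> (a \<odot>\<^bsub>Hom C X Y\<^esub> f) = a \<odot>\<^bsub>Hom C X Z\<^esub> (g \<cdot> f)"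

locale abelian_linear_category = linear_category +
  assumes zero_object: "\<exists>Z. is_zero_object C Z"
    and biproducts:
      "\<lbrakk>X \<in> Obj C; Y \<in> Obj C\<rbrakk> \<Longrightarrow> \<exists>S. is_direct_sum C S (\<lambda>j. if j = 0 then X else Y) 2"
    and kernels: "\<lbrakk>X \<in> Obj C; Y \<in> Obj C; f \<in> Mor C X Y\<rbrakk> \<Longrightarrow> \<exists>K k. is_kernel C X Y f K k"
    and cokernels: "\<lbrakk>X \<in> Obj C; Y \<in> Obj C; f \<in> Mor C X Y\<rbrakk> \<Longrightarrow> \<exists>K k. is_cokernel C X Y f K k"
    and mono_is_kernel:
      "is_mono C X Y f \<Longrightarrow> \<exists>Z \<in> Obj C. \<exists>g \<in> Mor C Y Z. is_kernel C Y Z g X f"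
    and epi_is_cokernel:
      "is_epi C X Y f \<Longrightarrow> \<exists>W \<in> Obj C. \<exists>g \<in> Mor C W X. is_cokernel C W X g Y f"

locale finite_semisimple_category = abelian_linear_category +
  assumes finite_dimensional_hom:
      "\<lbrakk>X \<in> Obj C; Y \<in> Obj C\<rbrakk> \<Longrightarrow> \<exists>B. finite B \<and> B \<subseteq> Mor C X Y \<and>
         (\<forall>f \<in> Mor C X Y. \<exists>a. f = (\<Oplus>\<^bsub>Hom C X Y\<^esub>b \<in> B. a b \<odot>\<^bsub>Hom C X Y\<^esub> b))"
    and semisimple:
      "X \<in> Obj C \<Longrightarrow> \<exists>S n. is_direct_sum C X S n \<and> (\<forall>j < n. is_simple C (S j))"
    and finitely_many_simples: "\<exists>I. finite I \<and> simple_representatives C I"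


section \<open>Functors\<close>

text \<open>A functor is represented by its object map and its morphism map.\<close>

definition is_functor ::
  "('k, 'o, 'm, 'z) lin_cat_scheme \<Rightarrow> ('l, 'p, 'n, 'y) lin_cat_scheme \<Rightarrow>
   ('o \<Rightarrow> 'p) \<Rightarrow> ('m \<Rightarrow> 'n) \<Rightarrow> bool" where
  "is_functor C D Fo Fm \<longleftrightarrow>
     (\<forall>X \<in> Obj C. Fo X \<in> Obj D) \<and>
     (\<forall>X \<in> Obj C. \<forall>Y \<in> Obj C. \<forall>f \<in> Mor C X Y. Fm f \<in> Mor D (Fo X) (Fo Y)) \<and>
     (\<forall>X \<in> Obj C. Fm (Id C X) = Id D (Fo X)) \<and>
     (\<forall>X \<in> Obj C. \<forall>Y \<in> Obj C. \<forall>Z \<in> Obj C. \<forall>f \<in> Mor C X Y. \<forall>g \<in> Mor C Y Z.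
        Fm (g \<cdot>\<^bsub>C\<^esub> f) = Fm g \<cdot>\<^bsub>D\<^esub> Fm f)"

definition is_linear_functor ::
  "('k, 'o, 'm, 'z) lin_cat_scheme \<Rightarrow> ('k, 'p, 'n, 'y) lin_cat_scheme \<Rightarrow>
   ('o \<Rightarrow> 'p) \<Rightarrow> ('m \<Rightarrow> 'n) \<Rightarrow> bool" where
  "is_linear_functor C D Fo Fm \<longleftrightarrow> is_functor C D Fo Fm \<and>
     (\<forall>X \<in> Obj C. \<forall>Y \<in> Obj C. \<forall>f \<in> Mor C X Y. \<forall>g \<in> Mor C X Y.
        Fm (f \<oplus>\<^bsub>Hom C X Y\<^esub> g) = Fm f \<oplus>\<^bsub>Hom D (Fo X) (Fo Y)\<^esub> Fm g) \<and>
     (\<forall>X \<in> Obj C. \<forall>Y \<in> Obj C. \<forall>f \<in> Mor C X Y. \<forall>a.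
        Fm (a \<odot>\<^bsub>Hom C X Y\<^esub> f) = a \<odot>\<^bsub>Hom D (Fo X) (Fo Y)\<^esub> Fm f)"

definition natural_transformation ::
  "('k, 'o, 'm, 'z) lin_cat_scheme \<Rightarrow> ('l, 'p, 'n, 'y) lin_cat_scheme \<Rightarrow>
   ('o \<Rightarrow> 'p) \<Rightarrow> ('m \<Rightarrow> 'n) \<Rightarrow> ('o \<Rightarrow> 'p) \<Rightarrow> ('m \<Rightarrow> 'n) \<Rightarrow> ('o \<Rightarrow> 'n) \<Rightarrow> bool" where
  "natural_transformation C D Fo Fm Go Gm \<eta> \<longleftrightarrow>
     is_functor C D Fo Fm \<and> is_functor C D Go Gm \<and>
     (\<forall>X \<in> Obj C. \<eta> X \<in> Mor D (Fo X) (Go X)) \<and>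
     (\<forall>X \<in> Obj C. \<forall>Y \<in> Obj C. \<forall>f \<in> Mor C X Y. \<eta> Y \<cdot>\<^bsub>D\<^esub> Fm f = Gm f \<cdot>\<^bsub>D\<^esub> \<eta> X)"

definition natural_isomorphism ::
  "('k, 'o, 'm, 'z) lin_cat_scheme \<Rightarrow> ('l, 'p, 'n, 'y) lin_cat_scheme \<Rightarrow>
   ('o \<Rightarrow> 'p) \<Rightarrow> ('m \<Rightarrow> 'n) \<Rightarrow> ('o \<Rightarrow> 'p) \<Rightarrow> ('m \<Rightarrow> 'n) \<Rightarrow> ('o \<Rightarrow> 'n) \<Rightarrow> bool" where
  "natural_isomorphism C D Fo Fm Go Gm \<eta> \<longleftrightarrow>
     natural_transformation C D Fo Fm Go Gm \<eta> \<and> (\<forall>X \<in> Obj C. is_iso D (Fo X) (Go X) (\<eta> X))"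

definition is_equivalence ::
  "('k, 'o, 'm, 'z) lin_cat_scheme \<Rightarrow> ('l, 'p, 'n, 'y) lin_cat_scheme \<Rightarrow>
   ('o \<Rightarrow> 'p) \<Rightarrow> ('m \<Rightarrow> 'n) \<Rightarrow> bool" where
  "is_equivalence C D Fo Fm \<longleftrightarrow> is_functor C D Fo Fm \<and>
     (\<exists>Go Gm \<eta> \<epsilon>. is_functor D C Go Gm \<and>
        natural_isomorphism C C id id (Go \<circ> Fo) (Gm \<circ> Fm) \<eta> \<and>
        natural_isomorphism D D (Fo \<circ> Go) (Fm \<circ> Gm) id id \<epsilon>)"

text \<open>\<open>L : C \<rightarrow> D\<close> is left adjoint to \<open>R : D \<rightarrow> C\<close>.\<close>

definition is_adjunction ::
  "('k, 'o, 'm, 'z) lin_cat_scheme \<Rightarrow> ('l, 'p, 'n, 'y) lin_cat_scheme \<Rightarrow>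
   ('o \<Rightarrow> 'p) \<Rightarrow> ('m \<Rightarrow> 'n) \<Rightarrow> ('p \<Rightarrow> 'o) \<Rightarrow> ('n \<Rightarrow> 'm) \<Rightarrow> bool" where
  "is_adjunction C D Lo Lm Ro Rm \<longleftrightarrow>
     is_functor C D Lo Lm \<and> is_functor D C Ro Rm \<and>
     (\<exists>\<eta> \<epsilon>. natural_transformation C C id id (Ro \<circ> Lo) (Rm \<circ> Lm) \<eta> \<and>
        natural_transformation D D (Lo \<circ> Ro) (Lm \<circ> Rm) id id \<epsilon> \<and>
        (\<forall>X \<in> Obj C. \<epsilon> (Lo X) \<cdot>\<^bsub>D\<^esub> Lm (\<eta> X) = Id D (Lo X)) \<and>
        (\<forall>Y \<in> Obj D. Rm (\<epsilon> Y) \<cdot>\<^bsub>C\<^esub> \<eta> (Ro Y) = Id C (Ro Y)))"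

text \<open>\<open>G\<close> is both left and right adjoint to \<open>F : C \<rightarrow> D\<close>.\<close>

definition two_sided_adjoint ::
  "('k, 'o, 'm, 'z) lin_cat_scheme \<Rightarrow> ('l, 'p, 'n, 'y) lin_cat_scheme \<Rightarrow>
   ('o \<Rightarrow> 'p) \<Rightarrow> ('m \<Rightarrow> 'n) \<Rightarrow> ('p \<Rightarrow> 'o) \<Rightarrow> ('n \<Rightarrow> 'm) \<Rightarrow> bool" where
  "two_sided_adjoint C D Fo Fm Go Gm \<longleftrightarrow>
     is_adjunction D C Go Gm Fo Fm \<and> is_adjunction C D Fo Fm Go Gm"

text \<open>
  A \<open>\<int>/2\<close>-action generated by \<open>U\<close>: a natural isomorphism \<open>\<eta> : U\<^sup>2 \<cong> id\<close> with
  \<open>U \<eta> = \<eta> U\<close>.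
\<close>

definition Z2_action ::
  "('k, 'o, 'm, 'z) lin_cat_scheme \<Rightarrow> ('o \<Rightarrow> 'o) \<Rightarrow> ('m \<Rightarrow> 'm) \<Rightarrow> ('o \<Rightarrow> 'm) \<Rightarrow> bool" where
  "Z2_action C Uo Um \<eta> \<longleftrightarrow> is_functor C C Uo Um \<and>
     natural_isomorphism C C (Uo \<circ> Uo) (Um \<circ> Um) id id \<eta> \<and>
     (\<forall>X \<in> Obj C. Um (\<eta> X) = \<eta> (Uo X))"


section \<open>Monoidal categories\<close>

text \<open>
  \<open>Assoc X Y Z\<close> is the associator from \<open>(X \<star> Y) \<star> Z\<close> to \<open>X \<star> (Y \<star> Z)\<close>.
\<close>

record ('k, 'o, 'm) tensor_cat = "('k, 'o, 'm) lin_cat" +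
  Ten :: "'o \<Rightarrow> 'o \<Rightarrow> 'o"  (infixl \<open>\<star>\<index>\<close> 70)
  Ten_mor :: "'m \<Rightarrow> 'm \<Rightarrow> 'm"  (infixl \<open>\<boxtimes>\<index>\<close> 70)
  Unit :: "'o"
  Assoc :: "'o \<Rightarrow> 'o \<Rightarrow> 'o \<Rightarrow> 'm"

abbreviation Assoc_inv :: "('k, 'o, 'm, 'z) tensor_cat_scheme \<Rightarrow> 'o \<Rightarrow> 'o \<Rightarrow> 'o \<Rightarrow> 'm" where
  "Assoc_inv M X Y Z \<equiv> inv_mor M ((X \<star>\<^bsub>M\<^esub> Y) \<star>\<^bsub>M\<^esub> Z) (X \<star>\<^bsub>M\<^esub> (Y \<star>\<^bsub>M\<^esub> Z)) (Assoc M X Y Z)"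

definition opposite_tensor ::
  "('k, 'o, 'm) tensor_cat \<Rightarrow> ('k, 'o, 'm) tensor_cat" where
  "opposite_tensor M = M\<lparr>
     Ten := \<lambda>X Y. Y \<star>\<^bsub>M\<^esub> X,
     Ten_mor := \<lambda>f g. g \<boxtimes>\<^bsub>M\<^esub> f,
     Assoc := \<lambda>X Y Z. Assoc_inv M Z Y X\<rparr>"

text \<open>
  Monoidal functors are taken in the sense of Etingof, Gelaki, Nikshych and Ostrik: a functor \<open>F\<close> with
  a natural isomorphism \<open>J X Y : F X \<otimes> F Y \<rightarrow> F (X \<otimes> Y)\<close> satisfying the hexagon axiom and such
  that \<open>F \<one> \<cong> \<one>\<close>; the compatibility with the unit constraints is then automatic.
\<close>

definition is_monoidal_functor ::
  "('k, 'o, 'm, 'z) tensor_cat_scheme \<Rightarrow> ('l, 'p, 'n, 'y) tensor_cat_scheme \<Rightarrow>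
   ('o \<Rightarrow> 'p) \<Rightarrow> ('m \<Rightarrow> 'n) \<Rightarrow> ('o \<Rightarrow> 'o \<Rightarrow> 'n) \<Rightarrow> bool" where
  "is_monoidal_functor C D Fo Fm J \<longleftrightarrow>
     is_functor C D Fo Fm \<and>
     (\<forall>X \<in> Obj C. \<forall>Y \<in> Obj C. is_iso D (Fo X \<star>\<^bsub>D\<^esub> Fo Y) (Fo (X \<star>\<^bsub>C\<^esub> Y)) (J X Y)) \<and>
     (\<forall>X \<in> Obj C. \<forall>X' \<in> Obj C. \<forall>Y \<in> Obj C. \<forall>Y' \<in> Obj C. \<forall>f \<in> Mor C X X'. \<forall>g \<in> Mor C Y Y'.
        J X' Y' \<cdot>\<^bsub>D\<^esub> (Fm f \<boxtimes>\<^bsub>D\<^esub> Fm g) = Fm (f \<boxtimes>\<^bsub>C\<^esub> g) \<cdot>\<^bsub>D\<^esub> J X Y) \<and>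
     (\<forall>X \<in> Obj C. \<forall>Y \<in> Obj C. \<forall>Z \<in> Obj C.
        Fm (Assoc C X Y Z) \<cdot>\<^bsub>D\<^esub> J (X \<star>\<^bsub>C\<^esub> Y) Z \<cdot>\<^bsub>D\<^esub> (J X Y \<boxtimes>\<^bsub>D\<^esub> Id D (Fo Z))
        = J X (Y \<star>\<^bsub>C\<^esub> Z) \<cdot>\<^bsub>D\<^esub> (Id D (Fo X) \<boxtimes>\<^bsub>D\<^esub> J Y Z) \<cdot>\<^bsub>D\<^esub> Assoc D (Fo X) (Fo Y) (Fo Z)) \<and>
     isomorphic D (Fo (Unit C)) (Unit D)"

definition is_tensor_equivalence ::
  "('k, 'o, 'm, 'z) tensor_cat_scheme \<Rightarrow> ('k, 'p, 'n, 'y) tensor_cat_scheme \<Rightarrow>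
   ('o \<Rightarrow> 'p) \<Rightarrow> ('m \<Rightarrow> 'n) \<Rightarrow> bool" where
  "is_tensor_equivalence C D Fo Fm \<longleftrightarrow>
     is_linear_functor C D Fo Fm \<and> is_equivalence C D Fo Fm \<and>
     (\<exists>J. is_monoidal_functor C D Fo Fm J)"


section \<open>Premodular categories\<close>

text \<open>
  The structure of a ribbon category: unitors \<open>\<one> \<star> X \<rightarrow> X\<close> and \<open>X \<star> \<one> \<rightarrow> X\<close>; left duals \<open>X\<^sup>*\<close> with
  \<open>X\<^sup>* \<star> X \<rightarrow> \<one>\<close> and \<open>\<one> \<rightarrow> X \<star> X\<^sup>*\<close>; right duals \<open>\<^sup>*X\<close> with \<open>X \<star> \<^sup>*X \<rightarrow> \<one>\<close> and \<open>\<one> \<rightarrow> \<^sup>*X \<star> X\<close>;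
  the braiding \<open>X \<star> Y \<rightarrow> Y \<star> X\<close>; and the twist.
\<close>

record ('k, 'o, 'm) ribbon_cat = "('k, 'o, 'm) tensor_cat" +
  Lunit :: "'o \<Rightarrow> 'm"
  Runit :: "'o \<Rightarrow> 'm"
  Ldual :: "'o \<Rightarrow> 'o"
  Ev :: "'o \<Rightarrow> 'm"
  Coev :: "'o \<Rightarrow> 'm"
  Rdual :: "'o \<Rightarrow> 'o"
  REv :: "'o \<Rightarrow> 'm"
  RCoev :: "'o \<Rightarrow> 'm"
  Braid :: "'o \<Rightarrow> 'o \<Rightarrow> 'm"
  Twist :: "'o \<Rightarrow> 'm"

abbreviation Lunit_inv :: "('k, 'o, 'm, 'z) ribbon_cat_scheme \<Rightarrow> 'o \<Rightarrow> 'm" where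
  "Lunit_inv A X \<equiv> inv_mor A (Unit A \<star>\<^bsub>A\<^esub> X) X (Lunit A X)"

abbreviation Runit_inv :: "('k, 'o, 'm, 'z) ribbon_cat_scheme \<Rightarrow> 'o \<Rightarrow> 'm" where
  "Runit_inv A X \<equiv> inv_mor A (X \<star>\<^bsub>A\<^esub> Unit A) X (Runit A X)"

abbreviation Braid_inv :: "('k, 'o, 'm, 'z) ribbon_cat_scheme \<Rightarrow> 'o \<Rightarrow> 'o \<Rightarrow> 'm" where
  "Braid_inv A X Y \<equiv> inv_mor A (X \<star>\<^bsub>A\<^esub> Y) (Y \<star>\<^bsub>A\<^esub> X) (Braid A X Y)"

context
  fixes A :: "('k, 'o, 'm, 'z) ribbon_cat_scheme" (structure)
begin

text \<open>
  \<open>D\<close> is a left dual of \<open>X\<close> with evaluation \<open>e : D \<star> X \<rightarrow> \<one>\<close> and coevaluation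
  \<open>d : \<one> \<rightarrow> X \<star> D\<close>; equivalently, \<open>X\<close> is a right dual of \<open>D\<close>.
\<close>

definition is_left_dual :: "'o \<Rightarrow> 'o \<Rightarrow> 'm \<Rightarrow> 'm \<Rightarrow> bool" where
  "is_left_dual X D e d \<longleftrightarrow> X \<in> Obj A \<and> D \<in> Obj A \<and>
     e \<in> Mor A (D \<star> X) (Unit A) \<and> d \<in> Mor A (Unit A) (X \<star> D) \<and>
     Runit A X \<cdot> (Id A X \<boxtimes> e) \<cdot> Assoc A X D X \<cdot> (d \<boxtimes> Id A X) \<cdot> Lunit_inv A X = Id A X \<and>
     Lunit A D \<cdot> (e \<boxtimes> Id A D) \<cdot> Assoc_inv A D X D \<cdot> (Id A D \<boxtimes> d) \<cdot> Runit_inv A D = Id A D"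

text \<open>The left dual \<open>f\<^sup>* : Y\<^sup>* \<rightarrow> X\<^sup>*\<close> of \<open>f : X \<rightarrow> Y\<close>.\<close>

definition ldual_mor :: "'o \<Rightarrow> 'o \<Rightarrow> 'm \<Rightarrow> 'm" where
  "ldual_mor X Y f =
     Lunit A (Ldual A X) \<cdot> (Ev A Y \<boxtimes> Id A (Ldual A X)) \<cdot> Assoc_inv A (Ldual A Y) Y (Ldual A X) \<cdot>
     (Id A (Ldual A Y) \<boxtimes> (f \<boxtimes> Id A (Ldual A X))) \<cdot>
     (Id A (Ldual A Y) \<boxtimes> Coev A X) \<cdot> Runit_inv A (Ldual A Y)"

end

locale monoidal_linear_category = linear_category A
  for A :: "('k::field, 'o, 'm, 'z) ribbon_cat_scheme" (structure) +
  assumes ten_closed: "\<lbrakk>X \<in> Obj A; Y \<in> Obj A\<rbrakk> \<Longrightarrow> X \<star> Y \<in> Obj A"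
    and unit_closed: "Unit A \<in> Obj A"
    and ten_mor_closed:
      "\<lbrakk>X \<in> Obj A; X' \<in> Obj A; Y \<in> Obj A; Y' \<in> Obj A; f \<in> Mor A X X'; g \<in> Mor A Y Y'\<rbrakk>
         \<Longrightarrow> f \<boxtimes> g \<in> Mor A (X \<star> Y) (X' \<star> Y')"
    and ten_id: "\<lbrakk>X \<in> Obj A; Y \<in> Obj A\<rbrakk> \<Longrightarrow> Id A X \<boxtimes> Id A Y = Id A (X \<star> Y)"
    and interchange:
      "\<lbrakk>X \<in> Obj A; X' \<in> Obj A; X'' \<in> Obj A; Y \<in> Obj A; Y' \<in> Obj A; Y'' \<in> Obj A;
        f \<in> Mor A X X'; f' \<in> Mor A X' X''; g \<in> Mor A Y Y'; g' \<in> Mor A Y' Y''\<rbrakk>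
         \<Longrightarrow> (f' \<cdot> f) \<boxtimes> (g' \<cdot> g) = (f' \<boxtimes> g') \<cdot> (f \<boxtimes> g)"
    and ten_add_left:
      "\<lbrakk>X \<in> Obj A; X' \<in> Obj A; Y \<in> Obj A; Y' \<in> Obj A;
        f \<in> Mor A X X'; f' \<in> Mor A X X'; g \<in> Mor A Y Y'\<rbrakk>
         \<Longrightarrow> (f \<oplus>\<^bsub>Hom A X X'\<^esub> f') \<boxtimes> g = (f \<boxtimes> g) \<oplus>\<^bsub>Hom A (X \<star> Y) (X' \<star> Y')\<^esub> (f' \<boxtimes> g)"
    and ten_add_right:
      "\<lbrakk>X \<in> Obj A; X' \<in> Obj A; Y \<in> Obj A; Y' \<in> Obj A;
        f \<in> Mor A X X'; g \<in> Mor A Y Y'; g' \<in> Mor A Y Y'\<rbrakk>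
         \<Longrightarrow> f \<boxtimes> (g \<oplus>\<^bsub>Hom A Y Y'\<^esub> g') = (f \<boxtimes> g) \<oplus>\<^bsub>Hom A (X \<star> Y) (X' \<star> Y')\<^esub> (f \<boxtimes> g')"
    and ten_smult_left:
      "\<lbrakk>X \<in> Obj A; X' \<in> Obj A; Y \<in> Obj A; Y' \<in> Obj A; f \<in> Mor A X X'; g \<in> Mor A Y Y'\<rbrakk>
         \<Longrightarrow> (a \<odot>\<^bsub>Hom A X X'\<^esub> f) \<boxtimes> g = a \<odot>\<^bsub>Hom A (X \<star> Y) (X' \<star> Y')\<^esub> (f \<boxtimes> g)"
    and ten_smult_right:
      "\<lbrakk>X \<in> Obj A; X' \<in> Obj A; Y \<in> Obj A; Y' \<in> Obj A; f \<in> Mor A X X'; g \<in> Mor A Y Y'\<rbrakk>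
         \<Longrightarrow> f \<boxtimes> (a \<odot>\<^bsub>Hom A Y Y'\<^esub> g) = a \<odot>\<^bsub>Hom A (X \<star> Y) (X' \<star> Y')\<^esub> (f \<boxtimes> g)"
    and assoc_iso:
      "\<lbrakk>X \<in> Obj A; Y \<in> Obj A; Z \<in> Obj A\<rbrakk>
         \<Longrightarrow> is_iso A ((X \<star> Y) \<star> Z) (X \<star> (Y \<star> Z)) (Assoc A X Y Z)"
    and assoc_natural:
      "\<lbrakk>X \<in> Obj A; X' \<in> Obj A; Y \<in> Obj A; Y' \<in> Obj A; Z \<in> Obj A; Z' \<in> Obj A;
        f \<in> Mor A X X'; g \<in> Mor A Y Y'; h \<in> Mor A Z Z'\<rbrakk>
         \<Longrightarrow> Assoc A X' Y' Z' \<cdot> ((f \<boxtimes> g) \<boxtimes> h) = (f \<boxtimes> (g \<boxtimes> h)) \<cdot> Assoc A X Y Z"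
    and lunit_iso: "X \<in> Obj A \<Longrightarrow> is_iso A (Unit A \<star> X) X (Lunit A X)"
    and lunit_natural:
      "\<lbrakk>X \<in> Obj A; Y \<in> Obj A; f \<in> Mor A X Y\<rbrakk>
         \<Longrightarrow> Lunit A Y \<cdot> (Id A (Unit A) \<boxtimes> f) = f \<cdot> Lunit A X"
    and runit_iso: "X \<in> Obj A \<Longrightarrow> is_iso A (X \<star> Unit A) X (Runit A X)"
    and runit_natural:
      "\<lbrakk>X \<in> Obj A; Y \<in> Obj A; f \<in> Mor A X Y\<rbrakk>
         \<Longrightarrow> Runit A Y \<cdot> (f \<boxtimes> Id A (Unit A)) = f \<cdot> Runit A X"
    and pentagon:
      "\<lbrakk>W \<in> Obj A; X \<in> Obj A; Y \<in> Obj A; Z \<in> Obj A\<rbrakk>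
         \<Longrightarrow> Assoc A W X (Y \<star> Z) \<cdot> Assoc A (W \<star> X) Y Z
           = (Id A W \<boxtimes> Assoc A X Y Z) \<cdot> Assoc A W (X \<star> Y) Z \<cdot> (Assoc A W X Y \<boxtimes> Id A Z)"
    and triangle:
      "\<lbrakk>X \<in> Obj A; Y \<in> Obj A\<rbrakk>
         \<Longrightarrow> (Id A X \<boxtimes> Lunit A Y) \<cdot> Assoc A X (Unit A) Y = Runit A X \<boxtimes> Id A Y"

locale fusion_category = monoidal_linear_category A + finite_semisimple_category A
  for A :: "('k::field, 'o, 'm, 'z) ribbon_cat_scheme" (structure) +
  assumes left_dual: "X \<in> Obj A \<Longrightarrow> is_left_dual A X (Ldual A X) (Ev A X) (Coev A X)"
    and right_dual: "X \<in> Obj A \<Longrightarrow> is_left_dual A (Rdual A X) X (REv A X) (RCoev A X)"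
    and unit_simple: "is_simple A (Unit A)"

locale premodular_category = fusion_category A
  for A :: "('k::{alg_closed_field, field_char_0}, 'o, 'm, 'z) ribbon_cat_scheme" (structure) +
  assumes braid_iso:
      "\<lbrakk>X \<in> Obj A; Y \<in> Obj A\<rbrakk> \<Longrightarrow> is_iso A (X \<star> Y) (Y \<star> X) (Braid A X Y)"
    and braid_natural:
      "\<lbrakk>X \<in> Obj A; X' \<in> Obj A; Y \<in> Obj A; Y' \<in> Obj A; f \<in> Mor A X X'; g \<in> Mor A Y Y'\<rbrakk>
         \<Longrightarrow> Braid A X' Y' \<cdot> (f \<boxtimes> g) = (g \<boxtimes> f) \<cdot> Braid A X Y"
    and hexagon_right:
      "\<lbrakk>X \<in> Obj A; Y \<in> Obj A; Z \<in> Obj A\<rbrakk>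
         \<Longrightarrow> Assoc A Y Z X \<cdot> Braid A X (Y \<star> Z) \<cdot> Assoc A X Y Z
           = (Id A Y \<boxtimes> Braid A X Z) \<cdot> Assoc A Y X Z \<cdot> (Braid A X Y \<boxtimes> Id A Z)"
    and hexagon_left:
      "\<lbrakk>X \<in> Obj A; Y \<in> Obj A; Z \<in> Obj A\<rbrakk>
         \<Longrightarrow> Assoc_inv A Z X Y \<cdot> Braid A (X \<star> Y) Z \<cdot> Assoc_inv A X Y Z
           = (Braid A X Z \<boxtimes> Id A Y) \<cdot> Assoc_inv A X Z Y \<cdot> (Id A X \<boxtimes> Braid A Y Z)"
    and twist_iso: "X \<in> Obj A \<Longrightarrow> is_iso A X X (Twist A X)"
    and twist_natural:
      "\<lbrakk>X \<in> Obj A; Y \<in> Obj A; f \<in> Mor A X Y\<rbrakk> \<Longrightarrow> Twist A Y \<cdot> f = f \<cdot> Twist A X"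
    and twist_ten:
      "\<lbrakk>X \<in> Obj A; Y \<in> Obj A\<rbrakk>
         \<Longrightarrow> Twist A (X \<star> Y) = Braid A Y X \<cdot> Braid A X Y \<cdot> (Twist A X \<boxtimes> Twist A Y)"
    and twist_dual: "X \<in> Obj A \<Longrightarrow> Twist A (Ldual A X) = ldual_mor A X X (Twist A X)"

context
  fixes A :: "('k::field, 'o, 'm, 'z) ribbon_cat_scheme" (structure)
begin

text \<open>
  The pivotal structure \<open>X \<rightarrow> X\<^sup>*\<^sup>*\<close> of a ribbon category is the Drinfeld isomorphism composed with the
  twist.
\<close>

definition drinfeld_iso :: "'o \<Rightarrow> 'm" where
  "drinfeld_iso X = (let D = Ldual A X; E = Ldual A D in
     Lunit A E \<cdot> (Ev A X \<boxtimes> Id A E) \<cdot> (Braid A X D \<boxtimes> Id A E) \<cdot> Assoc_inv A X D E \<cdot>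
     (Id A X \<boxtimes> Coev A D) \<cdot> Runit_inv A X)"

definition pivotal_iso :: "'o \<Rightarrow> 'm" where
  "pivotal_iso X = drinfeld_iso X \<cdot> Twist A X"

text \<open>The evaluation \<open>X \<star> X\<^sup>* \<rightarrow> \<one>\<close>.\<close>

definition pivotal_ev :: "'o \<Rightarrow> 'm" where
  "pivotal_ev X = Ev A (Ldual A X) \<cdot> (pivotal_iso X \<boxtimes> Id A (Ldual A X))"

definition dim :: "'o \<Rightarrow> 'k" where
  "dim X = (THE a. pivotal_ev X \<cdot> Coev A X = a \<odot>\<^bsub>Hom A (Unit A) (Unit A)\<^esub> Id A (Unit A))"

definition global_dim :: "'o set \<Rightarrow> 'k" where
  "global_dim I = (\<Sum>i \<in> I. (dim i)\<^sup>2)"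

end


section \<open>Half-braidings and the Drinfeld centre\<close>

text \<open>
  Families indexed by the objects of \<open>A\<close> are \<^const>\<open>extensional\<close>, so that half-braidings are equal
  as soon as their components are.
\<close>

context
  fixes A :: "('k::field, 'o, 'm, 'z) ribbon_cat_scheme" (structure)
begin

definition is_half_braiding :: "'o \<Rightarrow> ('o \<Rightarrow> 'm) \<Rightarrow> bool" where
  "is_half_braiding X \<gamma> \<longleftrightarrow> \<gamma> \<in> extensional (Obj A) \<and>
     (\<forall>B \<in> Obj A. is_iso A (B \<star> X) (X \<star> B) (\<gamma> B)) \<and>
     (\<forall>B \<in> Obj A. \<forall>B' \<in> Obj A. \<forall>f \<in> Mor A B B'. \<gamma> B' \<cdot> (f \<boxtimes> Id A X) = (Id A X \<boxtimes> f) \<cdot> \<gamma> B) \<and>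
     (\<forall>B \<in> Obj A. \<forall>B' \<in> Obj A. \<gamma> (B \<star> B') =
        Assoc A X B B' \<cdot> (\<gamma> B \<boxtimes> Id A B') \<cdot> Assoc_inv A B X B' \<cdot> (Id A B \<boxtimes> \<gamma> B') \<cdot> Assoc A B B' X)"

definition under_braiding :: "'o \<Rightarrow> 'o \<Rightarrow> 'm" where
  "under_braiding X = (\<lambda>B \<in> Obj A. Braid_inv A X B)"

definition ten_half_braiding :: "'o \<Rightarrow> ('o \<Rightarrow> 'm) \<Rightarrow> 'o \<Rightarrow> ('o \<Rightarrow> 'm) \<Rightarrow> 'o \<Rightarrow> 'm" where
  "ten_half_braiding X \<gamma> Y \<mu> = (\<lambda>B \<in> Obj A.
     Assoc_inv A X Y B \<cdot> (Id A X \<boxtimes> \<mu> B) \<cdot> Assoc A X B Y \<cdot> (\<gamma> B \<boxtimes> Id A Y) \<cdot> Assoc_inv A B X Y)"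

text \<open>
  If \<open>D\<^sub>1\<close>, \<open>D\<^sub>2\<close> are left duals of \<open>Z\<^sub>1\<close>, \<open>Z\<^sub>2\<close>, then \<open>D\<^sub>2 \<star> D\<^sub>1\<close> is a left dual of
  \<open>Z\<^sub>1 \<star> Z\<^sub>2\<close> with the following evaluation and coevaluation.
\<close>

definition ten_ev :: "'o \<Rightarrow> 'o \<Rightarrow> 'm \<Rightarrow> 'o \<Rightarrow> 'o \<Rightarrow> 'm \<Rightarrow> 'm" where
  "ten_ev Z\<^sub>1 D\<^sub>1 e\<^sub>1 Z\<^sub>2 D\<^sub>2 e\<^sub>2 =
     e\<^sub>2 \<cdot> (Id A D\<^sub>2 \<boxtimes> Lunit A Z\<^sub>2) \<cdot> (Id A D\<^sub>2 \<boxtimes> (e\<^sub>1 \<boxtimes> Id A Z\<^sub>2)) \<cdot>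
     (Id A D\<^sub>2 \<boxtimes> Assoc_inv A D\<^sub>1 Z\<^sub>1 Z\<^sub>2) \<cdot> Assoc A D\<^sub>2 D\<^sub>1 (Z\<^sub>1 \<star> Z\<^sub>2)"

definition ten_coev :: "'o \<Rightarrow> 'o \<Rightarrow> 'm \<Rightarrow> 'o \<Rightarrow> 'o \<Rightarrow> 'm \<Rightarrow> 'm" where
  "ten_coev Z\<^sub>1 D\<^sub>1 d\<^sub>1 Z\<^sub>2 D\<^sub>2 d\<^sub>2 =
     Assoc_inv A Z\<^sub>1 Z\<^sub>2 (D\<^sub>2 \<star> D\<^sub>1) \<cdot> (Id A Z\<^sub>1 \<boxtimes> Assoc A Z\<^sub>2 D\<^sub>2 D\<^sub>1) \<cdot>
     (Id A Z\<^sub>1 \<boxtimes> (d\<^sub>2 \<boxtimes> Id A D\<^sub>1)) \<cdot> (Id A Z\<^sub>1 \<boxtimes> Lunit_inv A D\<^sub>1) \<cdot> d\<^sub>1"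

text \<open>
  The right dual \<open>\<^sup>*f : \<^sup>*V \<rightarrow> \<^sup>*W\<close> of \<open>f : W \<rightarrow> V\<close>, for right duals \<open>W'\<close> of \<open>W\<close> with coevaluation
  \<open>d : \<one> \<rightarrow> W' \<star> W\<close> and \<open>V'\<close> of \<open>V\<close> with evaluation \<open>e : V \<star> V' \<rightarrow> \<one>\<close>.
\<close>

definition rdual_mor :: "'o \<Rightarrow> 'o \<Rightarrow> 'm \<Rightarrow> 'o \<Rightarrow> 'o \<Rightarrow> 'm \<Rightarrow> 'm \<Rightarrow> 'm" where
  "rdual_mor W W' d V V' e f =
     Runit A W' \<cdot> (Id A W' \<boxtimes> e) \<cdot> (Id A W' \<boxtimes> (f \<boxtimes> Id A V')) \<cdot>
     Assoc A W' W V' \<cdot> (d \<boxtimes> Id A V') \<cdot> Lunit_inv A V'"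

text \<open>
  The half-braiding \<open>(\<^sup>*\<gamma>)\<^sub>B = \<^sup>*(\<gamma>\<^bsub>B\<^sup>*\<^esub>) : B \<star> \<^sup>*X \<rightarrow> \<^sup>*X \<star> B\<close>, where the right duals of
  \<open>B\<^sup>* \<star> X\<close> and \<open>X \<star> B\<^sup>*\<close> are \<open>\<^sup>*X \<star> B\<close> and \<open>B \<star> \<^sup>*X\<close> (\<open>B\<close> being the right dual of \<open>B\<^sup>*\<close>).
\<close>

definition rdual_half_braiding :: "'o \<Rightarrow> ('o \<Rightarrow> 'm) \<Rightarrow> 'o \<Rightarrow> 'm" where
  "rdual_half_braiding X \<gamma> = (\<lambda>B \<in> Obj A. let B' = Ldual A B; X' = Rdual A X in
     rdual_mor
       (B' \<star> X) (X' \<star> B) (ten_coev X' X (RCoev A X) B B' (Coev A B))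
       (X \<star> B') (B \<star> X') (ten_ev B B' (Ev A B) X' X (REv A X))
       (\<gamma> B'))"

text \<open>
  The half-braiding \<open>\<nu>\<^sup>\<or>\<close> on a left dual \<open>Z'\<close> of \<open>Z\<close> with evaluation \<open>e : Z' \<star> Z \<rightarrow> \<one>\<close> and
  coevaluation \<open>d : \<one> \<rightarrow> Z \<star> Z'\<close>.
\<close>

definition vee_half_braiding :: "'o \<Rightarrow> 'o \<Rightarrow> 'm \<Rightarrow> 'm \<Rightarrow> ('o \<Rightarrow> 'm) \<Rightarrow> 'o \<Rightarrow> 'm" where
  "vee_half_braiding Z Z' e d \<nu> = (\<lambda>B \<in> Obj A.
     Braid_inv A Z' B \<cdot>
     Lunit A (B \<star> Z') \<cdot> (e \<boxtimes> Id A (B \<star> Z')) \<cdot> Assoc_inv A Z' Z (B \<star> Z') \<cdot>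
     (Id A Z' \<boxtimes> Assoc A Z B Z') \<cdot> (Id A Z' \<boxtimes> (\<nu> B \<boxtimes> Id A Z')) \<cdot> (Id A Z' \<boxtimes> Assoc_inv A B Z Z') \<cdot>
     Assoc A Z' B (Z \<star> Z') \<cdot> (Id A (Z' \<star> B) \<boxtimes> d) \<cdot> Runit_inv A (Z' \<star> B) \<cdot>
     Braid A B Z')"

end

type_synonym ('o, 'm) centre_obj = "'o \<times> ('o \<Rightarrow> 'm)"
type_synonym ('o, 'm) centre_mor = "('o, 'm) centre_obj \<times> 'm \<times> ('o, 'm) centre_obj"

text \<open>
  A morphism of the centre is stored together with its source and its target, because one and the
  same morphism of \<open>A\<close> can be a morphism between several pairs of objects of the centre.
\<close>

definition centre_hom ::
  "('k::field, 'o, 'm, 'z) ribbon_cat_scheme \<Rightarrow> ('o, 'm) centre_obj \<Rightarrow> ('o, 'm) centre_obj \<Rightarrow>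
   ('k, ('o, 'm) centre_mor) module" where
  "centre_hom A V W = (case V of (X, \<gamma>) \<Rightarrow> case W of (Y, \<mu>) \<Rightarrow>
     \<lparr>carrier = {(V, f, W) | f. f \<in> Mor A X Y \<and>
        (\<forall>B \<in> Obj A. \<mu> B \<cdot>\<^bsub>A\<^esub> (Id A B \<boxtimes>\<^bsub>A\<^esub> f) = (f \<boxtimes>\<^bsub>A\<^esub> Id A B) \<cdot>\<^bsub>A\<^esub> \<gamma> B)},
      monoid.mult = undefined,
      one = undefined,
      zero = (V, \<zero>\<^bsub>Hom A X Y\<^esub>, W),
      add = (\<lambda>(_, f, _) (_, g, _). (V, f \<oplus>\<^bsub>Hom A X Y\<^esub> g, W)),
      module.smult = (\<lambda>a (_, f, _). (V, a \<odot>\<^bsub>Hom A X Y\<^esub> f, W))\<rparr>)"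

definition centre ::
  "('k::field, 'o, 'm, 'z) ribbon_cat_scheme \<Rightarrow>
   ('k, ('o, 'm) centre_obj, ('o, 'm) centre_mor) lin_cat" where
  "centre A =
     \<lparr>Obj = {(X, \<gamma>). X \<in> Obj A \<and> is_half_braiding A X \<gamma>},
      Hom = centre_hom A,
      Id = (\<lambda>V. (V, Id A (fst V), V)),
      Comp = (\<lambda>(_, g, W) (V, f, _). (V, g \<cdot>\<^bsub>A\<^esub> f, W))\<rparr>"

definition forget_obj :: "('o, 'm) centre_obj \<Rightarrow> 'o" where
  "forget_obj V = fst V"

definition forget_mor :: "('o, 'm) centre_mor \<Rightarrow> 'm" where
  "forget_mor = (\<lambda>(_, f, _). f)"


section \<open>The reduced tensor product\<close>

text \<open>\<open>(E, i, p)\<close> is an image of the idempotent \<open>e\<close> on \<open>X\<close>, with inclusion \<open>i\<close> and projection \<open>p\<close>.\<close>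

definition is_image :: "('k, 'o, 'm, 'z) lin_cat_scheme \<Rightarrow> 'o \<Rightarrow> 'm \<Rightarrow> 'o \<times> 'm \<times> 'm \<Rightarrow> bool" where
  "is_image C X e S \<longleftrightarrow> (case S of (E, i, p) \<Rightarrow>
     E \<in> Obj C \<and> i \<in> Mor C E X \<and> p \<in> Mor C X E \<and> p \<cdot>\<^bsub>C\<^esub> i = Id C E \<and> i \<cdot>\<^bsub>C\<^esub> p = e)"

definition is_image_choice ::
  "('k, 'o, 'm, 'z) lin_cat_scheme \<Rightarrow> ('o \<Rightarrow> 'm \<Rightarrow> 'o \<times> 'm \<times> 'm) \<Rightarrow> bool" where
  "is_image_choice C im \<longleftrightarrow>
     (\<forall>X \<in> Obj C. \<forall>e \<in> Mor C X X. e \<cdot>\<^bsub>C\<^esub> e = e \<longrightarrow> is_image C X e (im X e))"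

context
  fixes A :: "('k::field, 'o, 'm, 'z) ribbon_cat_scheme" (structure)
    and I :: "'o set"
    and im :: "'o \<Rightarrow> 'm \<Rightarrow> 'o \<times> 'm \<times> 'm"
begin

definition Q_term :: "('o, 'm) centre_obj \<Rightarrow> ('o, 'm) centre_obj \<Rightarrow> 'o \<Rightarrow> 'm" where
  "Q_term V W i = (case V of (X, \<gamma>) \<Rightarrow> case W of (Y, \<mu>) \<Rightarrow> let i' = Ldual A i in
     (Id A X \<boxtimes> Lunit A Y) \<cdot> (Id A X \<boxtimes> (pivotal_ev A i \<boxtimes> Id A Y)) \<cdot>
     (Id A X \<boxtimes> Assoc_inv A i i' Y) \<cdot> Assoc A X i (i' \<star> Y) \<cdot>
     ((\<gamma> i \<cdot> Braid_inv A i X) \<boxtimes> (Braid A Y i' \<cdot> \<mu> i')) \<cdot>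
     Assoc_inv A X i (i' \<star> Y) \<cdot> (Id A X \<boxtimes> Assoc A i i' Y) \<cdot>
     (Id A X \<boxtimes> (Coev A i \<boxtimes> Id A Y)) \<cdot> (Id A X \<boxtimes> Lunit_inv A Y))"

definition Q :: "('o, 'm) centre_obj \<Rightarrow> ('o, 'm) centre_obj \<Rightarrow> 'm" where
  "Q V W = (let XY = fst V \<star> fst W in
     (1 / global_dim A I) \<odot>\<^bsub>Hom A XY XY\<^esub>
       (\<Oplus>\<^bsub>Hom A XY XY\<^esub>i \<in> I. dim A i \<odot>\<^bsub>Hom A XY XY\<^esub> Q_term V W i))"

definition red_image :: "('o, 'm) centre_obj \<Rightarrow> ('o, 'm) centre_obj \<Rightarrow> 'o" where
  "red_image V W = fst (im (fst V \<star> fst W) (Q V W))"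

definition red_incl :: "('o, 'm) centre_obj \<Rightarrow> ('o, 'm) centre_obj \<Rightarrow> 'm" where
  "red_incl V W = fst (snd (im (fst V \<star> fst W) (Q V W)))"

definition red_proj :: "('o, 'm) centre_obj \<Rightarrow> ('o, 'm) centre_obj \<Rightarrow> 'm" where
  "red_proj V W = snd (snd (im (fst V \<star> fst W) (Q V W)))"

text \<open>
  \<open>\<gamma> \<otimes> c\<^sup>-\<^sup>1\<close> commutes with the idempotent \<^term>\<open>Q V W\<close>, so its restriction to the image is
  obtained by composing with the inclusion and the projection; \<open>c \<otimes> \<mu>\<close> has the same restriction.
\<close>

definition red_obj ::
  "('o, 'm) centre_obj \<Rightarrow> ('o, 'm) centre_obj \<Rightarrow> ('o, 'm) centre_obj" where
  "red_obj V W = (case V of (X, \<gamma>) \<Rightarrow> case W of (Y, \<mu>) \<Rightarrow>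
     (red_image V W,
      \<lambda>B \<in> Obj A. (red_proj V W \<boxtimes> Id A B) \<cdot> ten_half_braiding A X \<gamma> Y (under_braiding A Y) B \<cdot>
        (Id A B \<boxtimes> red_incl V W)))"

definition red_mor ::
  "('o, 'm) centre_mor \<Rightarrow> ('o, 'm) centre_mor \<Rightarrow> ('o, 'm) centre_mor" where
  "red_mor F G = (case F of (V, f, V') \<Rightarrow> case G of (W, g, W') \<Rightarrow>
     (red_obj V W, red_proj V' W' \<cdot> (f \<boxtimes> g) \<cdot> red_incl V W, red_obj V' W'))"

text \<open>The associator of \<open>A\<close>, restricted to the images.\<close>

definition red_assoc ::
  "('o, 'm) centre_obj \<Rightarrow> ('o, 'm) centre_obj \<Rightarrow> ('o, 'm) centre_obj \<Rightarrow> ('o, 'm) centre_mor" where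
  "red_assoc V W T =
     (red_obj (red_obj V W) T,
      red_proj V (red_obj W T) \<cdot> (Id A (fst V) \<boxtimes> red_proj W T) \<cdot>
        Assoc A (fst V) (fst W) (fst T) \<cdot>
        (red_incl V W \<boxtimes> Id A (fst T)) \<cdot> red_incl (red_obj V W) T,
      red_obj V (red_obj W T))"

text \<open>
  The argument \<open>K\<close> is the unit; it is to be \<open>I \<one>\<close> for a two-sided adjoint \<open>I\<close> of the forgetful
  functor.
\<close>

definition reduced_centre ::
  "('o, 'm) centre_obj \<Rightarrow> ('k, ('o, 'm) centre_obj, ('o, 'm) centre_mor) tensor_cat" where
  "reduced_centre K =
     \<lparr>Obj = Obj (centre A), Hom = Hom (centre A), Id = Id (centre A), Comp = Comp (centre A),
      Ten = red_obj, Ten_mor = red_mor, Unit = K, Assoc = red_assoc\<rparr>"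

end


section \<open>The functor \<open>U\<close>\<close>

text \<open>
  The underlying object of \<open>U (X, \<gamma>)\<close> is \<open>X\<close> itself: in \<open>(\<^sup>*\<gamma>)\<^sup>\<or>\<close> the left dual of \<open>\<^sup>*X\<close> is taken to
  be \<open>X\<close>, with the (co)evaluation that exhibits \<open>\<^sup>*X\<close> as a right dual of \<open>X\<close>.
\<close>

definition U_obj ::
  "('k::field, 'o, 'm, 'z) ribbon_cat_scheme \<Rightarrow> ('o, 'm) centre_obj \<Rightarrow> ('o, 'm) centre_obj" where
  "U_obj A = (\<lambda>(X, \<gamma>).
     (X, vee_half_braiding A (Rdual A X) X (REv A X) (RCoev A X) (rdual_half_braiding A X \<gamma>)))"

definition U_mor ::
  "('k::field, 'o, 'm, 'z) ribbon_cat_scheme \<Rightarrow> ('o, 'm) centre_mor \<Rightarrow> ('o, 'm) centre_mor" where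
  "U_mor A = (\<lambda>(V, f, W). (U_obj A V, f, U_obj A W))"

definition twist_inverse ::
  "('k::field, 'o, 'm, 'z) ribbon_cat_scheme \<Rightarrow> ('o, 'm) centre_obj \<Rightarrow> ('o, 'm) centre_mor" where
  "twist_inverse A V =
     (U_obj A (U_obj A V), inv_mor A (fst V) (fst V) (Twist A (fst V)), V)"

end

theory Submission
  imports Defs
begin

text \<open>
  Let \<open>V = (X, \<gamma>)\<close> and \<open>T = (Y, \<mu>)\<close> be objects of the centre.  The object \<open>X \<star> Y\<close> carries the two
  half-braidings \<open>\<sigma> = \<gamma> \<otimes> c\<^sup>-\<^sup>1\<close> and \<open>\<tau> = c \<otimes> \<mu>\<close>.  Up to rearranging crossings, the idempotent \<open>Q\<close> is the
  normalised sum over the simple objects \<open>i\<close> of loops that cross \<open>X \<star> Y\<close> once by \<open>\<sigma>\<^sub>i\<close> and once by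
  \<open>\<tau>\<close> at the dual of \<open>i\<close>.  Two facts determine everything.  By the handle slide (\<open>handle_slide\<close>), \<open>Q\<close>
  intertwines \<open>\<sigma>\<close> and \<open>\<tau>\<close> with themselves and with each other.  By absorption (\<open>kirby_loop_absorb\<close>,
  \<open>kirby_loop_coabsorb\<close>), a morphism into \<open>X \<star> Y\<close> that intertwines one half-braiding with both \<open>\<sigma>\<close>
  and \<open>\<tau>\<close> is fixed by \<open>Q\<close>, because its loops open up and contribute \<open>\<Sum>\<^sub>i d\<^sub>i\<^sup>2\<close>; dually for morphisms out of
  \<open>X \<star> Y\<close>.  So the image of \<open>Q\<close> is the universal place where \<open>\<sigma>\<close> and \<open>\<tau>\<close> agree, and statements about
  reduced tensor products become statements about which morphisms commute with which half-braidings.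

  The functor \<open>U\<close> replaces \<open>\<gamma>\<close> by \<open>c\<^sup>-\<^sup>1 \<gamma>\<^sup>-\<^sup>1 c\<close> (\<open>U_obj_eq\<close>).  A morphism commutes with \<open>\<gamma>\<close> and \<open>\<mu>\<close> if
  and only if it commutes with \<open>U \<gamma>\<close> and \<open>U \<mu>\<close>, and the braiding \<open>c : Y \<star> X \<rightarrow> X \<star> Y\<close> exchanges the two
  roles: it carries \<open>c \<otimes> U \<gamma>\<close> to \<open>U \<sigma>\<close> and \<open>U \<mu> \<otimes> c\<^sup>-\<^sup>1\<close> to \<open>U \<tau>\<close> (\<open>central_braid_U\<close>).  By the two facts
  above, \<open>c\<close> intertwines the idempotent of \<open>(U T, U V)\<close> with that of \<open>(V, T)\<close> (\<open>Q_braid\<close>), hence restricts to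
  an isomorphism \<open>J\<close> of the images.  The associator restricts to the threefold images for the same reason:
  both iterated images are universal for three half-braidings on \<open>X \<star> Y \<star> Z\<close>.  After composition with the
  inclusions of the images, the hexagon for \<open>J\<close> is the Yang-Baxter relation \<open>braid_assoc\<close>.

  Applying \<open>U\<close> twice conjugates \<open>\<gamma>\<close> by double braidings, and these are expressed by the twist; so
  \<open>\<theta>\<^sup>-\<^sup>1\<close> is a morphism \<open>U (U V) \<rightarrow> V\<close> of the centre, which makes \<open>U\<close> an equivalence.  Finally \<open>I \<one>\<close>
  carries a universal arrow from \<open>\<one>\<close> to the forgetful functor; \<open>U (I \<one>)\<close> carries the same one, because the
  twist of \<open>\<one>\<close> is trivial, and the two objects are isomorphic.

  The handle slide itself rests on semisimplicity.  A strand \<open>B\<close> next to a loop \<open>i\<close> is fused to \<open>B \<star> i\<close>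
  and decomposed into simple objects \<open>k\<close>; on the other side \<open>k\<^sup>* \<star> B\<close> is decomposed into duals \<open>i\<^sup>*\<close>.  The
  two expansions agree block by block since the bases involved are dual to each other for the trace pairing,
  whose two evaluations differ by the factors \<open>d\<^sub>i\<close> and \<open>d\<^sub>k\<close> (\<open>mate_pairing\<close>).

  All isotopies are computed in a strict model of the category, in which associators and unitors disappear:
  see the type \<open>diagram\<close>.
\<close>

section \<open>Arrows with source and target\<close>

context linear_category begin

text \<open>
  Hom sets between different objects are disjoint, so source and target are functions of the morphism.
  With them the typing conditions of the axioms turn into equations that the simplifier can discharge.
\<close>

definition arr :: "'m \<Rightarrow> bool" where
  "arr f \<longleftrightarrow> (\<exists>X \<in> Obj C. \<exists>Y \<in> Obj C. f \<in> Mor C X Y)"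
definition src :: "'m \<Rightarrow> 'o" where
  "src f = (THE X. X \<in> Obj C \<and> (\<exists>Y \<in> Obj C. f \<in> Mor C X Y))"
definition tgt :: "'m \<Rightarrow> 'o" where
  "tgt f = (THE Y. Y \<in> Obj C \<and> (\<exists>X \<in> Obj C. f \<in> Mor C X Y))"

lemma Mor_typing:
  assumes "X \<in> Obj C" "Y \<in> Obj C" "f \<in> Mor C X Y"
  shows "arr f" "src f = X" "tgt f = Y"
proof -
  show "arr f" using assms by (auto simp: arr_def)
  show "src f = X" unfolding src_def using assms hom_disjoint by (intro the_equality) blast+
  show "tgt f = Y" unfolding tgt_def using assms hom_disjoint by (intro the_equality) blast+
qed

lemma arr_Mor: "arr f \<Longrightarrow> f \<in> Mor C (src f) (tgt f)"
  and src_closed [simp]: "arr f \<Longrightarrow> src f \<in> Obj C"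
  and tgt_closed [simp]: "arr f \<Longrightarrow> tgt f \<in> Obj C"
  using Mor_typing unfolding arr_def by metis+

lemma Mor_iff: "X \<in> Obj C \<Longrightarrow> Y \<in> Obj C \<Longrightarrow> f \<in> Mor C X Y \<longleftrightarrow> arr f \<and> src f = X \<and> tgt f = Y"
  using Mor_typing arr_Mor by blast

lemma comp_typing [simp]:
  assumes "arr f" "arr g" "src g = tgt f"
  shows "arr (g \<cdot> f)" "src (g \<cdot> f) = src f" "tgt (g \<cdot> f) = tgt g"
  using Mor_typing[OF _ _ comp_closed[OF _ _ _ arr_Mor[OF assms(1)], of "tgt g" g]] assms arr_Mor[of g]
  by auto

lemma Id_typing [simp]: "X \<in> Obj C \<Longrightarrow> arr (Id C X)" "X \<in> Obj C \<Longrightarrow> src (Id C X) = X"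
  "X \<in> Obj C \<Longrightarrow> tgt (Id C X) = X"
  using Mor_typing id_closed by blast+

lemma arr_comp_assoc [simp]:
  assumes "arr f" "arr g" "arr h" "src g = tgt f" "src h = tgt g"
  shows "(h \<cdot> g) \<cdot> f = h \<cdot> (g \<cdot> f)"
  using comp_assoc[of "src f" "tgt f" "tgt g" "tgt h" f g h] assms arr_Mor[of f] arr_Mor[of g]
    arr_Mor[of h] by auto

lemma arr_Id_left [simp]: "arr f \<Longrightarrow> tgt f = X \<Longrightarrow> Id C X \<cdot> f = f"
  using comp_id_left[of "src f" "tgt f" f] arr_Mor[of f] by auto

lemma arr_Id_right [simp]: "arr f \<Longrightarrow> src f = X \<Longrightarrow> f \<cdot> Id C X = f"
  using comp_id_right[of "src f" "tgt f" f] arr_Mor[of f] by auto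

lemma inverse_pair_unique:
  assumes "inverse_pair C X Y f g" "inverse_pair C X Y f h"
  shows "g = h"
proof -
  note d = assms[unfolded inverse_pair_def]
  have "g = (h \<cdot> f) \<cdot> g" using d comp_id_left[of Y X g] by simp
  also have "\<dots> = h \<cdot> (f \<cdot> g)" using d comp_assoc[of Y X Y X g f h] by auto
  also have "\<dots> = h" using d comp_id_right[of Y X h] by simp
  finally show ?thesis .
qed

lemma inverse_pair_inv_mor: "inverse_pair C X Y f g \<Longrightarrow> inv_mor C X Y f = g"
  unfolding inv_mor_def using inverse_pair_unique by blast

lemma is_iso_inverse_pair: "is_iso C X Y f \<Longrightarrow> inverse_pair C X Y f (inv_mor C X Y f)"
  unfolding is_iso_def using inverse_pair_inv_mor by metis

lemma iso_facts:
  assumes "is_iso C X Y f"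
  shows "arr f" "src f = X" "tgt f = Y"
    "arr (inv_mor C X Y f)" "src (inv_mor C X Y f) = Y" "tgt (inv_mor C X Y f) = X"
    "f \<cdot> inv_mor C X Y f = Id C Y" "inv_mor C X Y f \<cdot> f = Id C X"
  using is_iso_inverse_pair[OF assms] unfolding inverse_pair_def by (auto simp: Mor_iff)

lemma inverse_pairI:
  assumes "arr f" "arr g" "src f = X" "tgt f = Y" "src g = Y" "tgt g = X" "g \<cdot> f = Id C X" "f \<cdot> g = Id C Y"
  shows "inverse_pair C X Y f g"
  unfolding inverse_pair_def using assms by (auto simp: Mor_iff)

end

context monoidal_linear_category begin

lemmas [simp] = ten_closed unit_closed

lemma ten_typing [simp]:
  assumes "arr f" "arr g"
  shows "arr (f \<boxtimes> g)" "src (f \<boxtimes> g) = src f \<star> src g" "tgt (f \<boxtimes> g) = tgt f \<star> tgt g"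
  using Mor_typing[OF _ _ ten_mor_closed[OF _ _ _ _ arr_Mor[OF assms(1)] arr_Mor[OF assms(2)]]] assms
  by auto

lemma ten_comp:
  assumes "arr f" "arr f'" "arr g" "arr g'" "src f' = tgt f" "src g' = tgt g"
  shows "(f' \<cdot> f) \<boxtimes> (g' \<cdot> g) = (f' \<boxtimes> g') \<cdot> (f \<boxtimes> g)"
  using interchange[of "src f" "tgt f" "tgt f'" "src g" "tgt g" "tgt g'" f f' g g'] assms
    arr_Mor[of f] arr_Mor[of g] arr_Mor[of f'] arr_Mor[of g'] by auto

lemmas assoc_facts [simp] = iso_facts[OF assoc_iso]
lemmas lunit_facts [simp] = iso_facts[OF lunit_iso]
lemmas runit_facts [simp] = iso_facts[OF runit_iso]

lemma assoc_nat:
  assumes "arr f" "arr g" "arr h"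
  shows "Assoc A (tgt f) (tgt g) (tgt h) \<cdot> ((f \<boxtimes> g) \<boxtimes> h) = (f \<boxtimes> (g \<boxtimes> h)) \<cdot> Assoc A (src f) (src g) (src h)"
  using assoc_natural arr_Mor assms by simp

lemma runit_nat: "arr f \<Longrightarrow> Runit A (tgt f) \<cdot> (f \<boxtimes> Id A (Unit A)) = f \<cdot> Runit A (src f)"
  using runit_natural arr_Mor by simp

lemma lunit_nat: "arr f \<Longrightarrow> Lunit A (tgt f) \<cdot> (Id A (Unit A) \<boxtimes> f) = f \<cdot> Lunit A (src f)"
  using lunit_natural arr_Mor by simp

lemma cancel_left_iso:
  assumes "is_iso A X Y k" "arr f" "arr g" "tgt f = X" "tgt g = X" "k \<cdot> f = k \<cdot> g"
  shows "f = g"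
proof -
  note k = iso_facts[OF assms(1)]
  have "inv_mor A X Y k \<cdot> (k \<cdot> h) = h" if "arr h" "tgt h = X" for h
    using that k by (simp add: arr_comp_assoc[symmetric] del: arr_comp_assoc)
  then show ?thesis using assms by metis
qed

lemma cancel_right_iso:
  assumes "is_iso A X Y k" "arr f" "arr g" "src f = Y" "src g = Y" "f \<cdot> k = g \<cdot> k"
  shows "f = g"
proof -
  note k = iso_facts[OF assms(1)]
  have "(h \<cdot> k) \<cdot> inv_mor A X Y k = h" if "arr h" "src h = Y" for h
    using that k by simp
  then show ?thesis using assms by metis
qed

text \<open>
  Tensoring with the unit object is isomorphic to the identity functor through the unitors.
\<close>

lemma ten_unit_faithful:
  assumes "arr f" "arr g" "src f = src g" "tgt f = tgt g" "f \<boxtimes> Id A (Unit A) = g \<boxtimes> Id A (Unit A)"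
  shows "f = g"
  using runit_nat[of f] runit_nat[of g] assms
  by (intro cancel_right_iso[OF runit_iso[of "src f"], of f g]) auto

lemma unit_ten_faithful:
  assumes "arr f" "arr g" "src f = src g" "tgt f = tgt g" "Id A (Unit A) \<boxtimes> f = Id A (Unit A) \<boxtimes> g"
  shows "f = g"
  using lunit_nat[of f] lunit_nat[of g] assms
  by (intro cancel_right_iso[OF lunit_iso[of "src f"], of f g]) auto

lemma ten_comp_right: "arr f \<Longrightarrow> arr g \<Longrightarrow> src g = tgt f \<Longrightarrow> X \<in> Obj A \<Longrightarrow>
    (g \<cdot> f) \<boxtimes> Id A X = (g \<boxtimes> Id A X) \<cdot> (f \<boxtimes> Id A X)"
  using ten_comp[of f g "Id A X" "Id A X"] by simp

lemma ten_comp_left: "arr f \<Longrightarrow> arr g \<Longrightarrow> src g = tgt f \<Longrightarrow> X \<in> Obj A \<Longrightarrow>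
    Id A X \<boxtimes> (g \<cdot> f) = (Id A X \<boxtimes> g) \<cdot> (Id A X \<boxtimes> f)"
  using ten_comp[of "Id A X" "Id A X" f g] by simp

text \<open>
  Kelly's redundancy of one unit axiom: the pentagon with two units and the triangle axiom determine
  the right unitor of a tensor product, since tensoring with the unit is faithful.
\<close>

lemma runit_ten:
  assumes [simp]: "V \<in> Obj A" "X \<in> Obj A"
  shows "(Id A V \<boxtimes> Runit A X) \<cdot> Assoc A V X (Unit A) = Runit A (V \<star> X)"
proof -
  let ?I = "Unit A"
  let ?l = "Lunit A ?I"
  define a0 a1 a2 a3 where "a0 = Assoc A V X ?I" and "a1 = Assoc A V X (?I \<star> ?I)"
    and "a2 = Assoc A (V \<star> X) ?I ?I" and "a3 = Assoc A V (X \<star> ?I) ?I"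
  define l1 l2 where "l1 = Id A (V \<star> X) \<boxtimes> ?l" and "l2 = Id A V \<boxtimes> (Id A X \<boxtimes> ?l)"
  define m n where "m = Id A V \<boxtimes> Assoc A X ?I ?I" and "n = Assoc A V X ?I \<boxtimes> Id A ?I"
  define r1 r2 r3 where "r1 = Runit A (V \<star> X) \<boxtimes> Id A ?I" and "r2 = Id A V \<boxtimes> (Runit A X \<boxtimes> Id A ?I)"
    and "r3 = (Id A V \<boxtimes> Runit A X) \<boxtimes> Id A ?I"
  note defs = a0_def a1_def a2_def a3_def l1_def l2_def m_def n_def r1_def r2_def r3_def
  have e1: "l1 \<cdot> a2 = r1" unfolding defs by (rule triangle) simp_all
  have e2: "a0 \<cdot> l1 = l2 \<cdot> a1"
    unfolding defs using assoc_nat[of "Id A V" "Id A X" ?l] by (simp add: ten_id)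
  have e3: "a1 \<cdot> a2 = m \<cdot> a3 \<cdot> n" unfolding defs by (rule pentagon) simp_all
  have e4: "l2 \<cdot> m = r2" unfolding defs by (simp add: triangle flip: ten_comp_left)
  have e5: "a0 \<cdot> r3 = r2 \<cdot> a3"
    unfolding defs using assoc_nat[of "Id A V" "Runit A X" "Id A ?I"] by simp
  have [simp]: "arr a0" "arr a1" "arr a2" "arr a3" "arr l1" "arr l2" "arr m" "arr n" "arr r1" "arr r2" "arr r3"
    unfolding defs by simp_all
  have [simp]: "tgt a0 = V \<star> (X \<star> ?I)" "src a0 = V \<star> X \<star> ?I" "src a1 = V \<star> X \<star> (?I \<star> ?I)"
    "tgt a1 = V \<star> (X \<star> (?I \<star> ?I))" "src a2 = V \<star> X \<star> ?I \<star> ?I" "tgt a2 = V \<star> X \<star> (?I \<star> ?I)"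
    "src a3 = V \<star> (X \<star> ?I) \<star> ?I" "tgt a3 = V \<star> ((X \<star> ?I) \<star> ?I)"
    "src l1 = V \<star> X \<star> (?I \<star> ?I)" "tgt l1 = V \<star> X \<star> ?I"
    "src l2 = V \<star> (X \<star> (?I \<star> ?I))" "tgt l2 = V \<star> (X \<star> ?I)"
    "src m = V \<star> ((X \<star> ?I) \<star> ?I)" "tgt m = V \<star> (X \<star> (?I \<star> ?I))"
    "src n = V \<star> X \<star> ?I \<star> ?I" "tgt n = V \<star> (X \<star> ?I) \<star> ?I"
    "src r1 = V \<star> X \<star> ?I \<star> ?I" "tgt r1 = V \<star> X \<star> ?I"
    "src r2 = V \<star> ((X \<star> ?I) \<star> ?I)" "tgt r2 = V \<star> (X \<star> ?I)"
    "src r3 = V \<star> (X \<star> ?I) \<star> ?I" "tgt r3 = V \<star> X \<star> ?I"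
    unfolding defs by simp_all
  have "a0 \<cdot> r1 = (a0 \<cdot> l1) \<cdot> a2" unfolding e1[symmetric] by simp
  also have "\<dots> = l2 \<cdot> (a1 \<cdot> a2)" unfolding e2 by simp
  also have "\<dots> = (l2 \<cdot> m) \<cdot> a3 \<cdot> n" unfolding e3 by simp
  also have "\<dots> = (r2 \<cdot> a3) \<cdot> n" unfolding e4 by simp
  also have "\<dots> = a0 \<cdot> (r3 \<cdot> n)" unfolding e5[symmetric] by simp
  finally have "r1 = r3 \<cdot> n"
    using cancel_left_iso[OF assoc_iso[of V X ?I], of r1 "r3 \<cdot> n"] by (simp add: a0_def)
  then have "((Id A V \<boxtimes> Runit A X) \<cdot> Assoc A V X ?I) \<boxtimes> Id A ?I = Runit A (V \<star> X) \<boxtimes> Id A ?I"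
    unfolding defs by (simp add: ten_comp_right)
  then show ?thesis by (rule ten_unit_faithful[rotated 4]) simp_all
qed

end

section \<open>String diagrams that compose strictly\<close>

(* That notation would make the one-element list in an application such as f [X] ambiguous. *)
no_notation univ_poly (\<open>(\<open>open_block notation=\<open>postfix X\<close>\<close>_ [X]\<index>)\<close> 80)

text \<open>
  A diagram from \<open>[X\<^sub>1, \<dots>, X\<^sub>m]\<close> to \<open>[Y\<^sub>1, \<dots>, Y\<^sub>n]\<close> is stored as the family of the morphisms
  \<open>((V \<star> X\<^sub>1) \<star> \<dots>) \<star> X\<^sub>m \<rightarrow> ((V \<star> Y\<^sub>1) \<star> \<dots>) \<star> Y\<^sub>n\<close> for all objects \<open>V\<close>, in the manner of Cayley.  Because
  brackets always open on the left, placing diagrams next to each other is strictly associative and no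
  associator ever has to be written.  The value \<open>None\<close> marks expressions that do not fit together, so that
  associativity and whiskering laws hold without side conditions.
\<close>

type_synonym ('o, 'm) diagram = "'o list \<times> ('o \<Rightarrow> 'm) option \<times> 'o list"

definition sdom :: "('o, 'm) diagram \<Rightarrow> 'o list" where "sdom f = fst f"
definition scod :: "('o, 'm) diagram \<Rightarrow> 'o list" where "scod f = snd (snd f)"
definition fam :: "('o, 'm) diagram \<Rightarrow> 'o \<Rightarrow> 'm" where "fam f = the (fst (snd f))"

context monoidal_linear_category begin

definition vp :: "'o \<Rightarrow> 'o list \<Rightarrow> 'o" where "vp V xs = foldl (\<star>) V xs"
definition vm :: "'m \<Rightarrow> 'o list \<Rightarrow> 'm" where "vm f xs = foldl (\<lambda>f X. f \<boxtimes> Id A X) f xs"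

lemma vp_simps [simp]: "vp V [] = V" "vp V (X # xs) = vp (V \<star> X) xs" "vp V (xs @ ys) = vp (vp V xs) ys"
  by (simp_all add: vp_def)

lemma vm_simps [simp]: "vm f [] = f" "vm f (X # xs) = vm (f \<boxtimes> Id A X) xs" "vm f (xs @ ys) = vm (vm f xs) ys"
  by (simp_all add: vm_def)

lemma vp_closed [simp]: "V \<in> Obj A \<Longrightarrow> set xs \<subseteq> Obj A \<Longrightarrow> vp V xs \<in> Obj A"
  by (induction xs arbitrary: V) auto

lemma vm_typing [simp]:
  assumes "arr f" "set xs \<subseteq> Obj A"
  shows "arr (vm f xs)" "src (vm f xs) = vp (src f) xs" "tgt (vm f xs) = vp (tgt f) xs"
  using assms by (induction xs arbitrary: f) auto

lemma vm_Id [simp]: "V \<in> Obj A \<Longrightarrow> set xs \<subseteq> Obj A \<Longrightarrow> vm (Id A V) xs = Id A (vp V xs)"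
  by (induction xs arbitrary: V) (auto simp: ten_id)

lemma vm_comp: "arr f \<Longrightarrow> arr g \<Longrightarrow> src g = tgt f \<Longrightarrow> set xs \<subseteq> Obj A \<Longrightarrow> vm (g \<cdot> f) xs = vm g xs \<cdot> vm f xs"
  by (induction xs arbitrary: f g) (auto simp: ten_comp_right)

text \<open>
  The families that occur are generated from a few atoms; keeping track of the generation, rather than
  only of naturality in \<open>V\<close>, makes induction over diagrams available.
\<close>

inductive gen :: "'o list \<Rightarrow> ('o \<Rightarrow> 'm) \<Rightarrow> 'o list \<Rightarrow> bool" where
  gen_hat: "arr f \<Longrightarrow> gen [src f] (\<lambda>V \<in> Obj A. Id A V \<boxtimes> f) [tgt f]"
| gen_mm: "X \<in> Obj A \<Longrightarrow> Y \<in> Obj A \<Longrightarrow> gen [X, Y] (\<lambda>V \<in> Obj A. Assoc A V X Y) [X \<star> Y]"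
| gen_mi: "X \<in> Obj A \<Longrightarrow> Y \<in> Obj A \<Longrightarrow> gen [X \<star> Y] (\<lambda>V \<in> Obj A. Assoc_inv A V X Y) [X, Y]"
| gen_uu: "gen [] (\<lambda>V \<in> Obj A. Runit_inv A V) [Unit A]"
| gen_ui: "gen [Unit A] (\<lambda>V \<in> Obj A. Runit A V) []"
| gen_ide: "set xs \<subseteq> Obj A \<Longrightarrow> gen xs (\<lambda>V \<in> Obj A. Id A (vp V xs)) xs"
| gen_comp: "gen xs F ys \<Longrightarrow> gen ys G zs \<Longrightarrow> gen xs (\<lambda>V \<in> Obj A. G V \<cdot> F V) zs"
| gen_whisk: "gen xs F ys \<Longrightarrow> set us \<subseteq> Obj A \<Longrightarrow> set ws \<subseteq> Obj A \<Longrightarrow>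
    gen (us @ xs @ ws) (\<lambda>V \<in> Obj A. vm (F (vp V us)) ws) (us @ ys @ ws)"

lemma gen_objs: "gen xs F ys \<Longrightarrow> set xs \<subseteq> Obj A \<and> set ys \<subseteq> Obj A \<and> F \<in> extensional (Obj A)"
  by (induction rule: gen.induct) (auto simp: extensional_def)

lemma gen_typing:
  assumes "gen xs F ys" "V \<in> Obj A"
  shows "arr (F V)" "src (F V) = vp V xs" "tgt (F V) = vp V ys"
proof -
  have "\<forall>V \<in> Obj A. arr (F V) \<and> src (F V) = vp V xs \<and> tgt (F V) = vp V ys"
    using assms(1)
  proof (induction rule: gen.induct)
    case (gen_whisk xs F ys us ws)
    then show ?case by simp
  qed auto
  then show "arr (F V)" "src (F V) = vp V xs" "tgt (F V) = vp V ys" using assms by auto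
qed

lemma natural_inverse:
  assumes "is_iso A X Y k" "is_iso A X' Y' k'" "arr a" "arr b" "src a = X" "tgt a = X'" "src b = Y" "tgt b = Y'"
    "k' \<cdot> a = b \<cdot> k"
  shows "inv_mor A X' Y' k' \<cdot> b = a \<cdot> inv_mor A X Y k"
proof -
  note k = iso_facts[OF assms(1)] and k' = iso_facts[OF assms(2)]
  let ?i = "inv_mor A X Y k" and ?i' = "inv_mor A X' Y' k'"
  have "?i' \<cdot> b = ?i' \<cdot> (b \<cdot> (k \<cdot> ?i))" using assms(3-8) k k' by simp
  also have "\<dots> = ?i' \<cdot> ((b \<cdot> k) \<cdot> ?i)" using assms(3-8) k k' by simp
  also have "\<dots> = ?i' \<cdot> (k' \<cdot> (a \<cdot> ?i))" unfolding assms(9)[symmetric] using assms(3-8) k k' by simp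
  also have "\<dots> = (?i' \<cdot> k') \<cdot> (a \<cdot> ?i)"
    by (rule arr_comp_assoc[symmetric]) (use assms(3-8) k k' in simp_all)
  also have "\<dots> = a \<cdot> ?i" unfolding k'(8) using assms(3-8) k by simp
  finally show ?thesis .
qed

text \<open>
  Naturality in the object on the far left is what makes the interchange law hold.
\<close>

lemma gen_natural:
  assumes "gen xs F ys" "arr h"
  shows "F (tgt h) \<cdot> vm h xs = vm h ys \<cdot> F (src h)"
proof -
  have "\<forall>h. arr h \<longrightarrow> F (tgt h) \<cdot> vm h xs = vm h ys \<cdot> F (src h)"
    using assms(1)
  proof (induction rule: gen.induct)
    case (gen_hat f)
    then show ?case by (auto simp flip: ten_comp)
  next
    case (gen_mm X Y)
    then show ?case using assoc_nat[of _ "Id A X" "Id A Y"] by (auto simp: ten_id)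
  next
    case (gen_mi X Y)
    then show ?case using assoc_nat[of _ "Id A X" "Id A Y"]
      by (auto simp: ten_id intro!: natural_inverse[OF assoc_iso assoc_iso])
  next
    case gen_uu
    then show ?case using runit_nat by (auto intro!: natural_inverse[OF runit_iso runit_iso])
  next
    case gen_ui
    then show ?case using runit_nat by auto
  next
    case (gen_ide xs)
    then show ?case by auto
  next
    case (gen_comp xs F ys G zs)
    note o = gen_objs[OF gen_comp(1)] gen_objs[OF gen_comp(2)]
    show ?case
    proof (intro allI impI)
      fix h assume h [simp]: "arr h"
      have [simp]: "arr (vm h xs)" "arr (vm h ys)" "arr (vm h zs)" using o by auto
      note t = gen_typing[OF gen_comp(1)] gen_typing[OF gen_comp(2)]
      have "G (tgt h) \<cdot> F (tgt h) \<cdot> vm h xs = G (tgt h) \<cdot> vm h ys \<cdot> F (src h)"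
        using gen_comp(3) h by simp
      also have "\<dots> = (G (tgt h) \<cdot> vm h ys) \<cdot> F (src h)" using o t by simp
      also have "\<dots> = (vm h zs \<cdot> G (src h)) \<cdot> F (src h)" using gen_comp(4) h by simp
      finally show "(\<lambda>V\<in>Obj A. G V \<cdot> F V) (tgt h) \<cdot> vm h xs = vm h zs \<cdot> (\<lambda>V\<in>Obj A. G V \<cdot> F V) (src h)"
        using o t by simp
    qed
  next
    case (gen_whisk xs F ys us ws)
    note o = gen_objs[OF gen_whisk(1)] and t = gen_typing[OF gen_whisk(1)]
    show ?case
    proof (intro allI impI)
      fix h assume h [simp]: "arr h"
      have e: "F (tgt (vm h us)) \<cdot> vm (vm h us) xs = vm (vm h us) ys \<cdot> F (src (vm h us))"
        by (rule gen_whisk(4)[rule_format]) (use gen_whisk(2) in simp)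
      show "(\<lambda>V\<in>Obj A. vm (F (vp V us)) ws) (tgt h) \<cdot> vm h (us @ xs @ ws)
        = vm h (us @ ys @ ws) \<cdot> (\<lambda>V\<in>Obj A. vm (F (vp V us)) ws) (src h)"
        using arg_cong[OF e, of "\<lambda>k. vm k ws"] gen_whisk(2,3) o t by (simp add: vm_comp)
    qed
  qed
  then show ?thesis using assms by blast
qed

definition sarr :: "('o, 'm) diagram \<Rightarrow> bool" where
  "sarr f \<longleftrightarrow> fst (snd f) \<noteq> None \<and> gen (sdom f) (fam f) (scod f)"

definition scomp :: "('o, 'm) diagram \<Rightarrow> ('o, 'm) diagram \<Rightarrow> ('o, 'm) diagram"  (infixr \<open>\<bullet>\<close> 67) where
  "g \<bullet> f = (sdom f, if sarr f \<and> sarr g \<and> sdom g = scod f then Some (\<lambda>V \<in> Obj A. fam g V \<cdot> fam f V) else None,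
     scod g)"

definition W :: "'o list \<Rightarrow> ('o, 'm) diagram \<Rightarrow> 'o list \<Rightarrow> ('o, 'm) diagram" where
  "W us f ws = (us @ sdom f @ ws,
     if sarr f \<and> set us \<subseteq> Obj A \<and> set ws \<subseteq> Obj A then Some (\<lambda>V \<in> Obj A. vm (fam f (vp V us)) ws) else None,
     us @ scod f @ ws)"

definition ide :: "'o list \<Rightarrow> ('o, 'm) diagram" where
  "ide xs = (xs, if set xs \<subseteq> Obj A then Some (\<lambda>V \<in> Obj A. Id A (vp V xs)) else None, xs)"

definition hat :: "'m \<Rightarrow> ('o, 'm) diagram" where
  "hat f = ([src f], if arr f then Some (\<lambda>V \<in> Obj A. Id A V \<boxtimes> f) else None, [tgt f])"

definition mm :: "'o \<Rightarrow> 'o \<Rightarrow> ('o, 'm) diagram" where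
  "mm X Y = ([X, Y], if X \<in> Obj A \<and> Y \<in> Obj A then Some (\<lambda>V \<in> Obj A. Assoc A V X Y) else None, [X \<star> Y])"

definition mi :: "'o \<Rightarrow> 'o \<Rightarrow> ('o, 'm) diagram" where
  "mi X Y = ([X \<star> Y], if X \<in> Obj A \<and> Y \<in> Obj A then Some (\<lambda>V \<in> Obj A. Assoc_inv A V X Y) else None, [X, Y])"

definition uu :: "('o, 'm) diagram" where
  "uu = ([], Some (\<lambda>V \<in> Obj A. Runit_inv A V), [Unit A])"

definition ui :: "('o, 'm) diagram" where
  "ui = ([Unit A], Some (\<lambda>V \<in> Obj A. Runit A V), [])"

lemma sdom_simps [simp]: "sdom (g \<bullet> f) = sdom f" "sdom (W us f ws) = us @ sdom f @ ws"
  "sdom (ide xs) = xs" "sdom (hat h) = [src h]" "sdom (mm X Y) = [X, Y]" "sdom (mi X Y) = [X \<star> Y]"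
  "sdom uu = []" "sdom ui = [Unit A]"
  by (simp_all add: sdom_def scomp_def W_def ide_def hat_def mm_def mi_def uu_def ui_def)

lemma scod_simps [simp]: "scod (g \<bullet> f) = scod g" "scod (W us f ws) = us @ scod f @ ws"
  "scod (ide xs) = xs" "scod (hat h) = [tgt h]" "scod (mm X Y) = [X \<star> Y]" "scod (mi X Y) = [X, Y]"
  "scod uu = [Unit A]" "scod ui = []"
  by (simp_all add: scod_def scomp_def W_def ide_def hat_def mm_def mi_def uu_def ui_def)

lemma fam_simps [simp]:
  "sarr f \<Longrightarrow> sarr g \<Longrightarrow> sdom g = scod f \<Longrightarrow> V \<in> Obj A \<Longrightarrow> fam (g \<bullet> f) V = fam g V \<cdot> fam f V"
  "sarr f \<Longrightarrow> set us \<subseteq> Obj A \<Longrightarrow> set ws \<subseteq> Obj A \<Longrightarrow> V \<in> Obj A \<Longrightarrow> fam (W us f ws) V = vm (fam f (vp V us)) ws"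
  "set xs \<subseteq> Obj A \<Longrightarrow> V \<in> Obj A \<Longrightarrow> fam (ide xs) V = Id A (vp V xs)"
  "arr h \<Longrightarrow> V \<in> Obj A \<Longrightarrow> fam (hat h) V = Id A V \<boxtimes> h"
  "X \<in> Obj A \<Longrightarrow> Y \<in> Obj A \<Longrightarrow> V \<in> Obj A \<Longrightarrow> fam (mm X Y) V = Assoc A V X Y"
  "X \<in> Obj A \<Longrightarrow> Y \<in> Obj A \<Longrightarrow> V \<in> Obj A \<Longrightarrow> fam (mi X Y) V = Assoc_inv A V X Y"
  "V \<in> Obj A \<Longrightarrow> fam uu V = Runit_inv A V" "V \<in> Obj A \<Longrightarrow> fam ui V = Runit A V"
  by (simp_all add: fam_def scomp_def W_def ide_def hat_def mm_def mi_def uu_def ui_def)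

lemma sarr_objs [simp]: "sarr f \<Longrightarrow> set (sdom f) \<subseteq> Obj A" "sarr f \<Longrightarrow> set (scod f) \<subseteq> Obj A"
  using gen_objs unfolding sarr_def by blast+

lemma sarr_fam [simp]: "sarr f \<Longrightarrow> V \<in> Obj A \<Longrightarrow> arr (fam f V)"
  "sarr f \<Longrightarrow> V \<in> Obj A \<Longrightarrow> src (fam f V) = vp V (sdom f)"
  "sarr f \<Longrightarrow> V \<in> Obj A \<Longrightarrow> tgt (fam f V) = vp V (scod f)"
  using gen_typing unfolding sarr_def by blast+

lemma sarr_natural: "sarr f \<Longrightarrow> arr h \<Longrightarrow> fam f (tgt h) \<cdot> vm h (sdom f) = vm h (scod f) \<cdot> fam f (src h)"
  using gen_natural unfolding sarr_def by blast

lemma sarr_comp [simp]: "sarr (g \<bullet> f) \<longleftrightarrow> sarr g \<and> sarr f \<and> sdom g = scod f"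
  by (auto simp: sarr_def scomp_def sdom_def scod_def fam_def intro: gen_comp)

lemma sarr_W [simp]: "sarr (W us f ws) \<longleftrightarrow> sarr f \<and> set us \<subseteq> Obj A \<and> set ws \<subseteq> Obj A"
  by (auto simp: sarr_def W_def sdom_def scod_def fam_def intro: gen_whisk)

lemma sarr_simps [simp]: "sarr (ide xs) \<longleftrightarrow> set xs \<subseteq> Obj A" "sarr (hat h) \<longleftrightarrow> arr h"
  "sarr (mm X Y) \<longleftrightarrow> X \<in> Obj A \<and> Y \<in> Obj A" "sarr (mi X Y) \<longleftrightarrow> X \<in> Obj A \<and> Y \<in> Obj A" "sarr uu" "sarr ui"
  by (auto simp: sarr_def ide_def hat_def mm_def mi_def uu_def ui_def sdom_def scod_def fam_def intro: gen.intros)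

text \<open>
  Compositions and whiskerings have this property even when their parts do not fit together, so equality of diagrams
  can be tested on components.
\<close>

definition sane :: "('o, 'm) diagram \<Rightarrow> bool" where
  "sane f \<longleftrightarrow> fst (snd f) = None \<or> sarr f"

lemma sane_simps [simp]: "sarr f \<Longrightarrow> sane f" "sane (g \<bullet> f)" "sane (W us h ws)" "sane (ide xs)"
proof -
  show "sane (g \<bullet> f)" "sane (W us h ws)" "sane (ide xs)"
    unfolding sane_def by (auto simp: scomp_def[of g f] W_def[of us h ws] ide_def[of xs] sarr_comp[of g f, unfolded scomp_def]
      sarr_W[of us h ws, unfolded W_def] sarr_simps(1)[of xs, unfolded ide_def])
qed (simp add: sane_def)

lemma sarr_objD [simp]: "x \<in> set (sdom f) \<Longrightarrow> sarr f \<Longrightarrow> x \<in> Obj A" "x \<in> set (scod f) \<Longrightarrow> sarr f \<Longrightarrow> x \<in> Obj A"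
  using sarr_objs by blast+

lemma diagram_eqI:
  assumes "sdom f = sdom g" "scod f = scod g" "sarr f \<longleftrightarrow> sarr g" "sane f" "sane g"
    "\<And>V. sarr f \<Longrightarrow> sarr g \<Longrightarrow> V \<in> Obj A \<Longrightarrow> fam f V = fam g V"
  shows "f = g"
proof (cases "sarr f")
  case True
  then have "sarr g" using assms by simp
  have "fam f = fam g"
    using gen_objs[of "sdom f" "fam f" "scod f"] gen_objs[of "sdom g" "fam g" "scod g"] True \<open>sarr g\<close> assms(6)
    unfolding sarr_def by (intro extensionalityI) auto
  then show ?thesis using assms True \<open>sarr g\<close>
    by (auto simp: sdom_def scod_def fam_def sarr_def prod_eq_iff)
next
  case False
  then have "fst (snd f) = None" "fst (snd g) = None" using assms unfolding sane_def by auto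
  then show ?thesis using assms by (auto simp: sdom_def scod_def prod_eq_iff)
qed

lemma comp_s_assoc [simp]: "(h \<bullet> g) \<bullet> f = h \<bullet> (g \<bullet> f)"
  by (rule diagram_eqI) auto

lemma W_comp: "W us (g \<bullet> f) ws = W us g ws \<bullet> W us f ws"
  by (rule diagram_eqI) (auto simp: vm_comp)

lemma W_W [simp]: "W us (W us' f ws') ws = W (us @ us') f (ws' @ ws)"
  by (rule diagram_eqI) auto

lemma W_ide [simp]: "W us (ide xs) ws = ide (us @ xs @ ws)"
  by (rule diagram_eqI) auto

lemma W_Nil: "sarr f \<Longrightarrow> W [] f [] = f"
  by (rule diagram_eqI) auto

lemma ide_comp [simp]: "sarr f \<Longrightarrow> scod f = xs \<Longrightarrow> ide xs \<bullet> f = f"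
  by (rule diagram_eqI) auto

lemma comp_ide [simp]: "sarr f \<Longrightarrow> sdom f = xs \<Longrightarrow> f \<bullet> ide xs = f"
  by (rule diagram_eqI) auto

text \<open>
  Boxes that act on disjoint groups of strands commute: the family of the right box is natural in the object on its
  left, and the left box is a morphism there.
\<close>

lemma interchange_s:
  assumes "sarr f" "sarr g"
  shows "W (us @ scod f @ vs) g ws \<bullet> W us f (vs @ sdom g @ ws) = W us f (vs @ scod g @ ws) \<bullet> W (us @ sdom f @ vs) g ws"
proof (cases "set us \<subseteq> Obj A \<and> set vs \<subseteq> Obj A \<and> set ws \<subseteq> Obj A")
  case True
  show ?thesis
  proof (rule diagram_eqI)
    fix V assume V [simp]: "V \<in> Obj A"
    let ?k = "vm (fam f (vp V us)) vs"
    have k: "arr ?k" "src ?k = vp (vp (vp V us) (sdom f)) vs" "tgt ?k = vp (vp (vp V us) (scod f)) vs"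
      using True assms by auto
    have "vm (fam g (tgt ?k) \<cdot> vm ?k (sdom g)) ws = vm (vm ?k (scod g) \<cdot> fam g (src ?k)) ws"
      using sarr_natural[OF assms(2), of ?k] k by simp
    then show "fam (W (us @ scod f @ vs) g ws \<bullet> W us f (vs @ sdom g @ ws)) V
        = fam (W us f (vs @ scod g @ ws) \<bullet> W (us @ sdom f @ vs) g ws) V"
      using True assms k by (simp add: vm_comp)
  qed (use True assms in auto)
next
  case False
  then show ?thesis by (intro diagram_eqI) auto
qed

text \<open>
  The component at the unit object recovers the morphism, so equations may be checked between diagrams.
\<close>

lemma hat_faithful:
  assumes "arr f" "arr g" "hat f = hat g"
  shows "f = g"
proof -
  have "src f = src g" "tgt f = tgt g" using arg_cong[OF assms(3), of sdom] arg_cong[OF assms(3), of scod] by auto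
  moreover have "Id A (Unit A) \<boxtimes> f = Id A (Unit A) \<boxtimes> g"
    using arg_cong[OF assms(3), of "\<lambda>f. fam f (Unit A)"] assms(1,2) by simp
  ultimately show ?thesis using unit_ten_faithful assms(1,2) by blast
qed

lemma mm_mi: "X \<in> Obj A \<Longrightarrow> Y \<in> Obj A \<Longrightarrow> mm X Y \<bullet> mi X Y = ide [X \<star> Y]"
  "X \<in> Obj A \<Longrightarrow> Y \<in> Obj A \<Longrightarrow> mi X Y \<bullet> mm X Y = ide [X, Y]"
  "uu \<bullet> ui = ide [Unit A]" "ui \<bullet> uu = ide []"
  by (rule diagram_eqI; auto)+

lemma hat_comp: "arr f \<Longrightarrow> arr g \<Longrightarrow> src g = tgt f \<Longrightarrow> hat (g \<cdot> f) = hat g \<bullet> hat f"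
  by (rule diagram_eqI) (auto simp: ten_comp_left)

lemma hat_ten:
  assumes "arr f" "arr g"
  shows "hat (f \<boxtimes> g) = mm (tgt f) (tgt g) \<bullet> W [] (hat f) [tgt g] \<bullet> W [src f] (hat g) [] \<bullet> mi (src f) (src g)"
proof -
  have "hat (f \<boxtimes> g) \<bullet> mm (src f) (src g) = mm (tgt f) (tgt g) \<bullet> W [] (hat f) [tgt g] \<bullet> W [src f] (hat g) []"
    (is "?l = ?r")
  proof (rule diagram_eqI)
    fix V assume V [simp]: "V \<in> Obj A"
    have "((Id A V \<boxtimes> f) \<boxtimes> Id A (tgt g)) \<cdot> (Id A (V \<star> src f) \<boxtimes> g) = (Id A V \<boxtimes> f) \<boxtimes> g"
      using assms by (simp flip: ten_comp)
    then show "fam ?l V = fam ?r V" using assms assoc_nat[of "Id A V" f g] by simp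
  qed (use assms in auto)
  from arg_cong[OF this, of "\<lambda>t. t \<bullet> mi (src f) (src g)"] show ?thesis
    using assms by (simp add: mm_mi)
qed

text \<open>
  In the strict model the associator only regroups strands: split twice, fuse twice.  This is the pentagon axiom.
\<close>

lemma hat_Assoc:
  assumes [simp]: "X \<in> Obj A" "Y \<in> Obj A" "Z \<in> Obj A"
  shows "hat (Assoc A X Y Z) = mm X (Y \<star> Z) \<bullet> W [X] (mm Y Z) [] \<bullet> W [] (mi X Y) [Z] \<bullet> mi (X \<star> Y) Z"
proof -
  have "hat (Assoc A X Y Z) \<bullet> mm (X \<star> Y) Z \<bullet> W [] (mm X Y) [Z] = mm X (Y \<star> Z) \<bullet> W [X] (mm Y Z) []"
    (is "?l = ?r")
    by (rule diagram_eqI) (auto simp: pentagon)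
  from arg_cong[OF this, of "\<lambda>t. t \<bullet> W [] (mi X Y) [Z] \<bullet> mi (X \<star> Y) Z"]
  have "hat (Assoc A X Y Z) \<bullet> mm (X \<star> Y) Z \<bullet> (W [] (mm X Y) [Z] \<bullet> W [] (mi X Y) [Z]) \<bullet> mi (X \<star> Y) Z
    = mm X (Y \<star> Z) \<bullet> W [X] (mm Y Z) [] \<bullet> W [] (mi X Y) [Z] \<bullet> mi (X \<star> Y) Z" by simp
  then show ?thesis unfolding W_comp[symmetric] by (simp add: mm_mi)
qed

lemma hat_Lunit: "X \<in> Obj A \<Longrightarrow> hat (Lunit A X) = W [] ui [X] \<bullet> mi (Unit A) X"
proof -
  assume [simp]: "X \<in> Obj A"
  have "hat (Lunit A X) \<bullet> mm (Unit A) X = W [] ui [X]"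
    by (rule diagram_eqI) (auto simp: triangle)
  from arg_cong[OF this, of "\<lambda>t. t \<bullet> mi (Unit A) X"] show ?thesis by (simp add: mm_mi)
qed

lemma hat_Runit: "X \<in> Obj A \<Longrightarrow> hat (Runit A X) = W [X] ui [] \<bullet> mi X (Unit A)"
proof -
  assume [simp]: "X \<in> Obj A"
  have "hat (Runit A X) \<bullet> mm X (Unit A) = W [X] ui []"
    by (rule diagram_eqI) (auto simp: runit_ten)
  from arg_cong[OF this, of "\<lambda>t. t \<bullet> mi X (Unit A)"] show ?thesis by (simp add: mm_mi)
qed

lemma s_inverse_unique:
  assumes "sarr f" "sarr g" "sarr h" "sdom g = scod f" "sdom f = scod g" "sdom h = scod f" "sdom f = scod h"
    "g \<bullet> f = ide (sdom f)" "f \<bullet> h = ide (scod f)"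
  shows "g = h"
proof -
  have "g = g \<bullet> (f \<bullet> h)" using assms by simp
  also have "\<dots> = (g \<bullet> f) \<bullet> h" by simp
  also have "\<dots> = h" unfolding assms(8) using assms by simp
  finally show ?thesis .
qed

lemma hat_Id: "X \<in> Obj A \<Longrightarrow> hat (Id A X) = ide [X]"
  by (rule diagram_eqI) (auto simp: ten_id)

section \<open>Reading diagrams off morphisms\<close>

lemma W_cong_rest: "f = h \<Longrightarrow> W us f ws \<bullet> t = W us h ws \<bullet> t" and W_cong: "f = h \<Longrightarrow> W us f ws = W us h ws"
  by simp_all

text \<open>
  An equation between diagrams is needed next to further strands and in the middle of longer composites.
  Instantiated with an equation and simplified, these rules give rewrite rules for all such positions with at
  most three strands on the left.
\<close>

lemmas ctx_rules = W_cong_rest[where us = "[]"] W_cong_rest[where us = "[P]" for P]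
  W_cong_rest[where us = "[P, P']" for P P'] W_cong_rest[where us = "[P, P', P'']" for P P' P'']
  W_cong[where us = "[]"] W_cong[where us = "[P]" for P]
  W_cong[where us = "[P, P']" for P P'] W_cong[where us = "[P, P', P'']" for P P' P'']

lemmas ctx_simps = W_comp W_W comp_s_assoc W_ide append.simps append_Nil2

declare W_comp [simp]
lemmas [simp] = ctx_rules[OF mm_mi(1), simplified ctx_simps] ctx_rules[OF mm_mi(2), simplified ctx_simps]
  ctx_rules[OF mm_mi(3), simplified ctx_simps] ctx_rules[OF mm_mi(4), simplified ctx_simps]
lemmas [simp] = mm_mi

text \<open>
  An orientation of the interchange law for the simplifier: boxes further to the left are applied last.
\<close>

lemma interchange_rule:
  assumes "length us + length (scod f) \<le> length us'" "take (length us + length (scod f)) us' = us @ scod f"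
    "ws' = drop (length us + length (scod f)) us' @ sdom g @ ws" "sarr f" "sarr g"
  shows "W us' g ws \<bullet> W us f ws' = W us f (drop (length us + length (scod f)) us' @ scod g @ ws) \<bullet> W (us @ sdom f @ drop (length us + length (scod f)) us') g ws"
    "W us' g ws \<bullet> W us f ws' \<bullet> t = W us f (drop (length us + length (scod f)) us' @ scod g @ ws) \<bullet> W (us @ sdom f @ drop (length us + length (scod f)) us') g ws \<bullet> t"
proof -
  have "us' = us @ scod f @ drop (length us + length (scod f)) us'"
    using assms(2) append_take_drop_id[of "length us + length (scod f)" us'] by simp
  then show *: "W us' g ws \<bullet> W us f ws' = W us f (drop (length us + length (scod f)) us' @ scod g @ ws) \<bullet> W (us @ sdom f @ drop (length us + length (scod f)) us') g ws"
    using interchange_s[OF assms(4,5), of us "drop (length us + length (scod f)) us'" ws] assms(3) by metis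
  from arg_cong[OF *, of "\<lambda>s. s \<bullet> t"]
  show "W us' g ws \<bullet> W us f ws' \<bullet> t = W us f (drop (length us + length (scod f)) us' @ scod g @ ws) \<bullet> W (us @ sdom f @ drop (length us + length (scod f)) us') g ws \<bullet> t"
    by simp
qed

text \<open>
  The calculus \<open>rep\<close> computes the diagram of a morphism expression step by step; two morphisms are equal
  as soon as their diagrams are (\<open>rep_eqI\<close>).
\<close>

definition rep :: "'m \<Rightarrow> ('o, 'm) diagram \<Rightarrow> bool" where
  "rep f F \<longleftrightarrow> arr f \<and> hat f = F"

lemma rep_hat: "arr f \<Longrightarrow> rep f (hat f)" by (simp add: rep_def)

lemma rep_comp: "rep g G \<Longrightarrow> rep f F \<Longrightarrow> sdom G = scod F \<Longrightarrow> rep (g \<cdot> f) (G \<bullet> F)"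
  unfolding rep_def by (auto simp: hat_comp)

lemma rep_ten: "rep f F \<Longrightarrow> rep g G \<Longrightarrow> sdom F = [X] \<Longrightarrow> scod F = [X'] \<Longrightarrow> sdom G = [Y] \<Longrightarrow> scod G = [Y'] \<Longrightarrow>
    rep (f \<boxtimes> g) (mm X' Y' \<bullet> W [] F [Y'] \<bullet> W [X] G [] \<bullet> mi X Y)"
  unfolding rep_def by (auto simp: hat_ten)

lemma rep_Id: "X \<in> Obj A \<Longrightarrow> rep (Id A X) (ide [X])"
  by (simp add: rep_def hat_Id)

lemma rep_elim: "f = g \<Longrightarrow> rep f F \<Longrightarrow> rep g G \<Longrightarrow> (F = G \<Longrightarrow> P) \<Longrightarrow> P"
  by (simp add: rep_def)

lemma rep_eqI: "rep f F \<Longrightarrow> rep g G \<Longrightarrow> W [] F [] = W [] G [] \<Longrightarrow> f = g"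
  using hat_faithful unfolding rep_def by (auto simp: W_Nil)

lemma rep_inv_mor:
  assumes "is_iso A X Y f" "rep f F" "sarr G" "sdom G = [Y]" "scod G = [X]" "F \<bullet> G = ide [Y]"
  shows "rep (inv_mor A X Y f) G"
proof -
  note i = iso_facts[OF assms(1)]
  have o: "X \<in> Obj A" "Y \<in> Obj A" using i src_closed tgt_closed by metis+
  have F: "F = hat f" "sarr F" using assms(2) i by (auto simp: rep_def)
  have "hat (inv_mor A X Y f) = G"
  proof (rule s_inverse_unique[of F])
    have "hat (inv_mor A X Y f \<cdot> f) = hat (Id A X)" using i by simp
    then show "hat (inv_mor A X Y f) \<bullet> F = ide (sdom F)" using i(1-7) o by (simp add: hat_comp F hat_Id)
  qed (use assms i F in auto)
  then show ?thesis using i by (simp add: rep_def)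
qed

lemma rep_Assoc: "X \<in> Obj A \<Longrightarrow> Y \<in> Obj A \<Longrightarrow> Z \<in> Obj A \<Longrightarrow>
    rep (Assoc A X Y Z) (mm X (Y \<star> Z) \<bullet> W [X] (mm Y Z) [] \<bullet> W [] (mi X Y) [Z] \<bullet> mi (X \<star> Y) Z)"
  by (simp add: rep_def hat_Assoc)

lemma cancel_atoms [simp]: "X \<in> Obj A \<Longrightarrow> Y \<in> Obj A \<Longrightarrow> mm X Y \<bullet> mi X Y \<bullet> t = ide [X \<star> Y] \<bullet> t"
  "X \<in> Obj A \<Longrightarrow> Y \<in> Obj A \<Longrightarrow> mi X Y \<bullet> mm X Y \<bullet> t = ide [X, Y] \<bullet> t"
  "uu \<bullet> ui \<bullet> t = ide [Unit A] \<bullet> t" "ui \<bullet> uu \<bullet> t = ide [] \<bullet> t"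
  by (simp_all only: comp_s_assoc[symmetric] mm_mi)

lemma rep_Assoc_inv: "X \<in> Obj A \<Longrightarrow> Y \<in> Obj A \<Longrightarrow> Z \<in> Obj A \<Longrightarrow>
    rep (Assoc_inv A X Y Z) (mm (X \<star> Y) Z \<bullet> W [] (mm X Y) [Z] \<bullet> W [X] (mi Y Z) [] \<bullet> mi X (Y \<star> Z))"
  by (rule rep_inv_mor[OF assoc_iso rep_Assoc]) auto

lemma rep_Lunit: "X \<in> Obj A \<Longrightarrow> rep (Lunit A X) (W [] ui [X] \<bullet> mi (Unit A) X)"
  by (simp add: rep_def hat_Lunit)

lemma rep_Runit: "X \<in> Obj A \<Longrightarrow> rep (Runit A X) (W [X] ui [] \<bullet> mi X (Unit A))"
  by (simp add: rep_def hat_Runit)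

lemma rep_Lunit_inv: "X \<in> Obj A \<Longrightarrow> rep (Lunit_inv A X) (mm (Unit A) X \<bullet> W [] uu [X])"
  by (rule rep_inv_mor[OF lunit_iso rep_Lunit]) auto

lemma rep_Runit_inv: "X \<in> Obj A \<Longrightarrow> rep (Runit_inv A X) (mm X (Unit A) \<bullet> W [X] uu [])"
  by (rule rep_inv_mor[OF runit_iso rep_Runit]) auto

lemmas reps = rep_comp rep_ten rep_Id rep_Assoc rep_Assoc_inv rep_Lunit rep_Runit rep_Lunit_inv rep_Runit_inv

text \<open>
  In the strict model the axioms of a left dual become the two zigzag identities.
\<close>

lemma dual_strict:
  assumes "is_left_dual A X D e d"
  defines "ev \<equiv> ui \<bullet> hat e \<bullet> mm D X" and "coev \<equiv> mi X D \<bullet> hat d \<bullet> uu"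
  shows "X \<in> Obj A" "D \<in> Obj A" "sarr ev" "sdom ev = [D, X]" "scod ev = []" "sarr coev" "sdom coev = []" "scod coev = [X, D]"
    "rep e (uu \<bullet> ev \<bullet> mi D X)" "rep d (mm X D \<bullet> coev \<bullet> ui)"
    "W [X] ev [] \<bullet> W [] coev [X] = ide [X]" "W [] ev [D] \<bullet> W [D] coev [] = ide [D]"
proof -
  note l = assms(1)[unfolded is_left_dual_def]
  show [simp]: "X \<in> Obj A" "D \<in> Obj A" using l by auto
  have [simp]: "arr e" "src e = D \<star> X" "tgt e = Unit A" "arr d" "src d = Unit A" "tgt d = X \<star> D"
    using l by (auto simp: Mor_iff)
  show [simp]: "sarr ev" "sdom ev = [D, X]" "scod ev = []" "sarr coev" "sdom coev = []" "scod coev = [X, D]"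
    by (auto simp: ev_def coev_def)
  show e: "rep e (uu \<bullet> ev \<bullet> mi D X)" and d: "rep d (mm X D \<bullet> coev \<bullet> ui)"
    by (auto simp: ev_def coev_def rep_def)
  have z1: "Runit A X \<cdot> (Id A X \<boxtimes> e) \<cdot> Assoc A X D X \<cdot> (d \<boxtimes> Id A X) \<cdot> Lunit_inv A X = Id A X"
    and z2: "Lunit A D \<cdot> (e \<boxtimes> Id A D) \<cdot> Assoc_inv A D X D \<cdot> (Id A D \<boxtimes> d) \<cdot> Runit_inv A D = Id A D"
    using l by auto
  show "W [X] ev [] \<bullet> W [] coev [X] = ide [X]"
    by (rule rep_elim[OF z1], (rule reps e d | (simp; fail))+)
  show "W [] ev [D] \<bullet> W [D] coev [] = ide [D]"
    by (rule rep_elim[OF z2], (rule reps e d | (simp; fail))+)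
qed

abbreviation ZO where "ZO \<equiv> Obj (centre A)"

text \<open>
  The component \<open>\<gamma>\<^sub>B\<close> of a half-braiding as a crossing of the two strands \<open>[B, X]\<close>, and its inverse \<open>si\<close>.
\<close>

definition sb :: "('o, 'm) centre_obj \<Rightarrow> 'o \<Rightarrow> ('o, 'm) diagram" where
  "sb V B = mi (fst V) B \<bullet> hat (snd V B) \<bullet> mm B (fst V)"

definition si :: "('o, 'm) centre_obj \<Rightarrow> 'o \<Rightarrow> ('o, 'm) diagram" where
  "si V B = mi B (fst V) \<bullet> hat (inv_mor A (B \<star> fst V) (fst V \<star> B) (snd V B)) \<bullet> mm (fst V) B"

lemma ZO_iff: "V \<in> ZO \<longleftrightarrow> fst V \<in> Obj A \<and> is_half_braiding A (fst V) (snd V)"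
  by (auto simp: centre_def)

lemma ZO_fst [simp]: "V \<in> ZO \<Longrightarrow> fst V \<in> Obj A"
  by (simp add: ZO_iff)

lemma ZO_iso: "V \<in> ZO \<Longrightarrow> B \<in> Obj A \<Longrightarrow> is_iso A (B \<star> fst V) (fst V \<star> B) (snd V B)"
  by (simp add: ZO_iff is_half_braiding_def)

lemmas ZO_facts [simp] = iso_facts[OF ZO_iso]

lemma sb_typing [simp]: "sdom (sb V B) = [B, fst V]" "scod (sb V B) = [fst V, B]"
  "sdom (si V B) = [fst V, B]" "scod (si V B) = [B, fst V]"
  "V \<in> ZO \<Longrightarrow> B \<in> Obj A \<Longrightarrow> sarr (sb V B)" "V \<in> ZO \<Longrightarrow> B \<in> Obj A \<Longrightarrow> sarr (si V B)"
  by (simp_all add: sb_def si_def)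

lemma rep_sb: "V \<in> ZO \<Longrightarrow> B \<in> Obj A \<Longrightarrow> rep (snd V B) (mm (fst V) B \<bullet> sb V B \<bullet> mi B (fst V))"
  by (simp add: rep_def sb_def)

lemma rep_si: "V \<in> ZO \<Longrightarrow> B \<in> Obj A \<Longrightarrow>
    rep (inv_mor A (B \<star> fst V) (fst V \<star> B) (snd V B)) (mm B (fst V) \<bullet> si V B \<bullet> mi (fst V) B)"
  by (simp add: rep_def si_def)

lemma sb_si: "V \<in> ZO \<Longrightarrow> B \<in> Obj A \<Longrightarrow> sb V B \<bullet> si V B = ide [fst V, B]"
proof -
  assume V [simp]: "V \<in> ZO" "B \<in> Obj A"
  have "snd V B \<cdot> inv_mor A (B \<star> fst V) (fst V \<star> B) (snd V B) = Id A (fst V \<star> B)" by simp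
  then have "hat (snd V B) \<bullet> hat (inv_mor A (B \<star> fst V) (fst V \<star> B) (snd V B)) = ide [fst V \<star> B]"
    by (simp add: hat_Id flip: hat_comp)
  from arg_cong[OF this, of "\<lambda>s. s \<bullet> mm (fst V) B"] show ?thesis by (simp add: sb_def si_def)
qed

lemma si_sb: "V \<in> ZO \<Longrightarrow> B \<in> Obj A \<Longrightarrow> si V B \<bullet> sb V B = ide [B, fst V]"
proof -
  assume V [simp]: "V \<in> ZO" "B \<in> Obj A"
  have "inv_mor A (B \<star> fst V) (fst V \<star> B) (snd V B) \<cdot> snd V B = Id A (B \<star> fst V)" by simp
  then have "hat (inv_mor A (B \<star> fst V) (fst V \<star> B) (snd V B)) \<bullet> hat (snd V B) = ide [B \<star> fst V]"
    by (simp add: hat_Id flip: hat_comp)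
  from arg_cong[OF this, of "\<lambda>s. s \<bullet> mm B (fst V)"] show ?thesis by (simp add: sb_def si_def)
qed

lemmas [simp] = ctx_rules[OF sb_si, simplified ctx_simps] ctx_rules[OF si_sb, simplified ctx_simps]
lemmas [simp] = sb_si si_sb

lemma cancel_sb [simp]: "V \<in> ZO \<Longrightarrow> B \<in> Obj A \<Longrightarrow> sb V B \<bullet> si V B \<bullet> t = ide [fst V, B] \<bullet> t"
  "V \<in> ZO \<Longrightarrow> B \<in> Obj A \<Longrightarrow> si V B \<bullet> sb V B \<bullet> t = ide [B, fst V] \<bullet> t"
  by (simp_all only: comp_s_assoc[symmetric] sb_si si_sb)

lemma slide_hat:
  assumes [simp]: "V \<in> ZO" "arr f"
  shows "sb V (tgt f) \<bullet> W [] (hat f) [fst V] = W [fst V] (hat f) [] \<bullet> sb V (src f)"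
proof -
  have e: "snd V (tgt f) \<cdot> (f \<boxtimes> Id A (fst V)) = (Id A (fst V) \<boxtimes> f) \<cdot> snd V (src f)"
    using assms arr_Mor[of f] by (simp add: ZO_iff is_half_braiding_def)
  show ?thesis
    by (rule rep_elim[OF e], (rule reps rep_sb rep_hat | (simp; fail))+)
      (drule arg_cong[where f = "\<lambda>s. mi (fst V) (tgt f) \<bullet> s \<bullet> mm (src f) (fst V)"], simp)
qed

lemma slide_mm:
  assumes [simp]: "V \<in> ZO" "B \<in> Obj A" "B' \<in> Obj A"
  shows "sb V (B \<star> B') \<bullet> W [] (mm B B') [fst V] = W [fst V] (mm B B') [] \<bullet> W [] (sb V B) [B'] \<bullet> W [B] (sb V B') []"
proof -
  have e: "snd V (B \<star> B') = Assoc A (fst V) B B' \<cdot> (snd V B \<boxtimes> Id A B') \<cdot> Assoc_inv A B (fst V) B' \<cdot> (Id A B \<boxtimes> snd V B') \<cdot> Assoc A B B' (fst V)"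
    using assms(1)[unfolded ZO_iff is_half_braiding_def] by simp
  show ?thesis
    by (rule rep_elim[OF e], (rule reps rep_sb | (simp; fail))+)
      (drule arg_cong[where f = "\<lambda>s. mi (fst V) (B \<star> B') \<bullet> s \<bullet> mm (B \<star> B') (fst V) \<bullet> W [] (mm B B') [fst V]"], simp)
qed

text \<open>
  Sliding past single morphisms is naturality, and sliding past the fusion of two strands is multiplicativity.
\<close>

lemma ZO_I:
  assumes "fst V \<in> Obj A" "snd V \<in> extensional (Obj A)"
    and "\<And>B. B \<in> Obj A \<Longrightarrow> rep (snd V B) (mm (fst V) B \<bullet> h B \<bullet> mi B (fst V))"
    and "\<And>B. B \<in> Obj A \<Longrightarrow> sarr (h B) \<and> sdom (h B) = [B, fst V] \<and> scod (h B) = [fst V, B]"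
    and "\<And>B. B \<in> Obj A \<Longrightarrow> is_iso A (B \<star> fst V) (fst V \<star> B) (snd V B)"
    and hat: "\<And>f. arr f \<Longrightarrow> h (tgt f) \<bullet> W [] (hat f) [fst V] = W [fst V] (hat f) [] \<bullet> h (src f)"
    and mm: "\<And>B B'. B \<in> Obj A \<Longrightarrow> B' \<in> Obj A \<Longrightarrow> h (B \<star> B') \<bullet> W [] (mm B B') [fst V]
      = W [fst V] (mm B B') [] \<bullet> W [] (h B) [B'] \<bullet> W [B] (h B') []"
  shows "V \<in> ZO" "\<And>B. B \<in> Obj A \<Longrightarrow> sb V B = h B"
proof -
  note [simp] = assms(1)
  have h [simp]: "\<And>B. B \<in> Obj A \<Longrightarrow> sarr (h B)" "\<And>B. B \<in> Obj A \<Longrightarrow> sdom (h B) = [B, fst V]"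
    "\<And>B. B \<in> Obj A \<Longrightarrow> scod (h B) = [fst V, B]"
    using assms(4) by blast+
  show "V \<in> ZO"
    unfolding ZO_iff is_half_braiding_def
  proof (intro conjI ballI)
    fix B B' f assume o: "B \<in> Obj A" "B' \<in> Obj A" "f \<in> Mor A B B'"
    then have f: "arr f" "src f = B" "tgt f = B'" by (auto simp: Mor_iff)
    note hf = hat[OF f(1), unfolded f]
    show "snd V B' \<cdot> (f \<boxtimes> Id A (fst V)) = (Id A (fst V) \<boxtimes> f) \<cdot> snd V B"
      by (rule rep_eqI, (rule reps assms(3) rep_hat | (use o f in \<open>simp; fail\<close>))+)
        (use o f ctx_rules[OF hf, simplified ctx_simps] in simp)
  next
    fix B B' assume o [simp]: "B \<in> Obj A" "B' \<in> Obj A"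
    have *: "h (B \<star> B') = W [fst V] (mm B B') [] \<bullet> W [] (h B) [B'] \<bullet> W [B] (h B') [] \<bullet> W [] (mi B B') [fst V]"
      using arg_cong[OF mm[OF o], of "\<lambda>s. s \<bullet> W [] (mi B B') [fst V]"] by simp
    show "snd V (B \<star> B') = Assoc A (fst V) B B' \<cdot> (snd V B \<boxtimes> Id A B') \<cdot> Assoc_inv A B (fst V) B' \<cdot> (Id A B \<boxtimes> snd V B') \<cdot> Assoc A B B' (fst V)"
      by (rule rep_eqI, (rule reps assms(3) | (simp; fail))+) (simp add: *)
  qed (use assms in auto)
  fix B assume [simp]: "B \<in> Obj A"
  show "sb V B = h B" unfolding sb_def using assms(3)[of B] by (simp add: rep_def)
qed

section \<open>Sliding diagrams past a half-braiding\<close>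

lemma diagram_induct [consumes 1, case_names hat mm mi uu ui ide comp W]:
  assumes "sarr f"
    and "\<And>h. arr h \<Longrightarrow> P (hat h)"
    and "\<And>X Y. X \<in> Obj A \<Longrightarrow> Y \<in> Obj A \<Longrightarrow> P (mm X Y)"
    and "\<And>X Y. X \<in> Obj A \<Longrightarrow> Y \<in> Obj A \<Longrightarrow> P (mi X Y)"
    and "P uu" "P ui"
    and "\<And>xs. set xs \<subseteq> Obj A \<Longrightarrow> P (ide xs)"
    and "\<And>f g. sarr f \<Longrightarrow> sarr g \<Longrightarrow> sdom g = scod f \<Longrightarrow> P f \<Longrightarrow> P g \<Longrightarrow> P (g \<bullet> f)"
    and "\<And>f us ws. sarr f \<Longrightarrow> set us \<subseteq> Obj A \<Longrightarrow> set ws \<subseteq> Obj A \<Longrightarrow> P f \<Longrightarrow> P (W us f ws)"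
  shows "P f"
proof -
  have *: "P (xs, Some F, ys)" if "gen xs F ys" for xs F ys
    using that
  proof (induction rule: gen.induct)
    case (gen_comp xs F ys G zs)
    then have "sarr (xs, Some F, ys)" "sarr (ys, Some G, zs)"
      by (auto simp: sarr_def sdom_def scod_def fam_def)
    with assms(8)[OF this] gen_comp show ?case by (simp add: scomp_def) (simp add: fam_def sdom_def scod_def restrict_def)
  next
    case (gen_whisk xs F ys us ws)
    then have "sarr (xs, Some F, ys)"
      by (auto simp: sarr_def sdom_def scod_def fam_def)
    with assms(9)[OF this] gen_whisk show ?case by (simp add: W_def) (simp add: fam_def sdom_def scod_def restrict_def)
  qed (use assms(2-7) in \<open>auto simp: hat_def mm_def mi_def uu_def ui_def ide_def restrict_def\<close>)
  obtain xs F ys where "f = (xs, F, ys)" by (cases f) auto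
  then show ?thesis using assms(1) * by (auto simp: sarr_def sdom_def scod_def fam_def)
qed

text \<open>
  The strand of \<open>V\<close> crosses a whole list of strands, one after the other.
\<close>

primrec sbl :: "('o, 'm) centre_obj \<Rightarrow> 'o list \<Rightarrow> ('o, 'm) diagram" where
  "sbl V [] = ide [fst V]"
| "sbl V (B # Bs) = W [] (sb V B) Bs \<bullet> W [B] (sbl V Bs) []"

primrec sil :: "('o, 'm) centre_obj \<Rightarrow> 'o list \<Rightarrow> ('o, 'm) diagram" where
  "sil V [] = ide [fst V]"
| "sil V (B # Bs) = W [B] (sil V Bs) [] \<bullet> W [] (si V B) Bs"

lemma sbl_typing [simp]: "sdom (sbl V xs) = xs @ [fst V]" "scod (sbl V xs) = [fst V] @ xs"
  "sdom (sil V xs) = [fst V] @ xs" "scod (sil V xs) = xs @ [fst V]"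
  "V \<in> ZO \<Longrightarrow> set xs \<subseteq> Obj A \<Longrightarrow> sarr (sbl V xs)" "V \<in> ZO \<Longrightarrow> set xs \<subseteq> Obj A \<Longrightarrow> sarr (sil V xs)"
  by (induction xs) auto

lemma sbl_append:
  assumes "V \<in> ZO" "set xs \<subseteq> Obj A" "set ys \<subseteq> Obj A"
  shows "sbl V (xs @ ys) = W [] (sbl V xs) ys \<bullet> W xs (sbl V ys) []"
  using assms by (induction xs) (auto simp: W_Nil)

lemma sbl_sil:
  assumes "V \<in> ZO" "set xs \<subseteq> Obj A"
  shows "sbl V xs \<bullet> sil V xs = ide (fst V # xs)" "sil V xs \<bullet> sbl V xs = ide (xs @ [fst V])"
proof -
  show "sbl V xs \<bullet> sil V xs = ide (fst V # xs)" using assms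
  proof (induction xs)
    case (Cons B Bs)
    have "W [B] (sbl V Bs) [] \<bullet> W [B] (sil V Bs) [] \<bullet> W [] (si V B) Bs = W [B] (sbl V Bs \<bullet> sil V Bs) [] \<bullet> W [] (si V B) Bs"
      by simp
    also have "\<dots> = W [] (si V B) Bs" using Cons by (simp del: W_comp)
    finally show ?case using Cons by simp
  qed simp
  show "sil V xs \<bullet> sbl V xs = ide (xs @ [fst V])" using assms
  proof (induction xs)
    case (Cons B Bs)
    have "W [B] (sil V Bs) [] \<bullet> W [B] (sbl V Bs) [] = W [B] (sil V Bs \<bullet> sbl V Bs) []"
      by simp
    also have "\<dots> = ide (B # Bs @ [fst V])" using Cons by (simp del: W_comp)
    finally show ?case using Cons by simp
  qed simp
qed

text \<open>
  A half-braiding is trivial at the unit.  Multiplicativity at \<open>\<one> \<star> \<one>\<close> makes the crossing with the unit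
  idempotent, and it is invertible.
\<close>

lemma slide_uu:
  assumes [simp]: "V \<in> ZO"
  shows "W [] (sb V (Unit A)) [] \<bullet> W [] uu [fst V] = W [fst V] uu []"
proof -
  let ?s = "W [] (sb V (Unit A)) [] \<bullet> W [] uu [fst V]"
  have h: "hat (Lunit A (Unit A)) = W [] ui [Unit A] \<bullet> mi (Unit A) (Unit A)" by (simp add: hat_Lunit)
  have "W [] ui [Unit A] = hat (Lunit A (Unit A)) \<bullet> mm (Unit A) (Unit A)"
    unfolding h by simp
  have e1: "W [] (sb V (Unit A)) [] \<bullet> W [] (hat (Lunit A (Unit A))) [fst V] = W [fst V] (hat (Lunit A (Unit A))) [] \<bullet> W [] (sb V (Unit A \<star> Unit A)) []"
    using ctx_rules(5)[OF slide_hat[of V "Lunit A (Unit A)"], of "[]", simplified ctx_simps] by simp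
  have e2: "W [] (sb V (Unit A \<star> Unit A)) [] \<bullet> W [] (mm (Unit A) (Unit A)) [fst V] = W [fst V] (mm (Unit A) (Unit A)) [] \<bullet> W [] (sb V (Unit A)) [Unit A] \<bullet> W [Unit A] (sb V (Unit A)) []"
    using ctx_rules(5)[OF slide_mm[of V "Unit A" "Unit A"], of "[]", simplified ctx_simps] by simp
  have "W [] (sb V (Unit A)) [] \<bullet> W [] ui [Unit A, fst V] = W [fst V] ui [Unit A] \<bullet> W [] (sb V (Unit A)) [Unit A] \<bullet> W [Unit A] (sb V (Unit A)) []"
    using arg_cong[OF e1, of "\<lambda>s. s \<bullet> W [] (mm (Unit A) (Unit A)) [fst V]"] by (simp add: h e2)
  from arg_cong[OF this, of "\<lambda>s. s \<bullet> W [Unit A] (si V (Unit A)) [] \<bullet> W [] uu [fst V, Unit A]"]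
  have e3: "W [] (sb V (Unit A)) [] \<bullet> W [] ui [Unit A, fst V] \<bullet> W [Unit A] (si V (Unit A)) [] \<bullet> W [] uu [fst V, Unit A]
    = W [fst V] ui [Unit A] \<bullet> W [] (sb V (Unit A)) [Unit A] \<bullet> W [] uu [fst V, Unit A]" by simp
  have i1: "W [Unit A] (si V (Unit A)) [] \<bullet> W [] uu [fst V, Unit A] = W [] uu [Unit A, fst V] \<bullet> W [] (si V (Unit A)) []"
    using interchange_s[of uu "si V (Unit A)" "[]" "[]" "[]"] by simp
  have "ide [fst V, Unit A] = W [fst V] ui [Unit A] \<bullet> W [] (sb V (Unit A)) [Unit A] \<bullet> W [] uu [fst V, Unit A]"
    using e3 by (simp add: i1)
  from arg_cong[OF this, of "\<lambda>s. W [fst V] ui [] \<bullet> s \<bullet> W [fst V] uu []"]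
  have "ide [fst V] = W [fst V] ui [] \<bullet> W [fst V] ui [Unit A] \<bullet> W [] (sb V (Unit A)) [Unit A] \<bullet> W [] uu [fst V, Unit A] \<bullet> W [fst V] uu []" by simp
  also have "\<dots> = W [fst V] ui [] \<bullet> ?s"
    using interchange_s[of uu uu "[]" "[fst V]" "[]"] interchange_s[of "sb V (Unit A)" uu "[]" "[]" "[]"] interchange_s[of ui uu "[fst V]" "[]" "[]"]
    by (simp add: interchange_rule)
  finally have f: "ide [fst V] = W [fst V] ui [] \<bullet> ?s" .
  have "W [fst V] uu [] = W [fst V] uu [] \<bullet> ide [fst V]" by simp
  also have "\<dots> = ?s" unfolding f by simp
  finally show ?thesis by simp
qed

text \<open>
  Any diagram can be pulled through the strand of \<open>V\<close>: for atoms this is naturality and multiplicativity of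
  the half-braiding, and the property is stable under composition and whiskering.
\<close>

theorem slide:
  assumes [simp]: "V \<in> ZO" and "sarr f"
  shows "sbl V (scod f) \<bullet> W [] f [fst V] = W [fst V] f [] \<bullet> sbl V (sdom f)"
  using assms(2)
proof (induction rule: diagram_induct)
  case (hat h)
  then show ?case using ctx_rules(5)[OF slide_hat[of V h], of "[]", simplified ctx_simps] by simp
next
  case (mm X Y)
  then show ?case using ctx_rules(5)[OF slide_mm[of V X Y], of "[]", simplified ctx_simps] by simp
next
  case (mi X Y)
  have "W [] (sb V (X \<star> Y)) [] \<bullet> W [] (mm X Y) [fst V] = W [fst V] (mm X Y) [] \<bullet> W [] (sb V X) [Y] \<bullet> W [X] (sb V Y) []"
    using ctx_rules(5)[OF slide_mm[of V X Y], of "[]", simplified ctx_simps] mi by simp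
  from arg_cong[OF this, of "\<lambda>s. W [fst V] (mi X Y) [] \<bullet> s \<bullet> W [] (mi X Y) [fst V]"] mi show ?case by simp
next
  case uu
  show ?case using slide_uu by simp
next
  case ui
  from arg_cong[OF slide_uu[OF assms(1)], of "\<lambda>s. W [fst V] ui [] \<bullet> s \<bullet> W [] ui [fst V]"]
  show ?case by simp
next
  case (ide xs)
  then show ?case by simp
next
  case (comp f g)
  then show ?case
    by (metis W_comp comp_s_assoc scod_simps(1) sdom_simps(1))
next
  case (W f us ws)
  note o = W
  have ih: "W us (sbl V (scod f)) ws \<bullet> W us f (fst V # ws) = W (us @ [fst V]) f ws \<bullet> W us (sbl V (sdom f)) ws"
  proof -
    have "W us (sbl V (scod f) \<bullet> W [] f [fst V]) ws = W us (W [fst V] f [] \<bullet> sbl V (sdom f)) ws"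
      by (simp only: W(4))
    then show ?thesis by simp
  qed
  have "sbl V (us @ scod f @ ws) \<bullet> W us f (ws @ [fst V])
    = W [] (sbl V us) (scod f @ ws) \<bullet> W us (sbl V (scod f)) ws \<bullet> W (us @ scod f) (sbl V ws) [] \<bullet> W us f (ws @ [fst V])"
    using o by (simp add: sbl_append)
  also have "W (us @ scod f) (sbl V ws) [] \<bullet> W us f (ws @ [fst V]) = W us f (fst V # ws) \<bullet> W (us @ sdom f) (sbl V ws) []"
    using interchange_s[of f "sbl V ws" us "[]" "[]"] o by simp
  also have "W [] (sbl V us) (scod f @ ws) \<bullet> W us (sbl V (scod f)) ws \<bullet> W us f (fst V # ws) \<bullet> W (us @ sdom f) (sbl V ws) []
    = (W [] (sbl V us) (scod f @ ws) \<bullet> W (us @ [fst V]) f ws) \<bullet> W us (sbl V (sdom f)) ws \<bullet> W (us @ sdom f) (sbl V ws) []"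
    using arg_cong[OF ih, of "\<lambda>s. s \<bullet> W (us @ sdom f) (sbl V ws) []"] by simp
  also have "W [] (sbl V us) (scod f @ ws) \<bullet> W (us @ [fst V]) f ws = W (fst V # us) f ws \<bullet> W [] (sbl V us) (sdom f @ ws)"
    using interchange_s[of "sbl V us" f "[]" "[]" ws] o by simp
  finally show ?case using o by (simp add: sbl_append)
qed

lemma slide_inv:
  assumes [simp]: "V \<in> ZO" "sarr f"
  shows "sil V (scod f) \<bullet> W [fst V] f [] = W [] f [fst V] \<bullet> sil V (sdom f)"
proof -
  have *: "sil V (scod f) \<bullet> sbl V (scod f) \<bullet> t = ide (scod f @ [fst V]) \<bullet> t" for t
    by (simp only: comp_s_assoc[symmetric] sbl_sil(2)[OF assms(1) sarr_objs(2)[OF assms(2)]])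
  have "sil V (scod f) \<bullet> (sbl V (scod f) \<bullet> W [] f [fst V]) \<bullet> sil V (sdom f)
    = sil V (scod f) \<bullet> (W [fst V] f [] \<bullet> sbl V (sdom f)) \<bullet> sil V (sdom f)"
    by (simp only: slide[OF assms])
  then show ?thesis by (simp add: * sbl_sil)
qed

end

context premodular_category begin

lemmas braid_facts [simp] = iso_facts[OF braid_iso]

text \<open>
  The braiding as a crossing of two strands, and its inverse \<open>ci\<close>.
\<close>

definition cc :: "'o \<Rightarrow> 'o \<Rightarrow> ('o, 'm) diagram" where
  "cc X Y = mi Y X \<bullet> hat (Braid A X Y) \<bullet> mm X Y"

definition ci :: "'o \<Rightarrow> 'o \<Rightarrow> ('o, 'm) diagram" where
  "ci X Y = mi X Y \<bullet> hat (Braid_inv A X Y) \<bullet> mm Y X"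

lemma cc_typing [simp]: "sdom (cc X Y) = [X, Y]" "scod (cc X Y) = [Y, X]" "sdom (ci X Y) = [Y, X]" "scod (ci X Y) = [X, Y]"
  "X \<in> Obj A \<Longrightarrow> Y \<in> Obj A \<Longrightarrow> sarr (cc X Y)" "X \<in> Obj A \<Longrightarrow> Y \<in> Obj A \<Longrightarrow> sarr (ci X Y)"
  by (simp_all add: cc_def ci_def)

lemma rep_Braid: "X \<in> Obj A \<Longrightarrow> Y \<in> Obj A \<Longrightarrow> rep (Braid A X Y) (mm Y X \<bullet> cc X Y \<bullet> mi X Y)"
  by (simp add: rep_def cc_def)

lemma rep_Braid_inv: "X \<in> Obj A \<Longrightarrow> Y \<in> Obj A \<Longrightarrow> rep (Braid_inv A X Y) (mm X Y \<bullet> ci X Y \<bullet> mi Y X)"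
  by (simp add: rep_def ci_def)

lemma cc_ci: "X \<in> Obj A \<Longrightarrow> Y \<in> Obj A \<Longrightarrow> cc X Y \<bullet> ci X Y = ide [Y, X]"
  "X \<in> Obj A \<Longrightarrow> Y \<in> Obj A \<Longrightarrow> ci X Y \<bullet> cc X Y = ide [X, Y]"
proof -
  assume o [simp]: "X \<in> Obj A" "Y \<in> Obj A"
  have "hat (Braid A X Y) \<bullet> hat (Braid_inv A X Y) = ide [Y \<star> X]"
    "hat (Braid_inv A X Y) \<bullet> hat (Braid A X Y) = ide [X \<star> Y]"
    by (simp_all add: hat_Id flip: hat_comp)
  from arg_cong[OF this(1), of "\<lambda>s. s \<bullet> mm Y X"] arg_cong[OF this(2), of "\<lambda>s. s \<bullet> mm X Y"]
  show "cc X Y \<bullet> ci X Y = ide [Y, X]" "ci X Y \<bullet> cc X Y = ide [X, Y]" by (simp_all add: cc_def ci_def)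
qed

lemmas [simp] = ctx_rules[OF cc_ci(1), simplified ctx_simps] ctx_rules[OF cc_ci(2), simplified ctx_simps]
lemmas [simp] = cc_ci

lemma cancel_braids [simp]: "X \<in> Obj A \<Longrightarrow> Y \<in> Obj A \<Longrightarrow> cc X Y \<bullet> ci X Y \<bullet> t = ide [Y, X] \<bullet> t"
  "X \<in> Obj A \<Longrightarrow> Y \<in> Obj A \<Longrightarrow> ci X Y \<bullet> cc X Y \<bullet> t = ide [X, Y] \<bullet> t"
  by (simp_all only: comp_s_assoc[symmetric] cc_ci)

lemma is_iso_inv: "is_iso A X Y f \<Longrightarrow> is_iso A Y X (inv_mor A X Y f)"
  using is_iso_inverse_pair unfolding is_iso_def inverse_pair_def by blast

text \<open>
  The half-braidings \<open>c\<close> and \<open>c\<^sup>-\<^sup>1\<close> on \<open>X\<close>: the strand of \<open>X\<close> passes on one side of all others.  Treating the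
  braiding as a half-braiding lets \<open>slide\<close> prove its naturality and the Yang-Baxter relations.
\<close>

definition ovr :: "'o \<Rightarrow> ('o, 'm) centre_obj" where
  "ovr X = (X, \<lambda>B \<in> Obj A. Braid A B X)"

definition und :: "'o \<Rightarrow> ('o, 'm) centre_obj" where
  "und X = (X, under_braiding A X)"

lemma fst_ovr [simp]: "fst (ovr X) = X" "fst (und X) = X"
  by (simp_all add: ovr_def und_def)

lemma ovr:
  assumes [simp]: "X \<in> Obj A"
  shows "ovr X \<in> ZO" "\<And>B. B \<in> Obj A \<Longrightarrow> sb (ovr X) B = cc B X"
proof -
  have h: "cc (tgt f) X \<bullet> W [] (hat f) [X] = W [X] (hat f) [] \<bullet> cc (src f) X" if [simp]: "arr f" for f
  proof -
    have e: "Braid A (tgt f) X \<cdot> (f \<boxtimes> Id A X) = (Id A X \<boxtimes> f) \<cdot> Braid A (src f) X"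
      using braid_natural[of "src f" "tgt f" X X f "Id A X"] arr_Mor[of f] id_closed[of X] by simp
    show ?thesis
      by (rule rep_elim[OF e], (rule reps rep_Braid rep_hat | (simp; fail))+)
        (drule arg_cong[where f = "\<lambda>s. mi X (tgt f) \<bullet> s \<bullet> mm (src f) X"], simp)
  qed
  have m: "cc (B \<star> B') X \<bullet> W [] (mm B B') [X] = W [X] (mm B B') [] \<bullet> W [] (cc B X) [B'] \<bullet> W [B] (cc B' X) []"
    if [simp]: "B \<in> Obj A" "B' \<in> Obj A" for B B'
    by (rule rep_elim[OF hexagon_left[of B B' X]], (rule reps rep_Braid | (simp; fail))+)
      (drule arg_cong[where f = "\<lambda>s. W [X] (mm B B') [] \<bullet> W [] (mi X B) [B'] \<bullet> mi (X \<star> B) B' \<bullet> s \<bullet> mm B (B' \<star> X) \<bullet> W [B] (mm B' X) []"], simp)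
  show "ovr X \<in> ZO" "\<And>B. B \<in> Obj A \<Longrightarrow> sb (ovr X) B = cc B X"
    by (rule ZO_I[where h = "\<lambda>B. cc B X"]; simp add: ovr_def rep_Braid h m braid_iso)+
qed

lemma ovr_si: "X \<in> Obj A \<Longrightarrow> B \<in> Obj A \<Longrightarrow> si (ovr X) B = ci B X"
  by (simp add: si_def ci_def ovr_def)

lemma und:
  assumes [simp]: "X \<in> Obj A"
  shows "und X \<in> ZO" "\<And>B. B \<in> Obj A \<Longrightarrow> sb (und X) B = ci X B"
proof -
  have h: "ci X (tgt f) \<bullet> W [] (hat f) [X] = W [X] (hat f) [] \<bullet> ci X (src f)" if [simp]: "arr f" for f
  proof -
    have e: "Braid A X (tgt f) \<cdot> (Id A X \<boxtimes> f) = (f \<boxtimes> Id A X) \<cdot> Braid A X (src f)"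
      using braid_natural[of X X "src f" "tgt f" "Id A X" f] arr_Mor[of f] id_closed[of X] by simp
    show ?thesis
      by (rule rep_elim[OF e], (rule reps rep_Braid rep_hat | (simp; fail))+)
        (drule arg_cong[where f = "\<lambda>s. ci X (tgt f) \<bullet> mi (tgt f) X \<bullet> s \<bullet> mm X (src f) \<bullet> ci X (src f)"], simp)
  qed
  have m: "ci X (B \<star> B') \<bullet> W [] (mm B B') [X] = W [X] (mm B B') [] \<bullet> W [] (ci X B) [B'] \<bullet> W [B] (ci X B') []"
    if [simp]: "B \<in> Obj A" "B' \<in> Obj A" for B B'
    by (rule rep_elim[OF hexagon_right[of X B B']], (rule reps rep_Braid | (simp; fail))+)
      (drule arg_cong[where f = "\<lambda>s. ci X (B \<star> B') \<bullet> mi (B \<star> B') X \<bullet> mm (B \<star> B') X \<bullet> W [] (mm B B') [X] \<bullet> W [B] (mi B' X) [] \<bullet> mi B (B' \<star> X) \<bullet> s \<bullet> mm (X \<star> B) B' \<bullet> W [] (mm X B) [B'] \<bullet> W [] (ci X B) [B'] \<bullet> W [B] (ci X B') []"], simp)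
  show "und X \<in> ZO" "\<And>B. B \<in> Obj A \<Longrightarrow> sb (und X) B = ci X B"
    by (rule ZO_I[where h = "\<lambda>B. ci X B"]; simp add: und_def under_braiding_def rep_Braid_inv h m braid_iso is_iso_inv)+
qed

lemma inv_inv_mor: "is_iso A X Y f \<Longrightarrow> inv_mor A Y X (inv_mor A X Y f) = f"
  using is_iso_inverse_pair inverse_pair_inv_mor unfolding inverse_pair_def by metis

lemma und_si: "X \<in> Obj A \<Longrightarrow> B \<in> Obj A \<Longrightarrow> si (und X) B = cc X B"
  by (simp add: si_def cc_def und_def under_braiding_def inv_inv_mor braid_iso)

end

section \<open>Tensor products of half-braidings and the involution on them\<close>

context monoidal_linear_category begin

lemma wrapI: "sarr f \<Longrightarrow> sarr g \<Longrightarrow> W [] f [] = W [] g [] \<Longrightarrow> f = g"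
  by (simp add: W_Nil)

lemma slide_hat_W: "V \<in> ZO \<Longrightarrow> arr f \<Longrightarrow>
    W [] (sb V (tgt f)) [] \<bullet> W [] (hat f) [fst V] = W [fst V] (hat f) [] \<bullet> W [] (sb V (src f)) []"
  using slide[of V "hat f"] by simp

lemma slide_inv_hat_W: "V \<in> ZO \<Longrightarrow> arr f \<Longrightarrow>
    W [] (si V (tgt f)) [] \<bullet> W [fst V] (hat f) [] = W [] (hat f) [fst V] \<bullet> W [] (si V (src f)) []"
  using slide_inv[of V "hat f"] by simp

lemma slide_mm_W: "V \<in> ZO \<Longrightarrow> B \<in> Obj A \<Longrightarrow> B' \<in> Obj A \<Longrightarrow>
    W [] (sb V (B \<star> B')) [] \<bullet> W [] (mm B B') [fst V] = W [fst V] (mm B B') [] \<bullet> W [] (sb V B) [B'] \<bullet> W [B] (sb V B') []"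
  using slide[of V "mm B B'"] by simp

lemma slide_inv_mm_W: "V \<in> ZO \<Longrightarrow> B \<in> Obj A \<Longrightarrow> B' \<in> Obj A \<Longrightarrow>
    W [] (si V (B \<star> B')) [] \<bullet> W [fst V] (mm B B') [] = W [] (mm B B') [fst V] \<bullet> W [B] (si V B') [] \<bullet> W [] (si V B) [B']"
  using slide_inv[of V "mm B B'"] by simp

lemmas slide_rules = ctx_rules[OF slide_hat_W, simplified ctx_simps] ctx_rules[OF slide_mm_W, simplified ctx_simps]
  ctx_rules[OF slide_inv_hat_W, simplified ctx_simps] ctx_rules[OF slide_inv_mm_W, simplified ctx_simps]

lemma si_unique:
  assumes "V \<in> ZO" "B \<in> Obj A" "sarr G" "sdom G = [fst V, B]" "scod G = [B, fst V]" "sb V B \<bullet> G = ide [fst V, B]"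
  shows "si V B = G"
  by (rule s_inverse_unique[of "sb V B"]) (use assms in auto)

lemma rep_via: "rep f F \<Longrightarrow> F = G \<Longrightarrow> rep f G" by simp

text \<open>
  The standard tensor product of the centre; \<open>tens_sb\<close> and \<open>tens_si\<close> are its crossings on the unfused strands.
\<close>

definition tens :: "('o, 'm) centre_obj \<Rightarrow> ('o, 'm) centre_obj \<Rightarrow> ('o, 'm) centre_obj" where
  "tens V T = (fst V \<star> fst T, ten_half_braiding A (fst V) (snd V) (fst T) (snd T))"

definition tens_sb :: "('o, 'm) centre_obj \<Rightarrow> ('o, 'm) centre_obj \<Rightarrow> 'o \<Rightarrow> ('o, 'm) diagram" where
  "tens_sb V T B = W [] (mm (fst V) (fst T)) [B] \<bullet> W [fst V] (sb T B) [] \<bullet> W [] (sb V B) [fst T] \<bullet> W [B] (mi (fst V) (fst T)) []"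

definition tens_si :: "('o, 'm) centre_obj \<Rightarrow> ('o, 'm) centre_obj \<Rightarrow> 'o \<Rightarrow> ('o, 'm) diagram" where
  "tens_si V T B = W [B] (mm (fst V) (fst T)) [] \<bullet> W [] (si V B) [fst T] \<bullet> W [fst V] (si T B) [] \<bullet> W [] (mi (fst V) (fst T)) [B]"

lemma fst_tens [simp]: "fst (tens V T) = fst V \<star> fst T"
  by (simp add: tens_def)

lemma iso_of_rep:
  assumes "rep f F" "sarr G" "sdom F = [X]" "scod F = [Y]" "sdom G = [Y]" "scod G = [X]"
    "F \<bullet> G = ide [Y]" "G \<bullet> F = ide [X]" "rep g G"
  shows "is_iso A X Y f" "inv_mor A X Y f = g"
proof -
  have f: "arr f" "hat f = F" and g: "arr g" "hat g = G" using assms by (auto simp: rep_def)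
  then have t: "src f = X" "tgt f = Y" "src g = Y" "tgt g = X" using assms by auto
  then have [simp]: "X \<in> Obj A" "Y \<in> Obj A" using f g src_closed tgt_closed by metis+
  have "g \<cdot> f = Id A X" "f \<cdot> g = Id A Y"
    by (rule hat_faithful; use f g t assms in \<open>simp add: hat_comp hat_Id\<close>)+
  then have i: "inverse_pair A X Y f g" using f g t by (intro inverse_pairI) auto
  then show "is_iso A X Y f" "inv_mor A X Y f = g" by (auto simp: is_iso_def inverse_pair_inv_mor)
qed

lemma tens:
  assumes V [simp]: "V \<in> ZO" "T \<in> ZO"
  shows "tens V T \<in> ZO" "\<And>B. B \<in> Obj A \<Longrightarrow> sb (tens V T) B = tens_sb V T B"
    "\<And>B. B \<in> Obj A \<Longrightarrow> si (tens V T) B = tens_si V T B"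
proof -
  let ?X = "fst V" and ?Y = "fst T"
  have e: "snd (tens V T) B = Assoc_inv A ?X ?Y B \<cdot> (Id A ?X \<boxtimes> snd T B) \<cdot> Assoc A ?X B ?Y \<cdot> (snd V B \<boxtimes> Id A ?Y) \<cdot> Assoc_inv A B ?X ?Y"
    if "B \<in> Obj A" for B using that by (simp add: tens_def ten_half_braiding_def)
  have r: "rep (snd (tens V T) B) (mm (fst (tens V T)) B \<bullet> tens_sb V T B \<bullet> mi B (fst (tens V T)))" if [simp]: "B \<in> Obj A" for B
    unfolding e[OF that]
    by (rule rep_via, (rule reps rep_sb | (simp; fail))+) (simp add: tens_sb_def)
  have i: "is_iso A (B \<star> fst (tens V T)) (fst (tens V T) \<star> B) (snd (tens V T) B)" if [simp]: "B \<in> Obj A" for B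
  proof (rule iso_of_rep(1)[OF r])
    show "rep (Assoc A B ?X ?Y \<cdot> (inv_mor A (B \<star> ?X) (?X \<star> B) (snd V B) \<boxtimes> Id A ?Y) \<cdot> Assoc_inv A ?X B ?Y \<cdot>
        (Id A ?X \<boxtimes> inv_mor A (B \<star> ?Y) (?Y \<star> B) (snd T B)) \<cdot> Assoc A ?X ?Y B)
        (mm B (?X \<star> ?Y) \<bullet> tens_si V T B \<bullet> mi (?X \<star> ?Y) B)"
      by (rule rep_via, (rule reps rep_si | (simp; fail))+) (simp add: tens_si_def)
  qed (simp_all add: tens_sb_def tens_si_def)
  have h: "tens_sb V T (tgt f) \<bullet> W [] (hat f) [fst (tens V T)] = W [fst (tens V T)] (hat f) [] \<bullet> tens_sb V T (src f)"
    if [simp]: "arr f" for f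
    by (rule wrapI) (simp_all add: tens_sb_def interchange_rule slide_rules)
  have m: "tens_sb V T (B \<star> B') \<bullet> W [] (mm B B') [fst (tens V T)]
      = W [fst (tens V T)] (mm B B') [] \<bullet> W [] (tens_sb V T B) [B'] \<bullet> W [B] (tens_sb V T B') []"
    if [simp]: "B \<in> Obj A" "B' \<in> Obj A" for B B'
    by (rule wrapI) (simp_all add: tens_sb_def interchange_rule slide_rules)
  have x: "snd (tens V T) \<in> extensional (Obj A)" by (simp add: tens_def ten_half_braiding_def)
  show ZO: "tens V T \<in> ZO" "\<And>B. B \<in> Obj A \<Longrightarrow> sb (tens V T) B = tens_sb V T B"
    by (rule ZO_I[OF _ x r _ i h m]; simp add: tens_sb_def)+
  show "\<And>B. B \<in> Obj A \<Longrightarrow> si (tens V T) B = tens_si V T B"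
    by (rule si_unique) (simp_all add: ZO, simp_all add: tens_sb_def tens_si_def)
qed

end

context premodular_category begin

text \<open>
  The endomorphism \<open>c\<^sub>X\<^sub>,\<^sub>C\<^sup>-\<^sup>1 \<gamma>\<^sub>C\<^sup>-\<^sup>1\<close> of \<open>X C\<close> commutes with a strand \<open>B\<close> that passes \<open>X\<close> by the half-braiding and \<open>C\<close> by
  the braiding.
\<close>

lemma sb_past_cc:
  assumes [simp]: "V \<in> ZO" "B \<in> Obj A" "C \<in> Obj A"
  defines "X \<equiv> fst V"
  shows "W [X] (cc B C) [] \<bullet> W [] (sb V B) [C] \<bullet> W [B] (ci X C) [] \<bullet> W [B] (si V C) []
    = W [] (ci X C) [B] \<bullet> W [] (si V C) [B] \<bullet> W [X] (cc B C) [] \<bullet> W [] (sb V B) [C]"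
proof -
  have X [simp]: "X \<in> Obj A" and [simp]: "fst V = X" by (simp_all add: X_def)
  have e1: "W [] (sb V C) [B] \<bullet> W [C] (sb V B) [] \<bullet> W [] (cc B C) [X] = W [X] (cc B C) [] \<bullet> W [] (sb V B) [C] \<bullet> W [B] (sb V C) []"
    using slide[of V "cc B C"] by simp
  have e2: "W [] (cc X C) [B] \<bullet> W [X] (cc B C) [] \<bullet> W [] (sb V B) [C] = W [C] (sb V B) [] \<bullet> W [] (cc B C) [X] \<bullet> W [B] (cc X C) []"
    using slide[of "ovr C" "sb V B"] by (simp add: ovr)
  have e1': "W [] (si V C) [B] \<bullet> W [X] (cc B C) [] \<bullet> W [] (sb V B) [C] = W [C] (sb V B) [] \<bullet> W [] (cc B C) [X] \<bullet> W [B] (si V C) []"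
    using arg_cong[OF e1, of "\<lambda>s. W [] (si V C) [B] \<bullet> s \<bullet> W [B] (si V C) []"] by simp
  have e2': "W [X] (cc B C) [] \<bullet> W [] (sb V B) [C] \<bullet> W [B] (ci X C) [] = W [] (ci X C) [B] \<bullet> W [C] (sb V B) [] \<bullet> W [] (cc B C) [X]"
    using arg_cong[OF e2, of "\<lambda>s. W [] (ci X C) [B] \<bullet> s \<bullet> W [B] (ci X C) []"] by simp
  show ?thesis unfolding e1' using arg_cong[OF e2', of "\<lambda>s. s \<bullet> W [B] (si V C) []"] by simp
qed

text \<open>
  This commutation is the reason why \<open>c\<^sup>-\<^sup>1 \<gamma>\<^sup>-\<^sup>1 c\<close> is multiplicative: taking inverses reverses the order of
  the crossings with \<open>B\<close> and \<open>C\<close>, and here the two are seen to be interchangeable.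
\<close>

lemma U_commute:
  assumes [simp]: "V \<in> ZO" "B \<in> Obj A" "C \<in> Obj A"
  defines "X \<equiv> fst V"
  shows "W [B] (ci X C) [] \<bullet> W [B] (si V C) [] \<bullet> W [] (si V B) [C] \<bullet> W [] (cc B X) [C]
    = W [] (si V B) [C] \<bullet> W [] (cc B X) [C] \<bullet> W [B] (ci X C) [] \<bullet> W [B] (si V C) []"
proof -
  have X [simp]: "X \<in> Obj A" and [simp]: "fst V = X" by (simp_all add: X_def)
  have e1: "W [X] (cc B C) [] \<bullet> W [] (cc B X) [C] \<bullet> W [B] (ci X C) [] \<bullet> W [B] (si V C) []
    = W [] (ci X C) [B] \<bullet> W [] (si V C) [B] \<bullet> W [X] (cc B C) [] \<bullet> W [] (cc B X) [C]"
    using slide_inv[of "und B" "ci X C \<bullet> si V C"] by (simp add: und und_si)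
  note e2 = sb_past_cc[of V B C, folded X_def, simplified]
  have "W [] (si V B) [C] \<bullet> W [] (cc B X) [C] \<bullet> W [B] (ci X C) [] \<bullet> W [B] (si V C) []
    = W [] (si V B) [C] \<bullet> W [X] (ci B C) [] \<bullet> (W [X] (cc B C) [] \<bullet> W [] (cc B X) [C] \<bullet> W [B] (ci X C) [] \<bullet> W [B] (si V C) [])"
    by simp
  also have "\<dots> = W [] (si V B) [C] \<bullet> W [X] (ci B C) [] \<bullet> (W [] (ci X C) [B] \<bullet> W [] (si V C) [B] \<bullet> W [X] (cc B C) [] \<bullet> W [] (sb V B) [C]) \<bullet> W [] (si V B) [C] \<bullet> W [] (cc B X) [C]"
    unfolding e1 by simp
  also have "\<dots> = W [B] (ci X C) [] \<bullet> W [B] (si V C) [] \<bullet> W [] (si V B) [C] \<bullet> W [] (cc B X) [C]"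
    unfolding e2[symmetric] by simp
  finally show ?thesis by simp
qed

text \<open>
  The functor \<open>U\<close> on objects in its explicit form \<open>c\<^sup>-\<^sup>1 \<gamma>\<^sup>-\<^sup>1 c\<close>.
\<close>

definition Uo :: "('o, 'm) centre_obj \<Rightarrow> ('o, 'm) centre_obj" where
  "Uo V = (fst V, \<lambda>B \<in> Obj A. Braid_inv A (fst V) B \<cdot> inv_mor A (B \<star> fst V) (fst V \<star> B) (snd V B) \<cdot> Braid A B (fst V))"

definition U_sb :: "('o, 'm) centre_obj \<Rightarrow> 'o \<Rightarrow> ('o, 'm) diagram" where
  "U_sb V B = ci (fst V) B \<bullet> si V B \<bullet> cc B (fst V)"

definition U_si :: "('o, 'm) centre_obj \<Rightarrow> 'o \<Rightarrow> ('o, 'm) diagram" where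
  "U_si V B = ci B (fst V) \<bullet> sb V B \<bullet> cc (fst V) B"

lemma fst_Uo [simp]: "fst (Uo V) = fst V" by (simp add: Uo_def)

lemma Uo:
  assumes V [simp]: "V \<in> ZO"
  shows "Uo V \<in> ZO" "\<And>B. B \<in> Obj A \<Longrightarrow> sb (Uo V) B = U_sb V B"
    "\<And>B. B \<in> Obj A \<Longrightarrow> si (Uo V) B = U_si V B"
proof -
  let ?X = "fst V"
  have e: "snd (Uo V) B = Braid_inv A ?X B \<cdot> inv_mor A (B \<star> ?X) (?X \<star> B) (snd V B) \<cdot> Braid A B ?X"
    if "B \<in> Obj A" for B using that by (simp add: Uo_def)
  have r: "rep (snd (Uo V) B) (mm (fst (Uo V)) B \<bullet> U_sb V B \<bullet> mi B (fst (Uo V)))" if [simp]: "B \<in> Obj A" for B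
    unfolding e[OF that]
    by (rule rep_via, (rule reps rep_si rep_Braid rep_Braid_inv | (simp; fail))+) (simp add: U_sb_def)
  have i: "is_iso A (B \<star> fst (Uo V)) (fst (Uo V) \<star> B) (snd (Uo V) B)" if [simp]: "B \<in> Obj A" for B
  proof (rule iso_of_rep(1)[OF r])
    show "rep (Braid_inv A B ?X \<cdot> snd V B \<cdot> Braid A ?X B) (mm B ?X \<bullet> U_si V B \<bullet> mi ?X B)"
      by (rule rep_via, (rule reps rep_sb rep_Braid rep_Braid_inv | (simp; fail))+) (simp add: U_si_def)
  qed (simp_all add: U_sb_def U_si_def)
  have h: "U_sb V (tgt f) \<bullet> W [] (hat f) [fst (Uo V)] = W [fst (Uo V)] (hat f) [] \<bullet> U_sb V (src f)"
    if [simp]: "arr f" for f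
  proof (rule wrapI)
    have s1: "W [] (cc (tgt f) ?X) [] \<bullet> W [] (hat f) [?X] = W [?X] (hat f) [] \<bullet> W [] (cc (src f) ?X) []"
      using slide_hat_W[of "ovr ?X" f] by (simp add: ovr)
    have s2: "W [] (ci ?X (tgt f)) [] \<bullet> W [] (hat f) [?X] \<bullet> t = W [?X] (hat f) [] \<bullet> W [] (ci ?X (src f)) [] \<bullet> t" for t
      using arg_cong[OF slide_hat_W[of "und ?X" f], of "\<lambda>s. s \<bullet> t"] by (simp add: und)
    show "W [] (U_sb V (tgt f) \<bullet> W [] (hat f) [fst (Uo V)]) [] = W [] (W [fst (Uo V)] (hat f) [] \<bullet> U_sb V (src f)) []"
      by (simp add: U_sb_def slide_rules s1 s2)
  qed (simp_all add: U_sb_def)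
  have m: "U_sb V (B \<star> B') \<bullet> W [] (mm B B') [fst (Uo V)]
      = W [fst (Uo V)] (mm B B') [] \<bullet> W [] (U_sb V B) [B'] \<bullet> W [B] (U_sb V B') []"
    if [simp]: "B \<in> Obj A" "B' \<in> Obj A" for B B'
  proof (rule wrapI)
    have s1: "W [] (cc (B \<star> B') ?X) [] \<bullet> W [] (mm B B') [?X] = W [?X] (mm B B') [] \<bullet> W [] (cc B ?X) [B'] \<bullet> W [B] (cc B' ?X) []"
      using slide_mm_W[of "ovr ?X" B B'] by (simp add: ovr)
    have s2: "W [] (ci ?X (B \<star> B')) [] \<bullet> W [] (mm B B') [?X] \<bullet> t = W [?X] (mm B B') [] \<bullet> W [] (ci ?X B) [B'] \<bullet> W [B] (ci ?X B') [] \<bullet> t" for t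
      using arg_cong[OF slide_mm_W[of "und ?X" B B'], of "\<lambda>s. s \<bullet> t"] by (simp add: und)
    have c: "W [B] (ci ?X B') [] \<bullet> W [B] (si V B') [] \<bullet> W [] (si V B) [B'] \<bullet> W [] (cc B ?X) [B'] \<bullet> t
      = W [] (si V B) [B'] \<bullet> W [] (cc B ?X) [B'] \<bullet> W [B] (ci ?X B') [] \<bullet> W [B] (si V B') [] \<bullet> t" for t
      using arg_cong[OF U_commute[of V B B'], of "\<lambda>s. s \<bullet> t"] by simp
    show "W [] (U_sb V (B \<star> B') \<bullet> W [] (mm B B') [fst (Uo V)]) [] =
      W [] (W [fst (Uo V)] (mm B B') [] \<bullet> W [] (U_sb V B) [B'] \<bullet> W [B] (U_sb V B') []) []"
      by (simp add: U_sb_def slide_rules s1 s2 c)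
  qed (simp_all add: U_sb_def)
  have x: "snd (Uo V) \<in> extensional (Obj A)" by (simp add: Uo_def)
  show ZO: "Uo V \<in> ZO" "\<And>B. B \<in> Obj A \<Longrightarrow> sb (Uo V) B = U_sb V B"
    by (rule ZO_I[OF _ x r _ i h m]; simp add: U_sb_def)+
  show "\<And>B. B \<in> Obj A \<Longrightarrow> si (Uo V) B = U_si V B"
    by (rule si_unique) (simp_all add: ZO, simp_all add: U_sb_def U_si_def)
qed

text \<open>
  Bending the strand \<open>B\<close> around turns the crossing with a dual of \<open>B\<close> into the inverse crossing with \<open>B\<close>,
  because the coevaluation slides through the strand of \<open>V\<close>.
\<close>

lemma mate_is_inverse:
  assumes [simp]: "V \<in> ZO" "B \<in> Obj A" "D \<in> Obj A" "sarr ev" "sarr coev" "sdom ev = [D, B]" "scod ev = []"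
    "sdom coev = []" "scod coev = [B, D]"
    and z: "W [B] ev [] \<bullet> W [] coev [B] = ide [B]"
  shows "W [B, fst V] ev [] \<bullet> W [B] (sb V D) [B] \<bullet> W [] coev [fst V, B] = W [] (si V B) []"
proof -
  let ?X = "fst V"
  have s: "W [] (sb V B) [D] \<bullet> W [B] (sb V D) [] \<bullet> W [] coev [?X] = W [?X] coev []"
    using slide[of V coev] by simp
  let ?t = "W [B, ?X] ev [] \<bullet> W [B] (sb V D) [B] \<bullet> W [] coev [?X, B]"
  have i: "W [] (sb V B) [] \<bullet> W [B, ?X] ev [] = W [?X, B] ev [] \<bullet> W [] (sb V B) [D, B]"
    using interchange_s[of "sb V B" ev "[]" "[]" "[]"] by simp
  have "W [] (sb V B) [] \<bullet> ?t = (W [] (sb V B) [] \<bullet> W [B, ?X] ev []) \<bullet> W [B] (sb V D) [B] \<bullet> W [] coev [?X, B]"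
    by simp
  also have "\<dots> = ide [?X, B]" unfolding i
    using ctx_rules(5)[OF s, of "[B]", simplified ctx_simps] ctx_rules(6)[OF z, of ?X "[]", simplified ctx_simps] by simp
  finally have e: "W [] (sb V B) [] \<bullet> ?t = ide [?X, B]" .
  have "?t = W [] (si V B) [] \<bullet> (W [] (sb V B) [] \<bullet> ?t)" by simp
  also have "\<dots> = W [] (si V B) []" unfolding e by simp
  finally show ?thesis .
qed

text \<open>
  The definition of \<open>U\<close> takes mates twice, once for the dual of \<open>B\<close> and once for the dual of \<open>X\<close>.  The first
  mate inverts \<open>\<gamma>\<close> and the second one returns from the dual of \<open>X\<close> to \<open>X\<close>.
\<close>

lemma U_obj_eq:
  assumes [simp]: "V \<in> ZO"
  shows "U_obj A V = Uo V"
proof -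
  let ?X = "fst V" and ?X' = "Rdual A (fst V)"
  define rev rcoev where "rev = ui \<bullet> hat (REv A ?X) \<bullet> mm ?X ?X'" and "rcoev = mi ?X' ?X \<bullet> hat (RCoev A ?X) \<bullet> uu"
  note R = dual_strict[OF right_dual[OF ZO_fst[OF assms]], folded rev_def rcoev_def]
  note [simp] = R(1-8)
  have "vee_half_braiding A ?X' ?X (REv A ?X) (RCoev A ?X) (rdual_half_braiding A ?X (snd V)) B = snd (Uo V) B"
    if B [simp]: "B \<in> Obj A" for B
  proof -
    let ?B' = "Ldual A B"
    define ev coev where "ev = ui \<bullet> hat (Ev A B) \<bullet> mm ?B' B" and "coev = mi B ?B' \<bullet> hat (Coev A B) \<bullet> uu"
    note L = dual_strict[OF left_dual[OF B], folded ev_def coev_def]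
    note [simp] = L(1-8)
    have m: "W [B, ?X] ev [] \<bullet> W [B] (sb V ?B') [B] \<bullet> W [] coev [?X, B] = W [] (si V B) []"
      by (rule mate_is_inverse) (simp_all add: L)
    define N where "N = W [?X', B] rev [] \<bullet> W [?X', B, ?X] ev [?X'] \<bullet> W [?X', B] (sb V ?B') [B, ?X'] \<bullet> W [?X'] coev [?X, B, ?X'] \<bullet> W [] rcoev [B, ?X']"
    have [simp]: "sarr N" "sdom N = [B, ?X']" "scod N = [?X', B]" by (simp_all add: N_def)
    have r: "rep (rdual_half_braiding A ?X (snd V) B) (mm ?X' B \<bullet> N \<bullet> mi B ?X')"
      unfolding rdual_half_braiding_def Let_def rdual_mor_def ten_ev_def ten_coev_def restrict_apply'[OF B]
      by (rule rep_via, (rule reps rep_sb R(9,10) L(9,10) | (simp; fail))+)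
        (simp add: N_def, simp add: interchange_rule, simp add: W_Nil)
    define M where "M = W [B, ?X] ev [] \<bullet> W [B] (sb V ?B') [B] \<bullet> W [] coev [?X, B]"
    define K where "K = W [B] rev [?X] \<bullet> W [] M [?X', ?X]"
    have [simp]: "sarr M" "sdom M = [?X, B]" "scod M = [B, ?X]" by (simp_all add: M_def)
    have [simp]: "sarr K" "sdom K = [?X, B, ?X', ?X]" "scod K = [B, ?X]" by (simp_all add: K_def)
    have z: "W [] rev [B, ?X] \<bullet> W [?X] N [?X] \<bullet> W [?X, B] rcoev [] = W [] (si V B) []"
    proof -
      have "W [] rev [B, ?X] \<bullet> W [?X] N [?X] \<bullet> W [?X, B] rcoev []
        = W [] rev [B, ?X] \<bullet> W [?X, ?X'] K [] \<bullet> W [?X] rcoev [B, ?X', ?X] \<bullet> W [?X, B] rcoev []"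
        by (simp add: N_def K_def M_def)
      also have "\<dots> = W [] K [] \<bullet> W [] rev [?X, B, ?X', ?X] \<bullet> W [?X] rcoev [B, ?X', ?X] \<bullet> W [?X, B] rcoev []"
        using arg_cong[OF interchange_s[of rev K "[]" "[]" "[]"], of "\<lambda>s. s \<bullet> W [?X] rcoev [B, ?X', ?X] \<bullet> W [?X, B] rcoev []"] by simp
      also have "\<dots> = W [] K [] \<bullet> W [?X, B] rcoev []"
        using ctx_rules(1)[OF R(12), of "[B, ?X', ?X]", simplified ctx_simps] by simp
      also have "\<dots> = W [B] rev [?X] \<bullet> (W [] M [?X', ?X] \<bullet> W [?X, B] rcoev [])"
        by (simp add: K_def)
      also have "W [] M [?X', ?X] \<bullet> W [?X, B] rcoev [] = W [B, ?X] rcoev [] \<bullet> W [] M []"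
        using interchange_s[of M rcoev "[]" "[]" "[]"] by simp
      also have "W [B] rev [?X] \<bullet> W [B, ?X] rcoev [] \<bullet> W [] M [] = W [] M []"
        using ctx_rules(2)[OF R(12), of B "[]", simplified ctx_simps] by simp
      also have "\<dots> = W [] (si V B) []" by (simp add: M_def m)
      finally show ?thesis .
    qed
    have z': "W [] rev [B, ?X] \<bullet> W [?X] N [?X] \<bullet> W [?X, B] rcoev [] \<bullet> t = W [] (si V B) [] \<bullet> t" for t
      using arg_cong[OF z, of "\<lambda>s. s \<bullet> t"] by simp
    have i1: "W [] rev [B \<star> ?X] \<bullet> W [?X, ?X'] (mm B ?X) [] \<bullet> t = W [] (mm B ?X) [] \<bullet> W [] rev [B, ?X] \<bullet> t" for t
      using arg_cong[OF interchange_s[of rev "mm B ?X" "[]" "[]" "[]"], of "\<lambda>s. s \<bullet> t"] by simp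
    have i2: "W [?X \<star> B] rcoev [] \<bullet> W [] (mm ?X B) [] \<bullet> t = W [] (mm ?X B) [?X', ?X] \<bullet> W [?X, B] rcoev [] \<bullet> t" for t
      using arg_cong[OF interchange_s[of "mm ?X B" rcoev "[]" "[]" "[]"], of "\<lambda>s. s \<bullet> t"] by simp
    have i3: "W [?X \<star> B] (mm ?X' ?X) [] \<bullet> W [] (mm ?X B) [?X', ?X] \<bullet> t = W [] (mm ?X B) [?X' \<star> ?X] \<bullet> W [?X, B] (mm ?X' ?X) [] \<bullet> t" for t
      using arg_cong[OF interchange_s[of "mm ?X B" "mm ?X' ?X" "[]" "[]" "[]"], of "\<lambda>s. s \<bullet> t"] by simp
    show ?thesis
      unfolding vee_half_braiding_def Uo_def restrict_apply'[OF B] snd_conv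
      by (rule rep_eqI, (rule reps rep_sb rep_si rep_Braid rep_Braid_inv r R(9,10) | (simp; fail))+)
        (simp add: z' i1 i2 i3)
  qed
  then show ?thesis
    unfolding U_obj_def Uo_def
    by (auto simp: case_prod_beta vee_half_braiding_def fun_eq_iff)
qed

end

section \<open>Duals and the twist\<close>

context fusion_category begin

text \<open>
  Evaluation and coevaluation as a cap and a cup.
\<close>

definition ev :: "'o \<Rightarrow> ('o, 'm) diagram" where
  "ev X = ui \<bullet> hat (Ev A X) \<bullet> mm (Ldual A X) X"

definition co :: "'o \<Rightarrow> ('o, 'm) diagram" where
  "co X = mi X (Ldual A X) \<bullet> hat (Coev A X) \<bullet> uu"

lemma Ldual_closed [simp]: "X \<in> Obj A \<Longrightarrow> Ldual A X \<in> Obj A"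
  and Rdual_closed [simp]: "X \<in> Obj A \<Longrightarrow> Rdual A X \<in> Obj A"
  using left_dual right_dual by (auto simp: is_left_dual_def)

lemma ev_co_typing [simp]: "X \<in> Obj A \<Longrightarrow> sarr (ev X)" "X \<in> Obj A \<Longrightarrow> sdom (ev X) = [Ldual A X, X]"
  "X \<in> Obj A \<Longrightarrow> scod (ev X) = []" "X \<in> Obj A \<Longrightarrow> sarr (co X)" "X \<in> Obj A \<Longrightarrow> sdom (co X) = []"
  "X \<in> Obj A \<Longrightarrow> scod (co X) = [X, Ldual A X]"
  using dual_strict(3-8)[OF left_dual] by (simp_all add: ev_def co_def)

lemma rep_Ev: "X \<in> Obj A \<Longrightarrow> rep (Ev A X) (uu \<bullet> ev X \<bullet> mi (Ldual A X) X)"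
  and rep_Coev: "X \<in> Obj A \<Longrightarrow> rep (Coev A X) (mm X (Ldual A X) \<bullet> co X \<bullet> ui)"
  using dual_strict(9,10)[OF left_dual] unfolding ev_def co_def by blast+

lemma zigzag: "X \<in> Obj A \<Longrightarrow> W [X] (ev X) [] \<bullet> W [] (co X) [X] = ide [X]"
  "X \<in> Obj A \<Longrightarrow> W [] (ev X) [Ldual A X] \<bullet> W [Ldual A X] (co X) [] = ide [Ldual A X]"
  using dual_strict(11,12)[OF left_dual] unfolding ev_def co_def by blast+

lemmas zigzag_rules = ctx_rules[OF zigzag(1), simplified ctx_simps] ctx_rules[OF zigzag(2), simplified ctx_simps]

end

context premodular_category begin

definition tw :: "'o \<Rightarrow> ('o, 'm) diagram" where "tw X = hat (Twist A X)"
definition ti :: "'o \<Rightarrow> ('o, 'm) diagram" where "ti X = hat (inv_mor A X X (Twist A X))"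

lemmas twist_facts [simp] = iso_facts[OF twist_iso]

lemma tw_typing [simp]: "X \<in> Obj A \<Longrightarrow> sarr (tw X)" "X \<in> Obj A \<Longrightarrow> sdom (tw X) = [X]" "X \<in> Obj A \<Longrightarrow> scod (tw X) = [X]"
  "X \<in> Obj A \<Longrightarrow> sarr (ti X)" "X \<in> Obj A \<Longrightarrow> sdom (ti X) = [X]" "X \<in> Obj A \<Longrightarrow> scod (ti X) = [X]"
  by (simp_all add: tw_def ti_def)

lemma rep_Twist: "X \<in> Obj A \<Longrightarrow> rep (Twist A X) (tw X)"
  and rep_Twist_inv: "X \<in> Obj A \<Longrightarrow> rep (inv_mor A X X (Twist A X)) (ti X)"
  by (simp_all add: rep_def tw_def ti_def)

lemma tw_ti: "X \<in> Obj A \<Longrightarrow> tw X \<bullet> ti X = ide [X]" "X \<in> Obj A \<Longrightarrow> ti X \<bullet> tw X = ide [X]"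
  by (simp_all add: tw_def ti_def hat_Id flip: hat_comp)

lemmas [simp] = ctx_rules[OF tw_ti(1), simplified ctx_simps] ctx_rules[OF tw_ti(2), simplified ctx_simps]
lemmas [simp] = tw_ti

lemma tw_natural: "arr f \<Longrightarrow> tw (tgt f) \<bullet> hat f = hat f \<bullet> tw (src f)"
  using twist_natural[of "src f" "tgt f" f] arr_Mor[of f] by (simp add: tw_def flip: hat_comp)

lemma tw_ten:
  assumes [simp]: "X \<in> Obj A" "Y \<in> Obj A"
  shows "tw (X \<star> Y) \<bullet> mm X Y = mm X Y \<bullet> cc Y X \<bullet> cc X Y \<bullet> W [] (tw X) [Y] \<bullet> W [X] (tw Y) []"
  by (rule rep_elim[OF twist_ten[of X Y]], (rule reps rep_Twist rep_Braid | (simp; fail))+)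

text \<open>
  The twist of the unit is idempotent by \<open>twist_ten\<close>, as crossings with the unit are trivial, and it is invertible.
\<close>

lemma tw_unit: "tw (Unit A) = ide [Unit A]"
proof -
  let ?I = "Unit A"
  have c1: "W [] (cc ?I ?I) [] \<bullet> W [] uu [?I] = W [?I] uu []"
    using slide[of "ovr ?I" uu] by (simp add: ovr)
  have c2: "W [] (cc ?I ?I) [] \<bullet> W [?I] uu [] = W [] uu [?I]"
    using slide_inv[of "und ?I" uu] by (simp add: und und_si)
  have c1': "W [?I] ui [] \<bullet> W [] (cc ?I ?I) [] = W [] ui [?I]"
    using arg_cong[OF c1, of "\<lambda>s. W [?I] ui [] \<bullet> s \<bullet> W [] ui [?I]"] by simp
  have c2': "W [] ui [?I] \<bullet> W [] (cc ?I ?I) [] = W [?I] ui []"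
    using arg_cong[OF c2, of "\<lambda>s. W [] ui [?I] \<bullet> s \<bullet> W [?I] ui []"] by simp
  have l: "hat (Lunit A ?I) = W [] ui [?I] \<bullet> mi ?I ?I" by (simp add: hat_Lunit)
  have "W [] (tw ?I) [] \<bullet> W [] ui [?I] = W [] (tw ?I \<bullet> hat (Lunit A ?I)) [] \<bullet> W [] (mm ?I ?I) []"
    by (simp add: l)
  also have "\<dots> = W [] ui [?I] \<bullet> W [] (mi ?I ?I) [] \<bullet> W [] (tw (?I \<star> ?I) \<bullet> mm ?I ?I) []"
    using tw_natural[of "Lunit A ?I"] by (simp add: l)
  also have "\<dots> = W [] ui [?I] \<bullet> W [] (cc ?I ?I) [] \<bullet> W [] (cc ?I ?I) [] \<bullet> W [] (tw ?I) [?I] \<bullet> W [?I] (tw ?I) []"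
    unfolding tw_ten[OF unit_closed unit_closed] by simp
  also have "\<dots> = (W [?I] ui [] \<bullet> W [] (cc ?I ?I) []) \<bullet> W [] (tw ?I) [?I] \<bullet> W [?I] (tw ?I) []"
    unfolding c2'[symmetric] by simp
  also have "\<dots> = W [] ui [?I] \<bullet> W [] (tw ?I) [?I] \<bullet> W [?I] (tw ?I) []" unfolding c1' by simp
  finally have a: "W [] (tw ?I) [] \<bullet> W [] ui [?I] = W [] ui [?I] \<bullet> W [] (tw ?I) [?I] \<bullet> W [?I] (tw ?I) []" .
  have i: "W [] (tw ?I) [] \<bullet> W [] ui [?I] = W [] ui [?I] \<bullet> W [?I] (tw ?I) []"
    using interchange_s[of ui "tw ?I" "[]" "[]" "[]"] by simp
  have b: "W [] ui [?I] = W [] ui [?I] \<bullet> W [] (tw ?I) [?I]"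
    using arg_cong[OF a[unfolded i], of "\<lambda>s. s \<bullet> W [?I] (ti ?I) []"] by simp
  have j: "W [] (tw ?I) [?I] \<bullet> W [?I] uu [] = W [?I] uu [] \<bullet> W [] (tw ?I) []"
    "W [] ui [?I] \<bullet> W [?I] uu [] = uu \<bullet> ui"
    using interchange_s[of "tw ?I" uu "[]" "[]" "[]"] interchange_s[of ui uu "[]" "[]" "[]"] by (simp_all add: W_Nil)
  have "uu \<bullet> ui = (W [] ui [?I] \<bullet> W [] (tw ?I) [?I]) \<bullet> W [?I] uu []" unfolding b[symmetric] j ..
  also have "\<dots> = (W [] ui [?I] \<bullet> W [?I] uu []) \<bullet> W [] (tw ?I) []" by (simp add: j(1))
  also have "\<dots> = tw ?I" unfolding j(2) by (simp add: W_Nil)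
  finally show ?thesis by simp
qed

text \<open>
  The cap \<open>X X\<^sup>* \<rightarrow> \<one>\<close> of the pivotal structure in terms of twist and braiding (\<open>rep_pivotal_ev\<close>), and the
  matching cup \<open>\<one> \<rightarrow> X\<^sup>* X\<close>.
\<close>

definition sp :: "'o \<Rightarrow> ('o, 'm) diagram" where
  "sp X = ev X \<bullet> cc X (Ldual A X) \<bullet> W [] (tw X) [Ldual A X]"

definition sc :: "'o \<Rightarrow> ('o, 'm) diagram" where
  "sc X = W [Ldual A X] (ti X) [] \<bullet> ci (Ldual A X) X \<bullet> co X"

lemma sp_sc_typing [simp]: "X \<in> Obj A \<Longrightarrow> sarr (sp X)" "X \<in> Obj A \<Longrightarrow> sdom (sp X) = [X, Ldual A X]"
  "X \<in> Obj A \<Longrightarrow> scod (sp X) = []" "X \<in> Obj A \<Longrightarrow> sarr (sc X)" "X \<in> Obj A \<Longrightarrow> sdom (sc X) = []"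
  "X \<in> Obj A \<Longrightarrow> scod (sc X) = [Ldual A X, X]"
  by (simp_all add: sp_def sc_def)

text \<open>
  Substituting the Drinfeld isomorphism leaves a zigzag on the dual of \<open>X\<close>, which straightens.
\<close>

lemma rep_pivotal_ev:
  assumes [simp]: "X \<in> Obj A"
  shows "rep (pivotal_ev A X) (uu \<bullet> sp X \<bullet> mi X (Ldual A X))"
proof -
  let ?X' = "Ldual A X" let ?E = "Ldual A ?X'"
  have z: "W [] (ev ?X') [] \<bullet> W [] (ev X) [?E, ?X'] \<bullet> W [] (cc X ?X') [?E, ?X'] \<bullet> W [X] (co ?X') [?X'] \<bullet> t
    = W [] (ev X) [] \<bullet> W [] (cc X ?X') [] \<bullet> t" if "sarr t" "scod t = [X, ?X']" for t
  proof -
    define M where "M = ev X \<bullet> cc X ?X'"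
    have [simp]: "sarr M" "sdom M = [X, ?X']" "scod M = []" by (simp_all add: M_def)
    have "W [] (ev ?X') [] \<bullet> W [] M [?E, ?X'] = W [] M [] \<bullet> W [X, ?X'] (ev ?X') []"
      using interchange_s[of M "ev ?X'" "[]" "[]" "[]"] by simp
    from arg_cong[OF this, of "\<lambda>s. s \<bullet> W [X] (co ?X') [?X'] \<bullet> t"] show ?thesis
      using that zigzag_rules[of ?X'] by (simp add: M_def)
  qed
  show ?thesis unfolding pivotal_ev_def pivotal_iso_def drinfeld_iso_def Let_def
    by (rule rep_via, (rule reps rep_Twist rep_Ev rep_Coev rep_Braid | (simp; fail))+)
      (rule wrapI, simp_all add: sp_def z)
qed

text \<open>
  The pivotal cap and cup are a cap and cup for a right dual: twist and inverse twist cancel after the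
  two crossings have been pulled apart.
\<close>

lemma twist_zigzag:
  assumes [simp]: "X \<in> Obj A"
  shows "W [] (sp X) [X] \<bullet> W [X] (sc X) [] = ide [X]"
proof -
  let ?X' = "Ldual A X"
  have a: "W [?X'] (cc X X) [] \<bullet> W [] (cc X ?X') [X] \<bullet> W [X] (ci ?X' X) [] \<bullet> W [X] (co X) [] = W [] (ci ?X' X) [X] \<bullet> W [] (co X) [X]"
    using slide_inv[of "und X" "ci ?X' X \<bullet> co X"] by (simp add: und und_si)
  have a': "W [] (cc X ?X') [X] \<bullet> W [X] (ci ?X' X) [] \<bullet> W [X] (co X) [] = W [?X'] (ci X X) [] \<bullet> W [] (ci ?X' X) [X] \<bullet> W [] (co X) [X]"
    using arg_cong[OF a, of "\<lambda>s. W [?X'] (ci X X) [] \<bullet> s"] by simp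
  have b: "W [X] (ev X) [] = W [] (ev X) [X] \<bullet> W [?X'] (ci X X) [] \<bullet> W [] (ci ?X' X) [X]"
    using slide_inv[of "ovr X" "ev X"] by (simp add: ovr ovr_si)
  have k: "W [] (ev X) [X] \<bullet> W [] (cc X ?X') [X] \<bullet> W [X] (ci ?X' X) [] \<bullet> W [X] (co X) [] = ide [X]"
  proof -
    have "W [] (ev X) [X] \<bullet> W [] (cc X ?X') [X] \<bullet> W [X] (ci ?X' X) [] \<bullet> W [X] (co X) []
      = (W [] (ev X) [X] \<bullet> W [?X'] (ci X X) [] \<bullet> W [] (ci ?X' X) [X]) \<bullet> W [] (co X) [X]"
      unfolding a' by simp
    also have "\<dots> = ide [X]" unfolding b[symmetric] using zigzag by simp
    finally show ?thesis .
  qed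
  define M where "M = ci ?X' X \<bullet> co X"
  define E where "E = ev X \<bullet> cc X ?X'"
  have [simp]: "sarr M" "sdom M = []" "scod M = [?X', X]" "sarr E" "sdom E = [X, ?X']" "scod E = []"
    by (simp_all add: M_def E_def)
  have "W [] (sp X) [X] \<bullet> W [X] (sc X) []
    = W [] E [X] \<bullet> (W [] (tw X) [?X', X] \<bullet> W [X, ?X'] (ti X) []) \<bullet> W [X] M []"
    by (simp add: sp_def sc_def E_def M_def)
  also have "W [] (tw X) [?X', X] \<bullet> W [X, ?X'] (ti X) [] = W [X, ?X'] (ti X) [] \<bullet> W [] (tw X) [?X', X]"
    using interchange_s[of "tw X" "ti X" "[]" "[?X']" "[]"] by simp
  also have "W [] E [X] \<bullet> (W [X, ?X'] (ti X) [] \<bullet> W [] (tw X) [?X', X]) \<bullet> W [X] M []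
    = (W [] E [X] \<bullet> W [X, ?X'] (ti X) []) \<bullet> (W [] (tw X) [?X', X] \<bullet> W [X] M [])" by simp
  also have "W [] E [X] \<bullet> W [X, ?X'] (ti X) [] = W [] (ti X) [] \<bullet> W [] E [X]"
    using interchange_s[of E "ti X" "[]" "[]" "[]"] by simp
  also have "W [] (tw X) [?X', X] \<bullet> W [X] M [] = W [X] M [] \<bullet> W [] (tw X) []"
    using interchange_s[of "tw X" M "[]" "[]" "[]"] by simp
  also have "(W [] (ti X) [] \<bullet> W [] E [X]) \<bullet> W [X] M [] \<bullet> W [] (tw X) []
    = W [] (ti X) [] \<bullet> (W [] E [X] \<bullet> W [X] M []) \<bullet> W [] (tw X) []" by simp
  also have "W [] E [X] \<bullet> W [X] M [] = ide [X]" using k by (simp add: E_def M_def)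
  finally show ?thesis by simp
qed

text \<open>
  This is the compatibility of the twist with duals: it may be moved through a cap.
\<close>

lemma ev_twist:
  assumes [simp]: "X \<in> Obj A"
  shows "ev X \<bullet> W [] (tw (Ldual A X)) [X] = ev X \<bullet> W [Ldual A X] (tw X) []"
proof -
  let ?X' = "Ldual A X"
  define T where "T = W [] (ev X) [?X'] \<bullet> W [?X'] (tw X) [?X'] \<bullet> W [?X'] (co X) []"
  have [simp]: "sarr T" "sdom T = [?X']" "scod T = [?X']" by (simp_all add: T_def)
  have T: "tw ?X' = T"
    by (rule rep_elim[OF twist_dual[OF assms, unfolded ldual_mor_def]], (rule reps rep_Twist rep_Ev rep_Coev | (simp; fail))+)
     (simp add: T_def)
  define E where "E = ev X \<bullet> W [?X'] (tw X) []"
  have [simp]: "sarr E" "sdom E = [?X', X]" "scod E = []" by (simp_all add: E_def)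
  have "W [] (ev X) [] \<bullet> W [] T [X] = W [] (ev X) [] \<bullet> W [] E [?X', X] \<bullet> W [?X'] (co X) [X]"
    by (simp add: T_def E_def)
  also have "\<dots> = (W [] (ev X) [] \<bullet> W [] E [?X', X]) \<bullet> W [?X'] (co X) [X]" by simp
  also have "W [] (ev X) [] \<bullet> W [] E [?X', X] = W [] E [] \<bullet> W [?X', X] (ev X) []"
    using interchange_s[of E "ev X" "[]" "[]" "[]"] by simp
  also have "(W [] E [] \<bullet> W [?X', X] (ev X) []) \<bullet> W [?X'] (co X) [X] = W [] E []"
    using zigzag_rules[of X] by simp
  finally show ?thesis unfolding T by (simp add: W_Nil E_def)
qed

text \<open>
  Left and right traces of the identity agree.  The twist of \<open>\<one>\<close> is trivial, so the double braiding under the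
  evaluation is the inverse twist on both strands, and both can be moved to the same strand.
\<close>

lemma spherical:
  assumes [simp]: "X \<in> Obj A"
  shows "sp X \<bullet> co X = ev X \<bullet> sc X"
proof -
  let ?X' = "Ldual A X"
  have h: "hat (Ev A X) = uu \<bullet> ev X \<bullet> mi ?X' X" using rep_Ev[OF assms] by (simp add: rep_def)
  have "arr (Ev A X)" "src (Ev A X) = ?X' \<star> X" "tgt (Ev A X) = Unit A"
    using left_dual[OF assms] by (auto simp: is_left_dual_def Mor_iff)
  then have "hat (Ev A X) \<bullet> tw (?X' \<star> X) = hat (Ev A X)"
    using tw_natural[of "Ev A X"] by (simp add: tw_unit)
  from arg_cong[OF this[unfolded h], of "\<lambda>s. ui \<bullet> s \<bullet> mm ?X' X"]
  have "ev X \<bullet> mi ?X' X \<bullet> (tw (?X' \<star> X) \<bullet> mm ?X' X) = ev X" by simp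
  then have a: "ev X \<bullet> cc X ?X' \<bullet> cc ?X' X \<bullet> W [] (tw ?X') [X] \<bullet> W [?X'] (tw X) [] = ev X"
    unfolding tw_ten[OF Ldual_closed[OF assms] assms] by simp
  have e: "ev X \<bullet> W [] (ti ?X') [X] = ev X \<bullet> W [?X'] (ti X) []"
  proof -
    have i: "W [] (ti ?X') [X] \<bullet> W [?X'] (ti X) [] = W [?X'] (ti X) [] \<bullet> W [] (ti ?X') [X]"
      using interchange_s[of "ti ?X'" "ti X" "[]" "[]" "[]"] by simp
    have "(ev X \<bullet> W [?X'] (tw X) []) \<bullet> W [] (ti ?X') [X] \<bullet> W [?X'] (ti X) [] = ev X \<bullet> W [] (ti ?X') [X]"
      unfolding i by simp
    moreover have "(ev X \<bullet> W [] (tw ?X') [X]) \<bullet> W [] (ti ?X') [X] \<bullet> W [?X'] (ti X) [] = ev X \<bullet> W [?X'] (ti X) []"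
      by simp
    ultimately show ?thesis unfolding ev_twist[OF assms] by simp
  qed
  have b: "ev X \<bullet> cc X ?X' \<bullet> cc ?X' X = ev X \<bullet> W [?X'] (ti X) [] \<bullet> W [?X'] (ti X) []"
  proof -
    have "ev X \<bullet> cc X ?X' \<bullet> cc ?X' X = (ev X \<bullet> cc X ?X' \<bullet> cc ?X' X \<bullet> W [] (tw ?X') [X] \<bullet> W [?X'] (tw X) []) \<bullet> W [?X'] (ti X) [] \<bullet> W [] (ti ?X') [X]"
      by simp
    also have "\<dots> = ev X \<bullet> W [?X'] (ti X) [] \<bullet> W [] (ti ?X') [X]" unfolding a by simp
    also have "W [?X'] (ti X) [] \<bullet> W [] (ti ?X') [X] = W [] (ti ?X') [X] \<bullet> W [?X'] (ti X) []"
      using interchange_s[of "ti ?X'" "ti X" "[]" "[]" "[]"] by simp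
    also have "ev X \<bullet> W [] (ti ?X') [X] \<bullet> W [?X'] (ti X) [] = (ev X \<bullet> W [] (ti ?X') [X]) \<bullet> W [?X'] (ti X) []" by simp
    finally show ?thesis unfolding e by simp
  qed
  have n: "W [] (ci ?X' X) [] \<bullet> W [] (tw X) [?X'] = W [?X'] (tw X) [] \<bullet> W [] (ci ?X' X) []"
    using slide[of "und ?X'" "tw X"] by (simp add: und)
  have "W [] (sp X) [] = W [] (ev X \<bullet> cc X ?X' \<bullet> cc ?X' X) [] \<bullet> W [] (ci ?X' X) [] \<bullet> W [] (tw X) [?X']"
    by (simp add: sp_def)
  also have "\<dots> = W [] (ev X) [] \<bullet> W [?X'] (ti X) [] \<bullet> W [] (ci ?X' X) []"
    unfolding b n by simp
  finally have "W [] (sp X) [] \<bullet> W [] (co X) [] = W [] (ev X) [] \<bullet> W [] (sc X) []" by (simp add: sc_def)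
  then show ?thesis by (simp add: W_Nil)
qed

section \<open>Loops around an object with two half-braidings\<close>

text \<open>
  A loop coloured by \<open>i\<close> is created on the left of the strand \<open>Z\<close>; its right end crosses \<open>Z\<close> by \<open>\<tau>\<close>, its left
  end by \<open>\<sigma>\<close>, and the loop closes on the right.
\<close>

definition loop_diagram :: "('o, 'm) centre_obj \<Rightarrow> ('o, 'm) centre_obj \<Rightarrow> 'o \<Rightarrow> ('o, 'm) diagram" where
  "loop_diagram \<sigma> \<tau> i = W [fst \<sigma>] (sp i) [] \<bullet> W [] (sb \<sigma> i) [Ldual A i] \<bullet> W [i] (sb \<tau> (Ldual A i)) [] \<bullet> W [] (co i) [fst \<tau>]"

lemma loop_diagram_typing [simp]:
  assumes "\<sigma> \<in> ZO" "\<tau> \<in> ZO" "fst \<tau> = fst \<sigma>" "i \<in> Obj A"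
  shows "sarr (loop_diagram \<sigma> \<tau> i)" "sdom (loop_diagram \<sigma> \<tau> i) = [fst \<sigma>]" "scod (loop_diagram \<sigma> \<tau> i) = [fst \<sigma>]"
  using assms by (simp_all add: loop_diagram_def)

definition loop :: "('o, 'm) centre_obj \<Rightarrow> ('o, 'm) centre_obj \<Rightarrow> 'o \<Rightarrow> 'm" where
  "loop \<sigma> \<tau> i = (let Z = fst \<sigma>; i' = Ldual A i in
     Runit A Z \<cdot> (Id A Z \<boxtimes> pivotal_ev A i) \<cdot> Assoc A Z i i' \<cdot> (snd \<sigma> i \<boxtimes> Id A i') \<cdot> Assoc_inv A i Z i' \<cdot>
     (Id A i \<boxtimes> snd \<tau> i') \<cdot> Assoc A i i' Z \<cdot> (Coev A i \<boxtimes> Id A Z) \<cdot> Lunit_inv A Z)"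

lemma rep_loop:
  assumes "\<sigma> \<in> ZO" "\<tau> \<in> ZO" "fst \<tau> = fst \<sigma>" "i \<in> Obj A"
  shows "rep (loop \<sigma> \<tau> i) (loop_diagram \<sigma> \<tau> i)"
proof -
  note [simp] = assms
  have r: "rep (snd \<tau> B) (mm (fst \<sigma>) B \<bullet> sb \<tau> B \<bullet> mi B (fst \<sigma>))" if "B \<in> Obj A" for B
    using rep_sb[OF assms(2) that] by simp
  show ?thesis unfolding loop_def Let_def
    by (rule rep_via, (rule reps rep_pivotal_ev rep_Coev rep_sb[OF assms(1)] r | (simp; fail))+)
      (simp add: loop_diagram_def)
qed

text \<open>
  The condition says that the crossings \<open>\<rho>\<^sub>B\<close> and \<open>\<sigma>\<^sub>i\<close>, where \<open>\<kappa>\<close> is a half-braiding on \<open>B\<close>, may be exchanged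
  by means of the crossing \<open>\<kappa>\<^sub>i\<close>.
\<close>

definition pass :: "('o, 'm) centre_obj \<Rightarrow> ('o, 'm) centre_obj \<Rightarrow> ('o, 'm) centre_obj \<Rightarrow> 'o \<Rightarrow> bool" where
  "pass \<kappa> \<rho> \<sigma> i \<longleftrightarrow>
     W [] (sb \<rho> (fst \<kappa>)) [i] \<bullet> W [fst \<kappa>] (sb \<sigma> i) [] \<bullet> W [] (sb \<kappa> i) [fst \<sigma>]
     = W [fst \<rho>] (sb \<kappa> i) [] \<bullet> W [] (sb \<sigma> i) [fst \<kappa>] \<bullet> W [i] (sb \<rho> (fst \<kappa>)) []"

lemma pass_self: "\<sigma> \<in> ZO \<Longrightarrow> \<kappa> \<in> ZO \<Longrightarrow> i \<in> Obj A \<Longrightarrow> pass \<kappa> \<sigma> \<sigma> i"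
  unfolding pass_def using slide[of \<sigma> "sb \<kappa> i"] by simp

text \<open>
  If both ends of the loop can be exchanged with the crossing \<open>\<rho>\<^sub>B\<close> by the same \<open>\<kappa>\<close>, the loop moves through it:
  the two crossings of the loop with \<open>B\<close> that arise cancel at cup and cap.
\<close>

lemma loop_commutes:
  assumes [simp]: "\<sigma> \<in> ZO" "\<tau> \<in> ZO" "\<rho> \<in> ZO" "\<kappa> \<in> ZO" "fst \<tau> = fst \<sigma>" "fst \<rho> = fst \<sigma>" "i \<in> Obj A"
    and p: "pass \<kappa> \<rho> \<sigma> i" "pass \<kappa> \<rho> \<tau> (Ldual A i)"
  shows "W [] (sb \<rho> (fst \<kappa>)) [] \<bullet> W [fst \<kappa>] (loop_diagram \<sigma> \<tau> i) [] = W [] (loop_diagram \<sigma> \<tau> i) [fst \<kappa>] \<bullet> W [] (sb \<rho> (fst \<kappa>)) []"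
proof -
  let ?B = "fst \<kappa>" let ?Z = "fst \<sigma>" let ?i' = "Ldual A i"
  have c1: "W [] (sb \<rho> ?B) [i, ?i'] \<bullet> W [?B] (sb \<sigma> i) [?i'] = W [?Z] (sb \<kappa> i) [?i'] \<bullet> W [] (sb \<sigma> i) [?B, ?i'] \<bullet> W [i] (sb \<rho> ?B) [?i'] \<bullet> W [] (si \<kappa> i) [?Z, ?i']"
    using arg_cong[OF ctx_rules(5)[OF p(1)[unfolded pass_def], of "[?i']", simplified ctx_simps], of "\<lambda>s. s \<bullet> W [] (si \<kappa> i) [?Z, ?i']"] by simp
  have c2: "W [i] (sb \<rho> ?B) [?i'] \<bullet> W [i, ?B] (sb \<tau> ?i') [] \<bullet> W [i] (sb \<kappa> ?i') [?Z] = W [i, ?Z] (sb \<kappa> ?i') [] \<bullet> W [i] (sb \<tau> ?i') [?B] \<bullet> W [i, ?i'] (sb \<rho> ?B) []"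
    using ctx_rules(6)[OF p(2)[unfolded pass_def], of i "[]", simplified ctx_simps] by simp
  have s1: "W [] (co i) [?B] = W [i] (si \<kappa> ?i') [] \<bullet> W [] (si \<kappa> i) [?i'] \<bullet> W [?B] (co i) []"
    using slide_inv[of \<kappa> "co i"] by simp
  have s1': "W [] (si \<kappa> i) [?i', ?Z] \<bullet> W [?B] (co i) [?Z] = W [i] (sb \<kappa> ?i') [?Z] \<bullet> W [] (co i) [?B, ?Z]"
    using arg_cong[OF ctx_rules(5)[OF s1, of "[?Z]", simplified ctx_simps], of "\<lambda>s. W [i] (sb \<kappa> ?i') [?Z] \<bullet> s"] by simp
  have s2: "W [?Z, ?B] (sp i) [] \<bullet> W [?Z] (sb \<kappa> i) [?i'] \<bullet> W [?Z, i] (sb \<kappa> ?i') [] = W [?Z] (sp i) [?B]"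
    using ctx_rules(6)[OF slide[of \<kappa> "sp i"], of ?Z "[]", simplified ctx_simps] by simp
  have "W [] (sb \<rho> ?B) [] \<bullet> W [?B] (loop_diagram \<sigma> \<tau> i) [] = (W [] (sb \<rho> ?B) [] \<bullet> W [?B, ?Z] (sp i) []) \<bullet> W [?B] (sb \<sigma> i) [?i'] \<bullet> W [?B, i] (sb \<tau> ?i') [] \<bullet> W [?B] (co i) [?Z]"
    by (simp add: loop_diagram_def)
  also have "W [] (sb \<rho> ?B) [] \<bullet> W [?B, ?Z] (sp i) [] = W [?Z, ?B] (sp i) [] \<bullet> W [] (sb \<rho> ?B) [i, ?i']"
    using interchange_s[of "sb \<rho> ?B" "sp i" "[]" "[]" "[]"] by simp
  also have "(W [?Z, ?B] (sp i) [] \<bullet> W [] (sb \<rho> ?B) [i, ?i']) \<bullet> W [?B] (sb \<sigma> i) [?i'] \<bullet> W [?B, i] (sb \<tau> ?i') [] \<bullet> W [?B] (co i) [?Z]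
    = W [?Z, ?B] (sp i) [] \<bullet> (W [] (sb \<rho> ?B) [i, ?i'] \<bullet> W [?B] (sb \<sigma> i) [?i']) \<bullet> W [?B, i] (sb \<tau> ?i') [] \<bullet> W [?B] (co i) [?Z]" by simp
  also have "\<dots> = W [?Z, ?B] (sp i) [] \<bullet> W [?Z] (sb \<kappa> i) [?i'] \<bullet> W [] (sb \<sigma> i) [?B, ?i'] \<bullet> W [i] (sb \<rho> ?B) [?i'] \<bullet> (W [] (si \<kappa> i) [?Z, ?i'] \<bullet> W [?B, i] (sb \<tau> ?i') []) \<bullet> W [?B] (co i) [?Z]"
    unfolding c1 by simp
  also have "W [] (si \<kappa> i) [?Z, ?i'] \<bullet> W [?B, i] (sb \<tau> ?i') [] = W [i, ?B] (sb \<tau> ?i') [] \<bullet> W [] (si \<kappa> i) [?i', ?Z]"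
    using interchange_s[of "si \<kappa> i" "sb \<tau> ?i'" "[]" "[]" "[]"] by simp
  also have "W [?Z, ?B] (sp i) [] \<bullet> W [?Z] (sb \<kappa> i) [?i'] \<bullet> W [] (sb \<sigma> i) [?B, ?i'] \<bullet> W [i] (sb \<rho> ?B) [?i'] \<bullet> (W [i, ?B] (sb \<tau> ?i') [] \<bullet> W [] (si \<kappa> i) [?i', ?Z]) \<bullet> W [?B] (co i) [?Z]
    = W [?Z, ?B] (sp i) [] \<bullet> W [?Z] (sb \<kappa> i) [?i'] \<bullet> W [] (sb \<sigma> i) [?B, ?i'] \<bullet> (W [i] (sb \<rho> ?B) [?i'] \<bullet> W [i, ?B] (sb \<tau> ?i') [] \<bullet> W [i] (sb \<kappa> ?i') [?Z]) \<bullet> W [] (co i) [?B, ?Z]"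
    by (simp add: s1')
  also have "\<dots> = W [?Z, ?B] (sp i) [] \<bullet> W [?Z] (sb \<kappa> i) [?i'] \<bullet> (W [] (sb \<sigma> i) [?B, ?i'] \<bullet> W [i, ?Z] (sb \<kappa> ?i') []) \<bullet> W [i] (sb \<tau> ?i') [?B] \<bullet> W [i, ?i'] (sb \<rho> ?B) [] \<bullet> W [] (co i) [?B, ?Z]"
    unfolding c2 by simp
  also have "W [] (sb \<sigma> i) [?B, ?i'] \<bullet> W [i, ?Z] (sb \<kappa> ?i') [] = W [?Z, i] (sb \<kappa> ?i') [] \<bullet> W [] (sb \<sigma> i) [?i', ?B]"
    using interchange_s[of "sb \<sigma> i" "sb \<kappa> ?i'" "[]" "[]" "[]"] by simp
  also have "W [i, ?i'] (sb \<rho> ?B) [] \<bullet> W [] (co i) [?B, ?Z] = W [] (co i) [?Z, ?B] \<bullet> W [] (sb \<rho> ?B) []"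
    using interchange_s[of "co i" "sb \<rho> ?B" "[]" "[]" "[]"] by simp
  also have "W [?Z, ?B] (sp i) [] \<bullet> W [?Z] (sb \<kappa> i) [?i'] \<bullet> (W [?Z, i] (sb \<kappa> ?i') [] \<bullet> W [] (sb \<sigma> i) [?i', ?B]) \<bullet> W [i] (sb \<tau> ?i') [?B] \<bullet> W [] (co i) [?Z, ?B] \<bullet> W [] (sb \<rho> ?B) []
    = (W [?Z, ?B] (sp i) [] \<bullet> W [?Z] (sb \<kappa> i) [?i'] \<bullet> W [?Z, i] (sb \<kappa> ?i') []) \<bullet> W [] (sb \<sigma> i) [?i', ?B] \<bullet> W [i] (sb \<tau> ?i') [?B] \<bullet> W [] (co i) [?Z, ?B] \<bullet> W [] (sb \<rho> ?B) []" by simp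
  also have "\<dots> = W [] (loop_diagram \<sigma> \<tau> i) [?B] \<bullet> W [] (sb \<rho> ?B) []"
    unfolding s2 by (simp add: loop_diagram_def)
  finally show ?thesis .
qed

text \<open>
  The two half-braidings commute up to a braiding.  This is the relation between \<open>\<gamma> \<otimes> c\<^sup>-\<^sup>1\<close> and \<open>c \<otimes> \<mu>\<close> that makes the
  idempotent of the reduced tensor product commute with both of them.
\<close>

definition comm :: "('o, 'm) centre_obj \<Rightarrow> ('o, 'm) centre_obj \<Rightarrow> bool" where
  "comm \<sigma> \<tau> \<longleftrightarrow> (\<forall>B \<in> Obj A. \<forall>C \<in> Obj A.
     W [] (sb \<sigma> C) [B] \<bullet> W [C] (sb \<tau> B) [] \<bullet> W [] (cc B C) [fst \<tau>] = W [fst \<sigma>] (cc B C) [] \<bullet> W [] (sb \<tau> B) [C] \<bullet> W [B] (sb \<sigma> C) [])"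

text \<open>
  A loop moves through \<open>\<sigma>\<^sub>B\<close> on one side of \<open>B\<close> and through \<open>\<tau>\<^sub>B\<close> on the other side.
\<close>

lemma comm_pass:
  assumes [simp]: "\<sigma> \<in> ZO" "\<tau> \<in> ZO" "fst \<tau> = fst \<sigma>" "B \<in> Obj A" "i \<in> Obj A" and c: "comm \<sigma> \<tau>"
  shows "pass (ovr B) \<sigma> \<tau> i" "pass (und B) \<tau> \<sigma> i"
proof -
  let ?Z = "fst \<sigma>"
  have a: "W [] (sb \<sigma> C) [B] \<bullet> W [C] (sb \<tau> B) [] \<bullet> W [] (cc B C) [?Z] = W [?Z] (cc B C) [] \<bullet> W [] (sb \<tau> B) [C] \<bullet> W [B] (sb \<sigma> C) []"
    if "B \<in> Obj A" "C \<in> Obj A" for B C using c that unfolding comm_def by simp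
  show "pass (ovr B) \<sigma> \<tau> i" unfolding pass_def using a[of i B] by (simp add: ovr)
  show "pass (und B) \<tau> \<sigma> i" unfolding pass_def
    using arg_cong[OF a[of B i], of "\<lambda>s. W [?Z] (ci B i) [] \<bullet> s \<bullet> W [] (ci B i) [?Z]"] by (simp add: und)
qed

text \<open>
  The half-braiding \<open>\<gamma>\<close> and the braiding with \<open>X\<close> satisfy the relation because \<open>\<gamma>\<close> slides past braidings; the same
  holds for \<open>\<mu>\<close> and the strand \<open>Y\<close>; and crossings of \<open>X\<close> and of \<open>Y\<close> commute.
\<close>

lemma comm_tens:
  assumes [simp]: "V \<in> ZO" "T \<in> ZO"
  shows "comm (tens V (und (fst T))) (tens (ovr (fst V)) T)"
  unfolding comm_def
proof (intro ballI)
  fix B C assume [simp]: "B \<in> Obj A" "C \<in> Obj A"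
  let ?X = "fst V" let ?Y = "fst T"
  have v: "W [] (sb V C) [B] \<bullet> W [C] (cc B ?X) [] \<bullet> W [] (cc B C) [?X] = W [?X] (cc B C) [] \<bullet> W [] (cc B ?X) [C] \<bullet> W [B] (sb V C) []"
    using slide_inv[of "und B" "sb V C"] by (simp add: und und_si)
  have t: "W [] (cc ?Y C) [B] \<bullet> W [?Y] (cc B C) [] \<bullet> W [] (sb T B) [C] = W [C] (sb T B) [] \<bullet> W [] (cc B C) [?Y] \<bullet> W [B] (cc ?Y C) []"
    using slide[of "ovr C" "sb T B"] by (simp add: ovr)
  have t': "W [] (ci ?Y C) [B] \<bullet> W [C] (sb T B) [] \<bullet> W [] (cc B C) [?Y] = W [?Y] (cc B C) [] \<bullet> W [] (sb T B) [C] \<bullet> W [B] (ci ?Y C) []"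
    using arg_cong[OF t, of "\<lambda>s. W [] (ci ?Y C) [B] \<bullet> s \<bullet> W [B] (ci ?Y C) []"] by simp
  note v' = ctx_rules[OF v, simplified ctx_simps] and t'' = ctx_rules[OF t', simplified ctx_simps]
  show "W [] (sb (tens V (und ?Y)) C) [B] \<bullet> W [C] (sb (tens (ovr ?X) T) B) [] \<bullet> W [] (cc B C) [fst (tens (ovr ?X) T)] =
    W [fst (tens V (und ?Y))] (cc B C) [] \<bullet> W [] (sb (tens (ovr ?X) T) B) [C] \<bullet> W [B] (sb (tens V (und ?Y)) C) []"
    (is "?l = ?r")
  proof -
    let ?m = "mm ?X ?Y" let ?n = "mi ?X ?Y"
    have "?l = W [] ?m [C, B] \<bullet> W [?X] (ci ?Y C) [B] \<bullet> (W [] (sb V C) [?Y, B] \<bullet> W [C, ?X] (sb T B) []) \<bullet> W [C] (cc B ?X) [?Y] \<bullet> (W [C, B] ?n [] \<bullet> W [] (cc B C) [?X \<star> ?Y])"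
      by (simp add: tens ovr und tens_sb_def)
    also have "W [] (sb V C) [?Y, B] \<bullet> W [C, ?X] (sb T B) [] = W [?X, C] (sb T B) [] \<bullet> W [] (sb V C) [B, ?Y]"
      using interchange_s[of "sb V C" "sb T B" "[]" "[]" "[]"] by simp
    also have "W [C, B] ?n [] \<bullet> W [] (cc B C) [?X \<star> ?Y] = W [] (cc B C) [?X, ?Y] \<bullet> W [B, C] ?n []"
      using interchange_s[of "cc B C" ?n "[]" "[]" "[]"] by simp
    also have "W [] ?m [C, B] \<bullet> W [?X] (ci ?Y C) [B] \<bullet> (W [?X, C] (sb T B) [] \<bullet> W [] (sb V C) [B, ?Y]) \<bullet> W [C] (cc B ?X) [?Y] \<bullet> W [] (cc B C) [?X, ?Y] \<bullet> W [B, C] ?n []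
      = W [] ?m [C, B] \<bullet> (W [?X] (ci ?Y C) [B] \<bullet> W [?X, C] (sb T B) [] \<bullet> W [?X] (cc B C) [?Y]) \<bullet> W [] (cc B ?X) [C, ?Y] \<bullet> W [B] (sb V C) [?Y] \<bullet> W [B, C] ?n []"
      using v' by simp
    also have "\<dots> = W [] ?m [C, B] \<bullet> W [?X, ?Y] (cc B C) [] \<bullet> W [?X] (sb T B) [C] \<bullet> (W [?X, B] (ci ?Y C) [] \<bullet> W [] (cc B ?X) [C, ?Y]) \<bullet> W [B] (sb V C) [?Y] \<bullet> W [B, C] ?n []"
      using t'' by simp
    also have "W [?X, B] (ci ?Y C) [] \<bullet> W [] (cc B ?X) [C, ?Y] = W [] (cc B ?X) [?Y, C] \<bullet> W [B, ?X] (ci ?Y C) []"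
      using interchange_s[of "cc B ?X" "ci ?Y C" "[]" "[]" "[]"] by simp
    also have "W [] ?m [C, B] \<bullet> W [?X, ?Y] (cc B C) [] \<bullet> W [?X] (sb T B) [C] \<bullet> (W [] (cc B ?X) [?Y, C] \<bullet> W [B, ?X] (ci ?Y C) []) \<bullet> W [B] (sb V C) [?Y] \<bullet> W [B, C] ?n []
      = (W [] ?m [C, B] \<bullet> W [?X, ?Y] (cc B C) []) \<bullet> W [?X] (sb T B) [C] \<bullet> W [] (cc B ?X) [?Y, C] \<bullet> W [B, ?X] (ci ?Y C) [] \<bullet> W [B] (sb V C) [?Y] \<bullet> W [B, C] ?n []" by simp
    also have "W [] ?m [C, B] \<bullet> W [?X, ?Y] (cc B C) [] = W [?X \<star> ?Y] (cc B C) [] \<bullet> W [] ?m [B, C]"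
      using interchange_s[of ?m "cc B C" "[]" "[]" "[]"] by simp
    finally show ?thesis by (simp add: tens ovr und tens_sb_def)
  qed
qed

text \<open>
  The summand of \<open>Q\<close> crosses \<open>X\<close> and \<open>Y\<close> from between.  Pulling the cup to the left through \<open>X\<close> and the cap to the
  right through \<open>Y\<close> turns it into a loop around \<open>X \<star> Y\<close>.
\<close>

lemma rep_Q_term:
  assumes [simp]: "V \<in> ZO" "T \<in> ZO" "i \<in> Obj A"
  shows "rep (Q_term A V T i) (loop_diagram (tens V (und (fst T))) (tens (ovr (fst V)) T) i)"
proof -
  let ?X = "fst V" let ?Y = "fst T" let ?i' = "Ldual A i"
  have e: "Q_term A V T i = (Id A ?X \<boxtimes> Lunit A ?Y) \<cdot> (Id A ?X \<boxtimes> (pivotal_ev A i \<boxtimes> Id A ?Y)) \<cdot>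
     (Id A ?X \<boxtimes> Assoc_inv A i ?i' ?Y) \<cdot> Assoc A ?X i (?i' \<star> ?Y) \<cdot>
     ((snd V i \<cdot> Braid_inv A i ?X) \<boxtimes> (Braid A ?Y ?i' \<cdot> snd T ?i')) \<cdot>
     Assoc_inv A ?X i (?i' \<star> ?Y) \<cdot> (Id A ?X \<boxtimes> Assoc A i ?i' ?Y) \<cdot>
     (Id A ?X \<boxtimes> (Coev A i \<boxtimes> Id A ?Y)) \<cdot> (Id A ?X \<boxtimes> Lunit_inv A ?Y)"
    unfolding Q_term_def Let_def by (simp add: case_prod_beta)
  have s1: "W [i] (cc ?i' ?X) [] \<bullet> W [] (co i) [?X] = W [] (ci i ?X) [?i'] \<bullet> W [?X] (co i) []"
    using arg_cong[OF slide[of "ovr ?X" "co i"], of "\<lambda>s. W [] (ci i ?X) [?i'] \<bullet> s"] by (simp add: ovr)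
  have s2: "W [?Y] (sp i) [] \<bullet> W [] (ci ?Y i) [?i'] = W [] (sp i) [?Y] \<bullet> W [i] (cc ?Y ?i') []"
    using arg_cong[OF slide[of "und ?Y" "sp i"], of "\<lambda>s. s \<bullet> W [i] (cc ?Y ?i') []"] by (simp add: und)
  note s1' = ctx_rules[OF s1, simplified ctx_simps] and s2' = ctx_rules[OF s2, simplified ctx_simps]
  let ?m = "mm ?X ?Y" let ?n = "mi ?X ?Y"
  have i1: "W [i, ?i'] ?n [] \<bullet> W [] (co i) [?X \<star> ?Y] = W [] (co i) [?X, ?Y] \<bullet> W [] ?n []"
    using interchange_s[of "co i" ?n "[]" "[]" "[]"] by simp
  have i2: "W [?X \<star> ?Y] (sp i) [] \<bullet> W [] ?m [i, ?i'] \<bullet> t = W [] ?m [] \<bullet> W [?X, ?Y] (sp i) [] \<bullet> t" for t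
    using arg_cong[OF interchange_s[of ?m "sp i" "[]" "[]" "[]"], of "\<lambda>s. s \<bullet> t"] by simp
  have i3: "W [] (sb V i) [?Y, ?i'] \<bullet> W [i, ?X] (sb T ?i') [] \<bullet> t = W [?X, i] (sb T ?i') [] \<bullet> W [] (sb V i) [?i', ?Y] \<bullet> t" for t
    using arg_cong[OF interchange_s[of "sb V i" "sb T ?i'" "[]" "[]" "[]"], of "\<lambda>s. s \<bullet> t"] by simp
  have w: "W [] (loop_diagram (tens V (und ?Y)) (tens (ovr ?X) T) i) [] = W [] ?m [] \<bullet> W [?X] (sp i) [?Y] \<bullet> W [?X, i] (cc ?Y ?i') [] \<bullet> W [?X, i] (sb T ?i') [] \<bullet>
      W [] (sb V i) [?i', ?Y] \<bullet> W [] (ci i ?X) [?i', ?Y] \<bullet> W [?X] (co i) [?Y] \<bullet> W [] ?n []"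
    by (simp add: loop_diagram_def tens ovr und tens_sb_def i1 i2 i3 s1' s2')
  have p: "loop_diagram (tens V (und ?Y)) (tens (ovr ?X) T) i = ?m \<bullet> W [?X] (sp i) [?Y] \<bullet> W [?X, i] (cc ?Y ?i') [] \<bullet> W [?X, i] (sb T ?i') [] \<bullet>
      W [] (sb V i) [?i', ?Y] \<bullet> W [] (ci i ?X) [?i', ?Y] \<bullet> W [?X] (co i) [?Y] \<bullet> ?n"
    by (rule wrapI) (simp_all add: w tens ovr und)
  show ?thesis
    unfolding e p
    by (rule rep_via, (rule reps rep_pivotal_ev rep_Coev rep_sb rep_Braid rep_Braid_inv | (simp; fail))+)
      (simp, simp add: interchange_rule)
qed

text \<open>
  On a morphism that does not distinguish \<open>\<tau>\<close> from \<open>\<sigma>\<close>, both ends of the loop cross by \<open>\<sigma>\<close>; then the cup slides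
  through the strand and the loop comes off as a closed bubble.
\<close>

lemma loop_absorb:
  assumes [simp]: "\<sigma> \<in> ZO" "\<tau> \<in> ZO" "fst \<tau> = fst \<sigma>" "i \<in> Obj A" "sarr f" "scod f = [fst \<sigma>]"
    and e: "\<And>B. B \<in> Obj A \<Longrightarrow> W [] (sb \<tau> B) [] \<bullet> W [B] f [] = W [] (sb \<sigma> B) [] \<bullet> W [B] f []"
  shows "loop_diagram \<sigma> \<tau> i \<bullet> f = W [fst \<sigma>] (sp i \<bullet> co i) [] \<bullet> f"
proof -
  let ?Z = "fst \<sigma>" let ?i' = "Ldual A i"
  have c: "W [] (co i) [?Z] \<bullet> W [] f [] = W [i, ?i'] f [] \<bullet> W [] (co i) (sdom f)"
    using interchange_s[of "co i" f "[]" "[]" "[]"] by simp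
  have "W [] (loop_diagram \<sigma> \<tau> i \<bullet> f) [] = W [?Z] (sp i) [] \<bullet> W [] (sb \<sigma> i) [?i'] \<bullet> (W [i] (sb \<tau> ?i') [] \<bullet> W [i, ?i'] f []) \<bullet> W [] (co i) (sdom f)"
    by (simp add: loop_diagram_def c)
  also have "W [i] (sb \<tau> ?i') [] \<bullet> W [i, ?i'] f [] = W [i] (sb \<sigma> ?i') [] \<bullet> W [i, ?i'] f []"
    using ctx_rules(6)[OF e[of ?i'], of i "[]", simplified ctx_simps] by simp
  also have "W [?Z] (sp i) [] \<bullet> W [] (sb \<sigma> i) [?i'] \<bullet> (W [i] (sb \<sigma> ?i') [] \<bullet> W [i, ?i'] f []) \<bullet> W [] (co i) (sdom f)
    = W [?Z] (sp i) [] \<bullet> (W [] (sb \<sigma> i) [?i'] \<bullet> W [i] (sb \<sigma> ?i') [] \<bullet> W [] (co i) [?Z]) \<bullet> W [] f []"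
    by (simp add: c)
  also have "W [] (sb \<sigma> i) [?i'] \<bullet> W [i] (sb \<sigma> ?i') [] \<bullet> W [] (co i) [?Z] = W [?Z] (co i) []"
    using slide[of \<sigma> "co i"] by simp
  finally have "W [] (loop_diagram \<sigma> \<tau> i \<bullet> f) [] = W [] (W [?Z] (sp i \<bullet> co i) [] \<bullet> f) []" by simp
  then show ?thesis by (rule wrapI[rotated -1]) simp_all
qed

lemma loop_coabsorb:
  assumes [simp]: "\<sigma> \<in> ZO" "\<tau> \<in> ZO" "fst \<tau> = fst \<sigma>" "i \<in> Obj A" "sarr f" "sdom f = [fst \<sigma>]"
    and e: "\<And>B. B \<in> Obj A \<Longrightarrow> W [] f [B] \<bullet> W [] (sb \<tau> B) [] = W [] f [B] \<bullet> W [] (sb \<sigma> B) []"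
  shows "f \<bullet> loop_diagram \<sigma> \<tau> i = f \<bullet> W [fst \<sigma>] (sp i \<bullet> co i) []"
proof -
  let ?Z = "fst \<sigma>" let ?i' = "Ldual A i"
  have c: "W [] f [] \<bullet> W [?Z] (sp i) [] = W (scod f) (sp i) [] \<bullet> W [] f [i, ?i']"
    using interchange_s[of f "sp i" "[]" "[]" "[]"] by simp
  have "W [] (f \<bullet> loop_diagram \<sigma> \<tau> i) [] = (W [] f [] \<bullet> W [?Z] (sp i) []) \<bullet> W [] (sb \<sigma> i) [?i'] \<bullet> W [i] (sb \<tau> ?i') [] \<bullet> W [] (co i) [?Z]"
    by (simp add: loop_diagram_def)
  also have "\<dots> = W (scod f) (sp i) [] \<bullet> (W [] f [i, ?i'] \<bullet> W [] (sb \<sigma> i) [?i']) \<bullet> W [i] (sb \<tau> ?i') [] \<bullet> W [] (co i) [?Z]"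
    unfolding c by simp
  also have "W [] f [i, ?i'] \<bullet> W [] (sb \<sigma> i) [?i'] = W [] f [i, ?i'] \<bullet> W [] (sb \<tau> i) [?i']"
    using ctx_rules(5)[OF e[of i], of "[?i']", simplified ctx_simps] by simp
  also have "W (scod f) (sp i) [] \<bullet> (W [] f [i, ?i'] \<bullet> W [] (sb \<tau> i) [?i']) \<bullet> W [i] (sb \<tau> ?i') [] \<bullet> W [] (co i) [?Z]
    = (W (scod f) (sp i) [] \<bullet> W [] f [i, ?i']) \<bullet> (W [] (sb \<tau> i) [?i'] \<bullet> W [i] (sb \<tau> ?i') [] \<bullet> W [] (co i) [?Z])"
    by simp
  also have "W [] (sb \<tau> i) [?i'] \<bullet> W [i] (sb \<tau> ?i') [] \<bullet> W [] (co i) [?Z] = W [?Z] (co i) []"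
    using slide[of \<tau> "co i"] by simp
  finally have "W [] (f \<bullet> loop_diagram \<sigma> \<tau> i) [] = W [] (f \<bullet> W [?Z] (sp i \<bullet> co i) []) []" unfolding c[symmetric] by simp
  then show ?thesis by (rule wrapI[rotated -1]) simp_all
qed

section \<open>Loops under tensor products, and dinaturality\<close>

text \<open>
  Both ends of the loop cross the outer factor by the same half-braiding \<open>\<kappa>\<close>, so the cup slides through it and the
  factor remains untouched.
\<close>

lemma loop_diagram_tens_left:
  assumes [simp]: "\<sigma> \<in> ZO" "\<tau> \<in> ZO" "\<kappa> \<in> ZO" "fst \<tau> = fst \<sigma>" "i \<in> Obj A"
  defines "X \<equiv> fst \<kappa>" and "Z \<equiv> fst \<sigma>"
  shows "loop_diagram (tens \<kappa> \<sigma>) (tens \<kappa> \<tau>) i = mm X Z \<bullet> W [X] (loop_diagram \<sigma> \<tau> i) [] \<bullet> mi X Z"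
proof (rule wrapI)
  let ?i' = "Ldual A i"
  have [simp]: "fst \<kappa> = X" "fst \<sigma> = Z" "X \<in> Obj A" "Z \<in> Obj A" by (simp_all add: X_def Z_def)
  have s: "W [] (sb \<kappa> i) [?i'] \<bullet> W [i] (sb \<kappa> ?i') [] \<bullet> W [] (co i) [X] = W [X] (co i) []"
    using slide[of \<kappa> "co i"] by simp
  have i1: "W [i, ?i'] (mi X Z) [] \<bullet> W [] (co i) [X \<star> Z] = W [] (co i) [X, Z] \<bullet> W [] (mi X Z) []"
    using interchange_s[of "co i" "mi X Z" "[]" "[]" "[]"] by simp
  have i2: "W [X \<star> Z] (sp i) [] \<bullet> W [] (mm X Z) [i, ?i'] \<bullet> t = W [] (mm X Z) [] \<bullet> W [X, Z] (sp i) [] \<bullet> t" for t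
    using arg_cong[OF interchange_s[of "mm X Z" "sp i" "[]" "[]" "[]"], of "\<lambda>s. s \<bullet> t"] by simp
  have i3: "W [] (sb \<kappa> i) [Z, ?i'] \<bullet> W [i, X] (sb \<tau> ?i') [] \<bullet> t = W [X, i] (sb \<tau> ?i') [] \<bullet> W [] (sb \<kappa> i) [?i', Z] \<bullet> t" for t
    using arg_cong[OF interchange_s[of "sb \<kappa> i" "sb \<tau> ?i'" "[]" "[]" "[]"], of "\<lambda>s. s \<bullet> t"] by simp
  show "W [] (loop_diagram (tens \<kappa> \<sigma>) (tens \<kappa> \<tau>) i) [] = W [] (mm X Z \<bullet> W [X] (loop_diagram \<sigma> \<tau> i) [] \<bullet> mi X Z) []"
    by (simp add: loop_diagram_def tens tens_sb_def i1 i2 i3 ctx_rules[OF s, simplified ctx_simps])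
qed (simp_all add: tens X_def Z_def)

lemma loop_diagram_tens_right:
  assumes [simp]: "\<sigma> \<in> ZO" "\<tau> \<in> ZO" "\<kappa> \<in> ZO" "fst \<tau> = fst \<sigma>" "i \<in> Obj A"
  defines "X \<equiv> fst \<kappa>" and "Z \<equiv> fst \<sigma>"
  shows "loop_diagram (tens \<sigma> \<kappa>) (tens \<tau> \<kappa>) i = mm Z X \<bullet> W [] (loop_diagram \<sigma> \<tau> i) [X] \<bullet> mi Z X"
proof (rule wrapI)
  let ?i' = "Ldual A i"
  have [simp]: "fst \<kappa> = X" "fst \<sigma> = Z" "X \<in> Obj A" "Z \<in> Obj A" by (simp_all add: X_def Z_def)
  have s: "W [X] (sp i) [] \<bullet> W [] (sb \<kappa> i) [?i'] \<bullet> W [i] (sb \<kappa> ?i') [] = W [] (sp i) [X]"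
    using slide[of \<kappa> "sp i"] by simp
  have i1: "W [i, ?i'] (mi Z X) [] \<bullet> W [] (co i) [Z \<star> X] = W [] (co i) [Z, X] \<bullet> W [] (mi Z X) []"
    using interchange_s[of "co i" "mi Z X" "[]" "[]" "[]"] by simp
  have i2: "W [Z \<star> X] (sp i) [] \<bullet> W [] (mm Z X) [i, ?i'] \<bullet> t = W [] (mm Z X) [] \<bullet> W [Z, X] (sp i) [] \<bullet> t" for t
    using arg_cong[OF interchange_s[of "mm Z X" "sp i" "[]" "[]" "[]"], of "\<lambda>s. s \<bullet> t"] by simp
  have i3: "W [] (sb \<sigma> i) [X, ?i'] \<bullet> W [i, Z] (sb \<kappa> ?i') [] \<bullet> t = W [Z, i] (sb \<kappa> ?i') [] \<bullet> W [] (sb \<sigma> i) [?i', X] \<bullet> t" for t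
    using arg_cong[OF interchange_s[of "sb \<sigma> i" "sb \<kappa> ?i'" "[]" "[]" "[]"], of "\<lambda>s. s \<bullet> t"] by simp
  show "W [] (loop_diagram (tens \<sigma> \<kappa>) (tens \<tau> \<kappa>) i) [] = W [] (mm Z X \<bullet> W [] (loop_diagram \<sigma> \<tau> i) [X] \<bullet> mi Z X) []"
    by (simp add: loop_diagram_def tens tens_sb_def i1 i2 i3 ctx_rules[OF s, simplified ctx_simps])
qed (simp_all add: tens X_def Z_def)

text \<open>
  A strand pair \<open>B C\<close> is created by \<open>u\<close>, crosses \<open>Z\<close> by \<open>\<sigma>\<^sub>B\<close> and \<open>\<tau>\<^sub>C\<close>, and is consumed by \<open>v\<close>.  Both sides of the
  handle slide are sums of such expressions.
\<close>

definition Lam :: "('o, 'm) centre_obj \<Rightarrow> ('o, 'm) centre_obj \<Rightarrow> 'o \<Rightarrow> 'o \<Rightarrow> 'm \<Rightarrow> 'm \<Rightarrow> 'm" where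
  "Lam \<sigma> \<tau> B C u v = (let Z = fst \<sigma> in
     (Id A Z \<boxtimes> v) \<cdot> Assoc A Z B C \<cdot> (snd \<sigma> B \<boxtimes> Id A C) \<cdot> Assoc_inv A B Z C \<cdot> (Id A B \<boxtimes> snd \<tau> C) \<cdot> Assoc A B C Z \<cdot> (u \<boxtimes> Id A Z))"

lemma rep_Lam:
  assumes [simp]: "\<sigma> \<in> ZO" "\<tau> \<in> ZO" "fst \<tau> = fst \<sigma>" "B \<in> Obj A" "C \<in> Obj A" "S \<in> Obj A" "S' \<in> Obj A"
    and u: "rep u (mm B C \<bullet> U)" "sarr U" "sdom U = [S]" "scod U = [B, C]"
    and v: "rep v (V \<bullet> mi B C)" "sarr V" "sdom V = [B, C]" "scod V = [S']"
  shows "rep (Lam \<sigma> \<tau> B C u v) (mm (fst \<sigma>) S' \<bullet> W [fst \<sigma>] V [] \<bullet> W [] (sb \<sigma> B) [C] \<bullet> W [B] (sb \<tau> C) [] \<bullet> W [] U [fst \<sigma>] \<bullet> mi S (fst \<sigma>))"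
proof -
  have r: "rep (snd \<tau> B) (mm (fst \<sigma>) B \<bullet> sb \<tau> B \<bullet> mi B (fst \<sigma>))" if "B \<in> Obj A" for B
    using rep_sb[OF assms(2) that] by simp
  note [simp] = u(2-4) v(2-4)
  show ?thesis unfolding Lam_def Let_def
    by (rule rep_via, (rule reps u v r rep_sb[OF assms(1)] | (simp; fail))+, (simp)?)
qed

text \<open>
  Morphisms of the two strands slide through the crossings with \<open>Z\<close>.
\<close>

lemma Lam_dinatural:
  assumes [simp]: "\<sigma> \<in> ZO" "\<tau> \<in> ZO" "fst \<tau> = fst \<sigma>" "arr g" "arr h" "arr u" "arr v"
    "src g = B" "tgt g = B'" "src h = C" "tgt h = C'" "tgt u = B \<star> C" "src v = B' \<star> C'"
  shows "Lam \<sigma> \<tau> B' C' ((g \<boxtimes> h) \<cdot> u) v = Lam \<sigma> \<tau> B C u (v \<cdot> (g \<boxtimes> h))"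
proof -
  have [simp]: "B \<in> Obj A" "B' \<in> Obj A" "C \<in> Obj A" "C' \<in> Obj A"
    using src_closed tgt_closed assms(4,5,8-11) by metis+
  let ?Z = "fst \<sigma>"
  define U where "U = mi B C \<bullet> hat u"
  define V where "V = hat v \<bullet> mm B' C'"
  have u: "rep u (mm B C \<bullet> U)" "sarr U" "sdom U = [src u]" "scod U = [B, C]" by (simp_all add: U_def rep_def)
  have v: "rep v (V \<bullet> mi B' C')" "sarr V" "sdom V = [B', C']" "scod V = [tgt v]" by (simp_all add: V_def rep_def)
  note [simp] = u(2-4) v(2-4)
  have u': "rep ((g \<boxtimes> h) \<cdot> u) (mm B' C' \<bullet> W [] (hat g) [C'] \<bullet> W [B] (hat h) [] \<bullet> U)"
    by (rule rep_via, (rule reps u rep_hat | (simp; fail))+, (simp)?)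
  have v': "rep (v \<cdot> (g \<boxtimes> h)) ((V \<bullet> W [] (hat g) [C'] \<bullet> W [B] (hat h) []) \<bullet> mi B C)"
    by (rule rep_via, (rule reps v rep_hat | (simp; fail))+, (simp)?)
  have a: "W [] (sb \<sigma> B') [C'] \<bullet> W [] (hat g) [?Z, C'] = W [?Z] (hat g) [C'] \<bullet> W [] (sb \<sigma> B) [C']"
    using ctx_rules(5)[OF slide_hat_W[of \<sigma> g], of "[C']", simplified ctx_simps] by simp
  have b: "W [B] (sb \<tau> C') [] \<bullet> W [B] (hat h) [?Z] = W [B, ?Z] (hat h) [] \<bullet> W [B] (sb \<tau> C) []"
    using ctx_rules(6)[OF slide_hat_W[of \<tau> h], of B "[]", simplified ctx_simps] by simp
  have c: "W [B'] (sb \<tau> C') [] \<bullet> W [] (hat g) [C', ?Z] = W [] (hat g) [?Z, C'] \<bullet> W [B] (sb \<tau> C') []"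
    using interchange_s[of "hat g" "sb \<tau> C'" "[]" "[]" "[]"] by simp
  have d: "W [] (sb \<sigma> B) [C'] \<bullet> W [B, ?Z] (hat h) [] = W [?Z, B] (hat h) [] \<bullet> W [] (sb \<sigma> B) [C]"
    using interchange_s[of "sb \<sigma> B" "hat h" "[]" "[]" "[]"] by simp
  have m: "W [] (sb \<sigma> B') [C'] \<bullet> W [B'] (sb \<tau> C') [] \<bullet> W [] (hat g) [C', ?Z] \<bullet> W [B] (hat h) [?Z]
     = W [?Z] (hat g) [C'] \<bullet> W [?Z, B] (hat h) [] \<bullet> W [] (sb \<sigma> B) [C] \<bullet> W [B] (sb \<tau> C) []"
  proof -
    have "W [] (sb \<sigma> B') [C'] \<bullet> W [B'] (sb \<tau> C') [] \<bullet> W [] (hat g) [C', ?Z] \<bullet> W [B] (hat h) [?Z]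
      = W [] (sb \<sigma> B') [C'] \<bullet> (W [B'] (sb \<tau> C') [] \<bullet> W [] (hat g) [C', ?Z]) \<bullet> W [B] (hat h) [?Z]" by simp
    also have "\<dots> = (W [] (sb \<sigma> B') [C'] \<bullet> W [] (hat g) [?Z, C']) \<bullet> (W [B] (sb \<tau> C') [] \<bullet> W [B] (hat h) [?Z])"
      unfolding c by simp
    also have "\<dots> = W [?Z] (hat g) [C'] \<bullet> (W [] (sb \<sigma> B) [C'] \<bullet> W [B, ?Z] (hat h) []) \<bullet> W [B] (sb \<tau> C) []"
      unfolding a b by simp
    finally show ?thesis unfolding d by simp
  qed
  show ?thesis
    by (rule rep_eqI[OF rep_Lam[where S = "src u" and S' = "tgt v", OF _ _ _ _ _ _ _ u' _ _ _ v(1)] rep_Lam[where S = "src u" and S' = "tgt v", OF _ _ _ _ _ _ _ u(1) _ _ _ v']])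
      (simp_all add: arg_cong[OF m, of "\<lambda>s. s \<bullet> t" for t, simplified])
qed

text \<open>
  The four ways in which a fused strand enters the handle slide: \<open>ug\<close> and \<open>vf\<close> start from a morphism out of and into
  \<open>B \<star> i\<close>, while \<open>ue\<close> and \<open>ve\<close> start from a morphism out of and into \<open>k\<^sup>* \<star> B\<close>.  Each is obtained by bending the
  strand \<open>i\<close> or \<open>k\<close>.
\<close>

definition ug :: "'o \<Rightarrow> 'o \<Rightarrow> 'm \<Rightarrow> 'm" where
  "ug B i g = (g \<boxtimes> Id A (Ldual A i)) \<cdot> Assoc_inv A B i (Ldual A i) \<cdot> (Id A B \<boxtimes> Coev A i) \<cdot> Runit_inv A B"
definition vf :: "'o \<Rightarrow> 'o \<Rightarrow> 'm \<Rightarrow> 'm" where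
  "vf B i f = Runit A B \<cdot> (Id A B \<boxtimes> pivotal_ev A i) \<cdot> Assoc A B i (Ldual A i) \<cdot> (f \<boxtimes> Id A (Ldual A i))"
definition ue :: "'o \<Rightarrow> 'o \<Rightarrow> 'm \<Rightarrow> 'm" where
  "ue B k e = (Id A k \<boxtimes> e) \<cdot> Assoc A k (Ldual A k) B \<cdot> (Coev A k \<boxtimes> Id A B) \<cdot> Lunit_inv A B"
definition ve :: "'o \<Rightarrow> 'o \<Rightarrow> 'm \<Rightarrow> 'm" where
  "ve B k e = Lunit A B \<cdot> (pivotal_ev A k \<boxtimes> Id A B) \<cdot> Assoc_inv A k (Ldual A k) B \<cdot> (Id A k \<boxtimes> e)"

lemma rep_ug:
  assumes [simp]: "B \<in> Obj A" "i \<in> Obj A" "arr g" "src g = B \<star> i" "tgt g = k"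
  shows "rep (ug B i g) (mm k (Ldual A i) \<bullet> (W [] (hat g) [Ldual A i] \<bullet> W [] (mm B i) [Ldual A i] \<bullet> W [B] (co i) []))"
  unfolding ug_def
  by (rule rep_via, (rule reps rep_Coev rep_hat | (simp; fail))+, (simp)?)

lemma rep_vf:
  assumes [simp]: "B \<in> Obj A" "i \<in> Obj A" "arr f" "tgt f = B \<star> i" "src f = k"
  shows "rep (vf B i f) ((W [B] (sp i) [] \<bullet> W [] (mi B i) [Ldual A i] \<bullet> W [] (hat f) [Ldual A i]) \<bullet> mi k (Ldual A i))"
proof -
  have [simp]: "k \<in> Obj A" using src_closed[OF assms(3)] by simp
  show ?thesis unfolding vf_def
  by (rule rep_via, (rule reps rep_pivotal_ev rep_hat | (simp; fail))+, (simp)?)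
qed

lemma rep_ue:
  assumes [simp]: "B \<in> Obj A" "k \<in> Obj A" "arr e" "src e = Ldual A k \<star> B" "tgt e = i'"
  shows "rep (ue B k e) (mm k i' \<bullet> (W [k] (hat e) [] \<bullet> W [k] (mm (Ldual A k) B) [] \<bullet> W [] (co k) [B]))"
  unfolding ue_def
  by (rule rep_via, (rule reps rep_Coev rep_hat | (simp; fail))+, (simp)?)

lemma rep_ve:
  assumes [simp]: "B \<in> Obj A" "k \<in> Obj A" "arr e" "tgt e = Ldual A k \<star> B" "src e = i'"
  shows "rep (ve B k e) ((W [] (sp k) [B] \<bullet> W [k] (mi (Ldual A k) B) [] \<bullet> W [k] (hat e) []) \<bullet> mi k i')"
proof -
  have [simp]: "i' \<in> Obj A" using src_closed[OF assms(3)] by simp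
  show ?thesis unfolding ve_def
  by (rule rep_via, (rule reps rep_pivotal_ev rep_hat | (simp; fail))+, (simp)?)
qed

text \<open>
  The strand \<open>B\<close> crosses \<open>Z\<close> by \<open>\<sigma>\<close>, like the end \<open>i\<close> of the loop next to it; by multiplicativity the two
  are a single strand \<open>B \<star> i\<close>.
\<close>

lemma slide_over_loop:
  assumes [simp]: "\<sigma> \<in> ZO" "\<tau> \<in> ZO" "fst \<tau> = fst \<sigma>" "B \<in> Obj A" "i \<in> Obj A"
  shows "snd \<sigma> B \<cdot> (Id A B \<boxtimes> loop \<sigma> \<tau> i) = Lam \<sigma> \<tau> (B \<star> i) (Ldual A i) (ug B i (Id A (B \<star> i))) (vf B i (Id A (B \<star> i)))"
proof -
  let ?Z = "fst \<sigma>" let ?i' = "Ldual A i"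
  define U where "U = W [] (hat (Id A (B \<star> i))) [?i'] \<bullet> W [] (mm B i) [?i'] \<bullet> W [B] (co i) []"
  define V where "V = W [B] (sp i) [] \<bullet> W [] (mi B i) [?i'] \<bullet> W [] (hat (Id A (B \<star> i))) [?i']"
  have u: "rep (ug B i (Id A (B \<star> i))) (mm (B \<star> i) ?i' \<bullet> U)" unfolding U_def by (rule rep_ug) simp_all
  have v: "rep (vf B i (Id A (B \<star> i))) (V \<bullet> mi (B \<star> i) ?i')" unfolding V_def by (rule rep_vf) simp_all
  show ?thesis
    by (rule rep_eqI[OF _ rep_Lam[where S = B and S' = B, OF _ _ _ _ _ _ _ u _ _ _ v]], (rule reps rep_sb rep_loop | (simp add: U_def V_def hat_Id; fail))+)
      (simp add: loop_diagram_def U_def V_def hat_Id interchange_rule slide_rules)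
qed

text \<open>
  Here \<open>B\<close> crosses by \<open>\<tau>\<close> and is fused with the other end of the loop.
\<close>

lemma slide_under_loop:
  assumes [simp]: "\<sigma> \<in> ZO" "\<tau> \<in> ZO" "fst \<tau> = fst \<sigma>" "B \<in> Obj A" "k \<in> Obj A"
  shows "(loop \<sigma> \<tau> k \<boxtimes> Id A B) \<cdot> snd \<tau> B = Lam \<sigma> \<tau> k (Ldual A k \<star> B) (ue B k (Id A (Ldual A k \<star> B))) (ve B k (Id A (Ldual A k \<star> B)))"
proof -
  let ?Z = "fst \<sigma>" let ?k' = "Ldual A k"
  define U where "U = W [k] (hat (Id A (?k' \<star> B))) [] \<bullet> W [k] (mm ?k' B) [] \<bullet> W [] (co k) [B]"
  define V where "V = W [] (sp k) [B] \<bullet> W [k] (mi ?k' B) [] \<bullet> W [k] (hat (Id A (?k' \<star> B))) []"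
  have u: "rep (ue B k (Id A (?k' \<star> B))) (mm k (?k' \<star> B) \<bullet> U)" unfolding U_def by (rule rep_ue) simp_all
  have v: "rep (ve B k (Id A (?k' \<star> B))) (V \<bullet> mi k (?k' \<star> B))" unfolding V_def by (rule rep_ve) simp_all
  have r: "rep (snd \<tau> B) (mm ?Z B \<bullet> sb \<tau> B \<bullet> mi B ?Z)" if "B \<in> Obj A" for B
    using rep_sb[OF assms(2) that] by simp
  have t': "W [k] (sb \<tau> (?k' \<star> B)) [] \<bullet> W [k] (mm ?k' B) [?Z] \<bullet> t = W [k, ?Z] (mm ?k' B) [] \<bullet> W [k] (sb \<tau> ?k') [B] \<bullet> W [k, ?k'] (sb \<tau> B) [] \<bullet> t" for t
    using ctx_rules(2)[OF slide_mm_W[of \<tau> ?k' B], of k "[]" t, simplified ctx_simps] by simp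
  show ?thesis
    by (rule rep_eqI[OF _ rep_Lam[where S = B and S' = B, OF _ _ _ _ _ _ _ u _ _ _ v]], (rule reps r rep_loop | (simp add: U_def V_def hat_Id; fail))+)
      (simp add: loop_diagram_def U_def V_def hat_Id interchange_rule t')
qed

section \<open>Mates and traces\<close>

text \<open>
  The cup of the pivotal structure, as a morphism.
\<close>

definition cT :: "'o \<Rightarrow> 'm" where
  "cT k = (Id A (Ldual A k) \<boxtimes> inv_mor A k k (Twist A k)) \<cdot> Braid_inv A (Ldual A k) k \<cdot> Coev A k"

text \<open>
  Bending strands identifies morphisms \<open>k\<^sup>* \<star> B \<rightarrow> i\<^sup>*\<close> with morphisms \<open>B \<star> i \<rightarrow> k\<close> (by \<open>me\<close>), and morphisms
  \<open>k \<rightarrow> B \<star> i\<close> with morphisms \<open>i\<^sup>* \<rightarrow> k\<^sup>* \<star> B\<close> (by \<open>mf\<close>).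
\<close>

definition me :: "'o \<Rightarrow> 'o \<Rightarrow> 'o \<Rightarrow> 'm \<Rightarrow> 'm" where
  "me B k i e = Runit A k \<cdot> (Id A k \<boxtimes> Ev A i) \<cdot> Assoc A k (Ldual A i) i \<cdot> (ue B k e \<boxtimes> Id A i)"

definition mf :: "'o \<Rightarrow> 'o \<Rightarrow> 'o \<Rightarrow> 'm \<Rightarrow> 'm" where
  "mf B k i f = (Id A (Ldual A k) \<boxtimes> vf B i f) \<cdot> Assoc A (Ldual A k) k (Ldual A i) \<cdot> (cT k \<boxtimes> Id A (Ldual A i)) \<cdot> Lunit_inv A (Ldual A i)"

lemma rep_cT: "k \<in> Obj A \<Longrightarrow> rep (cT k) (mm (Ldual A k) k \<bullet> sc k \<bullet> ui)"
  unfolding cT_def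
  by (rule rep_via, (rule reps rep_Twist_inv rep_Braid_inv rep_Coev | (simp; fail))+, (simp add: sc_def)?)

definition ue_d :: "'o \<Rightarrow> 'o \<Rightarrow> 'm \<Rightarrow> ('o, 'm) diagram" where
  "ue_d B k e = W [k] (hat e) [] \<bullet> W [k] (mm (Ldual A k) B) [] \<bullet> W [] (co k) [B]"

definition vf_d :: "'o \<Rightarrow> 'o \<Rightarrow> 'm \<Rightarrow> ('o, 'm) diagram" where
  "vf_d B i f = W [B] (sp i) [] \<bullet> W [] (mi B i) [Ldual A i] \<bullet> W [] (hat f) [Ldual A i]"

lemma d_typing [simp]:
  "B \<in> Obj A \<Longrightarrow> k \<in> Obj A \<Longrightarrow> arr e \<Longrightarrow> src e = Ldual A k \<star> B \<Longrightarrow> sarr (ue_d B k e)"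
  "k \<in> Obj A \<Longrightarrow> sdom (ue_d B k e) = [B]" "scod (ue_d B k e) = [k, tgt e]"
  "B \<in> Obj A \<Longrightarrow> i \<in> Obj A \<Longrightarrow> arr f \<Longrightarrow> tgt f = B \<star> i \<Longrightarrow> sarr (vf_d B i f)"
  "sdom (vf_d B i f) = [src f, Ldual A i]" "i \<in> Obj A \<Longrightarrow> scod (vf_d B i f) = [B]"
  by (simp_all add: ue_d_def vf_d_def)

lemma rep_me:
  assumes [simp]: "B \<in> Obj A" "k \<in> Obj A" "i \<in> Obj A" "arr e" "src e = Ldual A k \<star> B" "tgt e = Ldual A i"
  shows "rep (me B k i e) (W [k] (ev i) [] \<bullet> W [] (ue_d B k e) [i] \<bullet> mi B i)"
  unfolding me_def ue_d_def
  by (rule rep_via, (rule reps rep_ue rep_Ev | (simp; fail))+, (simp)?)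

lemma rep_mf:
  assumes [simp]: "B \<in> Obj A" "k \<in> Obj A" "i \<in> Obj A" "arr f" "tgt f = B \<star> i" "src f = k"
  shows "rep (mf B k i f) (mm (Ldual A k) B \<bullet> W [Ldual A k] (vf_d B i f) [] \<bullet> W [] (sc k) [Ldual A i])"
  unfolding mf_def vf_d_def
  by (rule rep_via, (rule reps rep_vf rep_cT | (simp; fail))+, (simp)?)

lemma rep_typing: "rep f F \<Longrightarrow> sdom F = [X] \<Longrightarrow> scod F = [Y] \<Longrightarrow> arr f \<and> src f = X \<and> tgt f = Y"
  unfolding rep_def by auto

lemma me_mf_typing [simp]:
  "B \<in> Obj A \<Longrightarrow> k \<in> Obj A \<Longrightarrow> i \<in> Obj A \<Longrightarrow> arr e \<Longrightarrow> src e = Ldual A k \<star> B \<Longrightarrow> tgt e = Ldual A i \<Longrightarrow>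
     arr (me B k i e) \<and> src (me B k i e) = B \<star> i \<and> tgt (me B k i e) = k"
  "B \<in> Obj A \<Longrightarrow> k \<in> Obj A \<Longrightarrow> i \<in> Obj A \<Longrightarrow> arr f \<Longrightarrow> tgt f = B \<star> i \<Longrightarrow> src f = k \<Longrightarrow>
     arr (mf B k i f) \<and> src (mf B k i f) = Ldual A i \<and> tgt (mf B k i f) = Ldual A k \<star> B"
  using rep_typing[OF rep_me[of B k i e], of "B \<star> i" k] rep_typing[OF rep_mf[of B k i f], of "Ldual A i" "Ldual A k \<star> B"]
  by simp_all

lemma ue_eq_ug:
  assumes [simp]: "B \<in> Obj A" "k \<in> Obj A" "i \<in> Obj A" "arr e" "src e = Ldual A k \<star> B" "tgt e = Ldual A i"
  shows "ue B k e = ug B i (me B k i e)"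
proof -
  let ?i' = "Ldual A i"
  define G where "G = ue_d B k e"
  have [simp]: "sarr G" "sdom G = [B]" "scod G = [k, ?i']" by (simp_all add: G_def)
  have h: "hat (me B k i e) = W [k] (ev i) [] \<bullet> W [] G [i] \<bullet> mi B i"
    using rep_me[OF assms] by (simp add: rep_def G_def)
  have u: "rep (ue B k e) (mm k ?i' \<bullet> G)" using rep_ue[of B k e ?i'] by (simp add: G_def ue_d_def)
  have g: "W [] G [i, ?i'] \<bullet> W [B] (co i) [] = W [k, ?i'] (co i) [] \<bullet> W [] G []"
    using interchange_s[of G "co i" "[]" "[]" "[]"] by simp
  have "rep (ug B i (me B k i e)) (mm k ?i' \<bullet> (W [] (hat (me B k i e)) [?i'] \<bullet> W [] (mm B i) [?i'] \<bullet> W [B] (co i) []))"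
    by (rule rep_ug) simp_all
  then show ?thesis
    by (rule rep_eqI[OF u]) (simp add: h g zigzag_rules)
qed

lemma vf_eq_ve:
  assumes [simp]: "B \<in> Obj A" "k \<in> Obj A" "i \<in> Obj A" "arr f" "tgt f = B \<star> i" "src f = k"
  shows "vf B i f = ve B k (mf B k i f)"
proof -
  let ?i' = "Ldual A i" let ?k' = "Ldual A k"
  define V where "V = vf_d B i f"
  have [simp]: "sarr V" "sdom V = [k, ?i']" "scod V = [B]" by (simp_all add: V_def)
  have h: "hat (mf B k i f) = mm ?k' B \<bullet> W [?k'] V [] \<bullet> W [] (sc k) [?i']"
    using rep_mf[OF assms] by (simp add: rep_def V_def)
  have u: "rep (vf B i f) (V \<bullet> mi k ?i')" using rep_vf[of B i f k] by (simp add: V_def vf_d_def)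
  have g: "W [] (sp k) [B] \<bullet> W [k, ?k'] V [] \<bullet> t = W [] V [] \<bullet> W [] (sp k) [k, ?i'] \<bullet> t" for t
    using arg_cong[OF interchange_s[of "sp k" V "[]" "[]" "[]"], of "\<lambda>s. s \<bullet> t"] by simp
  have "rep (ve B k (mf B k i f)) ((W [] (sp k) [B] \<bullet> W [k] (mi ?k' B) [] \<bullet> W [k] (hat (mf B k i f)) []) \<bullet> mi k ?i')"
    by (rule rep_ve) simp_all
  then show ?thesis
    by (rule rep_eqI[OF u]) (simp add: h g ctx_rules[OF twist_zigzag, simplified ctx_simps])
qed

text \<open>
  The same closed diagram read in two ways: as a trace over the dual of \<open>i\<close> and as a trace over \<open>k\<close>.
\<close>

lemma mate_trace:
  assumes [simp]: "B \<in> Obj A" "k \<in> Obj A" "i \<in> Obj A" "arr e" "src e = Ldual A k \<star> B" "tgt e = Ldual A i"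
    and [simp]: "arr f" "tgt f = B \<star> i" "src f = k"
  shows "Ev A i \<cdot> ((e \<cdot> mf B k i f) \<boxtimes> Id A i) \<cdot> cT i = Ev A k \<cdot> (Id A (Ldual A k) \<boxtimes> (me B k i e \<cdot> f)) \<cdot> cT k"
proof -
  let ?i' = "Ldual A i" let ?k' = "Ldual A k"
  define H where "H = ev i \<bullet> W [] (hat e) [i] \<bullet> W [] (mm ?k' B) [i]"
  have [simp]: "sarr H" "sdom H = [?k', B, i]" "scod H = []" by (simp_all add: H_def)
  have s: "W [] (sc k) [?i', i] \<bullet> W [] (sc i) [] = W [?k', k] (sc i) [] \<bullet> W [] (sc k) []"
    using interchange_s[of "sc k" "sc i" "[]" "[]" "[]"] by simp
  have s': "W [] (sc k) [?i', i] \<bullet> W [] (sc i) [] \<bullet> t = W [?k', k] (sc i) [] \<bullet> W [] (sc k) [] \<bullet> t"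
    "W [] (sc k) [?i', i] \<bullet> sc i \<bullet> t = W [?k', k] (sc i) [] \<bullet> W [] (sc k) [] \<bullet> t" for t
    using arg_cong[OF s, of "\<lambda>s. s \<bullet> t"] by (simp_all add: W_Nil)
  define F where "F = mi B i \<bullet> hat f"
  have [simp]: "sarr F" "sdom F = [k]" "scod F = [B, i]" by (simp_all add: F_def)
  have g: "W [?k'] F [?i', i] \<bullet> W [?k', k] (sc i) [] = W [?k', B, i] (sc i) [] \<bullet> W [?k'] F []"
    using interchange_s[of F "sc i" "[?k']" "[]" "[]"] by simp
  have g': "W [?k'] F [?i', i] \<bullet> W [?k', k] (sc i) [] \<bullet> t = W [?k', B, i] (sc i) [] \<bullet> W [?k'] F [] \<bullet> t" for t
    using arg_cong[OF g, of "\<lambda>s. s \<bullet> t"] by simp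
  have m: "hat (mf B k i f) = mm ?k' B \<bullet> W [?k', B] (sp i) [] \<bullet> W [?k'] F [?i'] \<bullet> W [] (sc k) [?i']"
    using rep_mf[of B k i f] by (simp add: rep_def vf_d_def F_def)
  have L: "rep (Ev A i \<cdot> ((e \<cdot> mf B k i f) \<boxtimes> Id A i) \<cdot> cT i) (uu \<bullet> W [] H [] \<bullet> W [?k'] F [] \<bullet> W [] (sc k) [] \<bullet> ui)"
    by (rule rep_via, (rule reps rep_Ev rep_cT rep_hat | (simp; fail))+)
      (rule wrapI, simp_all add: H_def m s s' g' ctx_rules[OF twist_zigzag, simplified ctx_simps])
  have e: "hat (me B k i e) = W [k] (ev i) [] \<bullet> W [] (ue_d B k e) [i] \<bullet> mi B i"
    using rep_me[of B k i e] by (simp add: rep_def)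
  have mf: "hat (me B k i e \<cdot> f) = W [k] H [] \<bullet> W [] (co k) [B, i] \<bullet> F"
    by (simp add: hat_comp e H_def F_def ue_d_def)
  have i: "W [] (ev k) [] \<bullet> W [?k', k] H [] \<bullet> t = W [] H [] \<bullet> W [] (ev k) [?k', B, i] \<bullet> t" for t
    using arg_cong[OF interchange_s[of "ev k" H "[]" "[]" "[]"], of "\<lambda>s. s \<bullet> t"] by simp
  have R: "rep (Ev A k \<cdot> (Id A ?k' \<boxtimes> (me B k i e \<cdot> f)) \<cdot> cT k) (uu \<bullet> W [] H [] \<bullet> W [?k'] F [] \<bullet> W [] (sc k) [] \<bullet> ui)"
    by (rule rep_via, (rule rep_hat[of "me B k i e \<cdot> f"] reps rep_Ev rep_cT | (simp; fail))+)
      (rule wrapI, simp_all add: mf i zigzag_rules)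
  show ?thesis by (rule rep_eqI[OF L R]) simp
qed

end

section \<open>Linear algebra\<close>

text \<open>
  Gaussian elimination of one unknown per equation.  It yields an annihilating polynomial of an endomorphism from the
  finite dimension of its Hom space.
\<close>

lemma homogeneous_system_solution:
  fixes a :: "'j \<Rightarrow> 'b \<Rightarrow> 'k::field"
  assumes "finite B" "finite J" "card B < card J"
  shows "\<exists>c. (\<exists>j \<in> J. c j \<noteq> 0) \<and> (\<forall>b \<in> B. (\<Sum>j \<in> J. c j * a j b) = 0)"
  using assms
proof (induction B arbitrary: J a rule: finite_induct)
  case empty
  then obtain j where "j \<in> J" by fastforce
  then show ?case by (intro exI[of _ "\<lambda>_. 1"]) auto
next
  case (insert b B)
  show ?case
  proof (cases "\<forall>j \<in> J. a j b = 0")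
    case True
    obtain c where "\<exists>j \<in> J. c j \<noteq> 0" "\<forall>b \<in> B. (\<Sum>j \<in> J. c j * a j b) = 0"
      using insert.IH[of J a] insert.prems insert.hyps by auto
    then show ?thesis using True by (intro exI[of _ c]) auto
  next
    case False
    then obtain l where l: "l \<in> J" "a l b \<noteq> 0" by auto
    define a' where "a' j x = a j x - a j b / a l b * a l x" for j x
    have "card B < card (J - {l})" using insert l by (simp add: card_Diff_singleton)
    then obtain c where c: "\<exists>j \<in> J - {l}. c j \<noteq> 0" "\<forall>x \<in> B. (\<Sum>j \<in> J - {l}. c j * a' j x) = 0"
      using insert.IH[of "J - {l}" a'] insert.prems by auto
    define s where "s = (\<Sum>j \<in> J - {l}. c j * (a j b / a l b))"
    define d where "d j = (if j = l then - s else c j)" for j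
    have sum: "(\<Sum>j \<in> J. d j * a j x) = (\<Sum>j \<in> J - {l}. c j * a' j x)" for x
    proof -
      have "(\<Sum>j \<in> J. d j * a j x) = d l * a l x + (\<Sum>j \<in> J - {l}. d j * a j x)"
        using l insert.prems by (simp add: sum.remove)
      also have "(\<Sum>j \<in> J - {l}. d j * a j x) = (\<Sum>j \<in> J - {l}. c j * a j x)"
        by (rule sum.cong) (auto simp: d_def)
      also have "d l * a l x + \<dots> = (\<Sum>j \<in> J - {l}. c j * a' j x)"
        by (simp add: d_def s_def a'_def algebra_simps sum_subtractf sum_distrib_right sum_distrib_left)
      finally show ?thesis .
    qed
    have "(\<Sum>j \<in> J - {l}. c j * a' j b) = 0" using l by (simp add: a'_def)
    then show ?thesis using c sum by (intro exI[of _ d]) (auto simp: d_def)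
  qed
qed

context linear_category begin

abbreviation KR :: "'k ring" where "KR \<equiv> ring_of_type_algebra"

lemma KR_simps [simp]: "carrier KR = UNIV" "a \<otimes>\<^bsub>KR\<^esub> b = a * b" "a \<oplus>\<^bsub>KR\<^esub> b = a + b" "\<one>\<^bsub>KR\<^esub> = 1" "\<zero>\<^bsub>KR\<^esub> = 0"
  by (simp_all add: ring_of_type_algebra_def)

lemma Hom_abelian_group: "X \<in> Obj C \<Longrightarrow> Y \<in> Obj C \<Longrightarrow> abelian_group (Hom C X Y)"
  using hom_module module.axioms by blast

lemma Hom_monoid: "X \<in> Obj C \<Longrightarrow> Y \<in> Obj C \<Longrightarrow> abelian_monoid (Hom C X Y)"
  using Hom_abelian_group abelian_group.axioms by blast

lemma Hom_facts:
  assumes "X \<in> Obj C" "Y \<in> Obj C"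
  shows "\<zero>\<^bsub>Hom C X Y\<^esub> \<in> Mor C X Y"
    "f \<in> Mor C X Y \<Longrightarrow> g \<in> Mor C X Y \<Longrightarrow> f \<oplus>\<^bsub>Hom C X Y\<^esub> g \<in> Mor C X Y"
    "f \<in> Mor C X Y \<Longrightarrow> a \<odot>\<^bsub>Hom C X Y\<^esub> f \<in> Mor C X Y"
    "f \<in> Mor C X Y \<Longrightarrow> 0 \<odot>\<^bsub>Hom C X Y\<^esub> f = \<zero>\<^bsub>Hom C X Y\<^esub>"
    "f \<in> Mor C X Y \<Longrightarrow> 1 \<odot>\<^bsub>Hom C X Y\<^esub> f = f"
    "f \<in> Mor C X Y \<Longrightarrow> (a * b) \<odot>\<^bsub>Hom C X Y\<^esub> f = a \<odot>\<^bsub>Hom C X Y\<^esub> (b \<odot>\<^bsub>Hom C X Y\<^esub> f)"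
    "f \<in> Mor C X Y \<Longrightarrow> (a + b) \<odot>\<^bsub>Hom C X Y\<^esub> f = a \<odot>\<^bsub>Hom C X Y\<^esub> f \<oplus>\<^bsub>Hom C X Y\<^esub> b \<odot>\<^bsub>Hom C X Y\<^esub> f"
    "f \<in> Mor C X Y \<Longrightarrow> g \<in> Mor C X Y \<Longrightarrow> a \<odot>\<^bsub>Hom C X Y\<^esub> (f \<oplus>\<^bsub>Hom C X Y\<^esub> g) = a \<odot>\<^bsub>Hom C X Y\<^esub> f \<oplus>\<^bsub>Hom C X Y\<^esub> a \<odot>\<^bsub>Hom C X Y\<^esub> g"
    "f \<in> Mor C X Y \<Longrightarrow> f \<oplus>\<^bsub>Hom C X Y\<^esub> \<zero>\<^bsub>Hom C X Y\<^esub> = f"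
    "f \<in> Mor C X Y \<Longrightarrow> \<zero>\<^bsub>Hom C X Y\<^esub> \<oplus>\<^bsub>Hom C X Y\<^esub> f = f"
    "a \<odot>\<^bsub>Hom C X Y\<^esub> \<zero>\<^bsub>Hom C X Y\<^esub> = \<zero>\<^bsub>Hom C X Y\<^esub>"
proof -
  interpret M: module KR "Hom C X Y" using hom_module assms .
  show "\<zero>\<^bsub>Hom C X Y\<^esub> \<in> Mor C X Y"
    "f \<in> Mor C X Y \<Longrightarrow> g \<in> Mor C X Y \<Longrightarrow> f \<oplus>\<^bsub>Hom C X Y\<^esub> g \<in> Mor C X Y"
    "f \<in> Mor C X Y \<Longrightarrow> f \<oplus>\<^bsub>Hom C X Y\<^esub> \<zero>\<^bsub>Hom C X Y\<^esub> = f"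
    "f \<in> Mor C X Y \<Longrightarrow> \<zero>\<^bsub>Hom C X Y\<^esub> \<oplus>\<^bsub>Hom C X Y\<^esub> f = f" by simp_all
  show "f \<in> Mor C X Y \<Longrightarrow> a \<odot>\<^bsub>Hom C X Y\<^esub> f \<in> Mor C X Y" by (rule M.smult_closed) simp_all
  show "f \<in> Mor C X Y \<Longrightarrow> 0 \<odot>\<^bsub>Hom C X Y\<^esub> f = \<zero>\<^bsub>Hom C X Y\<^esub>" using M.smult_l_null by simp
  show "f \<in> Mor C X Y \<Longrightarrow> 1 \<odot>\<^bsub>Hom C X Y\<^esub> f = f" using M.smult_one by simp
  show "f \<in> Mor C X Y \<Longrightarrow> (a * b) \<odot>\<^bsub>Hom C X Y\<^esub> f = a \<odot>\<^bsub>Hom C X Y\<^esub> (b \<odot>\<^bsub>Hom C X Y\<^esub> f)" using M.smult_assoc1[of a b f] by simp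
  show "f \<in> Mor C X Y \<Longrightarrow> (a + b) \<odot>\<^bsub>Hom C X Y\<^esub> f = a \<odot>\<^bsub>Hom C X Y\<^esub> f \<oplus>\<^bsub>Hom C X Y\<^esub> b \<odot>\<^bsub>Hom C X Y\<^esub> f" using M.smult_l_distr[of a b f] by simp
  show "f \<in> Mor C X Y \<Longrightarrow> g \<in> Mor C X Y \<Longrightarrow> a \<odot>\<^bsub>Hom C X Y\<^esub> (f \<oplus>\<^bsub>Hom C X Y\<^esub> g) = a \<odot>\<^bsub>Hom C X Y\<^esub> f \<oplus>\<^bsub>Hom C X Y\<^esub> a \<odot>\<^bsub>Hom C X Y\<^esub> g" using M.smult_r_distr[of a f g] by simp
  show "a \<odot>\<^bsub>Hom C X Y\<^esub> \<zero>\<^bsub>Hom C X Y\<^esub> = \<zero>\<^bsub>Hom C X Y\<^esub>" using M.smult_r_null by simp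
qed

lemma comp_zero:
  assumes "X \<in> Obj C" "Y \<in> Obj C" "Z \<in> Obj C"
  shows "f \<in> Mor C X Y \<Longrightarrow> \<zero>\<^bsub>Hom C Y Z\<^esub> \<cdot> f = \<zero>\<^bsub>Hom C X Z\<^esub>"
    "g \<in> Mor C Y Z \<Longrightarrow> g \<cdot> \<zero>\<^bsub>Hom C X Y\<^esub> = \<zero>\<^bsub>Hom C X Z\<^esub>"
proof -
  show "\<zero>\<^bsub>Hom C Y Z\<^esub> \<cdot> f = \<zero>\<^bsub>Hom C X Z\<^esub>" if f: "f \<in> Mor C X Y"
  proof -
    have z: "\<zero>\<^bsub>Hom C Y Z\<^esub> \<in> Mor C Y Z" using Hom_facts assms by blast
    have "\<zero>\<^bsub>Hom C Y Z\<^esub> \<cdot> f = (0 \<odot>\<^bsub>Hom C Y Z\<^esub> \<zero>\<^bsub>Hom C Y Z\<^esub>) \<cdot> f" using Hom_facts(4)[OF assms(2,3) z] by simp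
    also have "\<dots> = 0 \<odot>\<^bsub>Hom C X Z\<^esub> (\<zero>\<^bsub>Hom C Y Z\<^esub> \<cdot> f)" using comp_smult_left[OF assms f z] .
    also have "\<dots> = \<zero>\<^bsub>Hom C X Z\<^esub>" using Hom_facts(4)[OF assms(1,3)] comp_closed[OF assms f z] by blast
    finally show ?thesis .
  qed
  show "g \<cdot> \<zero>\<^bsub>Hom C X Y\<^esub> = \<zero>\<^bsub>Hom C X Z\<^esub>" if g: "g \<in> Mor C Y Z"
  proof -
    have z: "\<zero>\<^bsub>Hom C X Y\<^esub> \<in> Mor C X Y" using Hom_facts assms by blast
    have "g \<cdot> \<zero>\<^bsub>Hom C X Y\<^esub> = g \<cdot> (0 \<odot>\<^bsub>Hom C X Y\<^esub> \<zero>\<^bsub>Hom C X Y\<^esub>)" using Hom_facts(4)[OF assms(1,2) z] by simp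
    also have "\<dots> = 0 \<odot>\<^bsub>Hom C X Z\<^esub> (g \<cdot> \<zero>\<^bsub>Hom C X Y\<^esub>)" using comp_smult_right[OF assms z g] .
    also have "\<dots> = \<zero>\<^bsub>Hom C X Z\<^esub>" using Hom_facts(4)[OF assms(1,3)] comp_closed[OF assms z g] by blast
    finally show ?thesis .
  qed
qed

end

lemma (in abelian_monoid) finsum_swap:
  assumes "finite I" "finite J" "\<And>i j. i \<in> I \<Longrightarrow> j \<in> J \<Longrightarrow> f i j \<in> carrier G"
  shows "(\<Oplus>i \<in> I. \<Oplus>j \<in> J. f i j) = (\<Oplus>j \<in> J. \<Oplus>i \<in> I. f i j)"
  using assms(1,3)
proof (induction I rule: finite_induct)
  case (insert x F)
  have "(\<Oplus>j \<in> J. \<Oplus>i \<in> insert x F. f i j) = (\<Oplus>j \<in> J. f x j \<oplus> (\<Oplus>i \<in> F. f i j))"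
    using insert by (intro finsum_cong') (auto intro!: finsum_insert finsum_closed a_closed)
  also have "\<dots> = (\<Oplus>j \<in> J. f x j) \<oplus> (\<Oplus>j \<in> J. \<Oplus>i \<in> F. f i j)"
    using insert by (intro finsum_addf) (auto intro!: finsum_closed)
  finally show ?case using insert by (subst finsum_insert) (auto intro!: finsum_closed)
qed simp

lemma finsum_additive:
  assumes "abelian_group G" "abelian_group H" "finite I" "\<And>i. i \<in> I \<Longrightarrow> f i \<in> carrier G"
    and "\<And>x. x \<in> carrier G \<Longrightarrow> h x \<in> carrier H"
    and add: "\<And>x y. x \<in> carrier G \<Longrightarrow> y \<in> carrier G \<Longrightarrow> h (x \<oplus>\<^bsub>G\<^esub> y) = h x \<oplus>\<^bsub>H\<^esub> h y"
  shows "h (\<Oplus>\<^bsub>G\<^esub>i \<in> I. f i) = (\<Oplus>\<^bsub>H\<^esub>i \<in> I. h (f i))"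
proof -
  interpret G: abelian_group G by fact
  interpret H: abelian_group H by fact
  have "h \<zero>\<^bsub>G\<^esub> \<oplus>\<^bsub>H\<^esub> h \<zero>\<^bsub>G\<^esub> = h \<zero>\<^bsub>G\<^esub> \<oplus>\<^bsub>H\<^esub> \<zero>\<^bsub>H\<^esub>" using add[of "\<zero>\<^bsub>G\<^esub>" "\<zero>\<^bsub>G\<^esub>"] assms(5) by simp
  then have z: "h \<zero>\<^bsub>G\<^esub> = \<zero>\<^bsub>H\<^esub>" using assms(5) by simp
  show ?thesis using assms(3,4)
  proof (induction I rule: finite_induct)
    case (insert x F)
    have "h (\<Oplus>\<^bsub>G\<^esub>i \<in> insert x F. f i) = h (f x \<oplus>\<^bsub>G\<^esub> (\<Oplus>\<^bsub>G\<^esub>i \<in> F. f i))"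
      using insert by (subst G.finsum_insert) auto
    also have "\<dots> = h (f x) \<oplus>\<^bsub>H\<^esub> h (\<Oplus>\<^bsub>G\<^esub>i \<in> F. f i)"
      using insert by (intro add) (auto intro!: G.finsum_closed)
    finally show ?case using insert assms(5) by (subst H.finsum_insert) auto
  qed (simp add: z)
qed

section \<open>Linear maps between Hom spaces and Schur's lemma\<close>

context linear_category begin

text \<open>
  The constructions that are applied to sums below are linear in the morphism; the rules \<open>lins\<close> establish this by
  following the shape of the expression.
\<close>

definition lin :: "'o \<Rightarrow> 'o \<Rightarrow> 'o \<Rightarrow> 'o \<Rightarrow> ('m \<Rightarrow> 'm) \<Rightarrow> bool" where
  "lin X Y X' Y' h \<longleftrightarrow> X \<in> Obj C \<and> Y \<in> Obj C \<and> X' \<in> Obj C \<and> Y' \<in> Obj C \<and>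
     (\<forall>f \<in> Mor C X Y. h f \<in> Mor C X' Y') \<and>
     (\<forall>f \<in> Mor C X Y. \<forall>g \<in> Mor C X Y. h (f \<oplus>\<^bsub>Hom C X Y\<^esub> g) = h f \<oplus>\<^bsub>Hom C X' Y'\<^esub> h g) \<and>
     (\<forall>f \<in> Mor C X Y. \<forall>a. h (a \<odot>\<^bsub>Hom C X Y\<^esub> f) = a \<odot>\<^bsub>Hom C X' Y'\<^esub> h f)"

lemma lin_id: "X \<in> Obj C \<Longrightarrow> Y \<in> Obj C \<Longrightarrow> lin X Y X Y (\<lambda>f. f)"
  by (simp add: lin_def)

lemma lin_comp_left: "lin X Y X' Y' h \<Longrightarrow> arr g \<Longrightarrow> src g = Y' \<Longrightarrow> tgt g = Z \<Longrightarrow> lin X Y X' Z (\<lambda>f. g \<cdot> h f)"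
  using arr_Mor[of g] tgt_closed[of g] unfolding lin_def
  by (auto simp: comp_add_right comp_smult_right intro: comp_closed)

lemma lin_comp_right: "lin X Y X' Y' h \<Longrightarrow> arr g \<Longrightarrow> tgt g = X' \<Longrightarrow> src g = Z \<Longrightarrow> lin X Y Z Y' (\<lambda>f. h f \<cdot> g)"
  using arr_Mor[of g] src_closed[of g] unfolding lin_def
  by (auto simp: comp_add_left comp_smult_left intro: comp_closed)

lemma lin_closed: "lin X Y X' Y' h \<Longrightarrow> f \<in> Mor C X Y \<Longrightarrow> h f \<in> Mor C X' Y'"
  by (simp add: lin_def)

lemma lin_smult: "lin X Y X' Y' h \<Longrightarrow> f \<in> Mor C X Y \<Longrightarrow> h (a \<odot>\<^bsub>Hom C X Y\<^esub> f) = a \<odot>\<^bsub>Hom C X' Y'\<^esub> h f"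
  by (simp add: lin_def)

lemma lin_zero: "lin X Y X' Y' h \<Longrightarrow> h \<zero>\<^bsub>Hom C X Y\<^esub> = \<zero>\<^bsub>Hom C X' Y'\<^esub>"
proof -
  assume l: "lin X Y X' Y' h"
  then have o: "X \<in> Obj C" "Y \<in> Obj C" "X' \<in> Obj C" "Y' \<in> Obj C" by (auto simp: lin_def)
  have z: "\<zero>\<^bsub>Hom C X Y\<^esub> \<in> Mor C X Y" using Hom_facts(1) o by blast
  have "h \<zero>\<^bsub>Hom C X Y\<^esub> = h (0 \<odot>\<^bsub>Hom C X Y\<^esub> \<zero>\<^bsub>Hom C X Y\<^esub>)" using Hom_facts(11)[OF o(1,2)] by simp
  also have "\<dots> = 0 \<odot>\<^bsub>Hom C X' Y'\<^esub> h \<zero>\<^bsub>Hom C X Y\<^esub>" using lin_smult[OF l z] .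
  also have "\<dots> = \<zero>\<^bsub>Hom C X' Y'\<^esub>" using Hom_facts(4)[OF o(3,4)] lin_closed[OF l z] by blast
  finally show ?thesis .
qed

lemma lin_finsum:
  assumes l: "lin X Y X' Y' h" and "finite I" "\<And>i. i \<in> I \<Longrightarrow> f i \<in> Mor C X Y"
  shows "h (\<Oplus>\<^bsub>Hom C X Y\<^esub>i \<in> I. f i) = (\<Oplus>\<^bsub>Hom C X' Y'\<^esub>i \<in> I. h (f i))"
  using l unfolding lin_def by (intro finsum_additive) (auto intro: Hom_abelian_group assms)

lemma finsum_Mor: "X \<in> Obj C \<Longrightarrow> Y \<in> Obj C \<Longrightarrow> (\<And>i. i \<in> I \<Longrightarrow> f i \<in> Mor C X Y) \<Longrightarrow> (\<Oplus>\<^bsub>Hom C X Y\<^esub>i \<in> I. f i) \<in> Mor C X Y"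
  by (intro abelian_monoid.finsum_closed Hom_monoid) auto

lemma Hom_finsum_cong: "X \<in> Obj C \<Longrightarrow> Y \<in> Obj C \<Longrightarrow> (\<And>i. i \<in> I \<Longrightarrow> f i = g i) \<Longrightarrow> (\<And>i. i \<in> I \<Longrightarrow> g i \<in> Mor C X Y) \<Longrightarrow>
    (\<Oplus>\<^bsub>Hom C X Y\<^esub>i \<in> I. f i) = (\<Oplus>\<^bsub>Hom C X Y\<^esub>i \<in> I. g i)"
  by (intro abelian_monoid.finsum_cong' Hom_monoid) auto

lemma lin_smult_self: "X \<in> Obj C \<Longrightarrow> Y \<in> Obj C \<Longrightarrow> lin X Y X Y (\<lambda>f. a \<odot>\<^bsub>Hom C X Y\<^esub> f)"
  unfolding lin_def using Hom_facts[of X Y] by (auto simp: mult.commute simp flip: Hom_facts(6))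

lemma smult_finsum_scalars:
  assumes "X \<in> Obj C" "Y \<in> Obj C" "finite I" "f \<in> Mor C X Y"
  shows "(\<Oplus>\<^bsub>Hom C X Y\<^esub>i \<in> I. a i \<odot>\<^bsub>Hom C X Y\<^esub> f) = (\<Sum>i \<in> I. a i) \<odot>\<^bsub>Hom C X Y\<^esub> f"
  using assms(3)
proof (induction I rule: finite_induct)
  case empty
  then show ?case using Hom_facts(4)[OF assms(1,2,4)] by (simp add: abelian_monoid.finsum_empty[OF Hom_monoid[OF assms(1,2)]])
next
  case (insert i I)
  then show ?case using assms Hom_facts[OF assms(1,2)]
    by (subst abelian_monoid.finsum_insert[OF Hom_monoid[OF assms(1,2)]]) auto
qed

lemma zero_object_unique:
  assumes "is_zero_object C Z" "X \<in> Obj C"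
  shows "f \<in> Mor C X Z \<Longrightarrow> g \<in> Mor C X Z \<Longrightarrow> f = g" "f \<in> Mor C Z X \<Longrightarrow> g \<in> Mor C Z X \<Longrightarrow> f = g"
  using assms unfolding is_zero_object_def by blast+

text \<open>
  If the identity vanished, every morphism into or out of the object would be zero.
\<close>

lemma simple_Id_nonzero:
  assumes "is_simple C X"
  shows "Id C X \<noteq> \<zero>\<^bsub>Hom C X X\<^esub>"
proof
  assume z: "Id C X = \<zero>\<^bsub>Hom C X X\<^esub>"
  have X: "X \<in> Obj C" using assms by (simp add: is_simple_def)
  have "is_zero_object C X"
    unfolding is_zero_object_def
  proof (intro conjI ballI X)
    fix Y assume Y: "Y \<in> Obj C"
    have "f = \<zero>\<^bsub>Hom C Y X\<^esub>" if "f \<in> Mor C Y X" for f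
      using comp_id_left[OF Y X that] comp_zero(1)[OF Y X X that] z by simp
    then show "\<exists>!f. f \<in> Mor C Y X" using Hom_facts(1)[OF Y X] by blast
    have "f = \<zero>\<^bsub>Hom C X Y\<^esub>" if "f \<in> Mor C X Y" for f
      using comp_id_right[OF X Y that] comp_zero(2)[OF X X Y that] z by simp
    then show "\<exists>!f. f \<in> Mor C X Y" using Hom_facts(1)[OF X Y] by blast
  qed
  then show False using assms by (simp add: is_simple_def)
qed

end

context monoidal_linear_category begin

lemma lin_ten_left: "lin X Y X' Y' h \<Longrightarrow> arr g \<Longrightarrow> src g = Z \<Longrightarrow> tgt g = Z' \<Longrightarrow> lin X Y (Z \<star> X') (Z' \<star> Y') (\<lambda>f. g \<boxtimes> h f)"
  using arr_Mor[of g] src_closed[of g] tgt_closed[of g] unfolding lin_def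
  by (auto simp: ten_add_right ten_smult_right intro!: ten_mor_closed)

lemma lin_ten_right: "lin X Y X' Y' h \<Longrightarrow> arr g \<Longrightarrow> src g = Z \<Longrightarrow> tgt g = Z' \<Longrightarrow> lin X Y (X' \<star> Z) (Y' \<star> Z') (\<lambda>f. h f \<boxtimes> g)"
  using arr_Mor[of g] src_closed[of g] tgt_closed[of g] unfolding lin_def
  by (auto simp: ten_add_left ten_smult_left intro!: ten_mor_closed)

end

lemmas (in monoidal_linear_category) lins = lin_comp_left lin_comp_right lin_ten_left lin_ten_right lin_id

context abelian_linear_category begin

lemma kernel_mono:
  assumes "X \<in> Obj C" "Y \<in> Obj C" "f \<in> Mor C X Y" "is_kernel C X Y f K k"
  shows "is_mono C K X k"
  unfolding is_mono_def
proof (intro conjI ballI impI)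
  note K = assms(4)[unfolded is_kernel_def]
  show o: "K \<in> Obj C" "X \<in> Obj C" "k \<in> Mor C K X" using K assms by auto
  fix V g h assume V: "V \<in> Obj C" "g \<in> Mor C V K" "h \<in> Mor C V K" "k \<cdot> g = k \<cdot> h"
  have "f \<cdot> (k \<cdot> g) = (f \<cdot> k) \<cdot> g" using comp_assoc[of V K X Y g k f] V o assms by simp
  also have "\<dots> = \<zero>\<^bsub>Hom C V Y\<^esub>" using K comp_zero(1)[of V K Y g] V o assms by simp
  finally have "f \<cdot> (k \<cdot> g) = \<zero>\<^bsub>Hom C V Y\<^esub>" .
  moreover have "k \<cdot> g \<in> Mor C V X" using comp_closed V o by blast
  ultimately have "\<exists>!u. u \<in> Mor C V K \<and> k \<cdot> u = k \<cdot> g" using K V by blast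
  then show "g = h" using V by metis
qed

text \<open>
  The kernel of a nonzero morphism between simple objects is zero, so the morphism is a monomorphism into a simple object.
\<close>

lemma schur:
  assumes X: "is_simple C X" and Y: "is_simple C Y" and f: "f \<in> Mor C X Y"
  shows "f = \<zero>\<^bsub>Hom C X Y\<^esub> \<or> is_iso C X Y f"
proof -
  have o [simp]: "X \<in> Obj C" "Y \<in> Obj C" using X Y by (auto simp: is_simple_def)
  obtain K k where K: "is_kernel C X Y f K k" using kernels o f by blast
  note K' = K[unfolded is_kernel_def]
  have m: "is_mono C K X k" by (rule kernel_mono[OF o f K])
  then consider "is_zero_object C K" | "is_iso C K X k" using X by (auto simp: is_simple_def)
  then show ?thesis
  proof cases
    case 1
    have "is_mono C X Y f" unfolding is_mono_def
    proof (intro conjI ballI impI o f)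
      fix V g h assume V: "V \<in> Obj C" "g \<in> Mor C V X" "h \<in> Mor C V X" "f \<cdot> g = f \<cdot> h"
      note H = Hom_facts[OF V(1) o(1)] and H' = Hom_facts[OF V(1) o(2)]
      define d where "d = g \<oplus>\<^bsub>Hom C V X\<^esub> (-1) \<odot>\<^bsub>Hom C V X\<^esub> h"
      have d: "d \<in> Mor C V X" unfolding d_def using H V by blast
      have fh: "f \<cdot> h \<in> Mor C V Y" using comp_closed V o f by blast
      have "f \<cdot> d = 1 \<odot>\<^bsub>Hom C V Y\<^esub> (f \<cdot> h) \<oplus>\<^bsub>Hom C V Y\<^esub> (-1) \<odot>\<^bsub>Hom C V Y\<^esub> (f \<cdot> h)"
        unfolding d_def using comp_add_right[of V X Y g _ f] comp_smult_right[of V X Y h f] V o f H H'(5) fh by simp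
      also have "\<dots> = \<zero>\<^bsub>Hom C V Y\<^esub>" using H'(7)[OF fh, of 1 "-1"] H'(4)[OF fh] by simp
      finally obtain u where u: "u \<in> Mor C V K" "k \<cdot> u = d" using K' d V by blast
      have "u = \<zero>\<^bsub>Hom C V K\<^esub>" using zero_object_unique(1)[OF 1 V(1) u(1)] Hom_facts(1)[of V K] V K' by blast
      then have d0: "d = \<zero>\<^bsub>Hom C V X\<^esub>" using u comp_zero(2)[of V K X k] V K' by auto
      have "h = d \<oplus>\<^bsub>Hom C V X\<^esub> h" unfolding d0 using H V by simp
      also have "\<dots> = g \<oplus>\<^bsub>Hom C V X\<^esub> ((-1) \<odot>\<^bsub>Hom C V X\<^esub> h \<oplus>\<^bsub>Hom C V X\<^esub> 1 \<odot>\<^bsub>Hom C V X\<^esub> h)"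
      proof -
        interpret G: abelian_group "Hom C V X" by (rule Hom_abelian_group[OF V(1) o(1)])
        show ?thesis unfolding d_def using G.a_assoc[of g "(-1) \<odot>\<^bsub>Hom C V X\<^esub> h" h] V H by simp
      qed
      also have "\<dots> = g" using H(7)[OF V(3), of "-1" 1] H(4)[OF V(3)] H(9)[OF V(2)] by simp
      finally show "g = h" by simp
    qed
    then show ?thesis using Y X unfolding is_simple_def by blast
  next
    case 2
    note k = iso_facts[OF 2]
    have ff: "arr f" "src f = X" "tgt f = Y" using f by (auto simp: Mor_iff)
    have "f = f \<cdot> (k \<cdot> inv_mor C K X k)" using k ff by simp
    also have "\<dots> = (f \<cdot> k) \<cdot> inv_mor C K X k" using k ff by simp
    also have "\<dots> = \<zero>\<^bsub>Hom C X Y\<^esub>"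
      using K' comp_zero(1)[of X K Y "inv_mor C K X k"] k by (simp add: Mor_iff)
    finally show ?thesis by simp
  qed
qed

end

context premodular_category begin

text \<open>
  Horner's scheme for a polynomial in the endomorphism \<open>f\<close>.
\<close>

definition poly_eval_list :: "'o \<Rightarrow> 'm \<Rightarrow> 'k list \<Rightarrow> 'm" where
  "poly_eval_list X f as = foldr (\<lambda>a t. a \<odot>\<^bsub>Hom A X X\<^esub> Id A X \<oplus>\<^bsub>Hom A X X\<^esub> f \<cdot> t) as \<zero>\<^bsub>Hom A X X\<^esub>"

definition poly_eval :: "'o \<Rightarrow> 'm \<Rightarrow> 'k poly \<Rightarrow> 'm" where
  "poly_eval X f p = poly_eval_list X f (coeffs p)"

context
  fixes X f
  assumes X [simp]: "X \<in> Obj A" and f [simp]: "f \<in> Mor A X X"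
begin

private lemma fX [simp]: "arr f" "src f = X" "tgt f = X"
  using Mor_typing[OF X X f] by simp_all

private lemmas H = Hom_facts[OF X X]

lemma poly_eval_0: "poly_eval X f 0 = \<zero>\<^bsub>Hom A X X\<^esub>"
  by (simp add: poly_eval_def poly_eval_list_def)

lemma poly_eval_pCons: "poly_eval X f (pCons a p) = a \<odot>\<^bsub>Hom A X X\<^esub> Id A X \<oplus>\<^bsub>Hom A X X\<^esub> f \<cdot> poly_eval X f p"
proof (cases "a = 0 \<and> p = 0")
  case True
  then show ?thesis using H(4)[OF id_closed[OF X]] comp_zero(2)[OF X X X f] H(9)[OF H(1)]
    by (simp add: poly_eval_0)
next
  case False
  then show ?thesis by (auto simp: poly_eval_def poly_eval_list_def cCons_def coeffs_eq_Nil)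
qed

lemma poly_eval_closed [simp]: "poly_eval X f p \<in> Mor A X X"
  by (induction p) (auto simp: poly_eval_0 poly_eval_pCons intro!: H(1-3) id_closed comp_closed)

lemma poly_eval_add: "poly_eval X f (p + q) = poly_eval X f p \<oplus>\<^bsub>Hom A X X\<^esub> poly_eval X f q"
proof (induction p q rule: poly_induct2)
  case 0
  then show ?case using H(9)[OF H(1)] by (simp add: poly_eval_0)
next
  case (pCons a p b q)
  interpret G: abelian_group "Hom A X X" by (rule Hom_abelian_group[OF X X])
  have c: "f \<cdot> poly_eval X f p \<in> Mor A X X" "f \<cdot> poly_eval X f q \<in> Mor A X X" "a \<odot>\<^bsub>Hom A X X\<^esub> Id A X \<in> Mor A X X" "b \<odot>\<^bsub>Hom A X X\<^esub> Id A X \<in> Mor A X X"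
    using comp_closed[of X X X] H(3)[OF id_closed[OF X]] by auto
  show ?case using pCons c H(7)[OF id_closed[OF X]]
    by (simp add: poly_eval_pCons comp_add_right[of X X X] G.a_ac)
qed

lemma poly_eval_smult: "poly_eval X f (smult c p) = c \<odot>\<^bsub>Hom A X X\<^esub> poly_eval X f p"
proof (induction p)
  case 0
  then show ?case using H(11) by (simp add: poly_eval_0)
next
  case (pCons a p)
  have "f \<cdot> poly_eval X f p \<in> Mor A X X" using comp_closed[of X X X] by auto
  then show ?case using pCons H(8)[of _ _ c] H(3)[OF id_closed[OF X]] H(6)[OF id_closed[OF X]]
    by (simp add: poly_eval_pCons comp_smult_right[of X X X])
qed

lemma poly_eval_root_factor: "poly_eval X f ([:- r, 1:] * q) = (f \<oplus>\<^bsub>Hom A X X\<^esub> (- r) \<odot>\<^bsub>Hom A X X\<^esub> Id A X) \<cdot> poly_eval X f q"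
proof -
  interpret G: abelian_group "Hom A X X" by (rule Hom_abelian_group[OF X X])
  have c: "f \<cdot> poly_eval X f q \<in> Mor A X X" using comp_closed[of X X X] by auto
  have "[:- r, 1:] * q = smult (- r) q + pCons 0 q" by simp
  then have "poly_eval X f ([:- r, 1:] * q) = (- r) \<odot>\<^bsub>Hom A X X\<^esub> poly_eval X f q \<oplus>\<^bsub>Hom A X X\<^esub> f \<cdot> poly_eval X f q"
    using H(4)[OF id_closed[OF X]] H(10)[OF c] by (simp only: poly_eval_add poly_eval_smult poly_eval_pCons)
  also have "\<dots> = (f \<oplus>\<^bsub>Hom A X X\<^esub> (- r) \<odot>\<^bsub>Hom A X X\<^esub> Id A X) \<cdot> poly_eval X f q"
    using c H(3)[of "poly_eval X f q"] H(3)[OF id_closed[OF X]] comp_id_left[OF X X poly_eval_closed]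
    by (simp add: comp_add_left[of X X X] comp_smult_left[of X X X] id_closed G.a_comm)
  finally show ?thesis .
qed

text \<open>
  The powers of \<open>f\<close> cannot be linearly independent in a finite-dimensional space.
\<close>

lemma poly_eval_annihilator: "\<exists>p. p \<noteq> 0 \<and> poly_eval X f p = \<zero>\<^bsub>Hom A X X\<^esub>"
proof -
  interpret G: abelian_group "Hom A X X" by (rule Hom_abelian_group[OF X X])
  obtain B where B: "finite B" "B \<subseteq> Mor A X X"
    and sp: "\<And>g. g \<in> Mor A X X \<Longrightarrow> \<exists>a. g = (\<Oplus>\<^bsub>Hom A X X\<^esub>b \<in> B. a b \<odot>\<^bsub>Hom A X X\<^esub> b)"
    using finite_dimensional_hom[OF X X] by blast
  have "\<forall>j. \<exists>a. poly_eval X f (monom 1 j) = (\<Oplus>\<^bsub>Hom A X X\<^esub>b \<in> B. a b \<odot>\<^bsub>Hom A X X\<^esub> b)" using sp by simp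
  then obtain a where a: "\<And>j. poly_eval X f (monom 1 j) = (\<Oplus>\<^bsub>Hom A X X\<^esub>b \<in> B. a j b \<odot>\<^bsub>Hom A X X\<^esub> b)" by metis
  obtain c where c: "\<exists>j \<in> {..card B}. c j \<noteq> 0" "\<forall>b \<in> B. (\<Sum>j \<in> {..card B}. c j * a j b) = 0"
    using homogeneous_system_solution[of B "{..card B}" a] B by auto
  have sc: "\<And>x b. b \<in> B \<Longrightarrow> x \<odot>\<^bsub>Hom A X X\<^esub> b \<in> Mor A X X" using B H(3) by blast
  have e: "poly_eval X f (\<Sum>j \<in> J. smult (c j) (monom 1 j)) = (\<Oplus>\<^bsub>Hom A X X\<^esub>b \<in> B. (\<Sum>j \<in> J. c j * a j b) \<odot>\<^bsub>Hom A X X\<^esub> b)"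
    if "finite J" for J using that
  proof (induction J rule: finite_induct)
    case empty
    have "(\<Oplus>\<^bsub>Hom A X X\<^esub>b \<in> B. 0 \<odot>\<^bsub>Hom A X X\<^esub> b) = (\<Oplus>\<^bsub>Hom A X X\<^esub>b \<in> B. \<zero>\<^bsub>Hom A X X\<^esub>)"
      using B H(4) by (intro G.finsum_cong') auto
    then show ?case by (simp add: poly_eval_0)
  next
    case (insert j J)
    have "c j \<odot>\<^bsub>Hom A X X\<^esub> poly_eval X f (monom 1 j) = (\<Oplus>\<^bsub>Hom A X X\<^esub>b \<in> B. c j \<odot>\<^bsub>Hom A X X\<^esub> (a j b \<odot>\<^bsub>Hom A X X\<^esub> b))"
      unfolding a using B sc by (intro lin_finsum lin_smult_self) auto
    also have "\<dots> = (\<Oplus>\<^bsub>Hom A X X\<^esub>b \<in> B. (c j * a j b) \<odot>\<^bsub>Hom A X X\<^esub> b)"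
      using B sc H(6) by (intro G.finsum_cong') auto
    finally have "poly_eval X f (\<Sum>j \<in> insert j J. smult (c j) (monom 1 j)) =
      (\<Oplus>\<^bsub>Hom A X X\<^esub>b \<in> B. (c j * a j b) \<odot>\<^bsub>Hom A X X\<^esub> b) \<oplus>\<^bsub>Hom A X X\<^esub> (\<Oplus>\<^bsub>Hom A X X\<^esub>b \<in> B. (\<Sum>j \<in> J. c j * a j b) \<odot>\<^bsub>Hom A X X\<^esub> b)"
      using insert by (simp add: poly_eval_add poly_eval_smult)
    also have "\<dots> = (\<Oplus>\<^bsub>Hom A X X\<^esub>b \<in> B. (c j * a j b) \<odot>\<^bsub>Hom A X X\<^esub> b \<oplus>\<^bsub>Hom A X X\<^esub> (\<Sum>j \<in> J. c j * a j b) \<odot>\<^bsub>Hom A X X\<^esub> b)"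
      using sc by (intro G.finsum_addf[symmetric]) auto
    also have "\<dots> = (\<Oplus>\<^bsub>Hom A X X\<^esub>b \<in> B. (\<Sum>j \<in> insert j J. c j * a j b) \<odot>\<^bsub>Hom A X X\<^esub> b)"
      using insert B sc H(7) by (intro G.finsum_cong') auto
    finally show ?case .
  qed
  let ?p = "\<Sum>j \<in> {..card B}. smult (c j) (monom 1 j)"
  have "poly_eval X f ?p = (\<Oplus>\<^bsub>Hom A X X\<^esub>b \<in> B. \<zero>\<^bsub>Hom A X X\<^esub>)"
    unfolding e[OF finite_atMost] using c B H(4) by (intro G.finsum_cong') auto
  moreover have "?p \<noteq> 0"
  proof -
    obtain j where j: "j \<le> card B" "c j \<noteq> 0" using c by auto
    have "coeff ?p j = (\<Sum>l \<in> {..card B}. if l = j then c l else 0)"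
      by (simp add: coeff_sum smult_monom)
    then have "coeff ?p j = c j" using j by simp
    then show ?thesis using j by auto
  qed
  ultimately show ?thesis by auto
qed

text \<open>
  Over an algebraically closed field an annihilating polynomial has a linear factor \<open>f - r\<close>.  By Schur's lemma this factor
  is zero or invertible, and in the second case it can be cancelled, which lowers the degree.
\<close>

lemma endomorphism_scalar:
  assumes s: "is_simple A X"
  shows "\<exists>a. f = a \<odot>\<^bsub>Hom A X X\<^esub> Id A X"
proof -
  interpret G: abelian_group "Hom A X X" by (rule Hom_abelian_group[OF X X])
  have "\<exists>a. f = a \<odot>\<^bsub>Hom A X X\<^esub> Id A X" if "p \<noteq> 0" "poly_eval X f p = \<zero>\<^bsub>Hom A X X\<^esub>" for p
    using that
  proof (induction "degree p" arbitrary: p)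
    case 0
    then obtain c where p: "p = [:c:]" "c \<noteq> 0" by (metis degree_eq_zeroE pCons_0_0)
    have "c \<odot>\<^bsub>Hom A X X\<^esub> Id A X = \<zero>\<^bsub>Hom A X X\<^esub>"
      using 0 p comp_zero(2)[OF X X X f] H(9)[OF H(3)[OF id_closed[OF X]]] by (simp add: poly_eval_pCons poly_eval_0)
    then have "(1 / c) \<odot>\<^bsub>Hom A X X\<^esub> (c \<odot>\<^bsub>Hom A X X\<^esub> Id A X) = \<zero>\<^bsub>Hom A X X\<^esub>" using H(11) by simp
    then have "Id A X = \<zero>\<^bsub>Hom A X X\<^esub>" using H(5,6)[OF id_closed[OF X]] p by (simp flip: H(6)[OF id_closed[OF X]])
    then show ?case using simple_Id_nonzero[OF s] by simp
  next
    case (Suc n)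
    then obtain r where "poly p r = 0" using alg_closed_imp_poly_has_root[of p] by auto
    then obtain q where q: "p = [:- r, 1:] * q" using poly_eq_0_iff_dvd by (metis dvdE)
    have q0: "q \<noteq> 0" using Suc q by auto
    have "degree p = degree [:- r, 1:] + degree q" unfolding q using q0 by (intro degree_mult_eq) auto
    then have dq: "n = degree q" using Suc(2) by simp
    let ?g = "f \<oplus>\<^bsub>Hom A X X\<^esub> (- r) \<odot>\<^bsub>Hom A X X\<^esub> Id A X"
    have g: "?g \<in> Mor A X X" using H f id_closed[OF X] by blast
    from schur[OF s s g] show ?case
    proof
      assume z: "?g = \<zero>\<^bsub>Hom A X X\<^esub>"
      have c: "r \<odot>\<^bsub>Hom A X X\<^esub> Id A X \<in> Mor A X X" "(- r) \<odot>\<^bsub>Hom A X X\<^esub> Id A X \<in> Mor A X X" using H(3) id_closed[OF X] by blast+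
      have "f = f \<oplus>\<^bsub>Hom A X X\<^esub> ((- r) \<odot>\<^bsub>Hom A X X\<^esub> Id A X \<oplus>\<^bsub>Hom A X X\<^esub> r \<odot>\<^bsub>Hom A X X\<^esub> Id A X)"
        using H(7)[OF id_closed[OF X], of "- r" r] H(4)[OF id_closed[OF X]] H(9)[OF f] by simp
      also have "\<dots> = ?g \<oplus>\<^bsub>Hom A X X\<^esub> r \<odot>\<^bsub>Hom A X X\<^esub> Id A X" using G.a_assoc[OF f c(2,1)] by simp
      also have "\<dots> = r \<odot>\<^bsub>Hom A X X\<^esub> Id A X" unfolding z using H(10)[OF c(1)] .
      finally show ?thesis by blast
    next
      assume i: "is_iso A X X ?g"
      note ii = iso_facts[OF i]
      have pq: "?g \<cdot> poly_eval X f q = \<zero>\<^bsub>Hom A X X\<^esub>" using Suc(4) q poly_eval_root_factor by simp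
      have pt: "arr (poly_eval X f q)" "src (poly_eval X f q) = X" "tgt (poly_eval X f q) = X" using poly_eval_closed[of q] by (auto simp: Mor_iff simp del: poly_eval_closed)
      have "poly_eval X f q = (inv_mor A X X ?g \<cdot> ?g) \<cdot> poly_eval X f q" using ii(8) pt by simp
      also have "\<dots> = inv_mor A X X ?g \<cdot> (?g \<cdot> poly_eval X f q)" by (rule arr_comp_assoc) (use ii pt in simp_all)
      also have "\<dots> = \<zero>\<^bsub>Hom A X X\<^esub>" unfolding pq using comp_zero(2)[OF X X X, of "inv_mor A X X ?g"] ii by (simp add: Mor_iff)
      finally show ?thesis using Suc(1)[OF dq q0] by blast
    qed
  qed
  then show ?thesis using poly_eval_annihilator by blast
qed

end

section \<open>Dimensions and decompositions into simple objects\<close>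

lemma pivotal_ev_typing [simp]: "X \<in> Obj A \<Longrightarrow> arr (pivotal_ev A X)" "X \<in> Obj A \<Longrightarrow> src (pivotal_ev A X) = X \<star> Ldual A X"
  "X \<in> Obj A \<Longrightarrow> tgt (pivotal_ev A X) = Unit A"
  using rep_typing[OF rep_pivotal_ev[of X], of "X \<star> Ldual A X" "Unit A"] by simp_all

lemma Ev_Coev_typing [simp]: "X \<in> Obj A \<Longrightarrow> arr (Ev A X)" "X \<in> Obj A \<Longrightarrow> src (Ev A X) = Ldual A X \<star> X"
  "X \<in> Obj A \<Longrightarrow> tgt (Ev A X) = Unit A" "X \<in> Obj A \<Longrightarrow> arr (Coev A X)" "X \<in> Obj A \<Longrightarrow> src (Coev A X) = Unit A"
  "X \<in> Obj A \<Longrightarrow> tgt (Coev A X) = X \<star> Ldual A X"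
  using rep_typing[OF rep_Ev[of X], of "Ldual A X \<star> X" "Unit A"] rep_typing[OF rep_Coev[of X], of "Unit A" "X \<star> Ldual A X"] by simp_all

lemma cT_typing [simp]: "X \<in> Obj A \<Longrightarrow> arr (cT X)" "X \<in> Obj A \<Longrightarrow> src (cT X) = Unit A"
  "X \<in> Obj A \<Longrightarrow> tgt (cT X) = Ldual A X \<star> X"
  using rep_typing[OF rep_cT[of X], of "Unit A" "Ldual A X \<star> X"] by simp_all

lemma scalar_eq:
  assumes "is_simple A X" "a \<odot>\<^bsub>Hom A X X\<^esub> Id A X = b \<odot>\<^bsub>Hom A X X\<^esub> Id A X"
  shows "a = b"
proof (rule ccontr)
  assume "a \<noteq> b"
  have X: "X \<in> Obj A" using assms by (simp add: is_simple_def)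
  note H = Hom_facts[OF X X] and i = id_closed[OF X]
  have "(a - b) \<odot>\<^bsub>Hom A X X\<^esub> Id A X = a \<odot>\<^bsub>Hom A X X\<^esub> Id A X \<oplus>\<^bsub>Hom A X X\<^esub> (- b) \<odot>\<^bsub>Hom A X X\<^esub> Id A X"
    using H(7)[OF i, of a "- b"] by simp
  also have "\<dots> = (b + - b) \<odot>\<^bsub>Hom A X X\<^esub> Id A X" unfolding assms(2) H(7)[OF i] ..
  also have "\<dots> = \<zero>\<^bsub>Hom A X X\<^esub>" using H(4)[OF i] by simp
  finally have "(1 / (a - b)) \<odot>\<^bsub>Hom A X X\<^esub> ((a - b) \<odot>\<^bsub>Hom A X X\<^esub> Id A X) = \<zero>\<^bsub>Hom A X X\<^esub>" using H(11) by simp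
  then have "Id A X = \<zero>\<^bsub>Hom A X X\<^esub>" using \<open>a \<noteq> b\<close> H(5)[OF i] by (simp flip: H(6)[OF i])
  then show False using simple_Id_nonzero[OF assms(1)] by simp
qed

text \<open>
  The description of the dimension has a unique solution because the unit is simple.
\<close>

lemma dim_works:
  assumes [simp]: "X \<in> Obj A"
  shows "pivotal_ev A X \<cdot> Coev A X = dim A X \<odot>\<^bsub>Hom A (Unit A) (Unit A)\<^esub> Id A (Unit A)"
proof -
  let ?I = "Unit A"
  have "pivotal_ev A X \<cdot> Coev A X \<in> Mor A ?I ?I" by (simp add: Mor_iff)
  then obtain a where a: "pivotal_ev A X \<cdot> Coev A X = a \<odot>\<^bsub>Hom A ?I ?I\<^esub> Id A ?I"
    using endomorphism_scalar[OF unit_closed _ unit_simple] by blast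
  have u: "a = b" if "pivotal_ev A X \<cdot> Coev A X = b \<odot>\<^bsub>Hom A ?I ?I\<^esub> Id A ?I" for b
    using scalar_eq[OF unit_simple] a that by simp
  have "dim A X = a" unfolding dim_def
  proof (rule the_equality)
    show "pivotal_ev A X \<cdot> Coev A X = a \<odot>\<^bsub>Hom A ?I ?I\<^esub> Id A ?I" by (rule a)
    show "b = a" if "pivotal_ev A X \<cdot> Coev A X = b \<odot>\<^bsub>Hom A ?I ?I\<^esub> Id A ?I" for b using u[OF that] by simp
  qed
  then show ?thesis using a by simp
qed

lemma left_dim:
  assumes [simp]: "X \<in> Obj A"
  shows "Ev A X \<cdot> cT X = dim A X \<odot>\<^bsub>Hom A (Unit A) (Unit A)\<^esub> Id A (Unit A)"
proof -
  have e: "W [] (sp X) [] \<bullet> W [] (co X) [] \<bullet> t = W [] (ev X) [] \<bullet> W [] (sc X) [] \<bullet> t" for t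
    using arg_cong[OF spherical[of X], of "\<lambda>s. W [] s [] \<bullet> t"] by simp
  have "Ev A X \<cdot> cT X = pivotal_ev A X \<cdot> Coev A X"
    by (rule rep_eqI, (rule reps rep_Ev rep_cT rep_pivotal_ev rep_Coev | (simp; fail))+) (simp add: e)
  then show ?thesis using dim_works by simp
qed

text \<open>
  The index \<open>a\<close> runs over the summands of a decomposition into simple objects; \<open>F k a\<close> and \<open>G k a\<close> vanish unless the
  \<open>a\<close>-th summand is isomorphic to \<open>k\<close>.  In this form one bound \<open>n\<close> serves for all \<open>k\<close>.
\<close>

lemma decomposition:
  assumes [simp]: "M \<in> Obj A" and I: "simple_representatives A I" "finite I"
  shows "\<exists>n F G. (\<forall>k \<in> I. \<forall>a < n. F k a \<in> Mor A k M \<and> G k a \<in> Mor A M k) \<and>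
     Id A M = (\<Oplus>\<^bsub>Hom A M M\<^esub>k \<in> I. \<Oplus>\<^bsub>Hom A M M\<^esub>a \<in> {..<n::nat}. F k a \<cdot> G k a)"
proof -
  have Io: "\<And>k. k \<in> I \<Longrightarrow> k \<in> Obj A" using I(1) unfolding simple_representatives_def is_simple_def by blast
  obtain S n where S: "is_direct_sum A M S n" "\<forall>j < n. is_simple A (S j)" using semisimple[OF assms(1)] by blast
  obtain i p where ip: "\<forall>j < n. i j \<in> Mor A (S j) M \<and> p j \<in> Mor A M (S j)"
    and one: "(\<Oplus>\<^bsub>Hom A M M\<^esub>j \<in> {..<n}. i j \<cdot> p j) = Id A M"
    using S(1) unfolding is_direct_sum_def by blast
  have So: "\<And>j. j < n \<Longrightarrow> S j \<in> Obj A" using S(1) unfolding is_direct_sum_def by blast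
  have "\<forall>j. \<exists>k. j < n \<longrightarrow> k \<in> I \<and> isomorphic A (S j) k"
    using I(1) S(2) unfolding simple_representatives_def by blast
  from choice[OF this] obtain \<kappa> where \<kappa>: "\<And>j. j < n \<Longrightarrow> \<kappa> j \<in> I \<and> isomorphic A (S j) (\<kappa> j)" by blast
  then have "\<forall>j. \<exists>\<phi>. j < n \<longrightarrow> is_iso A (S j) (\<kappa> j) \<phi>" unfolding isomorphic_def by blast
  from choice[OF this] obtain \<phi> where \<phi>: "\<And>j. j < n \<Longrightarrow> is_iso A (S j) (\<kappa> j) (\<phi> j)" by blast
  have k: "\<And>j. j < n \<Longrightarrow> \<kappa> j \<in> I" "\<And>j. j < n \<Longrightarrow> is_iso A (S j) (\<kappa> j) (\<phi> j)" by (simp_all add: \<kappa> \<phi>)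
  note pf = iso_facts[OF k(2)]
  define F where "F l a = (if l = \<kappa> a then i a \<cdot> inv_mor A (S a) (\<kappa> a) (\<phi> a) else \<zero>\<^bsub>Hom A l M\<^esub>)" for l a
  define G where "G l a = (if l = \<kappa> a then \<phi> a \<cdot> p a else \<zero>\<^bsub>Hom A M l\<^esub>)" for l a
  have ipt: "arr (i a)" "src (i a) = S a" "tgt (i a) = M" "arr (p a)" "src (p a) = M" "tgt (p a) = S a" if "a < n" for a
    using ip[rule_format, OF that] Mor_typing So[OF that] assms(1) by blast+
  have FG: "F l a \<in> Mor A l M" "G l a \<in> Mor A M l" if "l \<in> I" "a < n" for l a
  proof -
    note q = ipt[OF that(2)] pf[OF that(2)] and o = Io[OF that(1)]
    have z: "\<zero>\<^bsub>Hom A l M\<^esub> \<in> Mor A l M" "\<zero>\<^bsub>Hom A M l\<^esub> \<in> Mor A M l"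
      using Hom_facts(1)[OF o assms(1)] Hom_facts(1)[OF assms(1) o] by blast+
    have "i a \<cdot> inv_mor A (S a) (\<kappa> a) (\<phi> a) \<in> Mor A (\<kappa> a) M" "\<phi> a \<cdot> p a \<in> Mor A M (\<kappa> a)"
      using comp_closed[of "\<kappa> a" "S a" M "inv_mor A (S a) (\<kappa> a) (\<phi> a)" "i a"] comp_closed[of M "S a" "\<kappa> a" "p a" "\<phi> a"]
        is_iso_inverse_pair[OF k(2)[OF that(2)]] ip[rule_format, OF that(2)] assms(1)
      unfolding inverse_pair_def by blast+
    then show "F l a \<in> Mor A l M" "G l a \<in> Mor A M l" unfolding F_def G_def using z by simp_all
  qed
  have e: "F l a \<cdot> G l a = (if \<kappa> a = l then i a \<cdot> p a else \<zero>\<^bsub>Hom A M M\<^esub>)" if la: "l \<in> I" "a < n" for l a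
  proof (cases "l = \<kappa> a")
    case True
    note q = ipt[OF la(2)] pf[OF la(2)]
    have "F l a \<cdot> G l a = i a \<cdot> (inv_mor A (S a) (\<kappa> a) (\<phi> a) \<cdot> \<phi> a) \<cdot> p a"
      unfolding F_def G_def using True q(1-12) by simp
    also have "\<dots> = i a \<cdot> p a" unfolding q(14) using q(1-6) by simp
    finally show ?thesis using True by simp
  next
    case False
    then show ?thesis
      using comp_zero(2)[OF assms(1) Io[OF la(1)] assms(1) Hom_facts(1)[OF Io[OF la(1)] assms(1)]] unfolding F_def G_def by simp
  qed
  interpret H: abelian_group "Hom A M M" by (rule Hom_abelian_group) simp_all
  have ipc: "i a \<cdot> p a \<in> carrier (Hom A M M)" if "a < n" for a by (simp add: Mor_iff ipt that)
  have FGc: "F l a \<cdot> G l a \<in> carrier (Hom A M M)" if "l \<in> I" "a < n" for l a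
    using e[OF that] ipc[OF that(2)] by simp
  have "(\<Oplus>\<^bsub>Hom A M M\<^esub>k \<in> I. \<Oplus>\<^bsub>Hom A M M\<^esub>a \<in> {..<n}. F k a \<cdot> G k a) = (\<Oplus>\<^bsub>Hom A M M\<^esub>a \<in> {..<n}. \<Oplus>\<^bsub>Hom A M M\<^esub>k \<in> I. F k a \<cdot> G k a)"
    using FGc I(2) by (intro H.finsum_swap) auto
  also have "\<dots> = (\<Oplus>\<^bsub>Hom A M M\<^esub>a \<in> {..<n}. i a \<cdot> p a)"
  proof (intro H.finsum_cong')
    fix a assume a: "a \<in> {..<n}"
    have "(\<Oplus>\<^bsub>Hom A M M\<^esub>k \<in> I. F k a \<cdot> G k a) = (\<Oplus>\<^bsub>Hom A M M\<^esub>k \<in> I. if \<kappa> a = k then i a \<cdot> p a else \<zero>\<^bsub>Hom A M M\<^esub>)"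
      using a e ipc by (intro H.finsum_cong') auto
    also have "\<dots> = i a \<cdot> p a" using a k(1) I(2) ipc by (intro H.finsum_singleton) auto
    finally show "(\<Oplus>\<^bsub>Hom A M M\<^esub>k \<in> I. F k a \<cdot> G k a) = i a \<cdot> p a" .
  qed (use ipc in auto)
  finally have "Id A M = (\<Oplus>\<^bsub>Hom A M M\<^esub>k \<in> I. \<Oplus>\<^bsub>Hom A M M\<^esub>a \<in> {..<n}. F k a \<cdot> G k a)" using one by simp
  then show ?thesis using FG by blast
qed

text \<open>
  The left duals of morphisms \<open>f : i \<rightarrow> \<^sup>*N\<close> and \<open>g : \<^sup>*N \<rightarrow> i\<close>, read as morphisms \<open>N \<rightarrow> i\<^sup>*\<close> and \<open>i\<^sup>* \<rightarrow> N\<close>; \<open>rotate\<close>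
  does the same for endomorphisms of \<open>\<^sup>*N\<close>, so that it takes \<open>f \<cdot> g\<close> to \<open>fdual N i g \<cdot> edual N i f\<close>.
\<close>

definition edual :: "'o \<Rightarrow> 'o \<Rightarrow> 'm \<Rightarrow> 'm" where
  "edual N i f = Lunit A (Ldual A i) \<cdot> (REv A N \<boxtimes> Id A (Ldual A i)) \<cdot> Assoc_inv A N (Rdual A N) (Ldual A i) \<cdot>
     (Id A N \<boxtimes> (f \<boxtimes> Id A (Ldual A i))) \<cdot> (Id A N \<boxtimes> Coev A i) \<cdot> Runit_inv A N"

definition fdual :: "'o \<Rightarrow> 'o \<Rightarrow> 'm \<Rightarrow> 'm" where
  "fdual N i g = Lunit A N \<cdot> (Ev A i \<boxtimes> Id A N) \<cdot> Assoc_inv A (Ldual A i) i N \<cdot>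
     (Id A (Ldual A i) \<boxtimes> (g \<boxtimes> Id A N)) \<cdot> (Id A (Ldual A i) \<boxtimes> RCoev A N) \<cdot> Runit_inv A (Ldual A i)"

definition rotate :: "'o \<Rightarrow> 'm \<Rightarrow> 'm" where
  "rotate N m = Lunit A N \<cdot> (REv A N \<boxtimes> Id A N) \<cdot> Assoc_inv A N (Rdual A N) N \<cdot>
     (Id A N \<boxtimes> (m \<boxtimes> Id A N)) \<cdot> (Id A N \<boxtimes> RCoev A N) \<cdot> Runit_inv A N"

lemma REv_typing [simp]:
  assumes "N \<in> Obj A"
  shows "arr (REv A N)" "src (REv A N) = N \<star> Rdual A N" "tgt (REv A N) = Unit A"
    "arr (RCoev A N)" "src (RCoev A N) = Unit A" "tgt (RCoev A N) = Rdual A N \<star> N"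
proof -
  have o: "N \<star> Rdual A N \<in> Obj A" "Rdual A N \<star> N \<in> Obj A" using assms by simp_all
  have m: "REv A N \<in> Mor A (N \<star> Rdual A N) (Unit A)" "RCoev A N \<in> Mor A (Unit A) (Rdual A N \<star> N)"
    using right_dual[OF assms] unfolding is_left_dual_def by blast+
  show "arr (REv A N)" "src (REv A N) = N \<star> Rdual A N" "tgt (REv A N) = Unit A"
    "arr (RCoev A N)" "src (RCoev A N) = Unit A" "tgt (RCoev A N) = Rdual A N \<star> N"
    using Mor_typing[OF o(1) unit_closed m(1)] Mor_typing[OF unit_closed o(2) m(2)] by blast+
qed

text \<open>
  Decompose the right dual of \<open>N\<close> and dualise; the summands become the duals of the chosen simple objects.
\<close>

lemma dual_decomposition:
  assumes [simp]: "N \<in> Obj A" and I: "simple_representatives A I" "finite I"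
  shows "\<exists>n E E'. (\<forall>i \<in> I. \<forall>b < n. E i b \<in> Mor A N (Ldual A i) \<and> E' i b \<in> Mor A (Ldual A i) N) \<and>
     Id A N = (\<Oplus>\<^bsub>Hom A N N\<^esub>i \<in> I. \<Oplus>\<^bsub>Hom A N N\<^esub>b \<in> {..<n::nat}. E' i b \<cdot> E i b)"
proof -
  let ?M = "Rdual A N"
  have Io: "\<And>k. k \<in> I \<Longrightarrow> k \<in> Obj A" using I(1) unfolding simple_representatives_def is_simple_def by blast
  obtain n F G where FG: "\<forall>i \<in> I. \<forall>a < n. F i a \<in> Mor A i ?M \<and> G i a \<in> Mor A ?M i"
    and one: "Id A ?M = (\<Oplus>\<^bsub>Hom A ?M ?M\<^esub>k \<in> I. \<Oplus>\<^bsub>Hom A ?M ?M\<^esub>a \<in> {..<n::nat}. F k a \<cdot> G k a)"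
    using decomposition[OF Rdual_closed[OF assms(1)] I] by blast
  have FGt: "arr (F i a)" "src (F i a) = i" "tgt (F i a) = ?M" "arr (G i a)" "src (G i a) = ?M" "tgt (G i a) = i" if "i \<in> I" "a < n" for i a
    using FG[rule_format, OF that] Mor_typing Io[OF that(1)] Rdual_closed[OF assms(1)] by blast+
  define rev rcoev where "rev = ui \<bullet> hat (REv A N) \<bullet> mm N ?M" and "rcoev = mi ?M N \<bullet> hat (RCoev A N) \<bullet> uu"
  note R = dual_strict[OF right_dual[OF assms(1)], folded rev_def rcoev_def]
  note [simp] = R(1-8)
  have prod: "fdual N i (G i a) \<cdot> edual N i (F i a) = rotate N (F i a \<cdot> G i a)" if ia: "i \<in> I" "a < n" for i a
  proof -
    note [simp] = Io[OF ia(1)] FGt[OF ia]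
    let ?i' = "Ldual A i"
    define S where "S = W [] rev [?i'] \<bullet> W [N] (hat (F i a)) [?i'] \<bullet> W [N] (co i) []"
    have [simp]: "sarr S" "sdom S = [N]" "scod S = [?i']" by (simp_all add: S_def)
    have r: "rep (edual N i (F i a)) S" unfolding edual_def S_def
      by (rule rep_via, (rule reps R(9,10) rep_Coev rep_hat | (simp; fail))+, (simp)?)
    define T where "T = W [] (ev i) [N] \<bullet> W [?i'] (hat (G i a)) [N] \<bullet> W [?i'] rcoev []"
    have [simp]: "sarr T" "sdom T = [?i']" "scod T = [N]" by (simp_all add: T_def)
    have r': "rep (fdual N i (G i a)) T" unfolding fdual_def T_def
      by (rule rep_via, (rule reps R(9,10) rep_Ev rep_hat | (simp; fail))+, (simp)?)
    define H where "H = rev \<bullet> W [N] (hat (F i a)) []"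
    have [simp]: "sarr H" "sdom H = [N, i]" "scod H = []" by (simp_all add: H_def)
    define K where "K = W [] (hat (G i a)) [N] \<bullet> rcoev"
    have [simp]: "sarr K" "sdom K = []" "scod K = [i, N]" by (simp_all add: K_def)
    have S: "S = W [] H [?i'] \<bullet> W [N] (co i) []" by (simp add: S_def H_def)
    have T: "T = W [] (ev i) [N] \<bullet> W [?i'] K []" by (simp add: T_def K_def)
    have i1: "W [?i'] K [] \<bullet> W [] H [?i'] \<bullet> t = W [] H [?i', i, N] \<bullet> W [N, i, ?i'] K [] \<bullet> t" for t
      using arg_cong[OF interchange_s[of H K "[]" "[?i']" "[]"], of "\<lambda>s. s \<bullet> t"] by simp
    have i2: "W [] (ev i) [N] \<bullet> W [] H [?i', i, N] \<bullet> t = W [] H [N] \<bullet> W [N, i] (ev i) [N] \<bullet> t" for t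
      using arg_cong[OF interchange_s[of H "ev i" "[]" "[]" "[N]"], of "\<lambda>s. s \<bullet> t"] by simp
    have i3: "W [N, i, ?i'] K [] \<bullet> W [N] (co i) [] = W [N] (co i) [i, N] \<bullet> W [N] K []"
      using interchange_s[of "co i" K "[N]" "[]" "[]"] by simp
    have s: "W [] T [] \<bullet> W [] S [] = W [] H [N] \<bullet> W [N] K []"
      unfolding S T by (simp add: i1 i2 i3 zigzag_rules)
    show ?thesis unfolding rotate_def
      by (rule rep_eqI, (rule rep_comp[OF r' r] reps R(9,10) rep_hat | (simp; fail))+)
        (simp add: s, simp add: H_def K_def hat_comp)
  qed
  have lin: "lin ?M ?M N N (rotate N)"
    unfolding rotate_def by (rule lins | simp)+
  have rotId: "rotate N (Id A ?M) = Id A N"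
    using right_dual[OF assms(1)] unfolding rotate_def is_left_dual_def by (simp add: ten_id)
  have FGm: "F i b \<cdot> G i b \<in> Mor A ?M ?M" if "i \<in> I" "b < n" for i b
    by (simp add: Mor_iff FGt that)
  have rm: "rotate N (F i b \<cdot> G i b) \<in> Mor A N N" if "i \<in> I" "b < n" for i b
    using lin_closed[OF lin FGm[OF that]] .
  have "Id A N = (\<Oplus>\<^bsub>Hom A N N\<^esub>i \<in> I. rotate N (\<Oplus>\<^bsub>Hom A ?M ?M\<^esub>b \<in> {..<n}. F i b \<cdot> G i b))"
    unfolding rotId[symmetric] one using FGm I by (intro lin_finsum[OF lin] finsum_Mor) auto
  also have "\<dots> = (\<Oplus>\<^bsub>Hom A N N\<^esub>i \<in> I. \<Oplus>\<^bsub>Hom A N N\<^esub>b \<in> {..<n}. rotate N (F i b \<cdot> G i b))"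
    using FGm rm I by (intro Hom_finsum_cong lin_finsum[OF lin] finsum_Mor) auto
  also have "\<dots> = (\<Oplus>\<^bsub>Hom A N N\<^esub>i \<in> I. \<Oplus>\<^bsub>Hom A N N\<^esub>b \<in> {..<n}. fdual N i (G i b) \<cdot> edual N i (F i b))"
    using rm by (intro Hom_finsum_cong finsum_Mor) (auto simp: prod)
  finally have one': "Id A N = (\<Oplus>\<^bsub>Hom A N N\<^esub>i \<in> I. \<Oplus>\<^bsub>Hom A N N\<^esub>b \<in> {..<n}. fdual N i (G i b) \<cdot> edual N i (F i b))" .
  have t: "edual N i (F i b) \<in> Mor A N (Ldual A i)" "fdual N i (G i b) \<in> Mor A (Ldual A i) N" if "i \<in> I" "b < n" for i b
    unfolding edual_def fdual_def by (simp_all add: Mor_iff FGt that Io)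
  show ?thesis
    by (rule exI[of _ n], rule exI[of _ "\<lambda>i b. edual N i (F i b)"], rule exI[of _ "\<lambda>i b. fdual N i (G i b)"])
      (use t one' in auto)
qed

text \<open>
  The inverse of dualisation \<open>ldual_mor\<close> (\<open>ldual_unmate\<close>).
\<close>

definition unmate :: "'o \<Rightarrow> 'o \<Rightarrow> 'm \<Rightarrow> 'm" where
  "unmate i j w = Runit A i \<cdot> (Id A i \<boxtimes> Ev A j) \<cdot> Assoc A i (Ldual A j) j \<cdot> ((Id A i \<boxtimes> w) \<boxtimes> Id A j) \<cdot> (Coev A i \<boxtimes> Id A j) \<cdot> Lunit_inv A j"

lemma ldual_unmate:
  assumes [simp]: "i \<in> Obj A" "j \<in> Obj A" "arr w" "src w = Ldual A i" "tgt w = Ldual A j"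
  shows "ldual_mor A j i (unmate i j w) = w" "unmate i j w \<in> Mor A j i"
proof -
  let ?i' = "Ldual A i" let ?j' = "Ldual A j"
  define K where "K = W [i] (hat w) [] \<bullet> co i"
  have [simp]: "sarr K" "sdom K = []" "scod K = [i, ?j']" by (simp_all add: K_def)
  have r: "rep (unmate i j w) (W [i] (ev j) [] \<bullet> W [] K [j])" unfolding unmate_def K_def
    by (rule rep_via, (rule reps rep_Ev rep_Coev rep_hat | (simp; fail))+, (simp)?)
  show "unmate i j w \<in> Mor A j i" unfolding unmate_def by (simp add: Mor_iff)
  have k: "W [?i'] K [j, ?j'] \<bullet> W [?i'] (co j) [] = W [?i', i, ?j'] (co j) [] \<bullet> W [?i'] K []"
    using interchange_s[of K "co j" "[?i']" "[]" "[]"] by simp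
  show "ldual_mor A j i (unmate i j w) = w"
  proof -
    have a: "W [?i'] K [j, ?j'] \<bullet> W [?i'] (co j) [] \<bullet> t = W [?i', i, ?j'] (co j) [] \<bullet> W [?i'] K [] \<bullet> t" for t
      using arg_cong[OF k, of "\<lambda>s. s \<bullet> t"] by simp
    have z: "W [?i', i] (ev j) [?j'] \<bullet> W [?i', i, ?j'] (co j) [] = ide [?i', i, ?j']"
      using ctx_rules(7)[OF zigzag(2)[of j], of ?i' i "[]", simplified ctx_simps] by simp
    have z': "W [?i', i] (ev j) [?j'] \<bullet> W [?i', i, ?j'] (co j) [] \<bullet> t = ide [?i', i, ?j'] \<bullet> t" for t
      using arg_cong[OF z, of "\<lambda>s. s \<bullet> t"] by simp
    have i: "W [] (ev i) [?j'] \<bullet> W [?i', i] (hat w) [] = W [] (hat w) [] \<bullet> W [] (ev i) [?i']"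
      using interchange_s[of "ev i" "hat w" "[]" "[]" "[]"] by simp
    have "W [] (ev i) [?j'] \<bullet> W [?i'] K [] = (W [] (ev i) [?j'] \<bullet> W [?i', i] (hat w) []) \<bullet> W [?i'] (co i) []"
      by (simp add: K_def)
    also have "\<dots> = W [] (hat w) []" unfolding i using zigzag(2)[of i] by simp
    finally have f: "W [] (ev i) [?j'] \<bullet> W [?i'] K [] = W [] (hat w) []" .
    have "rep (ldual_mor A j i (unmate i j w)) (W [] (ev i) [?j'] \<bullet> W [?i'] K [])"
      unfolding ldual_mor_def
      by (rule rep_via, (rule r reps rep_Ev rep_Coev | (simp; fail))+) (simp add: a z' k z)
    then show ?thesis
      by (rule rep_eqI[OF _ rep_hat]) (simp_all add: f)
  qed
qed

section \<open>Dual bases of Hom spaces\<close>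

lemma ug_Id: "B \<in> Obj A \<Longrightarrow> i \<in> Obj A \<Longrightarrow> arr g \<Longrightarrow> src g = B \<star> i \<Longrightarrow>
    (g \<boxtimes> Id A (Ldual A i)) \<cdot> ug B i (Id A (B \<star> i)) = ug B i g"
  by (simp add: ug_def ten_id)

lemma vf_Id: "B \<in> Obj A \<Longrightarrow> i \<in> Obj A \<Longrightarrow> arr f \<Longrightarrow> tgt f = B \<star> i \<Longrightarrow>
    vf B i (Id A (B \<star> i)) \<cdot> (f \<boxtimes> Id A (Ldual A i)) = vf B i f"
  by (simp add: vf_def ten_id)

lemma ue_Id: "B \<in> Obj A \<Longrightarrow> k \<in> Obj A \<Longrightarrow> arr e \<Longrightarrow> src e = Ldual A k \<star> B \<Longrightarrow>
    (Id A k \<boxtimes> e) \<cdot> ue B k (Id A (Ldual A k \<star> B)) = ue B k e"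
  by (simp add: ue_def ten_id)

lemma ve_Id: "B \<in> Obj A \<Longrightarrow> k \<in> Obj A \<Longrightarrow> arr e \<Longrightarrow> tgt e = Ldual A k \<star> B \<Longrightarrow>
    ve B k (Id A (Ldual A k \<star> B)) \<cdot> (Id A k \<boxtimes> e) = ve B k e"
  by (simp add: ve_def ten_id)

lemma u_v_typing [simp]:
  "B \<in> Obj A \<Longrightarrow> i \<in> Obj A \<Longrightarrow> arr g \<Longrightarrow> src g = B \<star> i \<Longrightarrow> arr (ug B i g)"
  "B \<in> Obj A \<Longrightarrow> i \<in> Obj A \<Longrightarrow> arr g \<Longrightarrow> src g = B \<star> i \<Longrightarrow> src (ug B i g) = B"
  "B \<in> Obj A \<Longrightarrow> i \<in> Obj A \<Longrightarrow> arr g \<Longrightarrow> src g = B \<star> i \<Longrightarrow> tgt (ug B i g) = tgt g \<star> Ldual A i"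
  "B \<in> Obj A \<Longrightarrow> i \<in> Obj A \<Longrightarrow> arr f \<Longrightarrow> tgt f = B \<star> i \<Longrightarrow> arr (vf B i f)"
  "B \<in> Obj A \<Longrightarrow> i \<in> Obj A \<Longrightarrow> arr f \<Longrightarrow> tgt f = B \<star> i \<Longrightarrow> src (vf B i f) = src f \<star> Ldual A i"
  "B \<in> Obj A \<Longrightarrow> i \<in> Obj A \<Longrightarrow> arr f \<Longrightarrow> tgt f = B \<star> i \<Longrightarrow> tgt (vf B i f) = B"
  "B \<in> Obj A \<Longrightarrow> k \<in> Obj A \<Longrightarrow> arr e \<Longrightarrow> src e = Ldual A k \<star> B \<Longrightarrow> arr (ue B k e)"
  "B \<in> Obj A \<Longrightarrow> k \<in> Obj A \<Longrightarrow> arr e \<Longrightarrow> src e = Ldual A k \<star> B \<Longrightarrow> src (ue B k e) = B"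
  "B \<in> Obj A \<Longrightarrow> k \<in> Obj A \<Longrightarrow> arr e \<Longrightarrow> src e = Ldual A k \<star> B \<Longrightarrow> tgt (ue B k e) = k \<star> tgt e"
  "B \<in> Obj A \<Longrightarrow> k \<in> Obj A \<Longrightarrow> arr e' \<Longrightarrow> tgt e' = Ldual A k \<star> B \<Longrightarrow> arr (ve B k e')"
  "B \<in> Obj A \<Longrightarrow> k \<in> Obj A \<Longrightarrow> arr e' \<Longrightarrow> tgt e' = Ldual A k \<star> B \<Longrightarrow> src (ve B k e') = k \<star> src e'"
  "B \<in> Obj A \<Longrightarrow> k \<in> Obj A \<Longrightarrow> arr e' \<Longrightarrow> tgt e' = Ldual A k \<star> B \<Longrightarrow> tgt (ve B k e') = B"
  by (simp_all add: ug_def vf_def ue_def ve_def)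

lemma lin_uv:
  assumes "B \<in> Obj A" "i \<in> Obj A" "k \<in> Obj A" "j \<in> Obj A"
  shows "lin (B \<star> i) k B (k \<star> Ldual A i) (ug B i)" "lin j (Ldual A k \<star> B) (k \<star> j) B (ve B k)"
  unfolding ug_def ve_def by ((rule lins | simp add: assms)+)

lemma Lam_lin_v:
  assumes [simp]: "\<sigma> \<in> ZO" "\<tau> \<in> ZO" "fst \<tau> = fst \<sigma>" "arr u" "tgt u = B' \<star> C'" "B' \<in> Obj A" "C' \<in> Obj A" "S \<in> Obj A"
  shows "lin (B' \<star> C') S (src u \<star> fst \<sigma>) (fst \<sigma> \<star> S) (Lam \<sigma> \<tau> B' C' u)"
proof -
  have [simp]: "src (snd \<tau> B) = B \<star> fst \<sigma>" "tgt (snd \<tau> B) = fst \<sigma> \<star> B" if "B \<in> Obj A" for B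
    using ZO_facts(2,3)[OF assms(2) that] by simp_all
  show ?thesis unfolding Lam_def Let_def by (rule lins | simp)+
qed

lemma Lam_lin_u:
  assumes [simp]: "\<sigma> \<in> ZO" "\<tau> \<in> ZO" "fst \<tau> = fst \<sigma>" "arr v" "src v = B' \<star> C'" "B' \<in> Obj A" "C' \<in> Obj A" "S \<in> Obj A"
  shows "lin S (B' \<star> C') (S \<star> fst \<sigma>) (fst \<sigma> \<star> tgt v) (\<lambda>u. Lam \<sigma> \<tau> B' C' u v)"
proof -
  have [simp]: "src (snd \<tau> B) = B \<star> fst \<sigma>" "tgt (snd \<tau> B) = fst \<sigma> \<star> B" if "B \<in> Obj A" for B
    using ZO_facts(2,3)[OF assms(2) that] by simp_all
  show ?thesis unfolding Lam_def Let_def by (rule lins | simp)+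
qed

lemma lin_comp: "lin X Y X' Y' h \<Longrightarrow> lin X' Y' X'' Y'' h' \<Longrightarrow> lin X Y X'' Y'' (\<lambda>f. h' (h f))"
  unfolding lin_def by auto

lemma hom_simple:
  assumes "simple_representatives A I" "i \<in> I" "j \<in> I" "i \<noteq> j" "f \<in> Mor A i j"
  shows "f = \<zero>\<^bsub>Hom A i j\<^esub>"
proof (rule ccontr)
  assume n: "f \<noteq> \<zero>\<^bsub>Hom A i j\<^esub>"
  have s: "is_simple A i" "is_simple A j" using assms unfolding simple_representatives_def by blast+
  then have "isomorphic A i j" using schur[OF s assms(5)] n unfolding isomorphic_def by blast
  moreover have "i \<in> Obj A" using s by (simp add: is_simple_def)
  then have "isomorphic A i i" unfolding isomorphic_def is_iso_def inverse_pair_def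
    by (auto intro!: exI[of _ "Id A i"] id_closed)
  ultimately show False using assms(1,2,3,4) s unfolding simple_representatives_def by blast
qed

text \<open>
  A morphism between duals is the dual of a morphism between the objects, to which Schur's lemma applies.
\<close>

lemma hom_dual_simple:
  assumes I: "simple_representatives A I" and i: "i \<in> I" and j: "j \<in> I" and w: "w \<in> Mor A (Ldual A i) (Ldual A j)"
  shows "i \<noteq> j \<Longrightarrow> w = \<zero>\<^bsub>Hom A (Ldual A i) (Ldual A j)\<^esub>"
    "i = j \<Longrightarrow> \<exists>y. w = y \<odot>\<^bsub>Hom A (Ldual A i) (Ldual A i)\<^esub> Id A (Ldual A i)"
proof -
  have s: "is_simple A i" "is_simple A j" using assms unfolding simple_representatives_def by blast+
  then have [simp]: "i \<in> Obj A" "j \<in> Obj A" by (simp_all add: is_simple_def)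
  have [simp]: "arr w" "src w = Ldual A i" "tgt w = Ldual A j" using Mor_typing[OF _ _ w] by simp_all
  have u: "ldual_mor A j i (unmate i j w) = w" "unmate i j w \<in> Mor A j i" by (rule ldual_unmate; simp)+
  have l: "lin j i (Ldual A i) (Ldual A j) (ldual_mor A j i)"
    unfolding ldual_mor_def by (rule lins | simp)+
  show "w = \<zero>\<^bsub>Hom A (Ldual A i) (Ldual A j)\<^esub>" if "i \<noteq> j"
    using hom_simple[OF I j i _ u(2)] that u(1) lin_zero[OF l] by auto
  show "\<exists>y. w = y \<odot>\<^bsub>Hom A (Ldual A i) (Ldual A i)\<^esub> Id A (Ldual A i)" if e: "i = j"
  proof -
    obtain y where y: "unmate i i w = y \<odot>\<^bsub>Hom A i i\<^esub> Id A i" using endomorphism_scalar[OF _ _ s(1)] u(2) e by auto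
    have "ldual_mor A i i (Id A i) = Id A (Ldual A i)"
      using left_dual[of i] unfolding ldual_mor_def is_left_dual_def by (simp add: ten_id)
    then have "w = y \<odot>\<^bsub>Hom A (Ldual A i) (Ldual A i)\<^esub> Id A (Ldual A i)"
      using u(1) y lin_smult[OF l, of "Id A i" y] id_closed[of i] e by simp
    then show ?thesis by blast
  qed
qed

text \<open>
  Coordinates of \<open>m\<close> in a basis given by a decomposition of its target: only the summands of the type of its source
  contribute.
\<close>

lemma expand_left:
  assumes [simp]: "N \<in> Obj A" "i \<in> I" "finite I" and J: "\<And>j. j \<in> I \<Longrightarrow> J j \<in> Obj A"
    and E: "\<And>j b. j \<in> I \<Longrightarrow> b < n \<Longrightarrow> E j b \<in> Mor A N (J j) \<and> E' j b \<in> Mor A (J j) N"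
    and one: "Id A N = (\<Oplus>\<^bsub>Hom A N N\<^esub>j \<in> I. \<Oplus>\<^bsub>Hom A N N\<^esub>b \<in> {..<n::nat}. E' j b \<cdot> E j b)"
    and m: "m \<in> Mor A (J i) N"
    and y: "\<And>b. b < n \<Longrightarrow> E i b \<cdot> m = y b \<odot>\<^bsub>Hom A (J i) (J i)\<^esub> Id A (J i)"
    and z: "\<And>j b. j \<in> I \<Longrightarrow> b < n \<Longrightarrow> j \<noteq> i \<Longrightarrow> E j b \<cdot> m = \<zero>\<^bsub>Hom A (J i) (J j)\<^esub>"
  shows "m = (\<Oplus>\<^bsub>Hom A (J i) N\<^esub>b \<in> {..<n}. y b \<odot>\<^bsub>Hom A (J i) N\<^esub> E' i b)"
proof -
  let ?S = "J i"
  have S [simp]: "?S \<in> Obj A" using J by simp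
  interpret H: abelian_group "Hom A ?S N" by (rule Hom_abelian_group) simp_all
  have mt: "arr m" "src m = ?S" "tgt m = N" using Mor_typing[OF S _ m] by simp_all
  have l: "lin N N ?S N (\<lambda>t. t \<cdot> m)" by (rule lin_comp_right[OF lin_id]) (simp_all add: mt)
  have EE: "E' j b \<cdot> E j b \<in> Mor A N N" if "j \<in> I" "b < n" for j b
    using comp_closed[OF _ J[OF that(1)] _ ] E[OF that] by simp
  define T where "T j = (\<Oplus>\<^bsub>Hom A ?S N\<^esub>b \<in> {..<n}. (E' j b \<cdot> E j b) \<cdot> m)" for j
  have ass: "(E' j b \<cdot> E j b) \<cdot> m = E' j b \<cdot> (E j b \<cdot> m)" if "j \<in> I" "b < n" for j b
    using comp_assoc[OF S assms(1) J[OF that(1)] assms(1) m] E[OF that] by simp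
  have tz: "T j = \<zero>\<^bsub>Hom A ?S N\<^esub>" if "j \<in> I" "j \<noteq> i" for j
  proof -
    have "T j = (\<Oplus>\<^bsub>Hom A ?S N\<^esub>b \<in> {..<n}. \<zero>\<^bsub>Hom A ?S N\<^esub>)" unfolding T_def
      using that E by (intro H.finsum_cong') (auto simp: ass z comp_zero(2)[OF S J])
    then show ?thesis by simp
  qed
  have ey: "y b \<odot>\<^bsub>Hom A ?S N\<^esub> E' i b \<in> Mor A ?S N" if "b < n" for b
    using Hom_facts(3)[OF S assms(1)] E[OF assms(2) that] by blast
  have ti: "T i = (\<Oplus>\<^bsub>Hom A ?S N\<^esub>b \<in> {..<n}. y b \<odot>\<^bsub>Hom A ?S N\<^esub> E' i b)" unfolding T_def
  proof (intro H.finsum_cong')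
    fix b assume b: "b \<in> {..<n}"
    then have "E' i b \<in> Mor A ?S N" using E by simp
    then show "(E' i b \<cdot> E i b) \<cdot> m = y b \<odot>\<^bsub>Hom A ?S N\<^esub> E' i b"
      using b by (simp add: ass y comp_smult_right[OF S S assms(1) id_closed[OF S]] comp_id_right[OF S assms(1)])
  qed (use ey in auto)
  have Tc: "T j \<in> Mor A ?S N" if "j \<in> I" for j
    unfolding T_def using lin_closed[OF l EE] that by (intro finsum_Mor) auto
  have "m = Id A N \<cdot> m" using mt by simp
  also have "\<dots> = (\<Oplus>\<^bsub>Hom A ?S N\<^esub>j \<in> I. (\<Oplus>\<^bsub>Hom A N N\<^esub>b \<in> {..<n}. E' j b \<cdot> E j b) \<cdot> m)"
    unfolding one using EE by (intro lin_finsum[OF l]) (auto intro!: finsum_Mor)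
  also have "\<dots> = (\<Oplus>\<^bsub>Hom A ?S N\<^esub>j \<in> I. T j)"
    unfolding T_def using EE Tc[unfolded T_def] by (intro H.finsum_cong' lin_finsum[OF l]) auto
  also have "\<dots> = (\<Oplus>\<^bsub>Hom A ?S N\<^esub>j \<in> I. if i = j then T j else \<zero>\<^bsub>Hom A ?S N\<^esub>)"
    using Tc tz by (intro H.finsum_cong') auto
  also have "\<dots> = T i" using Tc by (intro H.finsum_singleton) auto
  finally show ?thesis unfolding ti .
qed

lemma expand_right:
  assumes [simp]: "N \<in> Obj A" "i \<in> I" "finite I" and J: "\<And>j. j \<in> I \<Longrightarrow> J j \<in> Obj A"
    and E: "\<And>j b. j \<in> I \<Longrightarrow> b < n \<Longrightarrow> F j b \<in> Mor A (J j) N \<and> G j b \<in> Mor A N (J j)"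
    and one: "Id A N = (\<Oplus>\<^bsub>Hom A N N\<^esub>j \<in> I. \<Oplus>\<^bsub>Hom A N N\<^esub>b \<in> {..<n::nat}. F j b \<cdot> G j b)"
    and m: "m \<in> Mor A N (J i)"
    and y: "\<And>b. b < n \<Longrightarrow> m \<cdot> F i b = y b \<odot>\<^bsub>Hom A (J i) (J i)\<^esub> Id A (J i)"
    and z: "\<And>j b. j \<in> I \<Longrightarrow> b < n \<Longrightarrow> j \<noteq> i \<Longrightarrow> m \<cdot> F j b = \<zero>\<^bsub>Hom A (J j) (J i)\<^esub>"
  shows "m = (\<Oplus>\<^bsub>Hom A N (J i)\<^esub>b \<in> {..<n}. y b \<odot>\<^bsub>Hom A N (J i)\<^esub> G i b)"
proof -
  let ?S = "J i"
  have S [simp]: "?S \<in> Obj A" using J by simp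
  interpret H: abelian_group "Hom A N ?S" by (rule Hom_abelian_group) simp_all
  have mt: "arr m" "src m = N" "tgt m = ?S" using Mor_typing[OF _ S m] by simp_all
  have l: "lin N N N ?S (\<lambda>t. m \<cdot> t)" by (rule lin_comp_left[OF lin_id]) (simp_all add: mt)
  have EE: "F j b \<cdot> G j b \<in> Mor A N N" if "j \<in> I" "b < n" for j b
    using comp_closed[OF _ J[OF that(1)] _ ] E[OF that] by simp
  define T where "T j = (\<Oplus>\<^bsub>Hom A N ?S\<^esub>b \<in> {..<n}. m \<cdot> (F j b \<cdot> G j b))" for j
  have ass: "m \<cdot> (F j b \<cdot> G j b) = (m \<cdot> F j b) \<cdot> G j b" if "j \<in> I" "b < n" for j b
    using comp_assoc[OF assms(1) J[OF that(1)] assms(1) S _ _ m] E[OF that] by simp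
  have tz: "T j = \<zero>\<^bsub>Hom A N ?S\<^esub>" if "j \<in> I" "j \<noteq> i" for j
  proof -
    have "T j = (\<Oplus>\<^bsub>Hom A N ?S\<^esub>b \<in> {..<n}. \<zero>\<^bsub>Hom A N ?S\<^esub>)" unfolding T_def
      using that E by (intro H.finsum_cong') (auto simp: ass z comp_zero(1)[OF assms(1) J S])
    then show ?thesis by simp
  qed
  have ey: "y b \<odot>\<^bsub>Hom A N ?S\<^esub> G i b \<in> Mor A N ?S" if "b < n" for b
    using Hom_facts(3)[OF assms(1) S] E[OF assms(2) that] by blast
  have ti: "T i = (\<Oplus>\<^bsub>Hom A N ?S\<^esub>b \<in> {..<n}. y b \<odot>\<^bsub>Hom A N ?S\<^esub> G i b)" unfolding T_def
  proof (intro H.finsum_cong')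
    fix b assume b: "b \<in> {..<n}"
    then have "G i b \<in> Mor A N ?S" using E by simp
    then show "m \<cdot> (F i b \<cdot> G i b) = y b \<odot>\<^bsub>Hom A N ?S\<^esub> G i b"
      using b by (simp add: ass y comp_smult_left[OF assms(1) S S _ id_closed[OF S]] comp_id_left[OF assms(1) S])
  qed (use ey in auto)
  have Tc: "T j \<in> Mor A N ?S" if "j \<in> I" for j
    unfolding T_def using lin_closed[OF l EE] that by (intro finsum_Mor) auto
  have "m = m \<cdot> Id A N" using mt by simp
  also have "\<dots> = (\<Oplus>\<^bsub>Hom A N ?S\<^esub>j \<in> I. m \<cdot> (\<Oplus>\<^bsub>Hom A N N\<^esub>b \<in> {..<n}. F j b \<cdot> G j b))"
    unfolding one using EE by (intro lin_finsum[OF l]) (auto intro!: finsum_Mor)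
  also have "\<dots> = (\<Oplus>\<^bsub>Hom A N ?S\<^esub>j \<in> I. T j)"
    unfolding T_def using EE Tc[unfolded T_def] by (intro H.finsum_cong' lin_finsum[OF l]) auto
  also have "\<dots> = (\<Oplus>\<^bsub>Hom A N ?S\<^esub>j \<in> I. if i = j then T j else \<zero>\<^bsub>Hom A N ?S\<^esub>)"
    using Tc tz by (intro H.finsum_cong') auto
  also have "\<dots> = T i" using Tc by (intro H.finsum_singleton) auto
  finally show ?thesis unfolding ti .
qed

text \<open>
  The scalars \<open>x\<close> and \<open>y\<close> are the values of the trace pairing of \<open>e\<close> and \<open>f\<close>, read over \<open>k\<close> and over the dual of \<open>i\<close>; the traces
  of the identities contribute the dimensions.
\<close>

lemma mate_pairing:
  assumes I: "simple_representatives A I" "i \<in> I" "k \<in> I" and [simp]: "B \<in> Obj A"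
    and e: "e \<in> Mor A (Ldual A k \<star> B) (Ldual A i)" and f: "f \<in> Mor A k (B \<star> i)"
    and x: "me B k i e \<cdot> f = x \<odot>\<^bsub>Hom A k k\<^esub> Id A k"
    and y: "e \<cdot> mf B k i f = y \<odot>\<^bsub>Hom A (Ldual A i) (Ldual A i)\<^esub> Id A (Ldual A i)"
  shows "dim A i * y = dim A k * x"
proof -
  have [simp]: "i \<in> Obj A" "k \<in> Obj A" using I unfolding simple_representatives_def is_simple_def by blast+
  let ?I = "Unit A"
  have [simp]: "arr e" "src e = Ldual A k \<star> B" "tgt e = Ldual A i" "arr f" "src f = k" "tgt f = B \<star> i"
    using Mor_typing[OF _ _ e] Mor_typing[OF _ _ f] by simp_all
  have t: "Ev A i \<cdot> ((e \<cdot> mf B k i f) \<boxtimes> Id A i) \<cdot> cT i = Ev A k \<cdot> (Id A (Ldual A k) \<boxtimes> (me B k i e \<cdot> f)) \<cdot> cT k"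
    by (rule mate_trace) simp_all
  have l1: "lin (Ldual A i) (Ldual A i) ?I ?I (\<lambda>m. Ev A i \<cdot> (m \<boxtimes> Id A i) \<cdot> cT i)" by (rule lins | simp)+
  have l2: "lin k k ?I ?I (\<lambda>m. Ev A k \<cdot> (Id A (Ldual A k) \<boxtimes> m) \<cdot> cT k)" by (rule lins | simp)+
  have a: "Ev A i \<cdot> ((e \<cdot> mf B k i f) \<boxtimes> Id A i) \<cdot> cT i = y \<odot>\<^bsub>Hom A ?I ?I\<^esub> (dim A i \<odot>\<^bsub>Hom A ?I ?I\<^esub> Id A ?I)"
    unfolding y using lin_smult[OF l1 id_closed, of y] by (simp add: ten_id left_dim)
  have b: "Ev A k \<cdot> (Id A (Ldual A k) \<boxtimes> (me B k i e \<cdot> f)) \<cdot> cT k = x \<odot>\<^bsub>Hom A ?I ?I\<^esub> (dim A k \<odot>\<^bsub>Hom A ?I ?I\<^esub> Id A ?I)"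
    unfolding x using lin_smult[OF l2 id_closed, of x] by (simp add: ten_id left_dim)
  have "(y * dim A i) \<odot>\<^bsub>Hom A ?I ?I\<^esub> Id A ?I = (x * dim A k) \<odot>\<^bsub>Hom A ?I ?I\<^esub> Id A ?I"
    using t unfolding a b by (simp add: Hom_facts(6)[OF _ _ id_closed])
  then show ?thesis using scalar_eq[OF unit_simple] by (simp add: mult.commute)
qed

text \<open>
  Both sides are expanded in the same family, once by expressing mates of the maps \<open>F\<close> through the \<open>E'\<close> and once by expressing
  mates of the \<open>E\<close> through the maps \<open>G\<close>.  The coefficients agree by \<open>mate_pairing\<close>.
\<close>

lemma slide_block:
  assumes [simp]: "\<sigma> \<in> ZO" "\<tau> \<in> ZO" "fst \<tau> = fst \<sigma>" "B \<in> Obj A"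
    and I: "simple_representatives A I" "finite I" and i: "i \<in> I" and k: "k \<in> I"
    and FG: "\<And>k a. k \<in> I \<Longrightarrow> a < n \<Longrightarrow> F k a \<in> Mor A k (B \<star> i) \<and> G k a \<in> Mor A (B \<star> i) k"
    and one: "Id A (B \<star> i) = (\<Oplus>\<^bsub>Hom A (B \<star> i) (B \<star> i)\<^esub>k \<in> I. \<Oplus>\<^bsub>Hom A (B \<star> i) (B \<star> i)\<^esub>a \<in> {..<n::nat}. F k a \<cdot> G k a)"
    and E: "\<And>i b. i \<in> I \<Longrightarrow> b < m \<Longrightarrow> E i b \<in> Mor A (Ldual A k \<star> B) (Ldual A i) \<and> E' i b \<in> Mor A (Ldual A i) (Ldual A k \<star> B)"
    and one': "Id A (Ldual A k \<star> B) = (\<Oplus>\<^bsub>Hom A (Ldual A k \<star> B) (Ldual A k \<star> B)\<^esub>i \<in> I. \<Oplus>\<^bsub>Hom A (Ldual A k \<star> B) (Ldual A k \<star> B)\<^esub>b \<in> {..<m::nat}. E' i b \<cdot> E i b)"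
  defines "H \<equiv> Hom A (B \<star> fst \<sigma>) (fst \<sigma> \<star> B)"
  shows "(\<Oplus>\<^bsub>H\<^esub>a \<in> {..<n}. dim A i \<odot>\<^bsub>H\<^esub> Lam \<sigma> \<tau> k (Ldual A i) (ug B i (G k a)) (vf B i (F k a)))
    = (\<Oplus>\<^bsub>H\<^esub>b \<in> {..<m}. dim A k \<odot>\<^bsub>H\<^esub> Lam \<sigma> \<tau> k (Ldual A i) (ue B k (E i b)) (ve B k (E' i b)))"
proof -
  let ?i' = "Ldual A i" let ?k' = "Ldual A k" let ?N = "?k' \<star> B" let ?M = "B \<star> i"
  have Is: "is_simple A j" if "j \<in> I" for j using I(1) that unfolding simple_representatives_def by blast
  then have Io [simp]: "j \<in> Obj A" if "j \<in> I" for j using that by (simp add: is_simple_def)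
  note [simp] = Io[OF i] Io[OF k]
  have FGt [simp]: "arr (F k a)" "src (F k a) = k" "tgt (F k a) = ?M" "arr (G k a)" "src (G k a) = ?M" "tgt (G k a) = k" if "a < n" for a
    using Mor_typing FG[OF k that] Io[OF k] ten_closed[OF assms(4) Io[OF i]] by blast+
  have Et [simp]: "arr (E i b)" "src (E i b) = ?N" "tgt (E i b) = ?i'" "arr (E' i b)" "src (E' i b) = ?i'" "tgt (E' i b) = ?N" if "b < m" for b
    using Mor_typing E[OF i that] Ldual_closed[OF Io[OF i]] ten_closed[OF Ldual_closed[OF Io[OF k]] assms(4)] by blast+
  interpret H: abelian_group H unfolding H_def by (rule Hom_abelian_group) simp_all
  have HO: "B \<star> fst \<sigma> \<in> Obj A" "fst \<sigma> \<star> B \<in> Obj A" by simp_all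
  note HF = Hom_facts[OF HO, folded H_def]
  have "\<exists>x. me B k i (E i b) \<cdot> F k a = x \<odot>\<^bsub>Hom A k k\<^esub> Id A k" if "a < n" "b < m" for a b
  proof -
    have "me B k i (E i b) \<cdot> F k a \<in> Mor A k k" by (simp add: Mor_iff that)
    then show ?thesis using endomorphism_scalar[OF _ _ Is[OF k]] by simp
  qed
  then obtain x where x: "\<And>a b. a < n \<Longrightarrow> b < m \<Longrightarrow> me B k i (E i b) \<cdot> F k a = x a b \<odot>\<^bsub>Hom A k k\<^esub> Id A k" by metis
  have "\<exists>y. E i b \<cdot> mf B k i (F k a) = y \<odot>\<^bsub>Hom A ?i' ?i'\<^esub> Id A ?i'" if "a < n" "b < m" for a b
  proof -
    have "E i b \<cdot> mf B k i (F k a) \<in> Mor A ?i' ?i'" by (simp add: Mor_iff that)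
    then show ?thesis using hom_dual_simple(2)[OF I(1) i i] by blast
  qed
  then obtain y where y: "\<And>a b. a < n \<Longrightarrow> b < m \<Longrightarrow> E i b \<cdot> mf B k i (F k a) = y a b \<odot>\<^bsub>Hom A ?i' ?i'\<^esub> Id A ?i'" by metis
  have xy: "dim A i * y a b = dim A k * x a b" if "a < n" "b < m" for a b
    by (rule mate_pairing[OF I(1) i k assms(4) _ _ x[OF that] y[OF that]]) (use FG[OF k that(1)] E[OF i that(2)] in blast)+
  define L where "L a b = Lam \<sigma> \<tau> k ?i' (ug B i (G k a)) (ve B k (E' i b))" for a b
  have Lc: "L a b \<in> carrier H" if "a < n" "b < m" for a b
  proof -
    have v: "ve B k (E' i b) \<in> Mor A (k \<star> ?i') B" by (simp add: Mor_iff that)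
    have l: "lin (k \<star> ?i') B (B \<star> fst \<sigma>) (fst \<sigma> \<star> B) (Lam \<sigma> \<tau> k ?i' (ug B i (G k a)))"
      using Lam_lin_v[of \<sigma> \<tau> "ug B i (G k a)" k ?i' B] that by simp
    show ?thesis unfolding L_def H_def by (rule lin_closed[OF l v])
  qed
  have left: "Lam \<sigma> \<tau> k ?i' (ug B i (G k a)) (vf B i (F k a)) = (\<Oplus>\<^bsub>H\<^esub>b \<in> {..<m}. y a b \<odot>\<^bsub>H\<^esub> L a b)" if a: "a < n" for a
  proof -
    note [simp] = FGt[OF a]
    let ?u = "ug B i (G k a)"
    have l0: "lin (k \<star> ?i') B (B \<star> fst \<sigma>) (fst \<sigma> \<star> B) (Lam \<sigma> \<tau> k ?i' ?u)"
      using Lam_lin_v[of \<sigma> \<tau> ?u k ?i' B] by simp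
    have l: "lin ?i' ?N (B \<star> fst \<sigma>) (fst \<sigma> \<star> B) (\<lambda>e. Lam \<sigma> \<tau> k ?i' ?u (ve B k e))"
      by (rule lin_comp[OF lin_uv(2)[of B k k ?i'] l0]) simp_all
    have m: "mf B k i (F k a) \<in> Mor A ?i' ?N" by (simp add: Mor_iff)
    have ex: "mf B k i (F k a) = (\<Oplus>\<^bsub>Hom A ?i' ?N\<^esub>b \<in> {..<m}. y a b \<odot>\<^bsub>Hom A ?i' ?N\<^esub> E' i b)"
    proof (rule expand_left[where J = "Ldual A" and E = E, OF _ i I(2) _ _ one' m])
      fix j b assume j: "j \<in> I" "b < m" "j \<noteq> i"
      have "E j b \<cdot> mf B k i (F k a) \<in> Mor A ?i' (Ldual A j)"
        using comp_closed[OF _ _ _ m] E[OF j(1,2)] Io[OF j(1)] by simp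
      then show "E j b \<cdot> mf B k i (F k a) = \<zero>\<^bsub>Hom A ?i' (Ldual A j)\<^esub>"
        using hom_dual_simple(1)[OF I(1) i j(1)] j(3) by blast
    qed (use E y a in auto)
    have E'm: "E' i b \<in> Mor A ?i' ?N" if "b < m" for b using E[OF i that] by blast
    have yE: "y a b \<odot>\<^bsub>Hom A ?i' ?N\<^esub> E' i b \<in> Mor A ?i' ?N" if "b < m" for b
      using Hom_facts(3)[OF _ _ E'm[OF that]] by simp
    have "Lam \<sigma> \<tau> k ?i' ?u (vf B i (F k a)) = Lam \<sigma> \<tau> k ?i' ?u (ve B k (mf B k i (F k a)))"
      using vf_eq_ve[of B k i "F k a"] by simp
    also have "\<dots> = (\<Oplus>\<^bsub>H\<^esub>b \<in> {..<m}. Lam \<sigma> \<tau> k ?i' ?u (ve B k (y a b \<odot>\<^bsub>Hom A ?i' ?N\<^esub> E' i b)))"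
      unfolding ex H_def using yE by (intro lin_finsum[OF l]) auto
    also have "\<dots> = (\<Oplus>\<^bsub>H\<^esub>b \<in> {..<m}. y a b \<odot>\<^bsub>H\<^esub> L a b)"
    proof (intro H.finsum_cong')
      show "Lam \<sigma> \<tau> k ?i' ?u (ve B k (y a b \<odot>\<^bsub>Hom A ?i' ?N\<^esub> E' i b)) = y a b \<odot>\<^bsub>H\<^esub> L a b" if "b \<in> {..<m}" for b
        using lin_smult[OF l E'm, of b "y a b"] that unfolding L_def H_def by simp
    qed (use Lc HF(3) a in auto)
    finally show ?thesis .
  qed
  have right: "Lam \<sigma> \<tau> k ?i' (ue B k (E i b)) (ve B k (E' i b)) = (\<Oplus>\<^bsub>H\<^esub>a \<in> {..<n}. x a b \<odot>\<^bsub>H\<^esub> L a b)" if b: "b < m" for b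
  proof -
    note [simp] = Et[OF b]
    let ?v = "ve B k (E' i b)"
    have l0: "lin B (k \<star> ?i') (B \<star> fst \<sigma>) (fst \<sigma> \<star> B) (\<lambda>u. Lam \<sigma> \<tau> k ?i' u ?v)"
      using Lam_lin_u[of \<sigma> \<tau> ?v k ?i' B] by simp
    have l: "lin ?M k (B \<star> fst \<sigma>) (fst \<sigma> \<star> B) (\<lambda>g. Lam \<sigma> \<tau> k ?i' (ug B i g) ?v)"
      by (rule lin_comp[OF lin_uv(1)[of B i k k] l0]) simp_all
    have m: "me B k i (E i b) \<in> Mor A ?M k" by (simp add: Mor_iff)
    have ex: "me B k i (E i b) = (\<Oplus>\<^bsub>Hom A ?M k\<^esub>a \<in> {..<n}. x a b \<odot>\<^bsub>Hom A ?M k\<^esub> G k a)"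
    proof (rule expand_right[where J = "\<lambda>j. j" and F = F, OF _ k I(2) _ _ one m])
      fix j a assume j: "j \<in> I" "a < n" "j \<noteq> k"
      have "me B k i (E i b) \<cdot> F j a \<in> Mor A j k"
        using comp_closed[OF _ _ _ _ m] FG[OF j(1,2)] Io[OF j(1)] by simp
      then show "me B k i (E i b) \<cdot> F j a = \<zero>\<^bsub>Hom A j k\<^esub>"
        using hom_simple[OF I(1) j(1) k j(3)] by blast
    qed (use FG x b in auto)
    have Gm: "G k a \<in> Mor A ?M k" if "a < n" for a using FG[OF k that] by blast
    have xG: "x a b \<odot>\<^bsub>Hom A ?M k\<^esub> G k a \<in> Mor A ?M k" if "a < n" for a
      using Hom_facts(3)[OF _ _ Gm[OF that]] by simp
    have "Lam \<sigma> \<tau> k ?i' (ue B k (E i b)) ?v = Lam \<sigma> \<tau> k ?i' (ug B i (me B k i (E i b))) ?v"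
      using ue_eq_ug[of B k i "E i b"] by simp
    also have "\<dots> = (\<Oplus>\<^bsub>H\<^esub>a \<in> {..<n}. Lam \<sigma> \<tau> k ?i' (ug B i (x a b \<odot>\<^bsub>Hom A ?M k\<^esub> G k a)) ?v)"
      unfolding ex H_def using xG by (intro lin_finsum[OF l]) auto
    also have "\<dots> = (\<Oplus>\<^bsub>H\<^esub>a \<in> {..<n}. x a b \<odot>\<^bsub>H\<^esub> L a b)"
    proof (intro H.finsum_cong')
      show "Lam \<sigma> \<tau> k ?i' (ug B i (x a b \<odot>\<^bsub>Hom A ?M k\<^esub> G k a)) ?v = x a b \<odot>\<^bsub>H\<^esub> L a b" if "a \<in> {..<n}" for a
        using lin_smult[OF l Gm, of a "x a b"] that unfolding L_def H_def by simp
    qed (use Lc HF(3) b in auto)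
    finally show ?thesis .
  qed
  have sl: "lin (B \<star> fst \<sigma>) (fst \<sigma> \<star> B) (B \<star> fst \<sigma>) (fst \<sigma> \<star> B) (\<lambda>f. c \<odot>\<^bsub>H\<^esub> f)" for c
    unfolding H_def by (rule lin_smult_self[OF HO])
  have sL: "c \<odot>\<^bsub>H\<^esub> L a b \<in> carrier H" if "a < n" "b < m" for a b c using HF(3) Lc[OF that] by blast
  have "(\<Oplus>\<^bsub>H\<^esub>a \<in> {..<n}. dim A i \<odot>\<^bsub>H\<^esub> Lam \<sigma> \<tau> k ?i' (ug B i (G k a)) (vf B i (F k a)))
    = (\<Oplus>\<^bsub>H\<^esub>a \<in> {..<n}. \<Oplus>\<^bsub>H\<^esub>b \<in> {..<m}. (dim A i * y a b) \<odot>\<^bsub>H\<^esub> L a b)"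
  proof (intro H.finsum_cong')
    fix a assume a: "a \<in> {..<n}"
    have "dim A i \<odot>\<^bsub>H\<^esub> (\<Oplus>\<^bsub>H\<^esub>b \<in> {..<m}. y a b \<odot>\<^bsub>H\<^esub> L a b) = (\<Oplus>\<^bsub>H\<^esub>b \<in> {..<m}. dim A i \<odot>\<^bsub>H\<^esub> (y a b \<odot>\<^bsub>H\<^esub> L a b))"
      using lin_finsum[OF sl, of "{..<m}" "\<lambda>b. y a b \<odot>\<^bsub>H\<^esub> L a b" "dim A i"] sL a unfolding H_def by simp
    also have "\<dots> = (\<Oplus>\<^bsub>H\<^esub>b \<in> {..<m}. (dim A i * y a b) \<odot>\<^bsub>H\<^esub> L a b)"
      using a sL Lc by (intro H.finsum_cong') (auto simp: HF(6))
    finally show "dim A i \<odot>\<^bsub>H\<^esub> Lam \<sigma> \<tau> k ?i' (ug B i (G k a)) (vf B i (F k a)) = (\<Oplus>\<^bsub>H\<^esub>b \<in> {..<m}. (dim A i * y a b) \<odot>\<^bsub>H\<^esub> L a b)"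
      using left a by simp
  qed (use sL in \<open>auto intro!: H.finsum_closed\<close>)
  also have "\<dots> = (\<Oplus>\<^bsub>H\<^esub>b \<in> {..<m}. \<Oplus>\<^bsub>H\<^esub>a \<in> {..<n}. (dim A i * y a b) \<odot>\<^bsub>H\<^esub> L a b)"
    using sL by (intro H.finsum_swap) auto
  also have "\<dots> = (\<Oplus>\<^bsub>H\<^esub>b \<in> {..<m}. dim A k \<odot>\<^bsub>H\<^esub> Lam \<sigma> \<tau> k ?i' (ue B k (E i b)) (ve B k (E' i b)))"
  proof (intro H.finsum_cong')
    fix b assume b: "b \<in> {..<m}"
    have "(\<Oplus>\<^bsub>H\<^esub>a \<in> {..<n}. (dim A i * y a b) \<odot>\<^bsub>H\<^esub> L a b) = (\<Oplus>\<^bsub>H\<^esub>a \<in> {..<n}. dim A k \<odot>\<^bsub>H\<^esub> (x a b \<odot>\<^bsub>H\<^esub> L a b))"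
      using b sL Lc by (intro H.finsum_cong') (auto simp: HF(6) xy intro!: HF(3))
    also have "\<dots> = dim A k \<odot>\<^bsub>H\<^esub> (\<Oplus>\<^bsub>H\<^esub>a \<in> {..<n}. x a b \<odot>\<^bsub>H\<^esub> L a b)"
      using lin_finsum[OF sl, of "{..<n}" "\<lambda>a. x a b \<odot>\<^bsub>H\<^esub> L a b" "dim A k"] sL b unfolding H_def by simp
    finally show "(\<Oplus>\<^bsub>H\<^esub>a \<in> {..<n}. (dim A i * y a b) \<odot>\<^bsub>H\<^esub> L a b) = dim A k \<odot>\<^bsub>H\<^esub> Lam \<sigma> \<tau> k ?i' (ue B k (E i b)) (ve B k (E' i b))"
      using right b by simp
  next
    show "(\<lambda>b. dim A k \<odot>\<^bsub>H\<^esub> Lam \<sigma> \<tau> k ?i' (ue B k (E i b)) (ve B k (E' i b))) \<in> {..<m} \<rightarrow> carrier H"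
      using right sL by (auto intro!: HF(3) H.finsum_closed)
  qed simp
  finally show ?thesis .
qed

section \<open>The handle slide\<close>

text \<open>
  A linear operation applied to an identity is the sum of its values on the pieces of a decomposition.
\<close>

lemma lin_expand:
  assumes l: "lin N N X Y h" and "finite I"
    and p: "\<And>j a. j \<in> I \<Longrightarrow> a < n \<Longrightarrow> p j a \<in> Mor A N N"
    and one: "Id A N = (\<Oplus>\<^bsub>Hom A N N\<^esub>j \<in> I. \<Oplus>\<^bsub>Hom A N N\<^esub>a \<in> {..<n::nat}. p j a)"
  shows "h (Id A N) = (\<Oplus>\<^bsub>Hom A X Y\<^esub>j \<in> I. \<Oplus>\<^bsub>Hom A X Y\<^esub>a \<in> {..<n}. h (p j a))"
proof -
  have o: "N \<in> Obj A" "X \<in> Obj A" "Y \<in> Obj A" using l by (simp_all add: lin_def)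
  have s: "(\<Oplus>\<^bsub>Hom A N N\<^esub>a \<in> {..<n}. p j a) \<in> Mor A N N" if "j \<in> I" for j
    using p that by (intro finsum_Mor o) auto
  have "h (Id A N) = (\<Oplus>\<^bsub>Hom A X Y\<^esub>j \<in> I. h (\<Oplus>\<^bsub>Hom A N N\<^esub>a \<in> {..<n}. p j a))"
    unfolding one using s by (intro lin_finsum[OF l assms(2)])
  also have "\<dots> = (\<Oplus>\<^bsub>Hom A X Y\<^esub>j \<in> I. \<Oplus>\<^bsub>Hom A X Y\<^esub>a \<in> {..<n}. h (p j a))"
  proof (intro Hom_finsum_cong o)
    fix j assume j: "j \<in> I"
    show "h (\<Oplus>\<^bsub>Hom A N N\<^esub>a \<in> {..<n}. p j a) = (\<Oplus>\<^bsub>Hom A X Y\<^esub>a \<in> {..<n}. h (p j a))"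
      using p j by (intro lin_finsum[OF l]) auto
    show "(\<Oplus>\<^bsub>Hom A X Y\<^esub>a \<in> {..<n}. h (p j a)) \<in> Mor A X Y"
      using lin_closed[OF l p] j by (intro finsum_Mor o) auto
  qed
  finally show ?thesis .
qed

text \<open>
  The fused strand \<open>B \<star> i\<close> is decomposed into simple objects, and one half of each piece is moved through the crossing.
\<close>

lemma Lam_expand_left:
  assumes [simp]: "\<sigma> \<in> ZO" "\<tau> \<in> ZO" "fst \<tau> = fst \<sigma>" "B \<in> Obj A" "i \<in> Obj A"
    and "finite I" and Io: "\<And>k. k \<in> I \<Longrightarrow> k \<in> Obj A"
    and FG: "\<And>k a. k \<in> I \<Longrightarrow> a < n \<Longrightarrow> F k a \<in> Mor A k (B \<star> i) \<and> G k a \<in> Mor A (B \<star> i) k"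
    and one: "Id A (B \<star> i) = (\<Oplus>\<^bsub>Hom A (B \<star> i) (B \<star> i)\<^esub>k \<in> I. \<Oplus>\<^bsub>Hom A (B \<star> i) (B \<star> i)\<^esub>a \<in> {..<n::nat}. F k a \<cdot> G k a)"
  defines "H \<equiv> Hom A (B \<star> fst \<sigma>) (fst \<sigma> \<star> B)"
  shows "Lam \<sigma> \<tau> (B \<star> i) (Ldual A i) (ug B i (Id A (B \<star> i))) (vf B i (Id A (B \<star> i)))
    = (\<Oplus>\<^bsub>H\<^esub>k \<in> I. \<Oplus>\<^bsub>H\<^esub>a \<in> {..<n}. Lam \<sigma> \<tau> k (Ldual A i) (ug B i (G k a)) (vf B i (F k a)))"
proof -
  let ?i' = "Ldual A i" let ?M = "B \<star> i"
  let ?u = "ug B i (Id A ?M)" let ?v = "vf B i (Id A ?M)"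
  have FGt: "arr (F k a)" "src (F k a) = k" "tgt (F k a) = ?M" "arr (G k a)" "src (G k a) = ?M" "tgt (G k a) = k" if "k \<in> I" "a < n" for k a
    using Mor_typing FG[OF that] Io[OF that(1)] ten_closed[OF assms(4,5)] by blast+
  have lL: "lin (?M \<star> ?i') B (B \<star> fst \<sigma>) (fst \<sigma> \<star> B) (Lam \<sigma> \<tau> ?M ?i' ?u)"
    using Lam_lin_v[of \<sigma> \<tau> ?u ?M ?i' B] by simp
  have lv: "lin ?M ?M (?M \<star> ?i') B (\<lambda>m. ?v \<cdot> (m \<boxtimes> Id A ?i'))" by (rule lins | simp)+
  have l: "lin ?M ?M (B \<star> fst \<sigma>) (fst \<sigma> \<star> B) (\<lambda>m. Lam \<sigma> \<tau> ?M ?i' ?u (?v \<cdot> (m \<boxtimes> Id A ?i')))"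
    by (rule lin_comp[OF lv lL])
  have FGm: "F k a \<cdot> G k a \<in> Mor A ?M ?M" if "k \<in> I" "a < n" for k a
    by (simp add: Mor_iff FGt that)
  have t: "Lam \<sigma> \<tau> ?M ?i' ?u (?v \<cdot> ((F k a \<cdot> G k a) \<boxtimes> Id A ?i')) = Lam \<sigma> \<tau> k ?i' (ug B i (G k a)) (vf B i (F k a))"
    if ka: "k \<in> I" "a < n" for k a
  proof -
    note [simp] = FGt[OF ka] Io[OF ka(1)]
    have a: "?v \<cdot> ((F k a \<cdot> G k a) \<boxtimes> Id A ?i') = (?v \<cdot> (F k a \<boxtimes> Id A ?i')) \<cdot> (G k a \<boxtimes> Id A ?i')"
      by (simp add: ten_comp_right)
    have b: "Lam \<sigma> \<tau> ?M ?i' ?u ((?v \<cdot> (F k a \<boxtimes> Id A ?i')) \<cdot> (G k a \<boxtimes> Id A ?i')) = Lam \<sigma> \<tau> k ?i' ((G k a \<boxtimes> Id A ?i') \<cdot> ?u) (?v \<cdot> (F k a \<boxtimes> Id A ?i'))"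
      by (rule Lam_dinatural[symmetric]) simp_all
    have c: "(G k a \<boxtimes> Id A ?i') \<cdot> ?u = ug B i (G k a)" by (rule ug_Id) simp_all
    have d: "?v \<cdot> (F k a \<boxtimes> Id A ?i') = vf B i (F k a)" by (rule vf_Id) simp_all
    show ?thesis unfolding a b unfolding c d ..
  qed
  have "Lam \<sigma> \<tau> ?M ?i' ?u ?v = Lam \<sigma> \<tau> ?M ?i' ?u (?v \<cdot> (Id A ?M \<boxtimes> Id A ?i'))"
    by (simp add: ten_id)
  also have "\<dots> = (\<Oplus>\<^bsub>H\<^esub>k \<in> I. \<Oplus>\<^bsub>H\<^esub>a \<in> {..<n}. Lam \<sigma> \<tau> ?M ?i' ?u (?v \<cdot> ((F k a \<cdot> G k a) \<boxtimes> Id A ?i')))"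
    unfolding H_def by (rule lin_expand[OF l assms(6) FGm one])
  also have "\<dots> = (\<Oplus>\<^bsub>H\<^esub>k \<in> I. \<Oplus>\<^bsub>H\<^esub>a \<in> {..<n}. Lam \<sigma> \<tau> k ?i' (ug B i (G k a)) (vf B i (F k a)))"
    unfolding H_def using lin_closed[OF l FGm]
    by (intro Hom_finsum_cong finsum_Mor) (auto simp: t)
  finally show ?thesis .
qed

lemma Lam_expand_right:
  assumes [simp]: "\<sigma> \<in> ZO" "\<tau> \<in> ZO" "fst \<tau> = fst \<sigma>" "B \<in> Obj A" "k \<in> Obj A"
    and "finite I" and Io: "\<And>k. k \<in> I \<Longrightarrow> k \<in> Obj A"
    and E: "\<And>i b. i \<in> I \<Longrightarrow> b < m \<Longrightarrow> E i b \<in> Mor A (Ldual A k \<star> B) (Ldual A i) \<and> E' i b \<in> Mor A (Ldual A i) (Ldual A k \<star> B)"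
    and one: "Id A (Ldual A k \<star> B) = (\<Oplus>\<^bsub>Hom A (Ldual A k \<star> B) (Ldual A k \<star> B)\<^esub>i \<in> I. \<Oplus>\<^bsub>Hom A (Ldual A k \<star> B) (Ldual A k \<star> B)\<^esub>b \<in> {..<m::nat}. E' i b \<cdot> E i b)"
  defines "H \<equiv> Hom A (B \<star> fst \<sigma>) (fst \<sigma> \<star> B)"
  shows "Lam \<sigma> \<tau> k (Ldual A k \<star> B) (ue B k (Id A (Ldual A k \<star> B))) (ve B k (Id A (Ldual A k \<star> B)))
    = (\<Oplus>\<^bsub>H\<^esub>i \<in> I. \<Oplus>\<^bsub>H\<^esub>b \<in> {..<m}. Lam \<sigma> \<tau> k (Ldual A i) (ue B k (E i b)) (ve B k (E' i b)))"
proof -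
  let ?N = "Ldual A k \<star> B"
  let ?u = "ue B k (Id A ?N)" let ?v = "ve B k (Id A ?N)"
  have Et: "arr (E i b)" "src (E i b) = ?N" "tgt (E i b) = Ldual A i" "arr (E' i b)" "src (E' i b) = Ldual A i" "tgt (E' i b) = ?N" if "i \<in> I" "b < m" for i b
    using Mor_typing E[OF that] Ldual_closed[OF Io[OF that(1)]] ten_closed[OF Ldual_closed[OF assms(5)] assms(4)] by blast+
  have lL: "lin (k \<star> ?N) B (B \<star> fst \<sigma>) (fst \<sigma> \<star> B) (Lam \<sigma> \<tau> k ?N ?u)"
    using Lam_lin_v[of \<sigma> \<tau> ?u k ?N B] by simp
  have lv: "lin ?N ?N (k \<star> ?N) B (\<lambda>e. ?v \<cdot> (Id A k \<boxtimes> e))" by (rule lins | simp)+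
  have l: "lin ?N ?N (B \<star> fst \<sigma>) (fst \<sigma> \<star> B) (\<lambda>e. Lam \<sigma> \<tau> k ?N ?u (?v \<cdot> (Id A k \<boxtimes> e)))"
    by (rule lin_comp[OF lv lL])
  have Em: "E' i b \<cdot> E i b \<in> Mor A ?N ?N" if "i \<in> I" "b < m" for i b
    by (simp add: Mor_iff Et that)
  have t: "Lam \<sigma> \<tau> k ?N ?u (?v \<cdot> (Id A k \<boxtimes> (E' i b \<cdot> E i b))) = Lam \<sigma> \<tau> k (Ldual A i) (ue B k (E i b)) (ve B k (E' i b))"
    if ib: "i \<in> I" "b < m" for i b
  proof -
    note [simp] = Et[OF ib] Io[OF ib(1)]
    have a: "?v \<cdot> (Id A k \<boxtimes> (E' i b \<cdot> E i b)) = (?v \<cdot> (Id A k \<boxtimes> E' i b)) \<cdot> (Id A k \<boxtimes> E i b)"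
      by (simp add: ten_comp_left)
    have bb: "Lam \<sigma> \<tau> k ?N ?u ((?v \<cdot> (Id A k \<boxtimes> E' i b)) \<cdot> (Id A k \<boxtimes> E i b)) = Lam \<sigma> \<tau> k (Ldual A i) ((Id A k \<boxtimes> E i b) \<cdot> ?u) (?v \<cdot> (Id A k \<boxtimes> E' i b))"
      by (rule Lam_dinatural[symmetric]) simp_all
    have c: "(Id A k \<boxtimes> E i b) \<cdot> ?u = ue B k (E i b)" by (rule ue_Id) simp_all
    have d: "?v \<cdot> (Id A k \<boxtimes> E' i b) = ve B k (E' i b)" by (rule ve_Id) simp_all
    show ?thesis unfolding a bb unfolding c d ..
  qed
  have "Lam \<sigma> \<tau> k ?N ?u ?v = Lam \<sigma> \<tau> k ?N ?u (?v \<cdot> (Id A k \<boxtimes> Id A ?N))"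
    by (simp add: ten_id)
  also have "\<dots> = (\<Oplus>\<^bsub>H\<^esub>i \<in> I. \<Oplus>\<^bsub>H\<^esub>b \<in> {..<m}. Lam \<sigma> \<tau> k ?N ?u (?v \<cdot> (Id A k \<boxtimes> (E' i b \<cdot> E i b))))"
    unfolding H_def by (rule lin_expand[OF l assms(6) Em one])
  also have "\<dots> = (\<Oplus>\<^bsub>H\<^esub>i \<in> I. \<Oplus>\<^bsub>H\<^esub>b \<in> {..<m}. Lam \<sigma> \<tau> k (Ldual A i) (ue B k (E i b)) (ve B k (E' i b)))"
    unfolding H_def using lin_closed[OF l Em]
    by (intro Hom_finsum_cong finsum_Mor) (auto simp: t)
  finally show ?thesis .
qed

text \<open>
  A strand that crosses \<open>Z\<close> by \<open>\<sigma>\<close> above the weighted sum of loops may instead cross by \<open>\<tau>\<close> below it.  Both sides decompose into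
  blocks indexed by the colours \<open>i\<close> and \<open>k\<close> of the loop before and after the slide, and the blocks agree by \<open>slide_block\<close>.
\<close>

theorem handle_slide:
  assumes [simp]: "\<sigma> \<in> ZO" "\<tau> \<in> ZO" "fst \<tau> = fst \<sigma>" "B \<in> Obj A"
    and I: "simple_representatives A I" "finite I"
  defines "H \<equiv> Hom A (B \<star> fst \<sigma>) (fst \<sigma> \<star> B)"
  shows "(\<Oplus>\<^bsub>H\<^esub>i \<in> I. dim A i \<odot>\<^bsub>H\<^esub> (snd \<sigma> B \<cdot> (Id A B \<boxtimes> loop \<sigma> \<tau> i)))
    = (\<Oplus>\<^bsub>H\<^esub>k \<in> I. dim A k \<odot>\<^bsub>H\<^esub> ((loop \<sigma> \<tau> k \<boxtimes> Id A B) \<cdot> snd \<tau> B))"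
proof -
  have Io [simp]: "\<And>k. k \<in> I \<Longrightarrow> k \<in> Obj A" using I(1) unfolding simple_representatives_def is_simple_def by blast
  interpret H: abelian_group H unfolding H_def by (rule Hom_abelian_group) simp_all
  have HO: "B \<star> fst \<sigma> \<in> Obj A" "fst \<sigma> \<star> B \<in> Obj A" by simp_all
  note HF = Hom_facts[OF HO, folded H_def]
  define PL where "PL i n F G \<longleftrightarrow> (\<forall>k \<in> I. \<forall>a < n. F k a \<in> Mor A k (B \<star> i) \<and> G k a \<in> Mor A (B \<star> i) k) \<and>
     Id A (B \<star> i) = (\<Oplus>\<^bsub>Hom A (B \<star> i) (B \<star> i)\<^esub>k \<in> I. \<Oplus>\<^bsub>Hom A (B \<star> i) (B \<star> i)\<^esub>a \<in> {..<n::nat}. F k a \<cdot> G k a)" for i n F G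
  have "\<exists>n F G. i \<in> I \<longrightarrow> PL i n F G" for i
  proof (cases "i \<in> I")
    case True
    have "\<exists>n F G. PL i n F G" unfolding PL_def by (rule decomposition[OF ten_closed[OF assms(4) Io[OF True]] I])
    then show ?thesis by blast
  qed blast
  then have "\<forall>i. \<exists>n F G. i \<in> I \<longrightarrow> PL i n F G" by blast
  from choice[OF this] obtain n where "\<forall>i. \<exists>F G. i \<in> I \<longrightarrow> PL i (n i) F G" by blast
  from choice[OF this] obtain F where "\<forall>i. \<exists>G. i \<in> I \<longrightarrow> PL i (n i) (F i) G" by blast
  from choice[OF this] obtain G where d: "\<And>i. i \<in> I \<Longrightarrow> PL i (n i) (F i) (G i)" by blast
  have FG: "F i k a \<in> Mor A k (B \<star> i) \<and> G i k a \<in> Mor A (B \<star> i) k" if "i \<in> I" "k \<in> I" "a < n i" for i k a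
    using d[OF that(1), unfolded PL_def] that(2,3) by blast
  have one: "Id A (B \<star> i) = (\<Oplus>\<^bsub>Hom A (B \<star> i) (B \<star> i)\<^esub>k \<in> I. \<Oplus>\<^bsub>Hom A (B \<star> i) (B \<star> i)\<^esub>a \<in> {..<n i}. F i k a \<cdot> G i k a)" if "i \<in> I" for i
    by (rule conjunct2[OF d[OF that, unfolded PL_def]])
  define PR where "PR k m E E' \<longleftrightarrow> (\<forall>i \<in> I. \<forall>b < m. E i b \<in> Mor A (Ldual A k \<star> B) (Ldual A i) \<and> E' i b \<in> Mor A (Ldual A i) (Ldual A k \<star> B)) \<and>
     Id A (Ldual A k \<star> B) = (\<Oplus>\<^bsub>Hom A (Ldual A k \<star> B) (Ldual A k \<star> B)\<^esub>i \<in> I. \<Oplus>\<^bsub>Hom A (Ldual A k \<star> B) (Ldual A k \<star> B)\<^esub>b \<in> {..<m::nat}. E' i b \<cdot> E i b)" for k m E E'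
  have "\<exists>m E E'. k \<in> I \<longrightarrow> PR k m E E'" for k
  proof (cases "k \<in> I")
    case True
    have "\<exists>m E E'. PR k m E E'" unfolding PR_def by (rule dual_decomposition[OF ten_closed[OF Ldual_closed[OF Io[OF True]] assms(4)] I])
    then show ?thesis by blast
  qed blast
  then have "\<forall>k. \<exists>m E E'. k \<in> I \<longrightarrow> PR k m E E'" by blast
  from choice[OF this] obtain m where "\<forall>k. \<exists>E E'. k \<in> I \<longrightarrow> PR k (m k) E E'" by blast
  from choice[OF this] obtain E where "\<forall>k. \<exists>E'. k \<in> I \<longrightarrow> PR k (m k) (E k) E'" by blast
  from choice[OF this] obtain E' where d': "\<And>k. k \<in> I \<Longrightarrow> PR k (m k) (E k) (E' k)" by blast
  have E: "E k i b \<in> Mor A (Ldual A k \<star> B) (Ldual A i) \<and> E' k i b \<in> Mor A (Ldual A i) (Ldual A k \<star> B)" if "k \<in> I" "i \<in> I" "b < m k" for k i b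
    using d'[OF that(1), unfolded PR_def] that(2,3) by blast
  have one': "Id A (Ldual A k \<star> B) = (\<Oplus>\<^bsub>Hom A (Ldual A k \<star> B) (Ldual A k \<star> B)\<^esub>i \<in> I. \<Oplus>\<^bsub>Hom A (Ldual A k \<star> B) (Ldual A k \<star> B)\<^esub>b \<in> {..<m k}. E' k i b \<cdot> E k i b)" if "k \<in> I" for k
    by (rule conjunct2[OF d'[OF that, unfolded PR_def]])
  define L where "L i k a = Lam \<sigma> \<tau> k (Ldual A i) (ug B i (G i k a)) (vf B i (F i k a))" for i k a
  define R where "R k i b = Lam \<sigma> \<tau> k (Ldual A i) (ue B k (E k i b)) (ve B k (E' k i b))" for k i b
  have Lc: "L i k a \<in> carrier H" if ika: "i \<in> I" "k \<in> I" "a < n i" for i k a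
  proof -
    have t: "arr (F i k a)" "src (F i k a) = k" "tgt (F i k a) = B \<star> i" "arr (G i k a)" "src (G i k a) = B \<star> i" "tgt (G i k a) = k"
      using Mor_typing FG[OF ika] Io[OF ika(2)] ten_closed[OF assms(4) Io[OF ika(1)]] by blast+
    have v: "vf B i (F i k a) \<in> Mor A (k \<star> Ldual A i) B" by (simp add: Mor_iff t ika)
    have l: "lin (k \<star> Ldual A i) B (B \<star> fst \<sigma>) (fst \<sigma> \<star> B) (Lam \<sigma> \<tau> k (Ldual A i) (ug B i (G i k a)))"
      using Lam_lin_v[of \<sigma> \<tau> "ug B i (G i k a)" k "Ldual A i" B] by (simp add: t ika)
    show ?thesis unfolding L_def H_def by (rule lin_closed[OF l v])
  qed
  have Rc: "R k i b \<in> carrier H" if kib: "k \<in> I" "i \<in> I" "b < m k" for k i b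
  proof -
    have t: "arr (E k i b)" "src (E k i b) = Ldual A k \<star> B" "tgt (E k i b) = Ldual A i" "arr (E' k i b)" "src (E' k i b) = Ldual A i" "tgt (E' k i b) = Ldual A k \<star> B"
      using Mor_typing E[OF kib] Ldual_closed[OF Io[OF kib(2)]] ten_closed[OF Ldual_closed[OF Io[OF kib(1)]] assms(4)] by blast+
    have v: "ve B k (E' k i b) \<in> Mor A (k \<star> Ldual A i) B" by (simp add: Mor_iff t kib)
    have l: "lin (k \<star> Ldual A i) B (B \<star> fst \<sigma>) (fst \<sigma> \<star> B) (Lam \<sigma> \<tau> k (Ldual A i) (ue B k (E k i b)))"
      using Lam_lin_v[of \<sigma> \<tau> "ue B k (E k i b)" k "Ldual A i" B] by (simp add: t kib)
    show ?thesis unfolding R_def H_def by (rule lin_closed[OF l v])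
  qed
  have block: "(\<Oplus>\<^bsub>H\<^esub>a \<in> {..<n i}. dim A i \<odot>\<^bsub>H\<^esub> L i k a) = (\<Oplus>\<^bsub>H\<^esub>b \<in> {..<m k}. dim A k \<odot>\<^bsub>H\<^esub> R k i b)" if ik: "i \<in> I" "k \<in> I" for i k
    unfolding L_def R_def H_def
    by (rule slide_block[OF assms(1-4) I ik FG[OF ik(1)] one[OF ik(1)] E[OF ik(2)] one'[OF ik(2)]])
  have sl: "lin (B \<star> fst \<sigma>) (fst \<sigma> \<star> B) (B \<star> fst \<sigma>) (fst \<sigma> \<star> B) (\<lambda>f. c \<odot>\<^bsub>H\<^esub> f)" for c
    unfolding H_def by (rule lin_smult_self[OF HO])
  have pull: "c \<odot>\<^bsub>H\<^esub> (\<Oplus>\<^bsub>H\<^esub>k \<in> I. \<Oplus>\<^bsub>H\<^esub>a \<in> {..<N::nat}. T k a) = (\<Oplus>\<^bsub>H\<^esub>k \<in> I. \<Oplus>\<^bsub>H\<^esub>a \<in> {..<N}. c \<odot>\<^bsub>H\<^esub> T k a)"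
    if T: "\<And>k a. k \<in> I \<Longrightarrow> a < N \<Longrightarrow> T k a \<in> carrier H" for c N T
  proof -
    have s: "(\<Oplus>\<^bsub>H\<^esub>a \<in> {..<N}. T k a) \<in> carrier H" if "k \<in> I" for k using T that by (intro H.finsum_closed) auto
    have "c \<odot>\<^bsub>H\<^esub> (\<Oplus>\<^bsub>H\<^esub>k \<in> I. \<Oplus>\<^bsub>H\<^esub>a \<in> {..<N}. T k a) = (\<Oplus>\<^bsub>H\<^esub>k \<in> I. c \<odot>\<^bsub>H\<^esub> (\<Oplus>\<^bsub>H\<^esub>a \<in> {..<N}. T k a))"
      using lin_finsum[OF sl I(2), of "\<lambda>k. \<Oplus>\<^bsub>H\<^esub>a \<in> {..<N}. T k a" c] s unfolding H_def by simp
    also have "\<dots> = (\<Oplus>\<^bsub>H\<^esub>k \<in> I. \<Oplus>\<^bsub>H\<^esub>a \<in> {..<N}. c \<odot>\<^bsub>H\<^esub> T k a)"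
    proof (intro H.finsum_cong')
      fix k assume k: "k \<in> I"
      show "c \<odot>\<^bsub>H\<^esub> (\<Oplus>\<^bsub>H\<^esub>a \<in> {..<N}. T k a) = (\<Oplus>\<^bsub>H\<^esub>a \<in> {..<N}. c \<odot>\<^bsub>H\<^esub> T k a)"
        using lin_finsum[OF sl, of "{..<N}" "T k" c] T k unfolding H_def by simp
    qed (use T HF(3) in \<open>auto intro!: H.finsum_closed\<close>)
    finally show ?thesis .
  qed
  have Sc: "(\<Oplus>\<^bsub>H\<^esub>a \<in> {..<n i}. dim A i \<odot>\<^bsub>H\<^esub> L i k a) \<in> carrier H" if "i \<in> I" "k \<in> I" for i k
    using Lc HF(3) that by (intro H.finsum_closed) auto
  have Tc: "(\<Oplus>\<^bsub>H\<^esub>b \<in> {..<m k}. dim A k \<odot>\<^bsub>H\<^esub> R k i b) \<in> carrier H" if "k \<in> I" "i \<in> I" for i k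
    using Rc HF(3) that by (intro H.finsum_closed) auto
  have "(\<Oplus>\<^bsub>H\<^esub>i \<in> I. dim A i \<odot>\<^bsub>H\<^esub> (snd \<sigma> B \<cdot> (Id A B \<boxtimes> loop \<sigma> \<tau> i)))
    = (\<Oplus>\<^bsub>H\<^esub>i \<in> I. \<Oplus>\<^bsub>H\<^esub>k \<in> I. \<Oplus>\<^bsub>H\<^esub>a \<in> {..<n i}. dim A i \<odot>\<^bsub>H\<^esub> L i k a)"
  proof (intro H.finsum_cong')
    fix i assume i: "i \<in> I"
    have "snd \<sigma> B \<cdot> (Id A B \<boxtimes> loop \<sigma> \<tau> i) = (\<Oplus>\<^bsub>H\<^esub>k \<in> I. \<Oplus>\<^bsub>H\<^esub>a \<in> {..<n i}. L i k a)"
      using slide_over_loop[OF assms(1-4) Io[OF i]] Lam_expand_left[OF assms(1-4) Io[OF i] I(2) Io FG[OF i] one[OF i]]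
      unfolding L_def H_def by simp
    then show "dim A i \<odot>\<^bsub>H\<^esub> (snd \<sigma> B \<cdot> (Id A B \<boxtimes> loop \<sigma> \<tau> i)) = (\<Oplus>\<^bsub>H\<^esub>k \<in> I. \<Oplus>\<^bsub>H\<^esub>a \<in> {..<n i}. dim A i \<odot>\<^bsub>H\<^esub> L i k a)"
      using pull[of "n i" "L i" "dim A i"] Lc i by simp
  qed (use Sc in \<open>auto intro!: H.finsum_closed\<close>)
  also have "\<dots> = (\<Oplus>\<^bsub>H\<^esub>i \<in> I. \<Oplus>\<^bsub>H\<^esub>k \<in> I. \<Oplus>\<^bsub>H\<^esub>b \<in> {..<m k}. dim A k \<odot>\<^bsub>H\<^esub> R k i b)"
  proof (rule H.finsum_cong'[OF refl])
    show "(\<lambda>i. \<Oplus>\<^bsub>H\<^esub>k \<in> I. \<Oplus>\<^bsub>H\<^esub>b \<in> {..<m k}. dim A k \<odot>\<^bsub>H\<^esub> R k i b) \<in> I \<rightarrow> carrier H"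
      by (intro Pi_I H.finsum_closed Tc)
    fix i assume i: "i \<in> I"
    show "(\<Oplus>\<^bsub>H\<^esub>k \<in> I. \<Oplus>\<^bsub>H\<^esub>a \<in> {..<n i}. dim A i \<odot>\<^bsub>H\<^esub> L i k a) = (\<Oplus>\<^bsub>H\<^esub>k \<in> I. \<Oplus>\<^bsub>H\<^esub>b \<in> {..<m k}. dim A k \<odot>\<^bsub>H\<^esub> R k i b)"
    proof (rule H.finsum_cong'[OF refl])
      show "(\<lambda>k. \<Oplus>\<^bsub>H\<^esub>b \<in> {..<m k}. dim A k \<odot>\<^bsub>H\<^esub> R k i b) \<in> I \<rightarrow> carrier H"
        by (intro Pi_I Tc i)
      fix k assume k: "k \<in> I"
      show "(\<Oplus>\<^bsub>H\<^esub>a \<in> {..<n i}. dim A i \<odot>\<^bsub>H\<^esub> L i k a) = (\<Oplus>\<^bsub>H\<^esub>b \<in> {..<m k}. dim A k \<odot>\<^bsub>H\<^esub> R k i b)"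
        by (rule block[OF i k])
    qed
  qed
  also have "\<dots> = (\<Oplus>\<^bsub>H\<^esub>k \<in> I. \<Oplus>\<^bsub>H\<^esub>i \<in> I. \<Oplus>\<^bsub>H\<^esub>b \<in> {..<m k}. dim A k \<odot>\<^bsub>H\<^esub> R k i b)"
    by (rule H.finsum_swap[OF I(2) I(2) Tc])
  also have "\<dots> = (\<Oplus>\<^bsub>H\<^esub>k \<in> I. dim A k \<odot>\<^bsub>H\<^esub> ((loop \<sigma> \<tau> k \<boxtimes> Id A B) \<cdot> snd \<tau> B))"
  proof -
    have e: "(loop \<sigma> \<tau> k \<boxtimes> Id A B) \<cdot> snd \<tau> B = (\<Oplus>\<^bsub>H\<^esub>i \<in> I. \<Oplus>\<^bsub>H\<^esub>b \<in> {..<m k}. R k i b)" if k: "k \<in> I" for k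
      using slide_under_loop[OF assms(1-4) Io[OF k]] Lam_expand_right[OF assms(1-4) Io[OF k] I(2) Io E[OF k] one'[OF k]]
      unfolding R_def H_def by simp
    have c: "(\<Oplus>\<^bsub>H\<^esub>i \<in> I. \<Oplus>\<^bsub>H\<^esub>b \<in> {..<m k}. R k i b) \<in> carrier H" if k: "k \<in> I" for k
      by (intro Pi_I H.finsum_closed Rc[OF k]) simp_all
    show ?thesis
    proof (rule H.finsum_cong'[OF refl])
      show "(\<lambda>k. dim A k \<odot>\<^bsub>H\<^esub> ((loop \<sigma> \<tau> k \<boxtimes> Id A B) \<cdot> snd \<tau> B)) \<in> I \<rightarrow> carrier H"
      proof (rule Pi_I)
        fix k assume k: "k \<in> I"
        show "dim A k \<odot>\<^bsub>H\<^esub> ((loop \<sigma> \<tau> k \<boxtimes> Id A B) \<cdot> snd \<tau> B) \<in> carrier H"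
          unfolding e[OF k] by (rule HF(3)[OF c[OF k]])
      qed
      fix k assume k: "k \<in> I"
      show "(\<Oplus>\<^bsub>H\<^esub>i \<in> I. \<Oplus>\<^bsub>H\<^esub>b \<in> {..<m k}. dim A k \<odot>\<^bsub>H\<^esub> R k i b) = dim A k \<odot>\<^bsub>H\<^esub> ((loop \<sigma> \<tau> k \<boxtimes> Id A B) \<cdot> snd \<tau> B)"
        unfolding e[OF k] by (rule pull[OF Rc[OF k], symmetric]) simp_all
    qed
  qed
  finally show ?thesis .
qed

end

section \<open>Morphisms that commute with half-braidings\<close>

context monoidal_linear_category begin

text \<open>
  A morphism of the centre, without the bookkeeping of source and target: \<open>f\<close> intertwines the half-braidings of \<open>V\<close> and \<open>T\<close>.
\<close>

definition central :: "('o, 'm) centre_obj \<Rightarrow> ('o, 'm) centre_obj \<Rightarrow> 'm \<Rightarrow> bool" where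
  "central V T f \<longleftrightarrow> V \<in> ZO \<and> T \<in> ZO \<and> arr f \<and> src f = fst V \<and> tgt f = fst T \<and>
     (\<forall>B \<in> Obj A. snd T B \<cdot> (Id A B \<boxtimes> f) = (f \<boxtimes> Id A B) \<cdot> snd V B)"

lemma centralD: "central V T f \<Longrightarrow> V \<in> ZO" "central V T f \<Longrightarrow> T \<in> ZO" "central V T f \<Longrightarrow> arr f" "central V T f \<Longrightarrow> src f = fst V" "central V T f \<Longrightarrow> tgt f = fst T"
  "central V T f \<Longrightarrow> B \<in> Obj A \<Longrightarrow> snd T B \<cdot> (Id A B \<boxtimes> f) = (f \<boxtimes> Id A B) \<cdot> snd V B"
  by (simp_all add: central_def)

lemma centralI:
  assumes [simp]: "V \<in> ZO" "T \<in> ZO" and r: "rep f F" and [simp]: "sdom F = [fst V]" "scod F = [fst T]"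
    and e: "\<And>B. B \<in> Obj A \<Longrightarrow> W [] (sb T B) [] \<bullet> W [B] F [] = W [] F [B] \<bullet> W [] (sb V B) []"
  shows "central V T f"
proof -
  have t: "arr f" "src f = fst V" "tgt f = fst T" 
  proof -
    have h: "arr f" "hat f = F" using r by (auto simp: rep_def)
    show "arr f" by (rule h)
    show "src f = fst V" "tgt f = fst T" using arg_cong[OF h(2), of sdom] arg_cong[OF h(2), of scod] h(1) by simp_all
  qed
  have [simp]: "sarr F" using r by (auto simp: rep_def)
  have "snd T B \<cdot> (Id A B \<boxtimes> f) = (f \<boxtimes> Id A B) \<cdot> snd V B" if [simp]: "B \<in> Obj A" for B
    by (rule rep_eqI, (rule reps r rep_sb | (simp; fail))+)
      (use ctx_rules[OF e[OF that], simplified ctx_simps] in simp)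
  then show ?thesis using t by (simp add: central_def)
qed

lemma central_strict:
  assumes c: "central V T f" and [simp]: "B \<in> Obj A"
  shows "W [] (sb T B) [] \<bullet> W [B] (hat f) [] = W [] (hat f) [B] \<bullet> W [] (sb V B) []"
proof -
  note [simp] = centralD(1-5)[OF c]
  show ?thesis
    by (rule rep_elim[OF centralD(6)[OF c assms(2)]], (rule reps rep_sb rep_hat | (simp; fail))+)
      (drule arg_cong[where f = "\<lambda>s. W [] (mi (fst T) B) [] \<bullet> W [] s [] \<bullet> W [] (mm B (fst V)) []"], simp)
qed

lemma central_Id: "V \<in> ZO \<Longrightarrow> central V V (Id A (fst V))"
  by (simp add: central_def ten_id)

lemma central_comp:
  assumes f: "central V T f" and g: "central T S g"
  shows "central V S (g \<cdot> f)"
proof -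
  note [simp] = centralD(1-5)[OF f] centralD(2-5)[OF g]
  show ?thesis
  proof (rule centralI)
    show "rep (g \<cdot> f) (hat g \<bullet> hat f)" by (rule rep_comp) (simp_all add: rep_hat)
    fix B assume B: "B \<in> Obj A"
    show "W [] (sb S B) [] \<bullet> W [B] (hat g \<bullet> hat f) [] = W [] (hat g \<bullet> hat f) [B] \<bullet> W [] (sb V B) []"
      using ctx_rules(1)[OF central_strict[OF g B], of "[]", simplified ctx_simps] central_strict[OF f B] by (simp add: B)
  qed simp_all
qed

lemma central_inverse:
  assumes f: "central V T f" and i: "inverse_pair A (fst V) (fst T) f g"
  shows "central T V g"
proof -
  note [simp] = centralD(1-5)[OF f]
  have g [simp]: "arr g" "src g = fst T" "tgt g = fst V" and gf: "g \<cdot> f = Id A (fst V)" "f \<cdot> g = Id A (fst T)"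
    using i Mor_typing[of "fst T" "fst V" g] unfolding inverse_pair_def by auto
  have h: "hat g \<bullet> hat f = ide [fst V]" "hat f \<bullet> hat g = ide [fst T]"
    using arg_cong[OF gf(1), of hat] arg_cong[OF gf(2), of hat] by (simp_all add: hat_comp hat_Id)
  note h' = ctx_rules[OF h(1), simplified ctx_simps] ctx_rules[OF h(2), simplified ctx_simps]
  show ?thesis
  proof (rule centralI[OF _ _ rep_hat[OF g(1)]])
    fix B assume B [simp]: "B \<in> Obj A"
    from arg_cong[OF central_strict[OF f B], of "\<lambda>s. W [] (hat g) [B] \<bullet> s \<bullet> W [B] (hat g) []"]
    show "W [] (sb V B) [] \<bullet> W [B] (hat g) [] = W [] (hat g) [B] \<bullet> W [] (sb T B) []"
      by (simp add: h')
  qed simp_all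
qed

lemma central_ten:
  assumes f: "central V V' f" and g: "central T T' g"
  shows "central (tens V T) (tens V' T') (f \<boxtimes> g)"
proof -
  note [simp] = centralD(1-5)[OF f] centralD(1-5)[OF g]
  show ?thesis
  proof (rule centralI)
    show "rep (f \<boxtimes> g) (mm (fst V') (fst T') \<bullet> W [] (hat f) [fst T'] \<bullet> W [fst V] (hat g) [] \<bullet> mi (fst V) (fst T))"
      by (rule rep_ten) (simp_all add: rep_hat)
    fix B assume B [simp]: "B \<in> Obj A"
    note r = ctx_rules[OF central_strict[OF f B], simplified ctx_simps] ctx_rules[OF central_strict[OF g B], simplified ctx_simps]
    have i: "W [fst V'] (sb T' B) [] \<bullet> W [] (hat f) [B, fst T'] \<bullet> t = W [] (hat f) [fst T', B] \<bullet> W [fst V] (sb T' B) [] \<bullet> t"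
      "W [] (sb V B) [fst T'] \<bullet> W [B, fst V] (hat g) [] \<bullet> t = W [fst V, B] (hat g) [] \<bullet> W [] (sb V B) [fst T] \<bullet> t" for t
      using arg_cong[OF interchange_s[of "hat f" "sb T' B" "[]" "[]" "[]"], of "\<lambda>s. s \<bullet> t"]
        arg_cong[OF interchange_s[of "sb V B" "hat g" "[]" "[]" "[]"], of "\<lambda>s. s \<bullet> t"] by simp_all
    show "W [] (sb (tens V' T') B) [] \<bullet> W [B] (mm (fst V') (fst T') \<bullet> W [] (hat f) [fst T'] \<bullet> W [fst V] (hat g) [] \<bullet> mi (fst V) (fst T)) []
      = W [] (mm (fst V') (fst T') \<bullet> W [] (hat f) [fst T'] \<bullet> W [fst V] (hat g) [] \<bullet> mi (fst V) (fst T)) [B] \<bullet> W [] (sb (tens V T) B) []"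
      by (simp add: tens tens_sb_def i r)
  qed (simp_all add: tens)
qed

lemma central_Assoc:
  assumes [simp]: "V \<in> ZO" "T \<in> ZO" "S \<in> ZO"
  shows "central (tens (tens V T) S) (tens V (tens T S)) (Assoc A (fst V) (fst T) (fst S))"
proof (rule centralI)
  show "rep (Assoc A (fst V) (fst T) (fst S)) (mm (fst V) (fst T \<star> fst S) \<bullet> W [fst V] (mm (fst T) (fst S)) [] \<bullet> W [] (mi (fst V) (fst T)) [fst S] \<bullet> mi (fst V \<star> fst T) (fst S))"
    by (rule rep_Assoc) simp_all
qed (simp_all add: tens tens_sb_def interchange_rule)

lemma ZO_eqI:
  assumes "V \<in> ZO" "T \<in> ZO" "fst V = fst T" "\<And>B. B \<in> Obj A \<Longrightarrow> sb V B = sb T B"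
  shows "V = T"
proof -
  have "snd V B = snd T B" if "B \<in> Obj A" for B
    using rep_eqI[OF rep_sb[OF assms(1) that] rep_sb[OF assms(2) that]] assms(3,4) that by simp
  moreover have "snd V \<in> extensional (Obj A)" "snd T \<in> extensional (Obj A)"
    using assms(1,2) by (auto simp: ZO_iff is_half_braiding_def)
  ultimately have "snd V = snd T" by (intro extensionalityI) auto
  then show ?thesis using assms(3) by (simp add: prod_eq_iff)
qed

end

context premodular_category begin

text \<open>
  Naturality of the braiding in the object that carries the half-braiding.
\<close>

lemma central_braid:
  assumes [simp]: "arr f"
  shows "central (ovr (src f)) (ovr (tgt f)) f" "central (und (src f)) (und (tgt f)) f"
proof -
  show "central (ovr (src f)) (ovr (tgt f)) f"
  proof (rule centralI[OF _ _ rep_hat])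
    fix B assume [simp]: "B \<in> Obj A"
    show "W [] (sb (ovr (tgt f)) B) [] \<bullet> W [B] (hat f) [] = W [] (hat f) [B] \<bullet> W [] (sb (ovr (src f)) B) []"
      using slide_inv[of "und B" "hat f"] by (simp add: ovr und und_si)
  qed (simp_all add: ovr)
  show "central (und (src f)) (und (tgt f)) f"
  proof (rule centralI[OF _ _ rep_hat])
    fix B assume [simp]: "B \<in> Obj A"
    show "W [] (sb (und (tgt f)) B) [] \<bullet> W [B] (hat f) [] = W [] (hat f) [B] \<bullet> W [] (sb (und (src f)) B) []"
      using slide_inv[of "ovr B" "hat f"] by (simp add: ovr und ovr_si)
  qed (simp_all add: und)
qed

text \<open>
  The hexagon axioms.
\<close>

lemma tens_ovr:
  assumes [simp]: "X \<in> Obj A" "Y \<in> Obj A"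
  shows "tens (ovr X) (ovr Y) = ovr (X \<star> Y)" "tens (und X) (und Y) = und (X \<star> Y)"
proof -
  show "tens (ovr X) (ovr Y) = ovr (X \<star> Y)"
  proof (rule ZO_eqI)
    fix B assume [simp]: "B \<in> Obj A"
    have "W [] (cc B (X \<star> Y)) [] \<bullet> W [B] (mm X Y) [] = W [] (mm X Y) [B] \<bullet> W [X] (cc B Y) [] \<bullet> W [] (cc B X) [Y]"
      using slide_inv[of "und B" "mm X Y"] by (simp add: und und_si)
    note e = arg_cong[OF this, of "\<lambda>s. s \<bullet> W [B] (mi X Y) []"]
    show "sb (tens (ovr X) (ovr Y)) B = sb (ovr (X \<star> Y)) B"
      by (rule wrapI) (use e in \<open>simp_all add: tens ovr tens_sb_def\<close>)
  qed (simp_all add: tens ovr)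
  show "tens (und X) (und Y) = und (X \<star> Y)"
  proof (rule ZO_eqI)
    fix B assume [simp]: "B \<in> Obj A"
    have "W [] (ci (X \<star> Y) B) [] \<bullet> W [B] (mm X Y) [] = W [] (mm X Y) [B] \<bullet> W [X] (ci Y B) [] \<bullet> W [] (ci X B) [Y]"
      using slide_inv[of "ovr B" "mm X Y"] by (simp add: ovr ovr_si)
    note e = arg_cong[OF this, of "\<lambda>s. s \<bullet> W [B] (mi X Y) []"]
    show "sb (tens (und X) (und Y)) B = sb (und (X \<star> Y)) B"
      by (rule wrapI) (use e in \<open>simp_all add: tens und tens_sb_def\<close>)
  qed (simp_all add: tens und)
qed

text \<open>
  Conjugating by braidings and inverting a half-braiding does not change which morphisms commute with it.
\<close>

lemma central_U: "central V T f \<Longrightarrow> central (Uo V) (Uo T) f"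
proof -
  assume f: "central V T f"
  note [simp] = centralD(1-5)[OF f]
  show ?thesis
  proof (rule centralI[OF _ _ rep_hat])
    fix B assume B [simp]: "B \<in> Obj A"
    let ?X = "fst V" let ?Y = "fst T"
    have s: "W [] (si T B) [] \<bullet> W [] (hat f) [B] = W [B] (hat f) [] \<bullet> W [] (si V B) []"
      using arg_cong[OF central_strict[OF f B], of "\<lambda>s. W [] (si T B) [] \<bullet> s \<bullet> W [] (si V B) []"] by simp
    have c: "W [] (cc B ?Y) [] \<bullet> W [B] (hat f) [] = W [] (hat f) [B] \<bullet> W [] (cc B ?X) []"
      using central_strict[OF central_braid(1), of f B] by (simp add: ovr)
    have c': "W [] (ci ?Y B) [] \<bullet> W [B] (hat f) [] = W [] (hat f) [B] \<bullet> W [] (ci ?X B) []"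
      using central_strict[OF central_braid(2), of f B] by (simp add: und)
    show "W [] (sb (Uo T) B) [] \<bullet> W [B] (hat f) [] = W [] (hat f) [B] \<bullet> W [] (sb (Uo V) B) []"
      using ctx_rules[OF s, simplified ctx_simps] ctx_rules[OF c, simplified ctx_simps] ctx_rules[OF c', simplified ctx_simps]
      by (simp add: Uo U_sb_def)
  qed (simp_all add: Uo)
qed

lemma central_U_D: "central (Uo V) (Uo T) f \<Longrightarrow> V \<in> ZO \<Longrightarrow> T \<in> ZO \<Longrightarrow> central V T f"
proof -
  assume f: "central (Uo V) (Uo T) f" and [simp]: "V \<in> ZO" "T \<in> ZO"
  have [simp]: "arr f" "src f = fst V" "tgt f = fst T" using centralD(3-5)[OF f] by simp_all
  show ?thesis
  proof (rule centralI[OF _ _ rep_hat])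
    fix B assume B [simp]: "B \<in> Obj A"
    let ?X = "fst V" let ?Y = "fst T"
    have s: "W [] (si (Uo T) B) [] \<bullet> W [] (hat f) [B] = W [B] (hat f) [] \<bullet> W [] (si (Uo V) B) []"
      using arg_cong[OF central_strict[OF f B], of "\<lambda>s. W [] (si (Uo T) B) [] \<bullet> s \<bullet> W [] (si (Uo V) B) []"] by (simp add: Uo(1))
    have c: "W [] (cc B ?Y) [] \<bullet> W [B] (hat f) [] = W [] (hat f) [B] \<bullet> W [] (cc B ?X) []"
      using central_strict[OF central_braid(1), of f B] by (simp add: ovr)
    have c': "W [] (ci ?Y B) [] \<bullet> W [B] (hat f) [] = W [] (hat f) [B] \<bullet> W [] (ci ?X B) []"
      using central_strict[OF central_braid(2), of f B] by (simp add: und)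
    have s': "W [] (ci B ?Y) [] \<bullet> W [] (sb T B) [] \<bullet> W [] (cc ?Y B) [] \<bullet> W [] (hat f) [B]
      = W [B] (hat f) [] \<bullet> W [] (ci B ?X) [] \<bullet> W [] (sb V B) [] \<bullet> W [] (cc ?X B) []"
      using s by (simp add: Uo U_si_def)
    from arg_cong[OF s', of "\<lambda>s. W [] (cc B ?Y) [] \<bullet> s \<bullet> W [] (ci ?X B) []"]
    show "W [] (sb T B) [] \<bullet> W [B] (hat f) [] = W [] (hat f) [B] \<bullet> W [] (sb V B) []"
      by (simp add: c'[symmetric] ctx_rules[OF c, simplified ctx_simps])
  qed simp_all
qed

text \<open>
  The double conjugate \<open>U (U \<gamma>)\<close> differs from \<open>\<gamma>\<close> by double braidings, which are quotients of twists; naturality of the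
  twist at the morphism \<open>\<gamma>\<^sub>B\<close> rearranges them.
\<close>

lemma central_twist:
  assumes [simp]: "V \<in> ZO"
  shows "central (Uo (Uo V)) V (inv_mor A (fst V) (fst V) (Twist A (fst V)))"
proof (rule centralI[OF _ _ rep_Twist_inv])
  fix B assume [simp]: "B \<in> Obj A"
  let ?X = "fst V"
  have tX: "W [] (tw (?X \<star> B)) [] \<bullet> W [] (mm ?X B) [] \<bullet> t = W [] (mm ?X B) [] \<bullet> W [] (cc B ?X) [] \<bullet> W [] (cc ?X B) [] \<bullet> W [] (tw ?X) [B] \<bullet> W [?X] (tw B) [] \<bullet> t" for t
    using ctx_rules(1)[OF tw_ten[of ?X B], of "[]" t] by simp
  have tB: "W [] (tw (B \<star> ?X)) [] \<bullet> W [] (mm B ?X) [] = W [] (mm B ?X) [] \<bullet> W [] (cc ?X B) [] \<bullet> W [] (cc B ?X) [] \<bullet> W [] (tw B) [?X] \<bullet> W [B] (tw ?X) []"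
    using ctx_rules(5)[OF tw_ten[of B ?X], of "[]"] by simp
  have h: "hat (snd V B) = mm ?X B \<bullet> sb V B \<bullet> mi B ?X" using rep_sb[of V B] by (simp add: rep_def)
  have n: "W [] (tw (?X \<star> B)) [] \<bullet> W [] (mm ?X B) [] \<bullet> W [] (sb V B) [] \<bullet> W [] (mi B ?X) [] = W [] (mm ?X B) [] \<bullet> W [] (sb V B) [] \<bullet> W [] (mi B ?X) [] \<bullet> W [] (tw (B \<star> ?X)) []"
    using ctx_rules(5)[OF tw_natural[of "snd V B"], of "[]"] by (simp add: h)
  have s: "W [] (sb V B) [] \<bullet> W [] (tw B) [?X] = W [?X] (tw B) [] \<bullet> W [] (sb V B) []"
    using slide[of V "tw B"] by (simp add: tw_def)
  have i: "W [B] (tw ?X) [] \<bullet> W [] (ti B) [?X] = W [] (ti B) [?X] \<bullet> W [B] (tw ?X) []"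
    "W [?X] (tw B) [] \<bullet> W [] (ti ?X) [B] = W [] (ti ?X) [B] \<bullet> W [?X] (tw B) []"
    using interchange_s[of "ti B" "tw ?X" "[]" "[]" "[]"] interchange_s[of "ti ?X" "tw B" "[]" "[]" "[]"] by simp_all
  \<comment> \<open>Naturality of the twist at \<open>\<gamma>\<^sub>B\<close>, with the twists of the tensor products written as double braidings.\<close>
  have k: "W [] (cc B ?X) [] \<bullet> W [] (cc ?X B) [] \<bullet> W [] (tw ?X) [B] \<bullet> W [?X] (tw B) [] \<bullet> W [] (sb V B) []
    = W [] (sb V B) [] \<bullet> W [] (cc ?X B) [] \<bullet> W [] (cc B ?X) [] \<bullet> W [] (tw B) [?X] \<bullet> W [B] (tw ?X) []"
    using arg_cong[OF n, of "\<lambda>s. W [] (mi ?X B) [] \<bullet> s \<bullet> W [] (mm B ?X) []"] by (simp add: tX tB)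
  have k': "W [?X] (tw B) [] \<bullet> W [] (sb V B) [] \<bullet> W [] (ti B) [?X] = W [] (sb V B) []"
    using ctx_rules(1)[OF s, of "[]" "W [] (ti B) [?X]", simplified ctx_simps, symmetric] ctx_rules(5)[OF tw_ti(1)[of B], of "[?X]"] by simp
  have l: "W [] (cc B ?X) [] \<bullet> W [] (cc ?X B) [] \<bullet> W [] (tw ?X) [B] \<bullet> W [] (sb V B) []
    = W [] (sb V B) [] \<bullet> W [] (cc ?X B) [] \<bullet> W [] (cc B ?X) [] \<bullet> W [B] (tw ?X) []"
  proof -
    have "W [] (cc B ?X) [] \<bullet> W [] (cc ?X B) [] \<bullet> W [] (tw ?X) [B] \<bullet> W [] (sb V B) []
      = (W [] (cc B ?X) [] \<bullet> W [] (cc ?X B) [] \<bullet> W [] (tw ?X) [B] \<bullet> W [?X] (tw B) [] \<bullet> W [] (sb V B) []) \<bullet> W [] (ti B) [?X]"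
      by (simp add: k')
    also have "\<dots> = W [] (sb V B) [] \<bullet> W [] (cc ?X B) [] \<bullet> W [] (cc B ?X) [] \<bullet> W [] (tw B) [?X] \<bullet> (W [B] (tw ?X) [] \<bullet> W [] (ti B) [?X])"
      unfolding k by simp
    also have "\<dots> = W [] (sb V B) [] \<bullet> W [] (cc ?X B) [] \<bullet> W [] (cc B ?X) [] \<bullet> W [B] (tw ?X) []"
      unfolding i using ctx_rules(1)[OF tw_ti(1)[of B], of "[?X]"] by simp
    finally show ?thesis .
  qed
  have t: "W [B] (tw ?X) [] \<bullet> W [B] (ti ?X) [] = ide [B, ?X]" "W [] (ti ?X) [B] \<bullet> W [] (tw ?X) [B] \<bullet> t = ide [?X, B] \<bullet> t" for t
    using ctx_rules(6)[OF tw_ti(1)[of ?X], of B "[]"] ctx_rules(1)[OF tw_ti(2)[of ?X], of "[B]" t] by simp_all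
  from arg_cong[OF l, of "\<lambda>s. W [] (ti ?X) [B] \<bullet> W [] (ci ?X B) [] \<bullet> W [] (ci B ?X) [] \<bullet> s \<bullet> W [B] (ti ?X) []"]
  show "W [] (sb V B) [] \<bullet> W [B] (ti ?X) [] = W [] (ti ?X) [B] \<bullet> W [] (sb (Uo (Uo V)) B) []"
    by (simp add: Uo U_sb_def U_si_def t)
qed (simp_all add: Uo ti_def)

text \<open>
  After \<open>U\<close> the roles of the two half-braidings are exchanged along the braiding \<open>Y \<star> X \<rightarrow> X \<star> Y\<close>.  Both identities are
  sequences of Yang-Baxter moves.
\<close>

lemma central_braid_U:
  assumes [simp]: "V \<in> ZO" "T \<in> ZO"
  defines "X \<equiv> fst V" and "Y \<equiv> fst T"
  shows "central (tens (ovr Y) (Uo V)) (Uo (tens V (und Y))) (Braid A Y X)"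
    "central (tens (Uo T) (und X)) (Uo (tens (ovr X) T)) (Braid A Y X)"
proof -
  have [simp]: "X \<in> Obj A" "Y \<in> Obj A" "fst V = X" "fst T = Y" by (simp_all add: X_def Y_def)
  have mmc: "W [] (cc B (X \<star> Y)) [] \<bullet> W [B] (mm X Y) [] = W [] (mm X Y) [B] \<bullet> W [X] (cc B Y) [] \<bullet> W [] (cc B X) [Y]"
    and mmi: "W [] (ci (X \<star> Y) B) [] \<bullet> W [B] (mm X Y) [] = W [] (mm X Y) [B] \<bullet> W [X] (ci Y B) [] \<bullet> W [] (ci X B) [Y]"
    if [simp]: "B \<in> Obj A" for B
    using slide_inv[of "und B" "mm X Y"] slide_inv[of "ovr B" "mm X Y"] by (simp_all add: und und_si ovr ovr_si)
  have yb: "W [X] (cc B Y) [] \<bullet> W [] (cc B X) [Y] \<bullet> W [B] (cc Y X) [] = W [] (cc Y X) [B] \<bullet> W [Y] (cc B X) [] \<bullet> W [] (cc B Y) [X]"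
    and yb': "W [X] (ci Y B) [] \<bullet> W [] (ci X B) [Y] \<bullet> W [B] (cc Y X) [] = W [] (cc Y X) [B] \<bullet> W [Y] (ci X B) [] \<bullet> W [] (ci Y B) [X]"
    if [simp]: "B \<in> Obj A" for B
    using slide_inv[of "und B" "cc Y X"] slide_inv[of "ovr B" "cc Y X"] by (simp_all add: und und_si ovr ovr_si)
  have r: "rep (Braid A Y X) (mm X Y \<bullet> cc Y X \<bullet> mi Y X)" by (rule rep_Braid) simp_all
  show "central (tens (ovr Y) (Uo V)) (Uo (tens V (und Y))) (Braid A Y X)"
  proof (rule centralI[OF _ _ r])
    fix B assume B [simp]: "B \<in> Obj A"
    have s1: "W [] (si V B) [Y] \<bullet> W [X] (cc Y B) [] \<bullet> W [] (cc Y X) [B] = W [B] (cc Y X) [] \<bullet> W [] (cc Y B) [X] \<bullet> W [Y] (si V B) []"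
      using slide_inv[of "und Y" "si V B"] by (simp add: und und_si)
    have s2: "W [] (ci X B) [Y] \<bullet> W [B] (cc Y X) [] \<bullet> W [] (cc Y B) [X] = W [X] (cc Y B) [] \<bullet> W [] (cc Y X) [B] \<bullet> W [Y] (ci X B) []"
      using slide_inv[of "und Y" "ci X B"] by (simp add: und und_si)
    show "W [] (sb (Uo (tens V (und Y))) B) [] \<bullet> W [B] (mm X Y \<bullet> cc Y X \<bullet> mi Y X) []
      = W [] (mm X Y \<bullet> cc Y X \<bullet> mi Y X) [B] \<bullet> W [] (sb (tens (ovr Y) (Uo V)) B) []"
      by (simp add: tens Uo und ovr und_si ovr_si U_sb_def tens_sb_def tens_si_def
        ctx_rules[OF mmc[OF B], simplified ctx_simps] ctx_rules[OF mmi[OF B], simplified ctx_simps]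
        ctx_rules[OF yb[OF B], simplified ctx_simps] ctx_rules[OF s1, simplified ctx_simps] ctx_rules[OF s2, simplified ctx_simps])
  qed (simp_all add: tens Uo und ovr)
  show "central (tens (Uo T) (und X)) (Uo (tens (ovr X) T)) (Braid A Y X)"
  proof (rule centralI[OF _ _ r])
    fix B assume B [simp]: "B \<in> Obj A"
    have s1: "W [X] (si T B) [] \<bullet> W [] (cc Y X) [B] \<bullet> W [Y] (cc B X) [] = W [] (cc B X) [Y] \<bullet> W [B] (cc Y X) [] \<bullet> W [] (si T B) [X]"
      using slide[of "ovr X" "si T B"] by (simp add: ovr)
    show "W [] (sb (Uo (tens (ovr X) T)) B) [] \<bullet> W [B] (mm X Y \<bullet> cc Y X \<bullet> mi Y X) []
      = W [] (mm X Y \<bullet> cc Y X \<bullet> mi Y X) [B] \<bullet> W [] (sb (tens (Uo T) (und X)) B) []"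
      by (simp add: tens Uo und ovr und_si ovr_si U_sb_def tens_sb_def tens_si_def
        ctx_rules[OF mmc[OF B], simplified ctx_simps] ctx_rules[OF mmi[OF B], simplified ctx_simps]
        ctx_rules[OF yb[OF B], simplified ctx_simps] ctx_rules[OF yb'[OF B], simplified ctx_simps] ctx_rules[OF s1, simplified ctx_simps])
  qed (simp_all add: tens Uo und ovr)
qed

end

section \<open>The normalised sum of loops\<close>

text \<open>
  Loops are summed over a chosen set of simple objects.  A nonzero global dimension makes this set finite and the sum
  normalisable.
\<close>

locale kirby = premodular_category A
  for A :: "('k::{alg_closed_field, field_char_0}, 'o, 'm, 'z) ribbon_cat_scheme" (structure) +
  fixes I :: "'o set"
  assumes I: "simple_representatives A I"
    and D: "global_dim A I \<noteq> 0"
begin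

text \<open>
  A sum over an infinite index set would be zero.
\<close>

lemma finite_I: "finite I"
  using D by (rule contrapos_np) (simp add: global_dim_def)

lemma I_Obj: "i \<in> I \<Longrightarrow> i \<in> Obj A"
proof -
  assume i: "i \<in> I"
  have "is_simple A i" using I[unfolded simple_representatives_def] i by blast
  then show ?thesis by (simp add: is_simple_def)
qed

text \<open>
  For the two half-braidings \<open>\<gamma> \<otimes> c\<^sup>-\<^sup>1\<close> and \<open>c \<otimes> \<mu>\<close> this is the idempotent \<open>Q\<close>, see \<open>Q_eq_kirby_loop\<close>.
\<close>

definition kirby_loop :: "('o, 'm) centre_obj \<Rightarrow> ('o, 'm) centre_obj \<Rightarrow> 'm" where
  "kirby_loop \<sigma> \<tau> = (let H = Hom A (fst \<sigma>) (fst \<sigma>) in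
     (1 / global_dim A I) \<odot>\<^bsub>H\<^esub> (\<Oplus>\<^bsub>H\<^esub>i \<in> I. dim A i \<odot>\<^bsub>H\<^esub> loop \<sigma> \<tau> i))"

lemma loop_Mor:
  assumes [simp]: "\<sigma> \<in> ZO" "\<tau> \<in> ZO" "fst \<tau> = fst \<sigma>" "i \<in> Obj A"
  shows "loop \<sigma> \<tau> i \<in> Mor A (fst \<sigma>) (fst \<sigma>)"
proof -
  have t: "arr (loop \<sigma> \<tau> i) \<and> src (loop \<sigma> \<tau> i) = fst \<sigma> \<and> tgt (loop \<sigma> \<tau> i) = fst \<sigma>"
    by (rule rep_typing[OF rep_loop[OF assms]]) simp_all
  show ?thesis by (simp add: Mor_iff t)
qed

lemma lin_kirby_loop:
  assumes [simp]: "\<sigma> \<in> ZO" "\<tau> \<in> ZO" "fst \<tau> = fst \<sigma>" and l: "lin (fst \<sigma>) (fst \<sigma>) X Y h"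
  shows "h (kirby_loop \<sigma> \<tau>) = (1 / global_dim A I) \<odot>\<^bsub>Hom A X Y\<^esub> (\<Oplus>\<^bsub>Hom A X Y\<^esub>i \<in> I. dim A i \<odot>\<^bsub>Hom A X Y\<^esub> h (loop \<sigma> \<tau> i))"
proof -
  let ?Z = "fst \<sigma>"
  have o: "?Z \<in> Obj A" "X \<in> Obj A" "Y \<in> Obj A" using l by (simp_all add: lin_def)
  have m: "loop \<sigma> \<tau> i \<in> Mor A ?Z ?Z" if "i \<in> I" for i by (rule loop_Mor) (simp_all add: I_Obj that)
  have m': "dim A i \<odot>\<^bsub>Hom A ?Z ?Z\<^esub> loop \<sigma> \<tau> i \<in> Mor A ?Z ?Z" if "i \<in> I" for i
    by (rule Hom_facts(3)[OF o(1) o(1) m[OF that]])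
  have "h (kirby_loop \<sigma> \<tau>) = (1 / global_dim A I) \<odot>\<^bsub>Hom A X Y\<^esub> h (\<Oplus>\<^bsub>Hom A ?Z ?Z\<^esub>i \<in> I. dim A i \<odot>\<^bsub>Hom A ?Z ?Z\<^esub> loop \<sigma> \<tau> i)"
    unfolding kirby_loop_def Let_def by (rule lin_smult[OF l finsum_Mor[OF o(1) o(1) m']])
  also have "h (\<Oplus>\<^bsub>Hom A ?Z ?Z\<^esub>i \<in> I. dim A i \<odot>\<^bsub>Hom A ?Z ?Z\<^esub> loop \<sigma> \<tau> i) = (\<Oplus>\<^bsub>Hom A X Y\<^esub>i \<in> I. h (dim A i \<odot>\<^bsub>Hom A ?Z ?Z\<^esub> loop \<sigma> \<tau> i))"
    by (rule lin_finsum[OF l finite_I m'])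
  also have "\<dots> = (\<Oplus>\<^bsub>Hom A X Y\<^esub>i \<in> I. dim A i \<odot>\<^bsub>Hom A X Y\<^esub> h (loop \<sigma> \<tau> i))"
    by (rule Hom_finsum_cong[OF o(2,3) lin_smult[OF l m] Hom_facts(3)[OF o(2,3) lin_closed[OF l m]]])
  finally show ?thesis .
qed

lemma kirby_loop_Mor:
  assumes [simp]: "\<sigma> \<in> ZO" "\<tau> \<in> ZO" "fst \<tau> = fst \<sigma>"
  shows "kirby_loop \<sigma> \<tau> \<in> Mor A (fst \<sigma>) (fst \<sigma>)"
  unfolding kirby_loop_def Let_def
  by (intro Hom_facts(3) finsum_Mor loop_Mor) (simp_all add: I_Obj)

lemma kirby_loop_typing [simp]:
  assumes [simp]: "\<sigma> \<in> ZO" "\<tau> \<in> ZO" "fst \<tau> = fst \<sigma>"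
  shows "arr (kirby_loop \<sigma> \<tau>)" "src (kirby_loop \<sigma> \<tau>) = fst \<sigma>" "tgt (kirby_loop \<sigma> \<tau>) = fst \<sigma>"
  by (rule Mor_typing[OF _ _ kirby_loop_Mor[OF assms]]; simp)+

lemma loop_central:
  assumes [simp]: "\<sigma> \<in> ZO" "\<tau> \<in> ZO" "fst \<tau> = fst \<sigma>" "i \<in> Obj A" and c: "comm \<sigma> \<tau>"
  shows "central \<sigma> \<sigma> (loop \<sigma> \<tau> i)" "central \<tau> \<tau> (loop \<sigma> \<tau> i)"
proof -
  show "central \<sigma> \<sigma> (loop \<sigma> \<tau> i)"
  proof (rule centralI[OF _ _ rep_loop])
    fix B assume [simp]: "B \<in> Obj A"
    have "pass (ovr B) \<sigma> \<sigma> i" by (rule pass_self) (simp_all add: ovr)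
    moreover have "pass (ovr B) \<sigma> \<tau> (Ldual A i)" by (rule comm_pass(1)[OF _ _ _ _ _ c]) simp_all
    ultimately have "W [] (sb \<sigma> (fst (ovr B))) [] \<bullet> W [fst (ovr B)] (loop_diagram \<sigma> \<tau> i) [] = W [] (loop_diagram \<sigma> \<tau> i) [fst (ovr B)] \<bullet> W [] (sb \<sigma> (fst (ovr B))) []"
      by (intro loop_commutes) (simp_all add: ovr)
    then show "W [] (sb \<sigma> B) [] \<bullet> W [B] (loop_diagram \<sigma> \<tau> i) [] = W [] (loop_diagram \<sigma> \<tau> i) [B] \<bullet> W [] (sb \<sigma> B) []" by (simp only: fst_ovr)
  qed simp_all
  show "central \<tau> \<tau> (loop \<sigma> \<tau> i)"
  proof (rule centralI[OF _ _ rep_loop])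
    fix B assume [simp]: "B \<in> Obj A"
    have "pass (und B) \<tau> \<tau> (Ldual A i)" by (rule pass_self) (simp_all add: und)
    moreover have "pass (und B) \<tau> \<sigma> i" by (rule comm_pass(2)[OF _ _ _ _ _ c]) simp_all
    ultimately have "W [] (sb \<tau> (fst (und B))) [] \<bullet> W [fst (und B)] (loop_diagram \<sigma> \<tau> i) [] = W [] (loop_diagram \<sigma> \<tau> i) [fst (und B)] \<bullet> W [] (sb \<tau> (fst (und B))) []"
      by (intro loop_commutes) (simp_all add: und)
    then show "W [] (sb \<tau> B) [] \<bullet> W [B] (loop_diagram \<sigma> \<tau> i) [] = W [] (loop_diagram \<sigma> \<tau> i) [B] \<bullet> W [] (sb \<tau> B) []" by (simp only: fst_ovr)
  qed simp_all
qed

text \<open>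
  The first two statements hold for every single loop; the third one is the handle slide, and the last one combines them.
\<close>

lemma kirby_loop_central:
  assumes [simp]: "\<sigma> \<in> ZO" "\<tau> \<in> ZO" "fst \<tau> = fst \<sigma>" and c: "comm \<sigma> \<tau>"
  shows "central \<sigma> \<sigma> (kirby_loop \<sigma> \<tau>)" "central \<tau> \<tau> (kirby_loop \<sigma> \<tau>)" "central \<tau> \<sigma> (kirby_loop \<sigma> \<tau>)" "central \<sigma> \<tau> (kirby_loop \<sigma> \<tau>)"
proof -
  let ?Z = "fst \<sigma>"
  have s: "snd \<rho> B \<cdot> (Id A B \<boxtimes> kirby_loop \<sigma> \<tau>) = (kirby_loop \<sigma> \<tau> \<boxtimes> Id A B) \<cdot> snd \<rho> B"
    if [simp]: "\<rho> \<in> ZO" "fst \<rho> = ?Z" "B \<in> Obj A" and c: "\<And>i. i \<in> I \<Longrightarrow> central \<rho> \<rho> (loop \<sigma> \<tau> i)" for \<rho> B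
  proof -
    have l: "lin ?Z ?Z (B \<star> ?Z) (?Z \<star> B) (\<lambda>f. snd \<rho> B \<cdot> (Id A B \<boxtimes> f))" by (rule lins | simp)+
    have l': "lin ?Z ?Z (B \<star> ?Z) (?Z \<star> B) (\<lambda>f. (f \<boxtimes> Id A B) \<cdot> snd \<rho> B)" by (rule lins | simp)+
    have e: "snd \<rho> B \<cdot> (Id A B \<boxtimes> loop \<sigma> \<tau> i) = (loop \<sigma> \<tau> i \<boxtimes> Id A B) \<cdot> snd \<rho> B" if "i \<in> I" for i
      by (rule centralD(6)[OF c[OF that]]) simp
    have m: "dim A i \<odot>\<^bsub>Hom A (B \<star> ?Z) (?Z \<star> B)\<^esub> ((loop \<sigma> \<tau> i \<boxtimes> Id A B) \<cdot> snd \<rho> B) \<in> Mor A (B \<star> ?Z) (?Z \<star> B)" if "i \<in> I" for i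
      by (rule Hom_facts(3)[OF _ _ lin_closed[OF l' loop_Mor]]) (simp_all add: I_Obj that)
    show ?thesis
      unfolding lin_kirby_loop[OF assms(1-3) l] lin_kirby_loop[OF assms(1-3) l']
      by (rule arg_cong[where f = "\<lambda>x. (1 / global_dim A I) \<odot>\<^bsub>Hom A (B \<star> ?Z) (?Z \<star> B)\<^esub> x"], rule Hom_finsum_cong)
        (simp_all add: e m)
  qed
  have a: "snd \<sigma> B \<cdot> (Id A B \<boxtimes> kirby_loop \<sigma> \<tau>) = (kirby_loop \<sigma> \<tau> \<boxtimes> Id A B) \<cdot> snd \<sigma> B"
    and b: "snd \<tau> B \<cdot> (Id A B \<boxtimes> kirby_loop \<sigma> \<tau>) = (kirby_loop \<sigma> \<tau> \<boxtimes> Id A B) \<cdot> snd \<tau> B" if "B \<in> Obj A" for B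
    using s[OF assms(1) refl that loop_central(1)[OF assms(1-3) I_Obj c]] s[OF assms(2,3) that loop_central(2)[OF assms(1-3) I_Obj c]] by blast+
  have h: "snd \<sigma> B \<cdot> (Id A B \<boxtimes> kirby_loop \<sigma> \<tau>) = (kirby_loop \<sigma> \<tau> \<boxtimes> Id A B) \<cdot> snd \<tau> B" if [simp]: "B \<in> Obj A" for B
  proof -
    have l: "lin ?Z ?Z (B \<star> ?Z) (?Z \<star> B) (\<lambda>f. snd \<sigma> B \<cdot> (Id A B \<boxtimes> f))" by (rule lins | simp)+
    have l': "lin ?Z ?Z (B \<star> ?Z) (?Z \<star> B) (\<lambda>f. (f \<boxtimes> Id A B) \<cdot> snd \<tau> B)" by (rule lins | simp)+
    show ?thesis
      unfolding lin_kirby_loop[OF assms(1-3) l] lin_kirby_loop[OF assms(1-3) l'] handle_slide[OF assms(1-3) that I finite_I] ..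
  qed
  show "central \<sigma> \<sigma> (kirby_loop \<sigma> \<tau>)" by (simp add: central_def a)
  show "central \<tau> \<tau> (kirby_loop \<sigma> \<tau>)" by (simp add: central_def b)
  show "central \<tau> \<sigma> (kirby_loop \<sigma> \<tau>)" by (simp add: central_def h)
  show "central \<sigma> \<tau> (kirby_loop \<sigma> \<tau>)" by (simp add: central_def b flip: h a)
qed

lemma absorb_scalars:
  assumes "X \<in> Obj A" "Y \<in> Obj A" "f \<in> Mor A X Y"
  shows "(1 / global_dim A I) \<odot>\<^bsub>Hom A X Y\<^esub> (\<Oplus>\<^bsub>Hom A X Y\<^esub>i \<in> I. dim A i \<odot>\<^bsub>Hom A X Y\<^esub> (dim A i \<odot>\<^bsub>Hom A X Y\<^esub> f)) = f"
proof -
  have "(\<Oplus>\<^bsub>Hom A X Y\<^esub>i \<in> I. dim A i \<odot>\<^bsub>Hom A X Y\<^esub> (dim A i \<odot>\<^bsub>Hom A X Y\<^esub> f)) = (\<Oplus>\<^bsub>Hom A X Y\<^esub>i \<in> I. (dim A i)\<^sup>2 \<odot>\<^bsub>Hom A X Y\<^esub> f)"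
    by (rule Hom_finsum_cong[OF assms(1,2)]) (simp_all add: power2_eq_square Hom_facts[OF assms(1,2)] assms(3))
  also have "\<dots> = global_dim A I \<odot>\<^bsub>Hom A X Y\<^esub> f"
    unfolding global_dim_def by (rule smult_finsum_scalars[OF assms(1,2) finite_I assms(3)])
  finally show ?thesis
    using Hom_facts(6)[OF assms, of "1 / global_dim A I" "global_dim A I"] Hom_facts(5)[OF assms] D by simp
qed

text \<open>
  A closed loop next to a strand is a scalar.
\<close>

lemma bubble:
  assumes [simp]: "Z \<in> Obj A" "i \<in> Obj A"
  shows "Runit A Z \<cdot> (Id A Z \<boxtimes> (pivotal_ev A i \<cdot> Coev A i)) \<cdot> Runit_inv A Z = dim A i \<odot>\<^bsub>Hom A Z Z\<^esub> Id A Z"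
proof -
  have l: "lin (Unit A) (Unit A) Z Z (\<lambda>f. Runit A Z \<cdot> (Id A Z \<boxtimes> f) \<cdot> Runit_inv A Z)" by (rule lins | simp)+
  show ?thesis unfolding dim_works[OF assms(2)] lin_smult[OF l id_closed[OF unit_closed]] by (simp add: ten_id)
qed

lemma rep_bubble:
  assumes [simp]: "Z \<in> Obj A" "i \<in> Obj A"
  shows "rep (Runit A Z \<cdot> (Id A Z \<boxtimes> (pivotal_ev A i \<cdot> Coev A i)) \<cdot> Runit_inv A Z) (W [Z] (sp i \<bullet> co i) [])"
  by (rule rep_via, (rule reps rep_pivotal_ev rep_Coev | (simp; fail))+, (simp)?)

text \<open>
  Every loop \<open>i\<close> comes off as a bubble and contributes \<open>d\<^sub>i\<close>, so the normalised sum contributes \<open>\<Sum>\<^sub>i d\<^sub>i\<^sup>2\<close> divided by the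
  global dimension.
\<close>

lemma kirby_loop_absorb:
  assumes s: "central V \<sigma> f" and t: "central V \<tau> f"
  shows "kirby_loop \<sigma> \<tau> \<cdot> f = f"
proof -
  note [simp] = centralD(1-5)[OF s] centralD(2)[OF t]
  have [simp]: "fst \<tau> = fst \<sigma>" using centralD(5)[OF s] centralD(5)[OF t] by simp
  let ?Z = "fst \<sigma>" let ?X = "fst V"
  have fm: "f \<in> Mor A ?X ?Z" by (simp add: Mor_iff)
  have e: "loop \<sigma> \<tau> i \<cdot> f = dim A i \<odot>\<^bsub>Hom A ?X ?Z\<^esub> f" if "i \<in> I" for i
  proof -
    note [simp] = I_Obj[OF that]
    have p: "loop_diagram \<sigma> \<tau> i \<bullet> hat f = W [?Z] (sp i \<bullet> co i) [] \<bullet> hat f"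
      by (rule loop_absorb) (simp_all add: central_strict[OF s] central_strict[OF t])
    have "loop \<sigma> \<tau> i \<cdot> f = (Runit A ?Z \<cdot> (Id A ?Z \<boxtimes> (pivotal_ev A i \<cdot> Coev A i)) \<cdot> Runit_inv A ?Z) \<cdot> f"
    proof (rule rep_eqI)
      show "rep (loop \<sigma> \<tau> i \<cdot> f) (loop_diagram \<sigma> \<tau> i \<bullet> hat f)" by (rule rep_comp[OF rep_loop rep_hat]) simp_all
      show "rep ((Runit A ?Z \<cdot> (Id A ?Z \<boxtimes> (pivotal_ev A i \<cdot> Coev A i)) \<cdot> Runit_inv A ?Z) \<cdot> f) (W [?Z] (sp i \<bullet> co i) [] \<bullet> hat f)"
        by (rule rep_comp[OF rep_bubble rep_hat]) simp_all
    qed (simp only: p)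
    also have "\<dots> = (dim A i \<odot>\<^bsub>Hom A ?Z ?Z\<^esub> Id A ?Z) \<cdot> f" by (subst bubble) simp_all
    also have "\<dots> = dim A i \<odot>\<^bsub>Hom A ?X ?Z\<^esub> f"
      using comp_smult_left[OF _ _ _ fm id_closed[of ?Z]] by simp
    finally show ?thesis .
  qed
  have l: "lin ?Z ?Z ?X ?Z (\<lambda>g. g \<cdot> f)" by (rule lins | simp)+
  have "kirby_loop \<sigma> \<tau> \<cdot> f = (1 / global_dim A I) \<odot>\<^bsub>Hom A ?X ?Z\<^esub> (\<Oplus>\<^bsub>Hom A ?X ?Z\<^esub>i \<in> I. dim A i \<odot>\<^bsub>Hom A ?X ?Z\<^esub> (loop \<sigma> \<tau> i \<cdot> f))"
    by (rule lin_kirby_loop[OF _ _ _ l]) simp_all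
  also have "(\<Oplus>\<^bsub>Hom A ?X ?Z\<^esub>i \<in> I. dim A i \<odot>\<^bsub>Hom A ?X ?Z\<^esub> (loop \<sigma> \<tau> i \<cdot> f)) = (\<Oplus>\<^bsub>Hom A ?X ?Z\<^esub>i \<in> I. dim A i \<odot>\<^bsub>Hom A ?X ?Z\<^esub> (dim A i \<odot>\<^bsub>Hom A ?X ?Z\<^esub> f))"
    by (rule Hom_finsum_cong) (simp_all add: e Hom_facts fm)
  also have "(1 / global_dim A I) \<odot>\<^bsub>Hom A ?X ?Z\<^esub> \<dots> = f" by (rule absorb_scalars[OF _ _ fm]) simp_all
  finally show ?thesis .
qed

lemma kirby_loop_coabsorb:
  assumes s: "central \<sigma> V f" and t: "central \<tau> V f"
  shows "f \<cdot> kirby_loop \<sigma> \<tau> = f"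
proof -
  note [simp] = centralD(1-5)[OF s] centralD(1)[OF t]
  have [simp]: "fst \<tau> = fst \<sigma>" using centralD(4)[OF s] centralD(4)[OF t] by simp
  let ?Z = "fst \<sigma>" let ?X = "fst V"
  have fm: "f \<in> Mor A ?Z ?X" by (simp add: Mor_iff)
  have e: "f \<cdot> loop \<sigma> \<tau> i = dim A i \<odot>\<^bsub>Hom A ?Z ?X\<^esub> f" if "i \<in> I" for i
  proof -
    note [simp] = I_Obj[OF that]
    have p: "hat f \<bullet> loop_diagram \<sigma> \<tau> i = hat f \<bullet> W [?Z] (sp i \<bullet> co i) []"
      by (rule loop_coabsorb) (simp_all flip: central_strict[OF s] central_strict[OF t])
    have "f \<cdot> loop \<sigma> \<tau> i = f \<cdot> (Runit A ?Z \<cdot> (Id A ?Z \<boxtimes> (pivotal_ev A i \<cdot> Coev A i)) \<cdot> Runit_inv A ?Z)"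
    proof (rule rep_eqI)
      show "rep (f \<cdot> loop \<sigma> \<tau> i) (hat f \<bullet> loop_diagram \<sigma> \<tau> i)" by (rule rep_comp[OF rep_hat rep_loop]) simp_all
      show "rep (f \<cdot> (Runit A ?Z \<cdot> (Id A ?Z \<boxtimes> (pivotal_ev A i \<cdot> Coev A i)) \<cdot> Runit_inv A ?Z)) (hat f \<bullet> W [?Z] (sp i \<bullet> co i) [])"
        by (rule rep_comp[OF rep_hat rep_bubble]) simp_all
    qed (simp only: p)
    also have "\<dots> = f \<cdot> (dim A i \<odot>\<^bsub>Hom A ?Z ?Z\<^esub> Id A ?Z)" by (subst bubble) simp_all
    also have "\<dots> = dim A i \<odot>\<^bsub>Hom A ?Z ?X\<^esub> f"
      using comp_smult_right[OF _ _ _ id_closed[of ?Z] fm] by simp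
    finally show ?thesis .
  qed
  have l: "lin ?Z ?Z ?Z ?X (\<lambda>g. f \<cdot> g)" by (rule lins | simp)+
  have "f \<cdot> kirby_loop \<sigma> \<tau> = (1 / global_dim A I) \<odot>\<^bsub>Hom A ?Z ?X\<^esub> (\<Oplus>\<^bsub>Hom A ?Z ?X\<^esub>i \<in> I. dim A i \<odot>\<^bsub>Hom A ?Z ?X\<^esub> (f \<cdot> loop \<sigma> \<tau> i))"
    by (rule lin_kirby_loop[OF _ _ _ l]) simp_all
  also have "(\<Oplus>\<^bsub>Hom A ?Z ?X\<^esub>i \<in> I. dim A i \<odot>\<^bsub>Hom A ?Z ?X\<^esub> (f \<cdot> loop \<sigma> \<tau> i)) = (\<Oplus>\<^bsub>Hom A ?Z ?X\<^esub>i \<in> I. dim A i \<odot>\<^bsub>Hom A ?Z ?X\<^esub> (dim A i \<odot>\<^bsub>Hom A ?Z ?X\<^esub> f))"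
    by (rule Hom_finsum_cong) (simp_all add: e Hom_facts fm)
  also have "(1 / global_dim A I) \<odot>\<^bsub>Hom A ?Z ?X\<^esub> \<dots> = f" by (rule absorb_scalars[OF _ _ fm]) simp_all
  finally show ?thesis .
qed

lemma Q_eq_kirby_loop:
  assumes [simp]: "V \<in> ZO" "T \<in> ZO"
  shows "Q A I V T = kirby_loop (tens V (und (fst T))) (tens (ovr (fst V)) T)"
proof -
  let ?X = "fst V" let ?Y = "fst T" let ?s = "tens V (und ?Y)" let ?t = "tens (ovr ?X) T"
  have [simp]: "?s \<in> ZO" "?t \<in> ZO" by (simp_all add: tens und ovr)
  have e: "Q_term A V T i = loop ?s ?t i" if "i \<in> I" for i
    by (rule rep_eqI[OF rep_Q_term rep_loop refl]) (simp_all add: I_Obj that)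
  have m: "dim A i \<odot>\<^bsub>Hom A (?X \<star> ?Y) (?X \<star> ?Y)\<^esub> loop ?s ?t i \<in> Mor A (?X \<star> ?Y) (?X \<star> ?Y)" if "i \<in> I" for i
    using loop_Mor[of ?s ?t i] by (intro Hom_facts(3)) (simp_all add: I_Obj that)
  show ?thesis unfolding Q_def kirby_loop_def Let_def fst_tens fst_ovr
    by (rule arg_cong[where f = "\<lambda>x. (1 / global_dim A I) \<odot>\<^bsub>Hom A (?X \<star> ?Y) (?X \<star> ?Y)\<^esub> x"], rule Hom_finsum_cong)
      (simp_all add: e m)
qed

lemma kirby_loop_tens:
  assumes [simp]: "\<sigma> \<in> ZO" "\<tau> \<in> ZO" "fst \<tau> = fst \<sigma>" "\<kappa> \<in> ZO"
  shows "kirby_loop (tens \<kappa> \<sigma>) (tens \<kappa> \<tau>) = Id A (fst \<kappa>) \<boxtimes> kirby_loop \<sigma> \<tau>"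
    "kirby_loop (tens \<sigma> \<kappa>) (tens \<tau> \<kappa>) = kirby_loop \<sigma> \<tau> \<boxtimes> Id A (fst \<kappa>)"
proof -
  let ?Z = "fst \<sigma>" let ?X = "fst \<kappa>"
  have l: "loop (tens \<kappa> \<sigma>) (tens \<kappa> \<tau>) i = Id A ?X \<boxtimes> loop \<sigma> \<tau> i" if "i \<in> I" for i
  proof -
    note [simp] = I_Obj[OF that]
    have "rep (Id A ?X \<boxtimes> loop \<sigma> \<tau> i) (mm ?X ?Z \<bullet> W [] (ide [?X]) [?Z] \<bullet> W [?X] (loop_diagram \<sigma> \<tau> i) [] \<bullet> mi ?X ?Z)"
      by (rule rep_ten[OF rep_Id rep_loop]) simp_all
    then show ?thesis
      using loop_diagram_tens_left[of \<sigma> \<tau> \<kappa> i] rep_loop[of "tens \<kappa> \<sigma>" "tens \<kappa> \<tau>" i] by (intro rep_eqI) (simp_all add: tens(1))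
  qed
  have r: "loop (tens \<sigma> \<kappa>) (tens \<tau> \<kappa>) i = loop \<sigma> \<tau> i \<boxtimes> Id A ?X" if "i \<in> I" for i
  proof -
    note [simp] = I_Obj[OF that]
    have "rep (loop \<sigma> \<tau> i \<boxtimes> Id A ?X) (mm ?Z ?X \<bullet> W [] (loop_diagram \<sigma> \<tau> i) [?X] \<bullet> W [?Z] (ide [?X]) [] \<bullet> mi ?Z ?X)"
      by (rule rep_ten[OF rep_loop rep_Id]) simp_all
    then show ?thesis
      using loop_diagram_tens_right[of \<sigma> \<tau> \<kappa> i] rep_loop[of "tens \<sigma> \<kappa>" "tens \<tau> \<kappa>" i] by (intro rep_eqI) (simp_all add: tens(1))
  qed
  have ll: "lin ?Z ?Z (?X \<star> ?Z) (?X \<star> ?Z) (\<lambda>f. Id A ?X \<boxtimes> f)" "lin ?Z ?Z (?Z \<star> ?X) (?Z \<star> ?X) (\<lambda>f. f \<boxtimes> Id A ?X)"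
    by (rule lins | simp)+
  have m: "dim A i \<odot>\<^bsub>Hom A (?X \<star> ?Z) (?X \<star> ?Z)\<^esub> (Id A ?X \<boxtimes> loop \<sigma> \<tau> i) \<in> Mor A (?X \<star> ?Z) (?X \<star> ?Z)"
    "dim A i \<odot>\<^bsub>Hom A (?Z \<star> ?X) (?Z \<star> ?X)\<^esub> (loop \<sigma> \<tau> i \<boxtimes> Id A ?X) \<in> Mor A (?Z \<star> ?X) (?Z \<star> ?X)" if "i \<in> I" for i
    using lin_closed[OF ll(1) loop_Mor[of \<sigma> \<tau> i]] lin_closed[OF ll(2) loop_Mor[of \<sigma> \<tau> i]]
    by (simp_all add: Hom_facts(3) I_Obj that)
  show "kirby_loop (tens \<kappa> \<sigma>) (tens \<kappa> \<tau>) = Id A ?X \<boxtimes> kirby_loop \<sigma> \<tau>"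
    unfolding lin_kirby_loop[OF assms(1-3) ll(1)] unfolding kirby_loop_def Let_def fst_tens
    by (rule arg_cong[where f = "\<lambda>x. (1 / global_dim A I) \<odot>\<^bsub>Hom A (?X \<star> ?Z) (?X \<star> ?Z)\<^esub> x"], rule Hom_finsum_cong)
      (simp_all add: l m)
  show "kirby_loop (tens \<sigma> \<kappa>) (tens \<tau> \<kappa>) = kirby_loop \<sigma> \<tau> \<boxtimes> Id A ?X"
    unfolding lin_kirby_loop[OF assms(1-3) ll(2)] unfolding kirby_loop_def Let_def fst_tens
    by (rule arg_cong[where f = "\<lambda>x. (1 / global_dim A I) \<odot>\<^bsub>Hom A (?Z \<star> ?X) (?Z \<star> ?X)\<^esub> x"], rule Hom_finsum_cong)
      (simp_all add: r m)
qed

end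

section \<open>The reduced tensor product\<close>

context monoidal_linear_category begin

text \<open>
  The half-braiding induced on the image of an idempotent.
\<close>

definition restriction :: "('o, 'm) centre_obj \<Rightarrow> 'o \<Rightarrow> 'm \<Rightarrow> 'm \<Rightarrow> ('o, 'm) centre_obj" where
  "restriction \<rho> E i p = (E, \<lambda>B \<in> Obj A. (p \<boxtimes> Id A B) \<cdot> snd \<rho> B \<cdot> (Id A B \<boxtimes> i))"

lemma fst_restriction [simp]: "fst (restriction \<rho> E i p) = E"
  by (simp add: restriction_def)

lemma restriction:
  assumes im: "is_image A (fst \<rho>) e (E, i, p)" and c: "central \<rho> \<rho> e"
  shows "restriction \<rho> E i p \<in> ZO" "central (restriction \<rho> E i p) \<rho> i" "central \<rho> (restriction \<rho> E i p) p"
    "B \<in> Obj A \<Longrightarrow> sb (restriction \<rho> E i p) B = W [] (hat p) [B] \<bullet> sb \<rho> B \<bullet> W [B] (hat i) []"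
proof -
  let ?Z = "fst \<rho>" let ?R = "restriction \<rho> E i p"
  note [simp] = centralD(1-5)[OF c]
  have E [simp]: "E \<in> Obj A" and im': "i \<in> Mor A E ?Z" "p \<in> Mor A ?Z E" "p \<cdot> i = Id A E" "i \<cdot> p = e"
    using im unfolding is_image_def by auto
  have [simp]: "arr i" "src i = E" "tgt i = ?Z" by (rule Mor_typing[OF _ _ im'(1)]; simp)+
  have [simp]: "arr p" "src p = ?Z" "tgt p = E" by (rule Mor_typing[OF _ _ im'(2)]; simp)+
  have pi: "hat p \<bullet> hat i = ide [E]" and ip: "hat i \<bullet> hat p = hat e"
    using arg_cong[OF im'(3), of hat] arg_cong[OF im'(4), of hat] by (simp_all add: hat_comp hat_Id)
  have pe: "hat p \<bullet> hat e = hat p" and ei: "hat e \<bullet> hat i = hat i"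
    using arg_cong[OF pi, of "\<lambda>s. s \<bullet> hat p"] arg_cong[OF pi, of "\<lambda>s. hat i \<bullet> s"] by (simp_all flip: ip)
  note cr = ctx_rules[OF pi, simplified ctx_simps] ctx_rules[OF ip, simplified ctx_simps]
    ctx_rules[OF pe, simplified ctx_simps] ctx_rules[OF ei, simplified ctx_simps]
  have e1: "W [] (sb \<rho> B) [] \<bullet> W [B] (hat e) [] = W [] (hat e) [B] \<bullet> W [] (sb \<rho> B) []" if "B \<in> Obj A" for B
    by (rule central_strict[OF c that])
  have e2: "W [] (si \<rho> B) [] \<bullet> W [] (hat e) [B] = W [B] (hat e) [] \<bullet> W [] (si \<rho> B) []" if [simp]: "B \<in> Obj A" for B
    using arg_cong[OF e1[OF that], of "\<lambda>s. W [] (si \<rho> B) [] \<bullet> s \<bullet> W [] (si \<rho> B) []"] by simp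
  note er = ctx_rules[OF e1, simplified ctx_simps] and er' = ctx_rules[OF e2, simplified ctx_simps]
  define h where "h B = W [] (hat p) [B] \<bullet> sb \<rho> B \<bullet> W [B] (hat i) []" for B
  define hi where "hi B = W [B] (hat p) [] \<bullet> si \<rho> B \<bullet> W [] (hat i) [B]" for B
  have x: "snd ?R \<in> extensional (Obj A)" by (simp add: restriction_def)
  have s: "snd ?R B = (p \<boxtimes> Id A B) \<cdot> snd \<rho> B \<cdot> (Id A B \<boxtimes> i)" if "B \<in> Obj A" for B
    using that by (simp add: restriction_def)
  have r: "rep (snd ?R B) (mm (fst ?R) B \<bullet> h B \<bullet> mi B (fst ?R))" if [simp]: "B \<in> Obj A" for B
    unfolding s[OF that]
    by (rule rep_via, (rule reps rep_sb rep_hat | (simp; fail))+) (simp add: h_def)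
  have iso: "is_iso A (B \<star> fst ?R) (fst ?R \<star> B) (snd ?R B)" if [simp]: "B \<in> Obj A" for B
  proof (rule iso_of_rep(1)[OF r])
    show "rep ((Id A B \<boxtimes> p) \<cdot> inv_mor A (B \<star> ?Z) (?Z \<star> B) (snd \<rho> B) \<cdot> (i \<boxtimes> Id A B)) (mm B E \<bullet> hi B \<bullet> mi E B)"
      by (rule rep_via, (rule reps rep_si rep_hat | (simp; fail))+) (simp add: hi_def)
    have a: "W [] (h B \<bullet> hi B) [] = ide [E, B]" and b: "W [] (hi B \<bullet> h B) [] = ide [B, E]"
      by (simp_all add: h_def hi_def cr er er')
    have a': "h B \<bullet> hi B = ide [E, B]" and b': "hi B \<bullet> h B = ide [B, E]"
      by (rule wrapI; use a b in \<open>simp add: h_def hi_def\<close>)+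
    have a'': "h B \<bullet> hi B \<bullet> t = ide [E, B] \<bullet> t" and b'': "hi B \<bullet> h B \<bullet> t = ide [B, E] \<bullet> t" for t
      by (simp_all only: a' b' flip: comp_s_assoc)
    have hs: "sarr (h B)" "sarr (hi B)" "sdom (h B) = [B, E]" "scod (h B) = [E, B]" "sdom (hi B) = [E, B]" "scod (hi B) = [B, E]"
      by (simp_all add: h_def hi_def)
    show "(mm (fst ?R) B \<bullet> h B \<bullet> mi B (fst ?R)) \<bullet> mm B E \<bullet> hi B \<bullet> mi E B = ide [fst ?R \<star> B]"
      "(mm B E \<bullet> hi B \<bullet> mi E B) \<bullet> mm (fst ?R) B \<bullet> h B \<bullet> mi B (fst ?R) = ide [B \<star> fst ?R]"
      by (simp_all add: a'' b'' hs)
  qed (simp_all add: h_def hi_def)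
  have n: "h (tgt f) \<bullet> W [] (hat f) [fst ?R] = W [fst ?R] (hat f) [] \<bullet> h (src f)" if [simp]: "arr f" for f
    by (rule wrapI) (simp_all add: h_def interchange_rule slide_rules)
  have m: "h (B \<star> B') \<bullet> W [] (mm B B') [fst ?R] = W [fst ?R] (mm B B') [] \<bullet> W [] (h B) [B'] \<bullet> W [B] (h B') []"
    if [simp]: "B \<in> Obj A" "B' \<in> Obj A" for B B'
    by (rule wrapI) (simp_all add: h_def interchange_rule slide_rules cr er)
  show ZO: "?R \<in> ZO" and sb: "\<And>B. B \<in> Obj A \<Longrightarrow> sb ?R B = W [] (hat p) [B] \<bullet> sb \<rho> B \<bullet> W [B] (hat i) []"
    unfolding h_def[symmetric]
    by (rule ZO_I[OF _ x r _ iso n m]; simp add: h_def)+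
  show "central ?R \<rho> i"
  proof (rule centralI[OF _ _ rep_hat])
    fix B assume [simp]: "B \<in> Obj A"
    show "W [] (sb \<rho> B) [] \<bullet> W [B] (hat i) [] = W [] (hat i) [B] \<bullet> W [] (sb ?R B) []"
      using ctx_rules(1)[OF e1, of B "[]" "W [B] (hat i) []"] by (simp add: sb cr)
  qed (simp_all add: ZO)
  show "central \<rho> ?R p"
  proof (rule centralI[OF _ _ rep_hat])
    fix B assume [simp]: "B \<in> Obj A"
    show "W [] (sb ?R B) [] \<bullet> W [B] (hat p) [] = W [] (hat p) [B] \<bullet> W [] (sb \<rho> B) []"
      by (simp add: sb cr er)
  qed (simp_all add: ZO)
qed

text \<open>
  Two half-braidings that the idempotent intertwines with each other have the same restriction.
\<close>

lemma restriction_eq: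
  assumes im: "is_image A (fst \<sigma>) e (E, i, p)" and c: "central \<sigma> \<sigma> e" "central \<tau> \<tau> e" "central \<tau> \<sigma> e"
  shows "restriction \<sigma> E i p = restriction \<tau> E i p"
proof (rule ZO_eqI)
  let ?Z = "fst \<sigma>"
  note [simp] = centralD(1-5)[OF c(1)] centralD(1-5)[OF c(2)]
  have z [simp]: "fst \<tau> = fst \<sigma>" using centralD(4)[OF c(1)] centralD(4)[OF c(2)] by simp
  have im2: "is_image A (fst \<tau>) e (E, i, p)" using im by simp
  show "restriction \<sigma> E i p \<in> ZO" "restriction \<tau> E i p \<in> ZO" by (rule restriction(1)[OF im c(1)], rule restriction(1)[OF im2 c(2)])
  have E [simp]: "E \<in> Obj A" and im': "i \<in> Mor A E ?Z" "p \<in> Mor A ?Z E" "p \<cdot> i = Id A E" "i \<cdot> p = e"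
    using im unfolding is_image_def by auto
  have [simp]: "arr i" "src i = E" "tgt i = ?Z" by (rule Mor_typing[OF _ _ im'(1)]; simp)+
  have [simp]: "arr p" "src p = ?Z" "tgt p = E" by (rule Mor_typing[OF _ _ im'(2)]; simp)+
  have pi: "hat p \<bullet> hat i = ide [E]" and ip: "hat i \<bullet> hat p = hat e"
    using arg_cong[OF im'(3), of hat] arg_cong[OF im'(4), of hat] by (simp_all add: hat_comp hat_Id)
  have pe: "hat p \<bullet> hat e = hat p" and ei: "hat e \<bullet> hat i = hat i"
    using arg_cong[OF pi, of "\<lambda>s. s \<bullet> hat p"] arg_cong[OF pi, of "\<lambda>s. hat i \<bullet> s"] by (simp_all flip: ip)
  note cr = ctx_rules[OF pe, simplified ctx_simps] ctx_rules[OF ei, simplified ctx_simps]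
  fix B assume B [simp]: "B \<in> Obj A"
  have "W [] (hat p) [B] \<bullet> W [] (sb \<sigma> B) [] \<bullet> W [B] (hat i) [] = W [] (hat p) [B] \<bullet> (W [] (sb \<sigma> B) [] \<bullet> W [B] (hat e) []) \<bullet> W [B] (hat i) []"
    by (simp add: cr)
  also have "\<dots> = W [] (hat p) [B] \<bullet> W [] (sb \<tau> B) [] \<bullet> W [B] (hat i) []"
    unfolding central_strict[OF c(3) B] by (simp add: cr)
  finally have e: "W [] (hat p) [B] \<bullet> W [] (sb \<sigma> B) [] \<bullet> W [B] (hat i) [] = W [] (hat p) [B] \<bullet> W [] (sb \<tau> B) [] \<bullet> W [B] (hat i) []" .
  show "sb (restriction \<sigma> E i p) B = sb (restriction \<tau> E i p) B"
    by (rule wrapI) (use e in \<open>simp_all add: restriction(4)[OF im c(1)] restriction(4)[OF im2 c(2)]\<close>)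
qed simp

end

locale reduced_tensor = kirby A I
  for A :: "('k::{alg_closed_field, field_char_0}, 'o, 'm, 'z) ribbon_cat_scheme" (structure) and I +
  fixes im :: "'o \<Rightarrow> 'm \<Rightarrow> 'o \<times> 'm \<times> 'm"
  assumes im: "is_image_choice A im"
begin

text \<open>
  The half-braidings \<open>\<gamma> \<otimes> c\<^sup>-\<^sup>1\<close> and \<open>c \<otimes> \<mu>\<close> on \<open>X \<star> Y\<close>.
\<close>

abbreviation left_braid :: "('o, 'm) centre_obj \<Rightarrow> ('o, 'm) centre_obj \<Rightarrow> ('o, 'm) centre_obj" where
  "left_braid V T \<equiv> tens V (und (fst T))"

abbreviation right_braid :: "('o, 'm) centre_obj \<Rightarrow> ('o, 'm) centre_obj \<Rightarrow> ('o, 'm) centre_obj" where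
  "right_braid V T \<equiv> tens (ovr (fst V)) T"

abbreviation RO :: "('o, 'm) centre_obj \<Rightarrow> ('o, 'm) centre_obj \<Rightarrow> ('o, 'm) centre_obj" where
  "RO \<equiv> red_obj A I im"

abbreviation ri :: "('o, 'm) centre_obj \<Rightarrow> ('o, 'm) centre_obj \<Rightarrow> 'm" where
  "ri \<equiv> red_incl A I im"

abbreviation rp :: "('o, 'm) centre_obj \<Rightarrow> ('o, 'm) centre_obj \<Rightarrow> 'm" where
  "rp \<equiv> red_proj A I im"

lemma left_right_braid [simp]: "V \<in> ZO \<Longrightarrow> T \<in> ZO \<Longrightarrow> left_braid V T \<in> ZO" "V \<in> ZO \<Longrightarrow> T \<in> ZO \<Longrightarrow> right_braid V T \<in> ZO"
  by (simp_all add: tens und ovr)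

lemma Q_central:
  assumes [simp]: "V \<in> ZO" "T \<in> ZO"
  shows "central (left_braid V T) (left_braid V T) (Q A I V T)" "central (right_braid V T) (right_braid V T) (Q A I V T)"
    "central (right_braid V T) (left_braid V T) (Q A I V T)" "central (left_braid V T) (right_braid V T) (Q A I V T)"
  unfolding Q_eq_kirby_loop[OF assms]
  by (rule kirby_loop_central; simp add: comm_tens)+

lemma Q_absorb:
  assumes "V \<in> ZO" "T \<in> ZO" "central S (left_braid V T) f" "central S (right_braid V T) f"
  shows "Q A I V T \<cdot> f = f"
  unfolding Q_eq_kirby_loop[OF assms(1,2)] by (rule kirby_loop_absorb[OF assms(3,4)])

lemma Q_coabsorb:
  assumes "V \<in> ZO" "T \<in> ZO" "central (left_braid V T) S f" "central (right_braid V T) S f"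
  shows "f \<cdot> Q A I V T = f"
  unfolding Q_eq_kirby_loop[OF assms(1,2)] by (rule kirby_loop_coabsorb[OF assms(3,4)])

lemma red_image:
  assumes [simp]: "V \<in> ZO" "T \<in> ZO"
  shows "is_image A (fst V \<star> fst T) (Q A I V T) (fst (RO V T), ri V T, rp V T)"
proof -
  let ?Q = "Q A I V T"
  have q: "?Q \<in> Mor A (fst V \<star> fst T) (fst V \<star> fst T)" by (simp add: Mor_iff centralD(3-5)[OF Q_central(1)[OF assms]])
  have qq: "?Q \<cdot> ?Q = ?Q" by (rule Q_absorb[OF assms Q_central(1,4)[OF assms]])
  have o: "fst V \<star> fst T \<in> Obj A" by simp
  have "is_image A (fst V \<star> fst T) ?Q (im (fst V \<star> fst T) ?Q)"
    by (rule im[unfolded is_image_choice_def, rule_format, OF o q qq])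
  moreover have "im (fst V \<star> fst T) ?Q = (fst (RO V T), ri V T, rp V T)"
    by (simp add: red_obj_def red_image_def red_incl_def red_proj_def case_prod_beta)
  ultimately show ?thesis by simp
qed

text \<open>
  The restrictions of \<open>\<gamma> \<otimes> c\<^sup>-\<^sup>1\<close> and \<open>c \<otimes> \<mu>\<close> to the image of \<open>Q\<close> agree.  That both descriptions are available is what makes
  all later arguments symmetric in the two factors.
\<close>

lemma red_obj_restriction:
  assumes [simp]: "V \<in> ZO" "T \<in> ZO"
  shows "RO V T = restriction (left_braid V T) (fst (RO V T)) (ri V T) (rp V T)" "RO V T = restriction (right_braid V T) (fst (RO V T)) (ri V T) (rp V T)"
proof -
  show a: "RO V T = restriction (left_braid V T) (fst (RO V T)) (ri V T) (rp V T)"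
    by (simp add: restriction_def red_obj_def case_prod_beta tens_def und_def)
  have "restriction (left_braid V T) (fst (RO V T)) (ri V T) (rp V T) = restriction (right_braid V T) (fst (RO V T)) (ri V T) (rp V T)"
    by (rule restriction_eq[OF _ Q_central(1-3)[OF assms]]) (simp add: red_image)
  with a show "RO V T = restriction (right_braid V T) (fst (RO V T)) (ri V T) (rp V T)" by (rule trans)
qed

text \<open>
  Inclusion and projection commute with the half-braiding of the reduced tensor product and either of the two half-braidings
  on the full tensor product.
\<close>

lemma red:
  assumes [simp]: "V \<in> ZO" "T \<in> ZO"
  shows "RO V T \<in> ZO" "central (RO V T) (left_braid V T) (ri V T)" "central (RO V T) (right_braid V T) (ri V T)"
    "central (left_braid V T) (RO V T) (rp V T)" "central (right_braid V T) (RO V T) (rp V T)"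
    "rp V T \<cdot> ri V T = Id A (fst (RO V T))" "ri V T \<cdot> rp V T = Q A I V T"
proof -
  have i1: "is_image A (fst (left_braid V T)) (Q A I V T) (fst (RO V T), ri V T, rp V T)"
    and i2: "is_image A (fst (right_braid V T)) (Q A I V T) (fst (RO V T), ri V T, rp V T)" by (simp_all add: red_image)
  note a = restriction(1-3)[OF i1 Q_central(1)[OF assms], folded red_obj_restriction(1)[OF assms]]
  note b = restriction(1-3)[OF i2 Q_central(2)[OF assms], folded red_obj_restriction(2)[OF assms]]
  show "RO V T \<in> ZO" "central (RO V T) (left_braid V T) (ri V T)" "central (RO V T) (right_braid V T) (ri V T)"
    "central (left_braid V T) (RO V T) (rp V T)" "central (right_braid V T) (RO V T) (rp V T)" by (rule a b)+
  show "rp V T \<cdot> ri V T = Id A (fst (RO V T))" "ri V T \<cdot> rp V T = Q A I V T" using i1 by (simp_all add: is_image_def)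
qed

lemma red_typing [simp]:
  assumes [simp]: "V \<in> ZO" "T \<in> ZO"
  shows "arr (ri V T)" "src (ri V T) = fst (RO V T)" "tgt (ri V T) = fst V \<star> fst T"
    "arr (rp V T)" "src (rp V T) = fst V \<star> fst T" "tgt (rp V T) = fst (RO V T)"
    "arr (Q A I V T)" "src (Q A I V T) = fst V \<star> fst T" "tgt (Q A I V T) = fst V \<star> fst T"
  using centralD(3-5)[OF red(2)[OF assms]] centralD(3-5)[OF red(4)[OF assms]] centralD(3-5)[OF Q_central(1)[OF assms]] by simp_all

end

section \<open>The tensor structure and its hexagon\<close>

lemma (in linear_category) comp_assoc_eq: "x \<cdot> y = z \<Longrightarrow> arr x \<Longrightarrow> arr y \<Longrightarrow> arr t \<Longrightarrow> src x = tgt y \<Longrightarrow> src y = tgt t \<Longrightarrow> x \<cdot> (y \<cdot> t) = z \<cdot> t"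
  using arr_comp_assoc[of t y x] by simp

text \<open>
  In the strict model both sides move \<open>Z\<close>, \<open>Y\<close> and \<open>X\<close> into the opposite order; they differ by a Yang-Baxter move.
\<close>

lemma (in premodular_category) braid_assoc:
  assumes [simp]: "X \<in> Obj A" "Y \<in> Obj A" "Z \<in> Obj A"
  shows "Assoc A X Y Z \<cdot> Braid A Z (X \<star> Y) \<cdot> (Id A Z \<boxtimes> Braid A Y X)
    = Braid A (Y \<star> Z) X \<cdot> (Braid A Z Y \<boxtimes> Id A X) \<cdot> Assoc_inv A Z Y X"
proof -
  have m1: "W [] (cc Z (X \<star> Y)) [] \<bullet> W [Z] (mm X Y) [] = W [] (mm X Y) [Z] \<bullet> W [X] (cc Z Y) [] \<bullet> W [] (cc Z X) [Y]"
    using slide_inv[of "und Z" "mm X Y"] by (simp add: und und_si)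
  have m2: "W [] (cc (Y \<star> Z) X) [] \<bullet> W [] (mm Y Z) [X] = W [X] (mm Y Z) [] \<bullet> W [] (cc Y X) [Z] \<bullet> W [Y] (cc Z X) []"
    using slide[of "ovr X" "mm Y Z"] by (simp add: ovr)
  have yb: "W [X] (cc Z Y) [] \<bullet> W [] (cc Z X) [Y] \<bullet> W [Z] (cc Y X) [] = W [] (cc Y X) [Z] \<bullet> W [Y] (cc Z X) [] \<bullet> W [] (cc Z Y) [X]"
    using slide_inv[of "und Z" "cc Y X"] by (simp add: und und_si)
  show ?thesis
    by (rule rep_eqI, (rule reps rep_Braid | (simp; fail))+)
      (simp add: ctx_rules[OF m1, simplified ctx_simps] ctx_rules[OF m2, simplified ctx_simps] ctx_rules[OF yb, simplified ctx_simps])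
qed

context reduced_tensor begin

lemma Uo_ZO [simp]: "V \<in> ZO \<Longrightarrow> Uo V \<in> ZO"
  by (rule Uo(1))

text \<open>
  Conjugating \<open>Q\<close> by the braiding gives a morphism that the other idempotent absorbs, since the braiding carries the pair of
  half-braidings of \<open>(U T, U V)\<close> to the image under \<open>U\<close> of the pair of \<open>(V, T)\<close>.
\<close>

lemma Q_braid:
  assumes [simp]: "V \<in> ZO" "T \<in> ZO"
  defines "c \<equiv> Braid A (fst T) (fst V)"
  shows "Q A I V T \<cdot> c = c \<cdot> Q A I (Uo T) (Uo V)"
proof -
  let ?X = "fst V" let ?Y = "fst T" let ?e = "Q A I V T" let ?e' = "Q A I (Uo T) (Uo V)"
  define d where "d = Braid_inv A ?Y ?X"
  have [simp]: "arr c" "src c = ?Y \<star> ?X" "tgt c = ?X \<star> ?Y" "arr d" "src d = ?X \<star> ?Y" "tgt d = ?Y \<star> ?X"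
    and dc: "d \<cdot> c = Id A (?Y \<star> ?X)" "c \<cdot> d = Id A (?X \<star> ?Y)"
    by (simp_all add: c_def d_def)
  have ip: "inverse_pair A (?Y \<star> ?X) (?X \<star> ?Y) c d"
    unfolding c_def d_def by (rule is_iso_inverse_pair[OF braid_iso]) simp_all
  have c1: "central (right_braid (Uo T) (Uo V)) (Uo (left_braid V T)) c" and c2: "central (left_braid (Uo T) (Uo V)) (Uo (right_braid V T)) c"
    using central_braid_U[OF assms(1,2)] by (simp_all add: c_def)
  have d1: "central (Uo (left_braid V T)) (right_braid (Uo T) (Uo V)) d" and d2: "central (Uo (right_braid V T)) (left_braid (Uo T) (Uo V)) d"
    by (rule central_inverse[OF c1], simp add: ip, rule central_inverse[OF c2], simp add: ip)
  note q = Q_central[OF assms(1,2)] and q' = Q_central[OF Uo_ZO[OF assms(2)] Uo_ZO[OF assms(1)]]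
  \<comment> \<open>Absorption on the left shows that \<open>?e\<close> fixes the image of \<open>?e'\<close> under the braiding; the mirrored argument below gives the converse.\<close>
  have "?e \<cdot> (c \<cdot> ?e' \<cdot> d) = c \<cdot> ?e' \<cdot> d"
  proof (rule Q_absorb)
    show "central (left_braid V T) (left_braid V T) (c \<cdot> ?e' \<cdot> d)" "central (left_braid V T) (right_braid V T) (c \<cdot> ?e' \<cdot> d)"
      by (rule central_U_D[OF central_comp[OF central_comp[OF d1 q'(2)] c1]], simp, simp)
        (rule central_U_D[OF central_comp[OF central_comp[OF d1 q'(3)] c2]], simp, simp)
  qed simp_all
  from arg_cong[OF this, of "\<lambda>x. x \<cdot> c"] have a: "?e \<cdot> c \<cdot> ?e' = c \<cdot> ?e'" by (simp add: dc)
  have "(d \<cdot> ?e \<cdot> c) \<cdot> ?e' = d \<cdot> ?e \<cdot> c"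
  proof (rule Q_coabsorb)
    show "central (left_braid (Uo T) (Uo V)) (left_braid (Uo T) (Uo V)) (d \<cdot> ?e \<cdot> c)"
      using central_comp[OF central_comp[OF c2 central_U[OF q(2)]] d2] by simp
    show "central (right_braid (Uo T) (Uo V)) (left_braid (Uo T) (Uo V)) (d \<cdot> ?e \<cdot> c)"
      using central_comp[OF central_comp[OF c1 central_U[OF q(4)]] d2] by simp
  qed simp_all
  from arg_cong[OF this, of "\<lambda>x. c \<cdot> x"] have b: "?e \<cdot> c \<cdot> ?e' = ?e \<cdot> c" by (simp add: comp_assoc_eq[OF dc(2)])
  show ?thesis using a b by simp
qed

text \<open>
  The tensor structure of \<open>U\<close>: the braiding, restricted to the images.
\<close>

definition J :: "('o, 'm) centre_obj \<Rightarrow> ('o, 'm) centre_obj \<Rightarrow> 'm" where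
  "J V T = rp V T \<cdot> Braid A (fst T) (fst V) \<cdot> ri (Uo T) (Uo V)"

lemma J_typing [simp]:
  assumes [simp]: "V \<in> ZO" "T \<in> ZO"
  shows "arr (J V T)" "src (J V T) = fst (RO (Uo T) (Uo V))" "tgt (J V T) = fst (RO V T)"
  by (simp_all add: J_def)

lemma red_absorb:
  assumes [simp]: "V \<in> ZO" "T \<in> ZO"
  shows "arr t \<Longrightarrow> tgt t = fst (RO V T) \<Longrightarrow> rp V T \<cdot> (ri V T \<cdot> t) = t"
    "arr t \<Longrightarrow> tgt t = fst V \<star> fst T \<Longrightarrow> ri V T \<cdot> (rp V T \<cdot> t) = Q A I V T \<cdot> t"
    "Q A I V T \<cdot> ri V T = ri V T" "rp V T \<cdot> Q A I V T = rp V T"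
    "arr t \<Longrightarrow> tgt t = fst (RO V T) \<Longrightarrow> Q A I V T \<cdot> (ri V T \<cdot> t) = ri V T \<cdot> t"
    "arr t \<Longrightarrow> tgt t = fst V \<star> fst T \<Longrightarrow> rp V T \<cdot> (Q A I V T \<cdot> t) = rp V T \<cdot> t"
proof -
  show a: "\<And>t. arr t \<Longrightarrow> tgt t = fst (RO V T) \<Longrightarrow> rp V T \<cdot> (ri V T \<cdot> t) = t"
    using comp_assoc_eq[OF red(6)[OF assms]] by simp
  show b: "\<And>t. arr t \<Longrightarrow> tgt t = fst V \<star> fst T \<Longrightarrow> ri V T \<cdot> (rp V T \<cdot> t) = Q A I V T \<cdot> t"
    using comp_assoc_eq[OF red(7)[OF assms]] by simp
  show c: "Q A I V T \<cdot> ri V T = ri V T" using b[of "ri V T"] by (simp add: red)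
  show d: "rp V T \<cdot> Q A I V T = rp V T" using a[of "rp V T"] by (simp add: red)
  show "arr t \<Longrightarrow> tgt t = fst (RO V T) \<Longrightarrow> Q A I V T \<cdot> (ri V T \<cdot> t) = ri V T \<cdot> t" using comp_assoc_eq[OF c] by simp
  show "arr t \<Longrightarrow> tgt t = fst V \<star> fst T \<Longrightarrow> rp V T \<cdot> (Q A I V T \<cdot> t) = rp V T \<cdot> t" using comp_assoc_eq[OF d] by simp
qed

lemma red_braid:
  assumes [simp]: "V \<in> ZO" "T \<in> ZO"
  shows "central (ovr (fst (RO V T))) (ovr (fst V \<star> fst T)) (ri V T)" "central (und (fst (RO V T))) (und (fst V \<star> fst T)) (ri V T)"
    "central (ovr (fst V \<star> fst T)) (ovr (fst (RO V T))) (rp V T)" "central (und (fst V \<star> fst T)) (und (fst (RO V T))) (rp V T)"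
  using central_braid[of "ri V T"] central_braid[of "rp V T"] by simp_all

lemma ri_mono:
  assumes [simp]: "V \<in> ZO" "T \<in> ZO" and t: "arr f" "arr g" "tgt f = fst (RO V T)" "tgt g = fst (RO V T)"
    and e: "ri V T \<cdot> f = ri V T \<cdot> g"
  shows "f = g"
  using arg_cong[OF e, of "\<lambda>s. rp V T \<cdot> s"] by (simp add: red_absorb t)

text \<open>
  No information is lost in the restriction, because the braiding intertwines the idempotents.
\<close>

lemma ri_J:
  assumes [simp]: "V \<in> ZO" "T \<in> ZO"
  shows "ri V T \<cdot> J V T = Braid A (fst T) (fst V) \<cdot> ri (Uo T) (Uo V)"
proof -
  let ?c = "Braid A (fst T) (fst V)"
  have "ri V T \<cdot> J V T = (Q A I V T \<cdot> ?c) \<cdot> ri (Uo T) (Uo V)" by (simp add: J_def red_absorb)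
  also have "\<dots> = ?c \<cdot> ri (Uo T) (Uo V)" unfolding Q_braid[OF assms] by (simp add: red_absorb)
  finally show ?thesis .
qed

lemma J_central:
  assumes [simp]: "V \<in> ZO" "T \<in> ZO"
  shows "central (RO (Uo T) (Uo V)) (Uo (RO V T)) (J V T)"
proof -
  have "central (right_braid (Uo T) (Uo V)) (Uo (left_braid V T)) (Braid A (fst T) (fst V))"
    using central_braid_U(1)[OF assms] by simp
  from central_comp[OF central_comp[OF red(3)[OF Uo_ZO[OF assms(2)] Uo_ZO[OF assms(1)]] this] central_U[OF red(4)[OF assms]]]
  show ?thesis by (simp add: J_def)
qed

lemma J_iso:
  assumes [simp]: "V \<in> ZO" "T \<in> ZO"
  shows "\<exists>K. inverse_pair A (fst (RO (Uo T) (Uo V))) (fst (RO V T)) (J V T) K"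
proof -
  let ?c = "Braid A (fst T) (fst V)" let ?d = "Braid_inv A (fst T) (fst V)"
  let ?K = "rp (Uo T) (Uo V) \<cdot> ?d \<cdot> ri V T"
  have dc: "?d \<cdot> ?c \<cdot> t = t" if "arr t" "tgt t = fst T \<star> fst V" for t
    using comp_assoc_eq[of ?d ?c _ t] that by simp
  have "?K \<cdot> J V T = rp (Uo T) (Uo V) \<cdot> ?d \<cdot> (ri V T \<cdot> J V T)" by simp
  also have "\<dots> = Id A (fst (RO (Uo T) (Uo V)))" unfolding ri_J[OF assms] by (simp add: dc red)
  finally have a: "?K \<cdot> J V T = Id A (fst (RO (Uo T) (Uo V)))" .
  have "ri V T \<cdot> (J V T \<cdot> ?K) = (ri V T \<cdot> J V T) \<cdot> ?K" by simp
  also have "\<dots> = ?c \<cdot> Q A I (Uo T) (Uo V) \<cdot> ?d \<cdot> ri V T" unfolding ri_J[OF assms] by (simp add: red_absorb)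
  also have "\<dots> = (?c \<cdot> Q A I (Uo T) (Uo V)) \<cdot> ?d \<cdot> ri V T" by simp
  also have "\<dots> = Q A I V T \<cdot> (?c \<cdot> ?d \<cdot> ri V T)" unfolding Q_braid[OF assms, symmetric] by simp
  also have "?c \<cdot> ?d \<cdot> ri V T = ri V T" using comp_assoc_eq[of ?c ?d _ "ri V T"] by simp
  finally have "ri V T \<cdot> (J V T \<cdot> ?K) = ri V T \<cdot> Id A (fst (RO V T))" by (simp add: red_absorb centralD(1)[OF red(2)] red(1))
  then have b: "J V T \<cdot> ?K = Id A (fst (RO V T))" by (rule ri_mono[rotated -1]) (simp_all add: red(1))
  show ?thesis by (rule exI[of _ ?K], rule inverse_pairI) (simp_all add: a b red(1))
qed

text \<open>
  The tensor product of central morphisms maps image to image, again by absorption.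
\<close>

lemma ri_red_mor:
  assumes f: "central V V' f" and g: "central T T' g"
  shows "ri V' T' \<cdot> (rp V' T' \<cdot> (f \<boxtimes> g) \<cdot> ri V T) = (f \<boxtimes> g) \<cdot> ri V T"
proof -
  note [simp] = centralD(1-5)[OF f] centralD(1-5)[OF g]
  have "central (RO V T) (left_braid V' T') ((f \<boxtimes> g) \<cdot> ri V T)"
    using central_comp[OF red(2) central_ten[OF f central_braid(2)[of g, unfolded centralD(4,5)[OF g]]]] by simp
  moreover have "central (RO V T) (right_braid V' T') ((f \<boxtimes> g) \<cdot> ri V T)"
    using central_comp[OF red(3) central_ten[OF central_braid(1)[of f, unfolded centralD(4,5)[OF f]] g]] by simp
  ultimately have "Q A I V' T' \<cdot> ((f \<boxtimes> g) \<cdot> ri V T) = (f \<boxtimes> g) \<cdot> ri V T" by (intro Q_absorb) simp_all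
  then show ?thesis by (simp add: red_absorb)
qed

lemma J_natural:
  assumes f: "central V V' f" and g: "central T T' g"
  shows "J V' T' \<cdot> (rp (Uo T') (Uo V') \<cdot> (g \<boxtimes> f) \<cdot> ri (Uo T) (Uo V)) = (rp V' T' \<cdot> (f \<boxtimes> g) \<cdot> ri V T) \<cdot> J V T"
proof -
  note [simp] = centralD(1-5)[OF f] centralD(1-5)[OF g]
  let ?R = "rp (Uo T') (Uo V') \<cdot> (g \<boxtimes> f) \<cdot> ri (Uo T) (Uo V)"
  let ?S = "rp V' T' \<cdot> (f \<boxtimes> g) \<cdot> ri V T"
  have n: "Braid A (fst T') (fst V') \<cdot> (g \<boxtimes> f) = (f \<boxtimes> g) \<cdot> Braid A (fst T) (fst V)"
    using braid_natural[of "fst T" "fst T'" "fst V" "fst V'" g f] arr_Mor[of f] arr_Mor[of g] by simp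
  have "ri V' T' \<cdot> (J V' T' \<cdot> ?R) = (ri V' T' \<cdot> J V' T') \<cdot> ?R" by simp
  also have "\<dots> = Braid A (fst T') (fst V') \<cdot> (ri (Uo T') (Uo V') \<cdot> ?R)" unfolding ri_J[OF centralD(2)[OF f] centralD(2)[OF g]] by simp
  also have "\<dots> = (Braid A (fst T') (fst V') \<cdot> (g \<boxtimes> f)) \<cdot> ri (Uo T) (Uo V)" unfolding ri_red_mor[OF central_U[OF g] central_U[OF f]] by simp
  also have "\<dots> = (f \<boxtimes> g) \<cdot> (Braid A (fst T) (fst V) \<cdot> ri (Uo T) (Uo V))" unfolding n by simp
  also have "\<dots> = ((f \<boxtimes> g) \<cdot> ri V T) \<cdot> J V T" unfolding ri_J[OF centralD(1)[OF f] centralD(1)[OF g], symmetric] by simp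
  also have "\<dots> = (ri V' T' \<cdot> ?S) \<cdot> J V T" unfolding ri_red_mor[OF f g] ..
  also have "\<dots> = ri V' T' \<cdot> (?S \<cdot> J V T)" by (rule arr_comp_assoc) simp_all
  finally show ?thesis by (rule ri_mono[rotated -1]) simp_all
qed

text \<open>
  Inclusions of the two threefold reduced tensor products into the threefold tensor products, and the corresponding projections.
\<close>

definition I1 :: "('o, 'm) centre_obj \<Rightarrow> ('o, 'm) centre_obj \<Rightarrow> ('o, 'm) centre_obj \<Rightarrow> 'm" where
  "I1 V M T = (ri V M \<boxtimes> Id A (fst T)) \<cdot> ri (RO V M) T"
definition P1 :: "('o, 'm) centre_obj \<Rightarrow> ('o, 'm) centre_obj \<Rightarrow> ('o, 'm) centre_obj \<Rightarrow> 'm" where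
  "P1 V M T = rp (RO V M) T \<cdot> (rp V M \<boxtimes> Id A (fst T))"
definition I2 :: "('o, 'm) centre_obj \<Rightarrow> ('o, 'm) centre_obj \<Rightarrow> ('o, 'm) centre_obj \<Rightarrow> 'm" where
  "I2 V M T = (Id A (fst V) \<boxtimes> ri M T) \<cdot> ri V (RO M T)"
definition P2 :: "('o, 'm) centre_obj \<Rightarrow> ('o, 'm) centre_obj \<Rightarrow> ('o, 'm) centre_obj \<Rightarrow> 'm" where
  "P2 V M T = rp V (RO M T) \<cdot> (Id A (fst V) \<boxtimes> rp M T)"

context
  fixes V M T
  assumes ZO3 [simp]: "V \<in> ZO" "M \<in> ZO" "T \<in> ZO"
begin

lemma IP_typing [simp]:
  "arr (I1 V M T)" "src (I1 V M T) = fst (RO (RO V M) T)" "tgt (I1 V M T) = (fst V \<star> fst M) \<star> fst T"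
  "arr (P1 V M T)" "tgt (P1 V M T) = fst (RO (RO V M) T)" "src (P1 V M T) = (fst V \<star> fst M) \<star> fst T"
  "arr (I2 V M T)" "src (I2 V M T) = fst (RO V (RO M T))" "tgt (I2 V M T) = fst V \<star> (fst M \<star> fst T)"
  "arr (P2 V M T)" "tgt (P2 V M T) = fst (RO V (RO M T))" "src (P2 V M T) = fst V \<star> (fst M \<star> fst T)"
  by (simp_all add: I1_def P1_def I2_def P2_def red(1))

lemma P1_I1: "P1 V M T \<cdot> I1 V M T = Id A (fst (RO (RO V M) T))"
proof -
  have "P1 V M T \<cdot> I1 V M T = rp (RO V M) T \<cdot> (((rp V M \<cdot> ri V M) \<boxtimes> Id A (fst T)) \<cdot> ri (RO V M) T)"
    by (simp add: P1_def I1_def red(1) ten_comp_right)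
  then show ?thesis by (simp add: red ten_id)
qed

lemma P2_I2: "P2 V M T \<cdot> I2 V M T = Id A (fst (RO V (RO M T)))"
proof -
  have "P2 V M T \<cdot> I2 V M T = rp V (RO M T) \<cdot> ((Id A (fst V) \<boxtimes> (rp M T \<cdot> ri M T)) \<cdot> ri V (RO M T))"
    by (simp add: P2_def I2_def red(1) ten_comp_left)
  then show ?thesis by (simp add: red ten_id)
qed

lemma I1_central:
  "central (RO (RO V M) T) (tens (tens V (und (fst M))) (und (fst T))) (I1 V M T)"
  "central (RO (RO V M) T) (tens (tens (ovr (fst V)) M) (und (fst T))) (I1 V M T)"
  "central (RO (RO V M) T) (tens (tens (ovr (fst V)) (ovr (fst M))) T) (I1 V M T)"
  using central_comp[OF red(2)[of "RO V M" T] central_ten[OF red(2)[of V M] central_Id[of "und (fst T)"]]]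
    central_comp[OF red(2)[of "RO V M" T] central_ten[OF red(3)[of V M] central_Id[of "und (fst T)"]]]
    central_comp[OF red(3)[of "RO V M" T] central_ten[OF red_braid(1)[of V M] central_Id[of T]]]
  by (simp_all add: I1_def red(1) und tens_ovr)

lemma I2_central:
  "central (RO V (RO M T)) (tens V (tens (und (fst M)) (und (fst T)))) (I2 V M T)"
  "central (RO V (RO M T)) (tens (ovr (fst V)) (tens M (und (fst T)))) (I2 V M T)"
  "central (RO V (RO M T)) (tens (ovr (fst V)) (tens (ovr (fst M)) T)) (I2 V M T)"
  using central_comp[OF red(2)[of V "RO M T"] central_ten[OF central_Id[of V] red_braid(2)[of M T]]]
    central_comp[OF red(3)[of V "RO M T"] central_ten[OF central_Id[of "ovr (fst V)"] red(2)[of M T]]]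
    central_comp[OF red(3)[of V "RO M T"] central_ten[OF central_Id[of "ovr (fst V)"] red(3)[of M T]]]
  by (simp_all add: I2_def red(1) ovr tens_ovr)

text \<open>
  The image of \<open>I1\<close> is the universal place where three half-braidings on \<open>(X \<star> Y) \<star> Z\<close> agree: the first two are needed to
  factor through the inner image, and then the first and the third to factor through the outer one.
\<close>

lemma I1_P1_absorb:
  assumes c1: "central S (tens (tens V (und (fst M))) (und (fst T))) g"
    and c2: "central S (tens (tens (ovr (fst V)) M) (und (fst T))) g"
    and c3: "central S (tens (tens (ovr (fst V)) (ovr (fst M))) T) g"
  shows "I1 V M T \<cdot> P1 V M T \<cdot> g = g"
proof -
  have [simp]: "arr g" "tgt g = (fst V \<star> fst M) \<star> fst T" using centralD(3,5)[OF c1] by simp_all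
  let ?h = "(rp V M \<boxtimes> Id A (fst T)) \<cdot> g"
  \<comment> \<open>The inner idempotent is the sum of loops around the first two factors.\<close>
  have q: "(Q A I V M \<boxtimes> Id A (fst T)) \<cdot> g = g"
    using kirby_loop_absorb[OF c1 c2] kirby_loop_tens(2)[of "left_braid V M" "right_braid V M" "und (fst T)"] by (simp add: Q_eq_kirby_loop und)
  have "central S (left_braid (RO V M) T) ?h"
    using central_comp[OF c1 central_ten[OF red(4)[of V M] central_Id[of "und (fst T)"]]] by (simp add: und)
  moreover have "central S (right_braid (RO V M) T) ?h"
    using central_comp[OF c3[unfolded tens_ovr(1)[OF ZO_fst[OF ZO3(1)] ZO_fst[OF ZO3(2)]]] central_ten[OF red_braid(3)[OF ZO3(1,2)] central_Id[of T]]] by simp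
  ultimately have h: "Q A I (RO V M) T \<cdot> ?h = ?h" by (intro Q_absorb) (simp_all add: red(1))
  have "I1 V M T \<cdot> P1 V M T \<cdot> g = (ri V M \<boxtimes> Id A (fst T)) \<cdot> (Q A I (RO V M) T \<cdot> ?h)"
    by (simp add: I1_def P1_def red(1) red_absorb)
  also have "\<dots> = ((ri V M \<cdot> rp V M) \<boxtimes> Id A (fst T)) \<cdot> g" unfolding h by (simp add: ten_comp_right red(1))
  also have "\<dots> = g" by (simp add: red q)
  finally show ?thesis .
qed

lemma I2_P2_absorb:
  assumes c1: "central S (tens V (tens (und (fst M)) (und (fst T)))) g"
    and c2: "central S (tens (ovr (fst V)) (tens M (und (fst T)))) g"
    and c3: "central S (tens (ovr (fst V)) (tens (ovr (fst M)) T)) g"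
  shows "I2 V M T \<cdot> P2 V M T \<cdot> g = g"
proof -
  have [simp]: "arr g" "tgt g = fst V \<star> (fst M \<star> fst T)" using centralD(3,5)[OF c1] by simp_all
  let ?h = "(Id A (fst V) \<boxtimes> rp M T) \<cdot> g"
  \<comment> \<open>The inner idempotent is the sum of loops around the last two factors.\<close>
  have q: "(Id A (fst V) \<boxtimes> Q A I M T) \<cdot> g = g"
    using kirby_loop_absorb[OF c2 c3] kirby_loop_tens(1)[of "left_braid M T" "right_braid M T" "ovr (fst V)"] by (simp add: Q_eq_kirby_loop ovr)
  have "central S (left_braid V (RO M T)) ?h"
    using central_comp[OF c1[unfolded tens_ovr(2)[OF ZO_fst[OF ZO3(2)] ZO_fst[OF ZO3(3)]]] central_ten[OF central_Id[of V] red_braid(4)[OF ZO3(2,3)]]] by simp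
  moreover have "central S (right_braid V (RO M T)) ?h"
    using central_comp[OF c2 central_ten[OF central_Id[of "ovr (fst V)"] red(4)[of M T]]] by (simp add: ovr)
  ultimately have h: "Q A I V (RO M T) \<cdot> ?h = ?h" by (intro Q_absorb) (simp_all add: red(1))
  have "I2 V M T \<cdot> P2 V M T \<cdot> g = (Id A (fst V) \<boxtimes> ri M T) \<cdot> (Q A I V (RO M T) \<cdot> ?h)"
    by (simp add: I2_def P2_def red(1) red_absorb)
  also have "\<dots> = (Id A (fst V) \<boxtimes> (ri M T \<cdot> rp M T)) \<cdot> g" unfolding h by (simp add: ten_comp_left red(1))
  also have "\<dots> = g" by (simp add: red q)
  finally show ?thesis .
qed

end

text \<open>
  The associator of the reduced tensor product and its inverse.
\<close>

definition assoc_map :: "('o, 'm) centre_obj \<Rightarrow> ('o, 'm) centre_obj \<Rightarrow> ('o, 'm) centre_obj \<Rightarrow> 'm" where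
  "assoc_map V M T = P2 V M T \<cdot> Assoc A (fst V) (fst M) (fst T) \<cdot> I1 V M T"

definition assoc_map_inv :: "('o, 'm) centre_obj \<Rightarrow> ('o, 'm) centre_obj \<Rightarrow> ('o, 'm) centre_obj \<Rightarrow> 'm" where
  "assoc_map_inv V M T = P1 V M T \<cdot> Assoc_inv A (fst V) (fst M) (fst T) \<cdot> I2 V M T"

context
  fixes V M T
  assumes ZO3 [simp]: "V \<in> ZO" "M \<in> ZO" "T \<in> ZO"
begin

lemma assoc_map_typing [simp]:
  "arr (assoc_map V M T)" "src (assoc_map V M T) = fst (RO (RO V M) T)" "tgt (assoc_map V M T) = fst (RO V (RO M T))"
  "arr (assoc_map_inv V M T)" "tgt (assoc_map_inv V M T) = fst (RO (RO V M) T)" "src (assoc_map_inv V M T) = fst (RO V (RO M T))"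
  by (simp_all add: assoc_map_def assoc_map_inv_def)

text \<open>
  Composed with the inclusions, the restricted associator is the associator.
\<close>

lemma I2_assoc_map: "I2 V M T \<cdot> assoc_map V M T = Assoc A (fst V) (fst M) (fst T) \<cdot> I1 V M T"
  unfolding assoc_map_def
  by (rule I2_P2_absorb[OF ZO3])
    (use central_comp[OF I1_central(1)[OF ZO3] central_Assoc] central_comp[OF I1_central(2)[OF ZO3] central_Assoc] central_comp[OF I1_central(3)[OF ZO3] central_Assoc] in \<open>simp_all add: und ovr\<close>)

lemma central_Assoc_inv:
  assumes [simp]: "R \<in> ZO" "R' \<in> ZO" "R'' \<in> ZO" "fst R = fst V" "fst R' = fst M" "fst R'' = fst T"
  shows "central (tens R (tens R' R'')) (tens (tens R R') R'') (Assoc_inv A (fst V) (fst M) (fst T))"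
  using central_inverse[OF central_Assoc[of R R' R''], of "Assoc_inv A (fst V) (fst M) (fst T)"]
    is_iso_inverse_pair[OF assoc_iso, of "fst V" "fst M" "fst T"] by simp

lemma I1_assoc_map_inv: "I1 V M T \<cdot> assoc_map_inv V M T = Assoc_inv A (fst V) (fst M) (fst T) \<cdot> I2 V M T"
  unfolding assoc_map_inv_def
  by (rule I1_P1_absorb[OF ZO3];
    rule central_comp[OF I2_central(1)[OF ZO3] central_Assoc_inv] central_comp[OF I2_central(2)[OF ZO3] central_Assoc_inv] central_comp[OF I2_central(3)[OF ZO3] central_Assoc_inv];
    simp add: und ovr)

lemma assoc_map_inverse_pair: "inverse_pair A (fst (RO (RO V M) T)) (fst (RO V (RO M T))) (assoc_map V M T) (assoc_map_inv V M T)"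
proof -
  let ?a = "Assoc A (fst V) (fst M) (fst T)" let ?a' = "Assoc_inv A (fst V) (fst M) (fst T)"
  have aa: "?a' \<cdot> ?a \<cdot> t = t" if "arr t" "tgt t = (fst V \<star> fst M) \<star> fst T" for t
    using comp_assoc_eq[of ?a' ?a _ t] that by simp
  have aa': "?a \<cdot> ?a' \<cdot> t = t" if "arr t" "tgt t = fst V \<star> (fst M \<star> fst T)" for t
    using comp_assoc_eq[of ?a ?a' _ t] that by simp
  have "assoc_map_inv V M T \<cdot> assoc_map V M T = P1 V M T \<cdot> ?a' \<cdot> (I2 V M T \<cdot> assoc_map V M T)" by (simp add: assoc_map_inv_def)
  also have "\<dots> = Id A (fst (RO (RO V M) T))" unfolding I2_assoc_map by (simp add: aa P1_I1)
  finally have 1: "assoc_map_inv V M T \<cdot> assoc_map V M T = Id A (fst (RO (RO V M) T))" .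
  have "assoc_map V M T \<cdot> assoc_map_inv V M T = P2 V M T \<cdot> ?a \<cdot> (I1 V M T \<cdot> assoc_map_inv V M T)" by (simp add: assoc_map_def)
  also have "\<dots> = Id A (fst (RO V (RO M T)))" unfolding I1_assoc_map_inv by (simp add: aa' P2_I2)
  finally have 2: "assoc_map V M T \<cdot> assoc_map_inv V M T = Id A (fst (RO V (RO M T)))" .
  show ?thesis by (rule inverse_pairI) (simp_all add: 1 2 red(1))
qed

lemma assoc_map_central: "central (RO (RO V M) T) (RO V (RO M T)) (assoc_map V M T)"
proof -
  have "central (tens V (tens (und (fst M)) (und (fst T)))) (RO V (RO M T)) (P2 V M T)"
    using central_comp[OF central_ten[OF central_Id[of V] red_braid(4)[OF ZO3(2,3)]] red(4)[of V "RO M T", simplified]]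
    by (simp add: P2_def tens_ovr red(1))
  from central_comp[OF central_comp[OF I1_central(1)[OF ZO3] central_Assoc] this[folded fst_ovr]]
  show ?thesis by (simp add: assoc_map_def und)
qed

end

text \<open>
  Since inclusions are monomorphisms, it is enough to compare after composing with \<open>I2\<close>.  There every \<open>J\<close> becomes a
  braiding, and what remains is \<open>braid_assoc\<close>.  The associator of the opposite tensor product is the inverse map.
\<close>

lemma J_hexagon:
  assumes ZO3 [simp]: "V \<in> ZO" "M \<in> ZO" "T \<in> ZO"
  shows
  "assoc_map V M T \<cdot> J (RO V M) T \<cdot> (rp (Uo T) (Uo (RO V M)) \<cdot> (Id A (fst T) \<boxtimes> J V M) \<cdot> ri (Uo T) (RO (Uo M) (Uo V)))
   = J V (RO M T) \<cdot> (rp (Uo (RO M T)) (Uo V) \<cdot> (J M T \<boxtimes> Id A (fst V)) \<cdot> ri (RO (Uo T) (Uo M)) (Uo V)) \<cdot> assoc_map_inv (Uo T) (Uo M) (Uo V)"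
  (is "?L = ?R")
proof -
  let ?X = "fst V" let ?Y = "fst M" let ?Z = "fst T"
  note [simp] = red(1)
  let ?VW = "RO V M" let ?WT = "RO M T" let ?WV' = "RO (Uo M) (Uo V)" let ?TW' = "RO (Uo T) (Uo M)"
  let ?S = "rp (Uo T) (Uo ?VW) \<cdot> (Id A ?Z \<boxtimes> J V M) \<cdot> ri (Uo T) ?WV'"
  let ?S' = "rp (Uo ?WT) (Uo V) \<cdot> (J M T \<boxtimes> Id A ?X) \<cdot> ri ?TW' (Uo V)"
  let ?a = "Assoc A ?X ?Y ?Z"
  have sl: "ri (Uo T) (Uo ?VW) \<cdot> ?S = (Id A ?Z \<boxtimes> J V M) \<cdot> ri (Uo T) ?WV'"
    using ri_red_mor[OF central_Id[of "Uo T"] J_central[of V M]] by simp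
  have sr: "ri (Uo ?WT) (Uo V) \<cdot> ?S' = (J M T \<boxtimes> Id A ?X) \<cdot> ri ?TW' (Uo V)"
    using ri_red_mor[OF J_central[of M T] central_Id[of "Uo V"]] by simp
  have n1: "(ri V M \<boxtimes> Id A ?Z) \<cdot> Braid A ?Z (fst ?VW) = Braid A ?Z (?X \<star> ?Y) \<cdot> (Id A ?Z \<boxtimes> ri V M)"
    using braid_natural[of ?Z ?Z "fst ?VW" "?X \<star> ?Y" "Id A ?Z" "ri V M"] arr_Mor[of "ri V M"] id_closed[of ?Z] by simp
  have n2: "(Id A ?X \<boxtimes> ri M T) \<cdot> Braid A (fst ?WT) ?X = Braid A (?Y \<star> ?Z) ?X \<cdot> (ri M T \<boxtimes> Id A ?X)"
    using braid_natural[of "fst ?WT" "?Y \<star> ?Z" ?X ?X "ri M T" "Id A ?X"] arr_Mor[of "ri M T"] id_closed[of ?X] by simp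
  have "I2 V M T \<cdot> ?L = (I2 V M T \<cdot> assoc_map V M T) \<cdot> J ?VW T \<cdot> ?S" by simp
  also have "\<dots> = ?a \<cdot> (ri V M \<boxtimes> Id A ?Z) \<cdot> (ri ?VW T \<cdot> J ?VW T) \<cdot> ?S" unfolding I2_assoc_map[OF ZO3] by (simp add: I1_def)
  also have "\<dots> = ?a \<cdot> ((ri V M \<boxtimes> Id A ?Z) \<cdot> Braid A ?Z (fst ?VW)) \<cdot> (ri (Uo T) (Uo ?VW) \<cdot> ?S)"
    by (subst ri_J) simp_all
  also have "\<dots> = ?a \<cdot> Braid A ?Z (?X \<star> ?Y) \<cdot> ((Id A ?Z \<boxtimes> ri V M) \<cdot> (Id A ?Z \<boxtimes> J V M)) \<cdot> ri (Uo T) ?WV'"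
    unfolding n1 sl by simp
  also have "(Id A ?Z \<boxtimes> ri V M) \<cdot> (Id A ?Z \<boxtimes> J V M) = Id A ?Z \<boxtimes> (ri V M \<cdot> J V M)" by (simp add: ten_comp_left)
  also have "\<dots> = (Id A ?Z \<boxtimes> Braid A ?Y ?X) \<cdot> (Id A ?Z \<boxtimes> ri (Uo M) (Uo V))" by (subst ri_J) (simp_all add: ten_comp_left)
  also have "?a \<cdot> Braid A ?Z (?X \<star> ?Y) \<cdot> ((Id A ?Z \<boxtimes> Braid A ?Y ?X) \<cdot> (Id A ?Z \<boxtimes> ri (Uo M) (Uo V))) \<cdot> ri (Uo T) ?WV'
    = (?a \<cdot> Braid A ?Z (?X \<star> ?Y) \<cdot> (Id A ?Z \<boxtimes> Braid A ?Y ?X)) \<cdot> I2 (Uo T) (Uo M) (Uo V)" by (simp add: I2_def)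
  also have "\<dots> = Braid A (?Y \<star> ?Z) ?X \<cdot> (Braid A ?Z ?Y \<boxtimes> Id A ?X) \<cdot> (Assoc_inv A ?Z ?Y ?X \<cdot> I2 (Uo T) (Uo M) (Uo V))"
    by (subst braid_assoc) simp_all
  finally have L: "I2 V M T \<cdot> ?L = Braid A (?Y \<star> ?Z) ?X \<cdot> (Braid A ?Z ?Y \<boxtimes> Id A ?X) \<cdot> (Assoc_inv A ?Z ?Y ?X \<cdot> I2 (Uo T) (Uo M) (Uo V))" .
  have "I2 V M T \<cdot> ?R = (Id A ?X \<boxtimes> ri M T) \<cdot> (ri V ?WT \<cdot> J V ?WT) \<cdot> ?S' \<cdot> assoc_map_inv (Uo T) (Uo M) (Uo V)" by (simp add: I2_def)
  also have "\<dots> = ((Id A ?X \<boxtimes> ri M T) \<cdot> Braid A (fst ?WT) ?X) \<cdot> (ri (Uo ?WT) (Uo V) \<cdot> ?S') \<cdot> assoc_map_inv (Uo T) (Uo M) (Uo V)"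
    by (subst ri_J) simp_all
  also have "\<dots> = Braid A (?Y \<star> ?Z) ?X \<cdot> ((ri M T \<boxtimes> Id A ?X) \<cdot> (J M T \<boxtimes> Id A ?X)) \<cdot> ri ?TW' (Uo V) \<cdot> assoc_map_inv (Uo T) (Uo M) (Uo V)"
    unfolding n2 sr by simp
  also have "(ri M T \<boxtimes> Id A ?X) \<cdot> (J M T \<boxtimes> Id A ?X) = (ri M T \<cdot> J M T) \<boxtimes> Id A ?X" by (simp add: ten_comp_right)
  also have "\<dots> = (Braid A ?Z ?Y \<boxtimes> Id A ?X) \<cdot> (ri (Uo T) (Uo M) \<boxtimes> Id A ?X)" by (subst ri_J) (simp_all add: ten_comp_right)
  also have "Braid A (?Y \<star> ?Z) ?X \<cdot> ((Braid A ?Z ?Y \<boxtimes> Id A ?X) \<cdot> (ri (Uo T) (Uo M) \<boxtimes> Id A ?X)) \<cdot> ri ?TW' (Uo V) \<cdot> assoc_map_inv (Uo T) (Uo M) (Uo V)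
    = Braid A (?Y \<star> ?Z) ?X \<cdot> (Braid A ?Z ?Y \<boxtimes> Id A ?X) \<cdot> (I1 (Uo T) (Uo M) (Uo V) \<cdot> assoc_map_inv (Uo T) (Uo M) (Uo V))" by (simp add: I1_def)
  also have "I1 (Uo T) (Uo M) (Uo V) \<cdot> assoc_map_inv (Uo T) (Uo M) (Uo V) = Assoc_inv A ?Z ?Y ?X \<cdot> I2 (Uo T) (Uo M) (Uo V)"
    using I1_assoc_map_inv[of "Uo T" "Uo M" "Uo V"] by simp
  finally have "I2 V M T \<cdot> ?L = I2 V M T \<cdot> ?R" unfolding L ..
  from arg_cong[OF this, of "\<lambda>s. P2 V M T \<cdot> s"] show ?thesis
    by (simp add: comp_assoc_eq[OF P2_I2[OF ZO3]])
qed

end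

section \<open>The centre and the inverse twist\<close>

context monoidal_linear_category begin

lemma centre_simps [simp]: "Hom (centre A) = centre_hom A" "Id (centre A) V = (V, Id A (fst V), V)"
  "Comp (centre A) (V', g, T) (V, f, T') = (V, g \<cdot> f, T)"
  by (simp_all add: centre_def)

lemma Mor_centre_iff: "V \<in> ZO \<Longrightarrow> T \<in> ZO \<Longrightarrow> F \<in> carrier (centre_hom A V T) \<longleftrightarrow> (\<exists>f. F = (V, f, T) \<and> central V T f)"
proof -
  assume z: "V \<in> ZO" "T \<in> ZO"
  have m: "f \<in> Mor A (fst V) (fst T) \<longleftrightarrow> arr f \<and> src f = fst V \<and> tgt f = fst T" for f
    by (rule Mor_iff) (simp_all add: z)
  show ?thesis by (auto simp: centre_hom_def central_def m z case_prod_beta)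
qed

lemma Mor_centreE:
  assumes "F \<in> carrier (centre_hom A V T)" "V \<in> ZO" "T \<in> ZO"
  obtains f where "F = (V, f, T)" "central V T f"
  using assms Mor_centre_iff by blast

lemma Mor_centreI: "central V T f \<Longrightarrow> (V, f, T) \<in> carrier (centre_hom A V T)"
  by (simp add: Mor_centre_iff centralD)

lemma centre_inverse_pair:
  assumes c: "central V T f" and i: "inverse_pair A (fst V) (fst T) f g"
  shows "inverse_pair (centre A) V T (V, f, T) (T, g, V)"
proof -
  have "g \<cdot> f = Id A (fst V)" "f \<cdot> g = Id A (fst T)" using i unfolding inverse_pair_def by auto
  then show ?thesis
    by (simp add: inverse_pair_def Mor_centreI c centralD(1,2)[OF c] central_inverse[OF c i])
qed

lemma centre_iso: "central V T f \<Longrightarrow> inverse_pair A (fst V) (fst T) f g \<Longrightarrow> is_iso (centre A) V T (V, f, T)"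
  unfolding is_iso_def by (blast intro: centre_inverse_pair)

text \<open>
  Inverses of central morphisms are central, so they may be computed in the underlying category.
\<close>

lemma centre_inv_mor:
  assumes c: "central V T f" and i: "inverse_pair A (fst V) (fst T) f g"
  shows "inv_mor (centre A) V T (V, f, T) = (T, g, V)"
  unfolding inv_mor_def
proof (rule the_equality)
  show "inverse_pair (centre A) V T (V, f, T) (T, g, V)" by (rule centre_inverse_pair[OF c i])
  fix G assume G: "inverse_pair (centre A) V T (V, f, T) G"
  note z = centralD(1,2)[OF c]
  have "G \<in> carrier (centre_hom A T V)" using G unfolding inverse_pair_def by simp
  then obtain h where h: "G = (T, h, V)" "central T V h" using z by (elim Mor_centreE) auto
  have e: "h \<cdot> f = Id A (fst V)" "f \<cdot> h = Id A (fst T)" using G unfolding inverse_pair_def h(1) by simp_all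
  have "inverse_pair A (fst V) (fst T) f h"
    by (rule inverse_pairI) (simp_all add: e centralD[OF c] centralD[OF h(2)])
  then show "G = (T, g, V)" using inverse_pair_unique[OF i] h(1) by simp
qed

end

context premodular_category begin

lemma Twist_inverse_pair: "X \<in> Obj A \<Longrightarrow> inverse_pair A X X (Twist A X) (inv_mor A X X (Twist A X))"
  by (rule is_iso_inverse_pair[OF twist_iso])

lemma Twist_facts [simp]:
  assumes "X \<in> Obj A"
  shows "arr (Twist A X)" "src (Twist A X) = X" "tgt (Twist A X) = X"
    "arr (inv_mor A X X (Twist A X))" "src (inv_mor A X X (Twist A X)) = X" "tgt (inv_mor A X X (Twist A X)) = X"
    "Twist A X \<cdot> inv_mor A X X (Twist A X) = Id A X" "inv_mor A X X (Twist A X) \<cdot> Twist A X = Id A X"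
  using iso_facts[OF twist_iso[OF assms]] by simp_all

lemma Twist_inv_natural:
  assumes [simp]: "arr f"
  shows "inv_mor A (tgt f) (tgt f) (Twist A (tgt f)) \<cdot> f = f \<cdot> inv_mor A (src f) (src f) (Twist A (src f))" (is "?t \<cdot> f = f \<cdot> ?s")
proof -
  let ?T = "Twist A (tgt f)" let ?S = "Twist A (src f)"
  have n: "?T \<cdot> f = f \<cdot> ?S" by (rule twist_natural[OF src_closed[OF assms] tgt_closed[OF assms] arr_Mor[OF assms]])
  have a: "f \<cdot> ?s = (?t \<cdot> ?T) \<cdot> (f \<cdot> ?s)" unfolding Twist_facts(8)[OF tgt_closed[OF assms]] by (rule arr_Id_left[symmetric]) simp_all
  have b: "(?t \<cdot> ?T) \<cdot> (f \<cdot> ?s) = ?t \<cdot> (?T \<cdot> (f \<cdot> ?s))" by (rule arr_comp_assoc) simp_all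
  have c: "?T \<cdot> (f \<cdot> ?s) = (f \<cdot> ?S) \<cdot> ?s" unfolding n[symmetric] by (rule arr_comp_assoc[symmetric]) simp_all
  have d: "(f \<cdot> ?S) \<cdot> ?s = f \<cdot> (?S \<cdot> ?s)" by (rule arr_comp_assoc) simp_all
  have e: "?S \<cdot> ?s = Id A (src f)" by (rule Twist_facts(7)[OF src_closed[OF assms]])
  have "f \<cdot> ?s = ?t \<cdot> ((f \<cdot> ?S) \<cdot> ?s)" by (rule trans[OF trans[OF a b]]) (rule arg_cong[OF c])
  also have "\<dots> = ?t \<cdot> f" unfolding d e by simp
  finally show ?thesis by (rule sym)
qed

lemma Twist_unit: "Twist A (Unit A) = Id A (Unit A)"
  by (rule hat_faithful) (use tw_unit in \<open>simp_all add: tw_def hat_Id\<close>)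

lemma central_Twist: "V \<in> ZO \<Longrightarrow> central V (Uo (Uo V)) (Twist A (fst V))"
  by (rule central_inverse[OF central_twist]) (simp_all add: inverse_pair_def id_closed Mor_iff)

lemma U_mor_eq: "V \<in> ZO \<Longrightarrow> T \<in> ZO \<Longrightarrow> U_mor A (V, f, T) = (Uo V, f, Uo T)"
  by (simp add: U_mor_def U_obj_eq)

lemma UU_obj_eq: "V \<in> ZO \<Longrightarrow> U_obj A (U_obj A V) = Uo (Uo V)"
  by (simp add: U_obj_eq Uo(1))

lemma twist_inverse_eq: "V \<in> ZO \<Longrightarrow> twist_inverse A V = (Uo (Uo V), inv_mor A (fst V) (fst V) (Twist A (fst V)), V)"
  by (simp add: twist_inverse_def UU_obj_eq)

lemma U_functor: "is_functor (centre A) (centre A) (U_obj A) (U_mor A)"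
  unfolding is_functor_def centre_simps
proof (intro conjI ballI)
  fix V assume V [simp]: "V \<in> ZO"
  show "U_obj A V \<in> ZO" by (simp add: U_obj_eq Uo(1))
  show "U_mor A (V, Id A (fst V), V) = (U_obj A V, Id A (fst (U_obj A V)), U_obj A V)" by (simp add: U_mor_eq U_obj_eq)
  fix T F assume T [simp]: "T \<in> ZO" and F: "F \<in> carrier (centre_hom A V T)"
  obtain f where f: "F = (V, f, T)" "central V T f" using Mor_centreE[OF F V T] .
  show "U_mor A F \<in> carrier (centre_hom A (U_obj A V) (U_obj A T))"
    unfolding f(1) U_mor_eq[OF V T] U_obj_eq[OF V] U_obj_eq[OF T] by (rule Mor_centreI[OF central_U[OF f(2)]])
next
  fix V T S F G assume z [simp]: "V \<in> ZO" "T \<in> ZO" "S \<in> ZO"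
    and F: "F \<in> carrier (centre_hom A V T)" and G: "G \<in> carrier (centre_hom A T S)"
  obtain f where f: "F = (V, f, T)" using Mor_centreE[OF F z(1,2)] .
  obtain g where g: "G = (T, g, S)" using Mor_centreE[OF G z(2,3)] .
  show "U_mor A (G \<cdot>\<^bsub>centre A\<^esub> F) = U_mor A G \<cdot>\<^bsub>centre A\<^esub> U_mor A F"
    by (simp add: f g U_mor_eq)
qed

lemma id_functor: "is_functor (centre A) (centre A) id id"
  unfolding is_functor_def centre_simps
proof (intro conjI ballI)
  fix V T S F G assume z [simp]: "V \<in> ZO" "T \<in> ZO" "S \<in> ZO"
    and F: "F \<in> carrier (centre_hom A V T)" and G: "G \<in> carrier (centre_hom A T S)"
  show "id (G \<cdot>\<^bsub>centre A\<^esub> F) = id G \<cdot>\<^bsub>centre A\<^esub> id F" by simp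
qed simp_all

lemma is_functor_comp: "is_functor B C Fo Fm \<Longrightarrow> is_functor C E Go Gm \<Longrightarrow> is_functor B E (Go \<circ> Fo) (Gm \<circ> Fm)"
proof -
  assume F: "is_functor B C Fo Fm" and G: "is_functor C E Go Gm"
  have o: "\<And>X. X \<in> Obj B \<Longrightarrow> Fo X \<in> Obj C"
    and m: "\<And>X Y f. X \<in> Obj B \<Longrightarrow> Y \<in> Obj B \<Longrightarrow> f \<in> Mor B X Y \<Longrightarrow> Fm f \<in> Mor C (Fo X) (Fo Y)"
    and c: "\<And>X Y Z f g. X \<in> Obj B \<Longrightarrow> Y \<in> Obj B \<Longrightarrow> Z \<in> Obj B \<Longrightarrow> f \<in> Mor B X Y \<Longrightarrow> g \<in> Mor B Y Z \<Longrightarrow> Fm (g \<cdot>\<^bsub>B\<^esub> f) = Fm g \<cdot>\<^bsub>C\<^esub> Fm f"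
    using F unfolding is_functor_def by blast+
  have c': "\<And>X Y Z f g. X \<in> Obj C \<Longrightarrow> Y \<in> Obj C \<Longrightarrow> Z \<in> Obj C \<Longrightarrow> f \<in> Mor C X Y \<Longrightarrow> g \<in> Mor C Y Z \<Longrightarrow> Gm (g \<cdot>\<^bsub>C\<^esub> f) = Gm g \<cdot>\<^bsub>E\<^esub> Gm f"
    using G unfolding is_functor_def by blast
  show ?thesis
    unfolding is_functor_def
  proof (intro conjI ballI)
    fix X Y Z f g assume h: "X \<in> Obj B" "Y \<in> Obj B" "Z \<in> Obj B" "f \<in> Mor B X Y" "g \<in> Mor B Y Z"
    show "(Gm \<circ> Fm) (g \<cdot>\<^bsub>B\<^esub> f) = (Gm \<circ> Fm) g \<cdot>\<^bsub>E\<^esub> (Gm \<circ> Fm) f"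
      unfolding o_apply c[OF h] by (rule c'[OF o[OF h(1)] o[OF h(2)] o[OF h(3)] m[OF h(1,2,4)] m[OF h(2,3,5)]])
  qed (use F G in \<open>simp_all add: is_functor_def\<close>)
qed

lemma UU_functor: "is_functor (centre A) (centre A) (U_obj A \<circ> U_obj A) (U_mor A \<circ> U_mor A)"
  by (rule is_functor_comp[OF U_functor U_functor])

lemma UU_mor_eq: "V \<in> ZO \<Longrightarrow> T \<in> ZO \<Longrightarrow> U_mor A (U_mor A (V, f, T)) = (Uo (Uo V), f, Uo (Uo T))"
  by (simp add: U_mor_eq Uo(1))

lemma twist_inverse_natural_isomorphism:
  "natural_isomorphism (centre A) (centre A) (U_obj A \<circ> U_obj A) (U_mor A \<circ> U_mor A) id id (twist_inverse A)"
  unfolding natural_isomorphism_def natural_transformation_def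
proof (intro conjI ballI UU_functor id_functor)
  fix V assume V: "V \<in> ZO"
  have c: "central (Uo (Uo V)) V (inv_mor A (fst V) (fst V) (Twist A (fst V)))" by (rule central_twist[OF V])
  show "twist_inverse A V \<in> Mor (centre A) ((U_obj A \<circ> U_obj A) V) (id V)"
    by (simp add: twist_inverse_eq V UU_obj_eq Mor_centreI[OF c])
  have "inverse_pair A (fst V) (fst V) (inv_mor A (fst V) (fst V) (Twist A (fst V))) (Twist A (fst V))"
    by (rule inverse_pairI) (simp_all add: V)
  then show "is_iso (centre A) ((U_obj A \<circ> U_obj A) V) (id V) (twist_inverse A V)"
    using centre_iso[OF c] by (simp add: twist_inverse_eq V UU_obj_eq)
  fix T F assume T: "T \<in> ZO" and F: "F \<in> Mor (centre A) V T"
  obtain f where f: "F = (V, f, T)" "central V T f" using F V T by (auto elim: Mor_centreE)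
  show "twist_inverse A T \<cdot>\<^bsub>centre A\<^esub> (U_mor A \<circ> U_mor A) F = id F \<cdot>\<^bsub>centre A\<^esub> twist_inverse A V"
    using Twist_inv_natural[of f] by (simp add: twist_inverse_eq V T f(1) UU_mor_eq centralD(3-5)[OF f(2)])
qed

lemma twist_natural_isomorphism:
  "natural_isomorphism (centre A) (centre A) id id (U_obj A \<circ> U_obj A) (U_mor A \<circ> U_mor A) (\<lambda>V. (V, Twist A (fst V), Uo (Uo V)))"
  unfolding natural_isomorphism_def natural_transformation_def
proof (intro conjI ballI UU_functor id_functor)
  fix V assume V: "V \<in> ZO"
  have c: "central V (Uo (Uo V)) (Twist A (fst V))" by (rule central_Twist[OF V])
  show "(V, Twist A (fst V), Uo (Uo V)) \<in> Mor (centre A) (id V) ((U_obj A \<circ> U_obj A) V)"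
    by (simp add: V UU_obj_eq Mor_centreI[OF c])
  show "is_iso (centre A) (id V) ((U_obj A \<circ> U_obj A) V) (V, Twist A (fst V), Uo (Uo V))"
    using centre_iso[OF c] Twist_inverse_pair[OF ZO_fst[OF V]] by (simp add: V UU_obj_eq)
  fix T F assume T: "T \<in> ZO" and F: "F \<in> Mor (centre A) V T"
  obtain f where f: "F = (V, f, T)" "central V T f" using F V T by (auto elim: Mor_centreE)
  note t = centralD(3-5)[OF f(2)]
  have "f \<in> Mor A (fst V) (fst T)" by (simp add: Mor_iff t V T)
  then have "Twist A (fst T) \<cdot> f = f \<cdot> Twist A (fst V)" by (rule twist_natural[OF ZO_fst[OF V] ZO_fst[OF T]])
  then show "(T, Twist A (fst T), Uo (Uo T)) \<cdot>\<^bsub>centre A\<^esub> id F = (U_mor A \<circ> U_mor A) F \<cdot>\<^bsub>centre A\<^esub> (V, Twist A (fst V), Uo (Uo V))"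
    by (simp add: V T f(1) UU_mor_eq)
qed

lemma U_Z2_action: "Z2_action (centre A) (U_obj A) (U_mor A) (twist_inverse A)"
  unfolding Z2_action_def
proof (intro conjI ballI U_functor twist_inverse_natural_isomorphism)
  fix V assume V: "V \<in> ZO"
  show "U_mor A (twist_inverse A V) = twist_inverse A (U_obj A V)"
    by (simp add: twist_inverse_eq V U_obj_eq Uo(1) U_mor_eq)
qed

lemma U_linear: "is_linear_functor (centre A) (centre A) (U_obj A) (U_mor A)"
  unfolding is_linear_functor_def
proof (intro conjI ballI allI U_functor)
  fix V T F G a assume V: "V \<in> ZO" and T: "T \<in> ZO" and F: "F \<in> Mor (centre A) V T"
  obtain f where f: "F = (V, f, T)" using F V T by (auto elim: Mor_centreE)
  show "U_mor A (a \<odot>\<^bsub>Hom (centre A) V T\<^esub> F) = a \<odot>\<^bsub>Hom (centre A) (U_obj A V) (U_obj A T)\<^esub> U_mor A F"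
    by (simp add: f U_mor_eq V T centre_hom_def U_obj_eq split_beta)
  assume G: "G \<in> Mor (centre A) V T"
  obtain g where g: "G = (V, g, T)" using G V T by (auto elim: Mor_centreE)
  show "U_mor A (F \<oplus>\<^bsub>Hom (centre A) V T\<^esub> G) = U_mor A F \<oplus>\<^bsub>Hom (centre A) (U_obj A V) (U_obj A T)\<^esub> U_mor A G"
    by (simp add: f g U_mor_eq V T centre_hom_def U_obj_eq split_beta)
qed

text \<open>
  The adjunction says that maps \<open>I \<one> \<rightarrow> V\<close> in the centre are the same as maps \<open>\<one> \<rightarrow> V\<close> between the underlying objects.
\<close>

lemma universal_unit_arrow:
  assumes adj: "is_adjunction A (centre A) Lo Lm forget_obj forget_mor"
  obtains \<eta> where "Lo (Unit A) \<in> ZO" "\<eta> \<in> Mor A (Unit A) (fst (Lo (Unit A)))"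
    "\<And>V f. V \<in> ZO \<Longrightarrow> f \<in> Mor A (Unit A) (fst V) \<Longrightarrow> \<exists>g. central (Lo (Unit A)) V g \<and> g \<cdot> \<eta> = f"
    "\<And>V g h. central (Lo (Unit A)) V g \<Longrightarrow> central (Lo (Unit A)) V h \<Longrightarrow> g \<cdot> \<eta> = h \<cdot> \<eta> \<Longrightarrow> g = h"
proof -
  let ?K = "Lo (Unit A)" let ?U = "Unit A"
  obtain \<eta> \<epsilon> where F: "is_functor A (centre A) Lo Lm"
    and n: "natural_transformation A A id id (forget_obj \<circ> Lo) (forget_mor \<circ> Lm) \<eta>"
    and e: "natural_transformation (centre A) (centre A) (Lo \<circ> forget_obj) (Lm \<circ> forget_mor) id id \<epsilon>"
    and t: "\<forall>X \<in> Obj A. \<epsilon> (Lo X) \<cdot>\<^bsub>centre A\<^esub> Lm (\<eta> X) = Id (centre A) (Lo X)"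
    and t': "\<forall>V \<in> ZO. forget_mor (\<epsilon> V) \<cdot> \<eta> (forget_obj V) = Id A (forget_obj V)"
    using adj unfolding is_adjunction_def by blast
  have Lo: "Lo X \<in> ZO" if "X \<in> Obj A" for X using F that unfolding is_functor_def by blast
  have Lm_ex: "\<exists>m. Lm f = (Lo X, m, Lo Y) \<and> central (Lo X) (Lo Y) m" if "X \<in> Obj A" "Y \<in> Obj A" "f \<in> Mor A X Y" for f X Y
  proof -
    have "Lm f \<in> Mor (centre A) (Lo X) (Lo Y)" using F that unfolding is_functor_def by blast
    then show ?thesis using Lo[OF that(1)] Lo[OF that(2)] by (simp add: Mor_centre_iff)
  qed
  have ee: "\<exists>m. \<epsilon> V = (Lo (fst V), m, V) \<and> central (Lo (fst V)) V m" if V: "V \<in> ZO" for V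
  proof -
    have "\<epsilon> V \<in> Mor (centre A) ((Lo \<circ> forget_obj) V) (id V)" using e V unfolding natural_transformation_def by blast
    then show ?thesis using Lo[OF ZO_fst[OF V]] V by (simp add: Mor_centre_iff forget_obj_def)
  qed
  have nt: "\<eta> X \<in> Mor A X (fst (Lo X))" if "X \<in> Obj A" for X
    using n that unfolding natural_transformation_def by (simp add: forget_obj_def)
  have nat: "\<eta> Y \<cdot> f = forget_mor (Lm f) \<cdot> \<eta> X" if "X \<in> Obj A" "Y \<in> Obj A" "f \<in> Mor A X Y" for X Y f
    using n that unfolding natural_transformation_def by simp
  have enat: "\<epsilon> T \<cdot>\<^bsub>centre A\<^esub> Lm (forget_mor G) = G \<cdot>\<^bsub>centre A\<^esub> \<epsilon> V" if "V \<in> ZO" "T \<in> ZO" "G \<in> Mor (centre A) V T" for V T G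
    using e that unfolding natural_transformation_def by simp
  have K: "?K \<in> ZO" by (rule Lo) simp
  have nu: "\<eta> ?U \<in> Mor A ?U (fst ?K)" by (rule nt) simp
  have [simp]: "arr (\<eta> ?U)" "src (\<eta> ?U) = ?U" "tgt (\<eta> ?U) = fst ?K" by (rule Mor_typing[OF _ _ nu]; simp add: K)+
  show thesis
  proof (rule that[OF K nu])
    fix V f assume V: "V \<in> ZO" and f: "f \<in> Mor A ?U (fst V)"
    have ft: "arr f" "src f = ?U" "tgt f = fst V" by (rule Mor_typing[OF _ _ f]; simp add: V)+
    obtain m where m: "Lm f = (?K, m, Lo (fst V))" "central ?K (Lo (fst V)) m" using Lm_ex[OF _ _ f] V by auto
    obtain k where k: "\<epsilon> V = (Lo (fst V), k, V)" "central (Lo (fst V)) V k" using ee[OF V] by blast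
    have nV: "\<eta> (fst V) \<in> Mor A (fst V) (fst (Lo (fst V)))" by (rule nt) (simp add: V)
    have nVt: "arr (\<eta> (fst V))" "src (\<eta> (fst V)) = fst V" "tgt (\<eta> (fst V)) = fst (Lo (fst V))"
      by (rule Mor_typing[OF _ _ nV]; simp add: V Lo)+
    have "(k \<cdot> m) \<cdot> \<eta> ?U = k \<cdot> (m \<cdot> \<eta> ?U)" by (simp add: centralD[OF m(2)] centralD[OF k(2)])
    also have "m \<cdot> \<eta> ?U = \<eta> (fst V) \<cdot> f" using nat[OF unit_closed ZO_fst[OF V] f] by (simp add: m(1) forget_mor_def)
    also have "k \<cdot> (\<eta> (fst V) \<cdot> f) = (k \<cdot> \<eta> (fst V)) \<cdot> f" by (simp add: centralD[OF k(2)] nVt ft)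
    also have "k \<cdot> \<eta> (fst V) = Id A (fst V)" using t'[rule_format, OF V] by (simp add: k(1) forget_mor_def forget_obj_def)
    finally have "(k \<cdot> m) \<cdot> \<eta> ?U = f" by (simp add: ft)
    then show "\<exists>g. central ?K V g \<and> g \<cdot> \<eta> ?U = f" using central_comp[OF m(2) k(2)] by blast
  next
    have key: "forget_mor (\<epsilon> V) \<cdot> forget_mor (Lm (g \<cdot> \<eta> ?U)) = g" if g: "central ?K V g" for V g
    proof -
      have V: "V \<in> ZO" by (rule centralD(2)[OF g])
      obtain k where k: "\<epsilon> V = (Lo (fst V), k, V)" "central (Lo (fst V)) V k" using ee[OF V] by blast
      obtain kK where kK: "\<epsilon> ?K = (Lo (fst ?K), kK, ?K)" "central (Lo (fst ?K)) ?K kK" using ee[OF K] by blast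
      have gm: "g \<in> Mor A (fst ?K) (fst V)" by (simp add: Mor_iff centralD[OF g] V K)
      obtain m where m: "Lm g = (Lo (fst ?K), m, Lo (fst V))" "central (Lo (fst ?K)) (Lo (fst V)) m"
        using Lm_ex[OF _ _ gm] V K by auto
      obtain l where l: "Lm (\<eta> ?U) = (?K, l, Lo (fst ?K))" "central ?K (Lo (fst ?K)) l" using Lm_ex[OF _ _ nu] K by auto
      have c: "Lm (g \<cdot> \<eta> ?U) = Lm g \<cdot>\<^bsub>centre A\<^esub> Lm (\<eta> ?U)"
        using F unit_closed ZO_fst[OF K] ZO_fst[OF V] nu gm unfolding is_functor_def by blast
      have a: "kK \<cdot> l = Id A (fst ?K)" using t[rule_format, OF unit_closed] by (simp add: kK(1) l(1))
      have b: "k \<cdot> m = g \<cdot> kK"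
        using enat[OF K V Mor_centreI[OF g, folded centre_simps(1)]] by (simp add: forget_mor_def k(1) m(1) kK(1))
      have "k \<cdot> forget_mor (Lm (g \<cdot> \<eta> ?U)) = (k \<cdot> m) \<cdot> l"
        by (simp add: c m(1) l(1) forget_mor_def centralD[OF k(2)] centralD[OF m(2)] centralD[OF l(2)])
      also have "\<dots> = g \<cdot> (kK \<cdot> l)" unfolding b by (simp add: centralD[OF g] centralD[OF kK(2)] centralD[OF l(2)])
      also have "\<dots> = g" unfolding a by (simp add: centralD[OF g])
      finally show ?thesis by (simp add: k(1) forget_mor_def)
    qed
    fix V g h assume g: "central ?K V g" and h: "central ?K V h" and gh: "g \<cdot> \<eta> ?U = h \<cdot> \<eta> ?U"
    show "g = h" using key[OF g] key[OF h] unfolding gh by simp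
  qed
qed

section \<open>The tensor equivalence\<close>

text \<open>
  The arrow \<open>\<eta> : \<one> \<rightarrow> I \<one>\<close> factors through a map \<open>\<psi> : I \<one> \<rightarrow> U (I \<one>)\<close>.  The inverse of \<open>\<psi>\<close> is \<open>\<theta>\<^sup>-\<^sup>1 \<psi>\<close>, because
  \<open>\<theta>\<^sup>-\<^sup>1 \<psi> \<psi>\<close> is an endomorphism of \<open>I \<one>\<close> in the centre that fixes \<open>\<eta>\<close>.
\<close>

lemma U_preserves_unit:
  assumes adj: "is_adjunction A (centre A) Lo Lm forget_obj forget_mor"
  shows "isomorphic (centre A) (U_obj A (Lo (Unit A))) (Lo (Unit A))"
proof -
  let ?K = "Lo (Unit A)"
  obtain \<eta> where K: "?K \<in> ZO" and n: "\<eta> \<in> Mor A (Unit A) (fst ?K)"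
    and ex: "\<And>V f. V \<in> ZO \<Longrightarrow> f \<in> Mor A (Unit A) (fst V) \<Longrightarrow> \<exists>g. central ?K V g \<and> g \<cdot> \<eta> = f"
    and un: "\<And>V g h. central ?K V g \<Longrightarrow> central ?K V h \<Longrightarrow> g \<cdot> \<eta> = h \<cdot> \<eta> \<Longrightarrow> g = h"
    using universal_unit_arrow[OF adj] by blast
  have nt: "arr \<eta>" "src \<eta> = Unit A" "tgt \<eta> = fst ?K" by (rule Mor_typing[OF _ _ n]; simp add: K)+
  let ?t = "inv_mor A (fst ?K) (fst ?K) (Twist A (fst ?K))"
  \<comment> \<open>The twist of the unit is trivial, so \<open>\<eta>\<close> does not see the twist.\<close>
  have t1: "inv_mor A (Unit A) (Unit A) (Twist A (Unit A)) = Id A (Unit A)"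
    using arr_Id_right[OF Twist_facts(4,5)[OF unit_closed]] Twist_facts(8)[OF unit_closed] unfolding Twist_unit by (rule trans[OF sym])
  have tn: "?t \<cdot> \<eta> = \<eta>" using Twist_inv_natural[OF nt(1)] by (simp add: nt t1)
  have UK: "Uo ?K \<in> ZO" by (rule Uo(1)[OF K])
  obtain \<psi> where p: "central ?K (Uo ?K) \<psi>" "\<psi> \<cdot> \<eta> = \<eta>" using ex[OF UK] n by auto
  note pt = centralD(3-5)[OF p(1), simplified]
  have c: "central (Uo ?K) ?K (?t \<cdot> \<psi>)" by (rule central_comp[OF central_U[OF p(1)] central_twist[OF K]])
  have "(?t \<cdot> \<psi>) \<cdot> \<psi> = Id A (fst ?K)"
  proof (rule un[OF central_comp[OF p(1) c] central_Id[OF K]])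
    show "((?t \<cdot> \<psi>) \<cdot> \<psi>) \<cdot> \<eta> = Id A (fst ?K) \<cdot> \<eta>" using tn by (simp add: pt nt p(2) K)
  qed
  then have 1: "?t \<cdot> \<psi> \<cdot> \<psi> = Id A (fst ?K)" by (simp add: pt K)
  have "\<psi> \<cdot> (?t \<cdot> \<psi>) = (\<psi> \<cdot> ?t) \<cdot> \<psi>" by (rule arr_comp_assoc[symmetric]) (simp_all add: pt K)
  also have "\<psi> \<cdot> ?t = ?t \<cdot> \<psi>" using Twist_inv_natural[OF pt(1)] by (simp add: pt)
  also have "(?t \<cdot> \<psi>) \<cdot> \<psi> = Id A (fst ?K)" using 1 by (simp add: pt K)
  finally have 2: "\<psi> \<cdot> (?t \<cdot> \<psi>) = Id A (fst ?K)" .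
  have "inverse_pair A (fst (Uo ?K)) (fst ?K) (?t \<cdot> \<psi>) \<psi>"
    by (rule inverse_pairI) (simp_all add: pt K 1 2)
  from centre_iso[OF c this] show ?thesis unfolding isomorphic_def U_obj_eq[OF K] by blast
qed

end

context reduced_tensor begin

abbreviation ZA :: "('o, 'm) centre_obj \<Rightarrow> ('k, ('o, 'm) centre_obj, ('o, 'm) centre_mor) tensor_cat" where
  "ZA K \<equiv> reduced_centre A I im K"

lemma ZA_simps [simp]: "Obj (ZA K) = ZO" "Hom (ZA K) = Hom (centre A)" "Id (ZA K) = Id (centre A)" "Comp (ZA K) = Comp (centre A)"
  "Ten (ZA K) = RO" "Ten_mor (ZA K) = red_mor A I im" "Unit (ZA K) = K" "Assoc (ZA K) = red_assoc A I im"
  by (simp_all add: reduced_centre_def)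

lemma opposite_simps [simp]: "Obj (opposite_tensor M) = Obj M" "Hom (opposite_tensor M) = Hom M" "Id (opposite_tensor M) = Id M"
  "Comp (opposite_tensor M) = Comp M" "Ten (opposite_tensor M) X Y = Ten M Y X" "Ten_mor (opposite_tensor M) f g = Ten_mor M g f"
  "Unit (opposite_tensor M) = Unit M" "Assoc (opposite_tensor M) X Y Z = Assoc_inv M Z Y X"
  by (simp_all add: opposite_tensor_def)

text \<open>
  The reduced centre and its opposite have the same underlying category as the centre.
\<close>

lemma is_iso_transfer:
  "is_iso (ZA K) = is_iso (centre A)" "is_iso (opposite_tensor (ZA K)) = is_iso (centre A)"
  "isomorphic (opposite_tensor (ZA K)) = isomorphic (centre A)" "inv_mor (ZA K) = inv_mor (centre A)"
  by (intro ext; simp add: is_iso_def isomorphic_def inv_mor_def inverse_pair_def)+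

lemma functor_transfer:
  "is_functor (ZA K) (opposite_tensor (ZA K)) = is_functor (centre A) (centre A)"
  "is_functor (opposite_tensor (ZA K)) (ZA K) = is_functor (centre A) (centre A)"
  "is_functor (ZA K) (ZA K) = is_functor (centre A) (centre A)"
  "is_functor (opposite_tensor (ZA K)) (opposite_tensor (ZA K)) = is_functor (centre A) (centre A)"
  by (intro ext; simp add: is_functor_def)+

lemma red_mor_eq: "red_mor A I im (V, f, V') (T, g, T') = (RO V T, rp V' T' \<cdot> (f \<boxtimes> g) \<cdot> ri V T, RO V' T')"
  by (simp add: red_mor_def)

lemma red_assoc_eq:
  assumes [simp]: "V \<in> ZO" "M \<in> ZO" "T \<in> ZO"
  shows "red_assoc A I im V M T = (RO (RO V M) T, assoc_map V M T, RO V (RO M T))"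
  by (simp add: red_assoc_def assoc_map_def P2_def I1_def red(1))

lemma red_assoc_inv:
  assumes "V \<in> ZO" "M \<in> ZO" "T \<in> ZO"
  shows "inv_mor (centre A) (RO (RO V M) T) (RO V (RO M T)) (red_assoc A I im V M T) = (RO V (RO M T), assoc_map_inv V M T, RO (RO V M) T)"
  unfolding red_assoc_eq[OF assms] by (rule centre_inv_mor[OF assoc_map_central[OF assms] assoc_map_inverse_pair[OF assms]])

lemma U_equivalence: "is_equivalence (ZA K) (opposite_tensor (ZA K)) (U_obj A) (U_mor A)"
proof -
  have t: "natural_isomorphism (ZA K) (ZA K) id id (U_obj A \<circ> U_obj A) (U_mor A \<circ> U_mor A) (\<lambda>V. (V, Twist A (fst V), Uo (Uo V)))"
    using twist_natural_isomorphism
    by (simp add: natural_isomorphism_def natural_transformation_def functor_transfer is_iso_transfer)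
  have t': "natural_isomorphism (opposite_tensor (ZA K)) (opposite_tensor (ZA K)) (U_obj A \<circ> U_obj A) (U_mor A \<circ> U_mor A) id id (twist_inverse A)"
    using twist_inverse_natural_isomorphism
    by (simp add: natural_isomorphism_def natural_transformation_def functor_transfer is_iso_transfer)
  show ?thesis unfolding is_equivalence_def functor_transfer
    using U_functor t t' by blast
qed

text \<open>
  The tensor structure as a family of morphisms of the centre.
\<close>

definition JZ :: "('o, 'm) centre_obj \<Rightarrow> ('o, 'm) centre_obj \<Rightarrow> ('o, 'm) centre_mor" where
  "JZ V T = (RO (Uo T) (Uo V), J V T, Uo (RO V T))"

lemma U_monoidal:
  assumes unit: "isomorphic (centre A) (U_obj A K) K"
  shows "is_monoidal_functor (ZA K) (opposite_tensor (ZA K)) (U_obj A) (U_mor A) JZ"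
  unfolding is_monoidal_functor_def
proof (intro conjI ballI)
  show "is_functor (ZA K) (opposite_tensor (ZA K)) (U_obj A) (U_mor A)"
    unfolding functor_transfer by (rule U_functor)
  show "isomorphic (opposite_tensor (ZA K)) (U_obj A (Unit (ZA K))) (Unit (opposite_tensor (ZA K)))"
    using unit by (simp add: is_iso_transfer)
  fix V T assume "V \<in> Obj (ZA K)" "T \<in> Obj (ZA K)"
  then have z: "V \<in> ZO" "T \<in> ZO" by simp_all
  obtain k where k: "inverse_pair A (fst (RO (Uo T) (Uo V))) (fst (RO V T)) (J V T) k" using J_iso[OF z] by blast
  have "is_iso (centre A) (RO (Uo T) (Uo V)) (Uo (RO V T)) (JZ V T)"
    unfolding JZ_def by (rule centre_iso[OF J_central[OF z], unfolded fst_Uo, OF k])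
  then show "is_iso (opposite_tensor (ZA K)) (U_obj A V \<star>\<^bsub>opposite_tensor (ZA K)\<^esub> U_obj A T) (U_obj A (V \<star>\<^bsub>ZA K\<^esub> T)) (JZ V T)"
    by (simp add: is_iso_transfer U_obj_eq z red(1))
next
  fix V V' T T' F G
  assume "V \<in> Obj (ZA K)" "V' \<in> Obj (ZA K)" "T \<in> Obj (ZA K)" "T' \<in> Obj (ZA K)"
    and F: "F \<in> Mor (ZA K) V V'" and G: "G \<in> Mor (ZA K) T T'"
  then have z: "V \<in> ZO" "V' \<in> ZO" "T \<in> ZO" "T' \<in> ZO" by simp_all
  obtain f where f: "F = (V, f, V')" "central V V' f" using F z by (auto elim: Mor_centreE)
  obtain g where g: "G = (T, g, T')" "central T T' g" using G z by (auto elim: Mor_centreE)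
  show "JZ V' T' \<cdot>\<^bsub>opposite_tensor (ZA K)\<^esub> (U_mor A F \<boxtimes>\<^bsub>opposite_tensor (ZA K)\<^esub> U_mor A G)
    = U_mor A (F \<boxtimes>\<^bsub>ZA K\<^esub> G) \<cdot>\<^bsub>opposite_tensor (ZA K)\<^esub> JZ V T"
    using J_natural[OF f(2) g(2)] by (simp add: f(1) g(1) JZ_def U_mor_eq red_mor_eq z red(1))
next
  fix V M T assume "V \<in> Obj (ZA K)" "M \<in> Obj (ZA K)" "T \<in> Obj (ZA K)"
  then have z: "V \<in> ZO" "M \<in> ZO" "T \<in> ZO" by simp_all
  note u = Uo(1)[OF z(1)] Uo(1)[OF z(2)] Uo(1)[OF z(3)]
  show "U_mor A (Assoc (ZA K) V M T) \<cdot>\<^bsub>opposite_tensor (ZA K)\<^esub> JZ (V \<star>\<^bsub>ZA K\<^esub> M) T \<cdot>\<^bsub>opposite_tensor (ZA K)\<^esub>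
       (JZ V M \<boxtimes>\<^bsub>opposite_tensor (ZA K)\<^esub> Id (opposite_tensor (ZA K)) (U_obj A T))
    = JZ V (M \<star>\<^bsub>ZA K\<^esub> T) \<cdot>\<^bsub>opposite_tensor (ZA K)\<^esub> (Id (opposite_tensor (ZA K)) (U_obj A V) \<boxtimes>\<^bsub>opposite_tensor (ZA K)\<^esub> JZ M T)
       \<cdot>\<^bsub>opposite_tensor (ZA K)\<^esub> Assoc (opposite_tensor (ZA K)) (U_obj A V) (U_obj A M) (U_obj A T)"
    using J_hexagon[OF z]
    by (simp add: JZ_def U_mor_eq red_mor_eq red_assoc_eq
      red_assoc_inv[OF u(3,2,1), unfolded red_assoc_eq[OF u(3,2,1)]] is_iso_transfer U_obj_eq z u red(1))
qed

lemma U_linear_reduced: "is_linear_functor (ZA K) (opposite_tensor (ZA K)) (U_obj A) (U_mor A)"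
  using U_linear by (simp add: is_linear_functor_def functor_transfer)

end

theorem proposition2p12:
  fixes A :: "('k::{alg_closed_field, field_char_0}, 'o, 'm) ribbon_cat"
    and Irr :: "'o set"
    and im :: "'o \<Rightarrow> 'm \<Rightarrow> 'o \<times> 'm \<times> 'm"
    and I_obj :: "'o \<Rightarrow> ('o, 'm) centre_obj"
    and I_mor :: "'m \<Rightarrow> ('o, 'm) centre_mor"
  assumes "premodular_category A"
    and "simple_representatives A Irr"
    and "global_dim A Irr \<noteq> 0"
    and "is_image_choice A im"
    and "two_sided_adjoint (centre A) A forget_obj forget_mor I_obj I_mor"
  defines "ZA \<equiv> reduced_centre A Irr im (I_obj (Unit A))"
  shows "is_tensor_equivalence ZA (opposite_tensor ZA) (U_obj A) (U_mor A)
    \<and> natural_isomorphism (centre A) (centre A) (U_obj A \<circ> U_obj A) (U_mor A \<circ> U_mor A) id id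
        (twist_inverse A)
    \<and> Z2_action (centre A) (U_obj A) (U_mor A) (twist_inverse A)"
proof -
  interpret premodular_category A by (rule assms(1))
  interpret R: reduced_tensor A Irr im
    by unfold_locales (rule assms(2-4))+
  have "is_adjunction A (centre A) I_obj I_mor forget_obj forget_mor"
    using assms(5) unfolding two_sided_adjoint_def by (rule conjunct1)
  then have "isomorphic (centre A) (U_obj A (I_obj (Unit A))) (I_obj (Unit A))" by (rule U_preserves_unit)
  then have "is_monoidal_functor ZA (opposite_tensor ZA) (U_obj A) (U_mor A) R.JZ"
    unfolding ZA_def by (rule R.U_monoidal)
  then have "is_tensor_equivalence ZA (opposite_tensor ZA) (U_obj A) (U_mor A)"
    unfolding is_tensor_equivalence_def ZA_def using R.U_linear_reduced R.U_equivalence by blast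
  then show ?thesis
    by (intro conjI twist_inverse_natural_isomorphism U_Z2_action)
qed

end
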